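(* Fix $a,b>0$ and $\ell>(\sqrt a+\sqrt b)^2$. Let $D=\ell^2-2(a+b)\ell+(a-b)^2$ and define $$h(x,y)=\tfrac12\left[(\ell+a-b)x+(\ell-a+b)y-|x-y|\sqrt{D}\right].$$ Then for every $\epsilon>0$, $$\lim_{N\to\infty}\mathbb{P}\left[\left|\frac{\mathcal{L}(xaN,ybN)}{N}-h(x,y)\right|>\epsilon\ \Big|\ \mathcal{L}(aN,bN)=\ell N\right]=0$$ for every $(x,y)\in(0,1)^2$ satisfying $$\frac1{\mathrm m}<\frac yx<\mathrm m,\qquad\text{where}\quad \mathrm m:=\frac{\ell-a-b+\sqrt D}{\ell-a-b-\sqrt D}.$$
   Context: Exponential last passage percolation: let $\{\omega_{\mathbf v}:\mathbf v\in\mathbb{N}^2\}$ ($\mathbb N=\{1,2,\dots\}$) be i.i.d. exponential random variables of mean $1$. An up/right path from $(1,1)$ to $\mathbf q\in\mathbb{N}^2$ is a sequence of lattice points starting at $(1,1)$ and ending at $\mathbf q$ whose successive increments are in $\{(1,0),(0,1)\}$. Define $\mathcal{L}(\mathbf q)=\max_{\pi}\sum_{\mathbf v\in\pi}\omega_{\mathbf v}$, the maximum over all up/right paths $\pi$ from $(1,1)$ to $\mathbf q$. For real $\alpha,\beta>0$ set $\mathcal{L}(\alpha,\beta)=\mathcal{L}(\lceil\alpha\rceil,\lceil\beta\rceil)$. Conditional probabilities are understood as $$\mathbb{P}(E\mid\mathcal{L}(\alpha,\beta)=c)=\lim_{\epsilon\downarrow0}\frac{\mathbb{P}(E\cap\{\mathcal{L}(\alpha,\beta)\in(c-\epsilon,c+\epsilon)\})}{\mathbb{P}(\mathcal{L}(\alpha,\beta)\in(c-\epsilon,c+\epsilon))}=\frac{\frac{\partial}{\partial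 c}\mathbb{P}(E\cap\{\mathcal{L}(\alpha,\beta)\le c\})}{\frac{\partial}{\partial c}\mathbb{P}(\mathcal{L}(\alpha,\beta)\le c)}.$$ *)

theory Defs
  imports "HOL-Probability.Probability"
begin

section \<open>Exponential last passage percolation\<close>

definition up_right_step :: "nat \<times> nat \<Rightarrow> nat \<times> nat \<Rightarrow> bool" where
  "up_right_step u v \<longleftrightarrow> v = (fst u + 1, snd u) \<or> v = (fst u, snd u + 1)"

definition up_right_paths :: "nat \<times> nat \<Rightarrow> (nat \<times> nat) list set" where
  "up_right_paths q =
     {p. p \<noteq> [] \<and> hd p = (1, 1) \<and> last p = q \<and> successively up_right_step p}"

definition last_passage :: "(nat \<times> nat \<Rightarrow> real) \<Rightarrow> nat \<times> nat \<Rightarrow> real" where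
  "last_passage w q = Max ((\<lambda>p. \<Sum>v\<leftarrow>p. w v) ` up_right_paths q)"

definition last_passage_real :: "(nat \<times> nat \<Rightarrow> real) \<Rightarrow> real \<Rightarrow> real \<Rightarrow> real" where
  "last_passage_real w \<alpha> \<beta> = last_passage w (nat \<lceil>\<alpha>\<rceil>, nat \<lceil>\<beta>\<rceil>)"

text \<open>The next two facts show that the maximum in \<^const>\<open>last_passage\<close> is over a finite
  nonempty set whenever both coordinates of the endpoint are positive.\<close>

lemma finite_up_right_paths: "finite (up_right_paths q)"
proof -
  have *: "set p \<subseteq> {..fst (last p)} \<times> {..snd (last p)} \<and>
      length p \<le> Suc (fst (last p) + snd (last p))"
    if "p \<noteq> []" "successively up_right_step p" for p
    using that
  proof (induction p rule: rev_induct)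
    case (snoc v p)
    show ?case
    proof (cases "p = []")
      case False
      then have "set p \<subseteq> {..fst (last p)} \<times> {..snd (last p)}"
        "length p \<le> Suc (fst (last p) + snd (last p))" "up_right_step (last p) v"
        using snoc by (auto simp: successively_append_iff)
      then show ?thesis
        by (fastforce simp: up_right_step_def)
    qed (simp add: mem_Times_iff)
  qed auto
  have "up_right_paths q \<subseteq>
      {p. set p \<subseteq> {..fst q} \<times> {..snd q} \<and> length p \<le> Suc (fst q + snd q)}"
    using * by (auto simp: up_right_paths_def)
  then show ?thesis
    by (rule finite_subset) (intro finite_lists_length_le finite_SigmaI finite_atMost)
qed

lemma up_right_paths_nonempty:
  assumes "1 \<le> i" "1 \<le> j"
  shows "up_right_paths (i, j) \<noteq> {}"
proof -
  have step_path: "up_right_paths v \<noteq> {}" if "up_right_paths u \<noteq> {}" "up_right_step u v" for u v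
  proof -
    from that obtain p where "p \<in> up_right_paths u" by auto
    with that have "p @ [v] \<in> up_right_paths v"
      by (auto simp: up_right_paths_def successively_append_iff)
    then show ?thesis by auto
  qed
  have "[(1, 1)] \<in> up_right_paths (1, 1)"
    by (simp add: up_right_paths_def)
  then have "up_right_paths (1, 1) \<noteq> {}" by blast
  with assms(1) have "up_right_paths (i, 1) \<noteq> {}"
  proof (induction i rule: dec_induct)
    case (step n)
    then show ?case using step_path[of "(n, 1)" "(Suc n, 1)"] by (auto simp: up_right_step_def)
  qed
  with assms(2) show ?thesis
  proof (induction j rule: dec_induct)
    case (step n)
    then show ?case using step_path[of "(i, n)" "(i, Suc n)"] by (auto simp: up_right_step_def)
  qed
qed

definition iid_exponential_weights :: "'a measure \<Rightarrow> (nat \<times> nat \<Rightarrow> 'a \<Rightarrow> real) \<Rightarrow> bool" where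
  "iid_exponential_weights M \<omega> \<longleftrightarrow>
     prob_space.indep_vars M (\<lambda>_. borel) \<omega> ({1..} \<times> {1..}) \<and>
     (\<forall>v \<in> {1..} \<times> {1..}. distributed M lborel (\<omega> v) (exponential_density 1))"

text \<open>Conditioning on a null event is by shrinking symmetric windows. If the limit does not
  exist, \<^const>\<open>Lim\<close> is an unspecified real, so a statement about this value carries the
  existence of the limit as a proof obligation.\<close>

definition cond_prob_eq :: "'a measure \<Rightarrow> ('a \<Rightarrow> bool) \<Rightarrow> ('a \<Rightarrow> real) \<Rightarrow> real \<Rightarrow> real" where
  "cond_prob_eq M E X c =
     Lim (at_right 0) (\<lambda>\<delta>. cond_prob M E (\<lambda>s. X s \<in> {c - \<delta> <..< c + \<delta>}))"

definition discr :: "real \<Rightarrow> real \<Rightarrow> real \<Rightarrow> real" where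
  "discr a b l = l\<^sup>2 - 2 * (a + b) * l + (a - b)\<^sup>2"

definition limit_shape :: "real \<Rightarrow> real \<Rightarrow> real \<Rightarrow> real \<Rightarrow> real \<Rightarrow> real" where
  "limit_shape a b l x y =
     1 / 2 * ((l + a - b) * x + (l - a + b) * y - \<bar>x - y\<bar> * sqrt (discr a b l))"

definition cone_slope :: "real \<Rightarrow> real \<Rightarrow> real \<Rightarrow> real" where
  "cone_slope a b l = (l - a - b + sqrt (discr a b l)) / (l - a - b - sqrt (discr a b l))"

end

(*
  Write a = l w z and b = l (1 - w) (1 - z) with 0 < z < w < 1; then sqrt D = l (w - z), and
  limit_shape is the smaller of l (w x + (1 - w) y) and l (z x + (1 - z) y).

  With boundary weights of rates z (bottom) and 1 - z (left) the increments of the passage time are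
  stationary (Burke). This gives exponential moments of L(m, n) that are sharp to exponential order,
  hence P(L(aN, bN) >= lN) is (w/z)^(aN) ((1-z)/(1-w))^(bN) exp(-(w-z) l N) up to exp(o(N)), and
  windows just below lN are no less likely to exponential order.

  Let y >= x; the other case is its transpose. That L(xaN, ybN) exceeds its limit while
  L(aN, bN) >= lN is exponentially less likely, by cutting the long path at column xaN and a joint
  moment bound. For the lower deviation, go from the origin along the diagonal to t(a, b)N, and from
  there in the characteristic direction (z^2, (1-z)^2). The diagonal point is handled by cutting the
  long path near it; for the second piece a low passage time and a long L(aN, bN) are negatively
  correlated (Harris), and the lower tail of a single passage time is exponentially small. The cone
  condition is exactly t > 0.

  The weight at the endpoint is independent of all others, so L(aN, bN) has a density, also jointly
  with an event of the remaining weights. It is at most a tail probability and at least exp(-t)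
  times the probability of a window of length t, so the conditional probability is exponentially
  small.
*)

theory Submission
  imports Defs "HOL-Real_Asymp.Real_Asymp"
begin

subsection \<open>Passage times with boundary values\<close>

text \<open>The conditioning event has exponentially small probability, so a law of large numbers is
  of no use: every bad event has to lose an exponential factor against the common benchmark
  \<open>cost\<close>. The parameters \<open>z\<close> and \<open>w\<close> are the two solutions q
  of a/q + b/(1 - q) = l, that is, the two stationary models whose mean passage time in direction
  (a, b) is l. The moment bounds for \<open>lpp\<close> carry a free parameter. Along the expected
  path their exponents are stationary in it, to first order, exactly at \<open>z\<close> and
  \<open>w\<close>. A macroscopic displacement (a late exit from the boundary, a wrong exit height
  in a column, an excess at an intermediate point) leaves a derivative of definite sign, and a small
  shift of the parameter then gains a factor exp(-cN). The gains are found in this way, from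
  derivatives at 0, so that no rate function has to be computed. Unions over exit points cost a
  polynomial factor, which half of the rate absorbs.\<close>

fun boundary_lpp :: "(nat \<times> nat \<Rightarrow> real) \<Rightarrow> (nat \<Rightarrow> real) \<Rightarrow> (nat \<Rightarrow> real) \<Rightarrow> nat \<Rightarrow> nat \<Rightarrow> real" where
  "boundary_lpp W f g 0 j = g j"
| "boundary_lpp W f g (Suc i) 0 = f (Suc i)"
| "boundary_lpp W f g (Suc i) (Suc j) =
     W (Suc i, Suc j) + max (boundary_lpp W f g i (Suc j)) (boundary_lpp W f g (Suc i) j)"

abbreviation lpp :: "(nat \<times> nat \<Rightarrow> real) \<Rightarrow> nat \<Rightarrow> nat \<Rightarrow> real" where
  "lpp W \<equiv> boundary_lpp W (\<lambda>_. 0) (\<lambda>_. 0)"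

text \<open>\<open>lpp (shifted p q W) m n\<close> reads exactly the sites with coordinates in p +
  1, ..., p + m and q + 1, ..., q + n. It therefore shares no weight with
  \<open>lpp W p q\<close>.\<close>

definition shifted :: "nat \<Rightarrow> nat \<Rightarrow> (nat \<times> nat \<Rightarrow> real) \<Rightarrow> nat \<times> nat \<Rightarrow> real" where
  "shifted p q W v = W (fst v + p, snd v + q)"

lemma boundary_lpp_mono:
  assumes "\<And>i j. i \<in> {1..m} \<Longrightarrow> j \<in> {1..n} \<Longrightarrow> W (i, j) \<le> W' (i, j)"
    and "\<And>i. f i \<le> f' i" "\<And>j. g j \<le> g' j"
  shows "boundary_lpp W f g m n \<le> boundary_lpp W' f' g' m n"
proof -
  have "i \<le> m \<Longrightarrow> j \<le> n \<Longrightarrow> boundary_lpp W f g i j \<le> boundary_lpp W' f' g' i j" for i j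
  proof (induction "i + j" arbitrary: i j rule: less_induct)
    case less
    show ?case
    proof (cases "i = 0 \<or> j = 0")
      case True
      then show ?thesis by (cases i) (auto simp: assms)
    next
      case False
      then obtain i' j' where ij: "i = Suc i'" "j = Suc j'" by (meson not0_implies_Suc)
      have "W (i, j) \<le> W' (i, j)"
        "boundary_lpp W f g i' j \<le> boundary_lpp W' f' g' i' j" "boundary_lpp W f g i j' \<le> boundary_lpp W' f' g' i j'"
        using less ij by (auto intro!: assms)
      then show ?thesis by (simp add: max_def ij)
    qed
  qed
  then show ?thesis by simp
qed

lemma boundary_lpp_cong:
  assumes "\<And>i j. i \<in> {1..m} \<Longrightarrow> j \<in> {1..n} \<Longrightarrow> W (i, j) = W' (i, j)"
  shows "boundary_lpp W f g m n = boundary_lpp W' f g m n"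
  by (intro antisym boundary_lpp_mono) (auto simp: assms)

lemma lpp_nonneg:
  assumes "\<And>v. 0 \<le> W v"
  shows "0 \<le> lpp W m n"
proof (induction "m + n" arbitrary: m n rule: less_induct)
  case less
  then have "0 \<le> lpp W (m - 1) n" if "m \<noteq> 0" using that by simp
  then show ?case
    by (cases m; cases n) (auto simp: assms le_max_iff_disj intro!: add_nonneg_nonneg)
qed

lemma lpp_zero [simp]: "lpp W m 0 = 0"
  by (cases m) auto

lemma lpp_mono:
  assumes "\<And>v. 0 \<le> W v" "m \<le> m'" "n \<le> n'"
  shows "lpp W m n \<le> lpp W m' n'"
proof -
  have 1: "lpp W i j \<le> lpp W (Suc i) j" for i j
    using assms(1)[of "(Suc i, j)"] by (cases j) auto
  have 2: "lpp W i j \<le> lpp W i (Suc j)" for i j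
    using assms(1)[of "(i, Suc j)"] by (cases i) auto
  have "lpp W m n \<le> lpp W m' n"
    using assms(2) by (rule lift_Suc_mono_le[of "\<lambda>i. lpp W i n", rotated]) (rule 1)
  also have "\<dots> \<le> lpp W m' n'"
    using assms(3) by (rule lift_Suc_mono_le[of "\<lambda>j. lpp W m' j", rotated]) (rule 2)
  finally show ?thesis .
qed

text \<open>A path to (p, q) continues with a path of the shifted rectangle, which starts at (p + 1,
  q + 1). The site skipped in between, and the remaining stretch when that rectangle is empty, can
  only add weight.\<close>

lemma lpp_superadditive:
  assumes W: "\<And>v. 0 \<le> W v"
  shows "lpp W p q + lpp (shifted p q W) m n \<le> lpp W (p + m) (q + n)"
proof (induction "m + n" arbitrary: m n rule: less_induct)
  case less
  show ?case
  proof (cases "m = 0 \<or> n = 0")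
    case True
    then show ?thesis using lpp_mono[OF W, of p "p + m" q "q + n"] by auto
  next
    case False
    then obtain i j where ij: "m = Suc i" "n = Suc j" by (meson not0_implies_Suc)
    have "lpp W p q + lpp (shifted p q W) i (Suc j) \<le> lpp W (p + i) (Suc (q + j))"
      "lpp W p q + lpp (shifted p q W) (Suc i) j \<le> lpp W (Suc (p + i)) (q + j)"
      using less[of i "Suc j"] less[of "Suc i" j] ij by auto
    then show ?thesis by (auto simp: shifted_def ij max_def add.commute)
  qed
qed

lemma lpp_shifted_le:
  assumes W: "\<And>v. 0 \<le> W v"
  shows "lpp (shifted p q W) m n \<le> lpp W (p + m) (q + n)"
  using lpp_superadditive[where W = W, OF W, of p q m n] lpp_nonneg[of W p q, OF W] by linarith

text \<open>The recursion has no memory: the values in column \<open>i\<close> act as the left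
  boundary for everything to their right.\<close>

lemma boundary_lpp_column_cut:
  "boundary_lpp W f g (i + m) n = boundary_lpp (shifted i 0 W) (\<lambda>k. f (i + k)) (\<lambda>j. boundary_lpp W f g i j) m n"
proof (induction "m + n" arbitrary: m n rule: less_induct)
  case less
  show ?case
  proof (cases m)
    case (Suc m')
    show ?thesis
    proof (cases n)
      case (Suc n')
      with less[of m' n] less[of m n'] \<open>m = Suc m'\<close> show ?thesis
        by (auto simp: shifted_def add.commute)
    qed (use Suc in auto)
  qed auto
qed

text \<open>A maximal path leaves the axes at some site (k, 0) or (0, k) and stays in the bulk
  afterwards. The shift is by \<open>k - 1\<close> because the first bulk site after (k, 0) is (k,
  1), in the same column.\<close>

lemma boundary_lpp_exit:
  assumes "1 \<le> m" "1 \<le> n"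
  shows "(\<exists>k\<in>{1..m}. boundary_lpp W f g m n \<le> f k + lpp (shifted (k - 1) 0 W) (Suc m - k) n) \<or>
    (\<exists>k\<in>{1..n}. boundary_lpp W f g m n \<le> g k + lpp (shifted 0 (k - 1) W) m (Suc n - k))"
  using assms
proof (induction "m + n" arbitrary: m n rule: less_induct)
  case less
  then obtain i j where ij: "m = Suc i" "n = Suc j" by (metis Suc_le_D One_nat_def)
  \<comment> \<open>Appending the site (m, n) to a bulk path from either neighbour does not move its
    exit point, so the induction may keep \<open>k\<close>.\<close>
  have step: "lpp (shifted p q W) (Suc i - p) (Suc j - q) \<ge> W (m, n) + lpp (shifted p q W) (i - p) (Suc j - q)"
    "lpp (shifted p q W) (Suc i - p) (Suc j - q) \<ge> W (m, n) + lpp (shifted p q W) (Suc i - p) (j - q)"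
    if "p \<le> i" "q \<le> j" for p q
    using that by (auto simp: Suc_diff_le shifted_def ij)
  show ?case
  proof (cases "boundary_lpp W f g i (Suc j) \<ge> boundary_lpp W f g (Suc i) j")
    case True
    then have eq: "boundary_lpp W f g m n = W (m, n) + boundary_lpp W f g i (Suc j)" by (simp add: ij max_absorb1)
    show ?thesis
    proof (cases "i = 0")
      case True
      have "boundary_lpp W f g m n \<le> g (Suc j) + lpp (shifted 0 (Suc j - 1) W) m (Suc n - Suc j)"
        using eq True by (simp add: ij shifted_def)
      then show ?thesis by (intro disjI2 bexI[of _ "Suc j"]) (auto simp: ij simp del: boundary_lpp.simps)
    next
      case False
      then consider k where "k \<in> {1..i}" "boundary_lpp W f g i (Suc j) \<le> f k + lpp (shifted (k - 1) 0 W) (Suc i - k) (Suc j)"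
        | k where "k \<in> {1..Suc j}" "boundary_lpp W f g i (Suc j) \<le> g k + lpp (shifted 0 (k - 1) W) i (Suc (Suc j) - k)"
        using less.hyps[of i "Suc j"] ij by auto
      then show ?thesis
      proof cases
        case 1
        then have a: "k - 1 \<le> i" "Suc i - (k - 1) = Suc m - k" "i - (k - 1) = Suc i - k" by (auto simp: ij)
        from step(1)[OF a(1) le0[of j]] have "boundary_lpp W f g m n \<le> f k + lpp (shifted (k - 1) 0 W) (Suc m - k) n"
          using 1(2) eq unfolding a diff_zero ij by linarith
        with 1 show ?thesis by (intro disjI1 bexI[of _ k]) (auto simp: ij)
      next
        case 2
        then have a: "k - 1 \<le> j" "Suc j - (k - 1) = Suc n - k" "j - (k - 1) = Suc j - k" by (auto simp: ij)
        from step(1)[OF le0[of i] a(1)] have "boundary_lpp W f g m n \<le> g k + lpp (shifted 0 (k - 1) W) m (Suc n - k)"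
          using 2(2) eq unfolding a diff_zero ij by linarith
        with 2 show ?thesis by (intro disjI2 bexI[of _ k]) (auto simp: ij)
      qed
    qed
  next
    case F: False
    then have eq: "boundary_lpp W f g m n = W (m, n) + boundary_lpp W f g (Suc i) j" by (simp add: ij max_absorb2)
    show ?thesis
    proof (cases "j = 0")
      case True
      have "boundary_lpp W f g m n \<le> f (Suc i) + lpp (shifted (Suc i - 1) 0 W) (Suc m - Suc i) n"
        using eq True by (simp add: ij shifted_def)
      then show ?thesis by (intro disjI1 bexI[of _ "Suc i"]) (auto simp: ij simp del: boundary_lpp.simps)
    next
      case False
      then consider k where "k \<in> {1..Suc i}" "boundary_lpp W f g (Suc i) j \<le> f k + lpp (shifted (k - 1) 0 W) (Suc (Suc i) - k) j"
        | k where "k \<in> {1..j}" "boundary_lpp W f g (Suc i) j \<le> g k + lpp (shifted 0 (k - 1) W) (Suc i) (Suc j - k)"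
        using less.hyps[of "Suc i" j] ij by auto
      then show ?thesis
      proof cases
        case 1
        then have a: "k - 1 \<le> i" "Suc i - (k - 1) = Suc m - k" "i - (k - 1) = Suc i - k" by (auto simp: ij)
        from step(2)[OF a(1) le0[of j]] have "boundary_lpp W f g m n \<le> f k + lpp (shifted (k - 1) 0 W) (Suc m - k) n"
          using 1(2) eq unfolding a diff_zero ij by linarith
        with 1 show ?thesis by (intro disjI1 bexI[of _ k]) (auto simp: ij)
      next
        case 2
        then have a: "k - 1 \<le> j" "Suc j - (k - 1) = Suc n - k" "j - (k - 1) = Suc j - k" by (auto simp: ij)
        from step(2)[OF le0[of i] a(1)] have "boundary_lpp W f g m n \<le> g k + lpp (shifted 0 (k - 1) W) m (Suc n - k)"
          using 2(2) eq unfolding a diff_zero ij by linarith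
        with 2 show ?thesis by (intro disjI2 bexI[of _ k]) (auto simp: ij)
      qed
    qed
  qed
qed

lemma shifted_shifted: "shifted p q (shifted p' q' W) = shifted (p + p') (q + q') W"
  by (auto simp: shifted_def fun_eq_iff add.assoc)

lemma shifted_0_0 [simp]: "shifted 0 0 W = W"
  by (auto simp: shifted_def fun_eq_iff)

text \<open>This is the exit lemma with column \<open>i\<close> as left boundary. An exit through
  the zero bottom boundary gives a path that avoids column \<open>i\<close> altogether; it is
  dominated by the choice k = 1. Row \<open>k\<close> is used by both pieces, which explains
  \<open>Suc n - k\<close>.\<close>

lemma lpp_column_exit:
  assumes W: "\<And>v. 0 \<le> W v" and "1 \<le> m" "1 \<le> n"
  shows "\<exists>k\<in>{1..n}. lpp W (i + m) n \<le> lpp W i k + lpp (shifted i (k - 1) W) m (Suc n - k)"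
proof -
  have W': "0 \<le> shifted p q W v" for p q v using W by (simp add: shifted_def)
  from boundary_lpp_exit[OF assms(2,3), of "shifted i 0 W" "\<lambda>_. 0" "lpp W i"]
  consider k where "k \<in> {1..m}" "lpp W (i + m) n \<le> lpp (shifted (k - 1 + i) 0 W) (Suc m - k) n"
    | k where "k \<in> {1..n}" "lpp W (i + m) n \<le> lpp W i k + lpp (shifted i (k - 1) W) m (Suc n - k)"
    unfolding boundary_lpp_column_cut by (auto simp: shifted_shifted)
  then show ?thesis
  proof cases
    case 1
    have "lpp (shifted (k - 1 + i) 0 W) (Suc m - k) n \<le> lpp (shifted i 0 W) m n"
      using lpp_shifted_le[of "shifted i 0 W" "k - 1" 0 "Suc m - k" n] W' 1(1) by (auto simp: shifted_shifted)
    with 1 lpp_nonneg[of W i 1, OF W] have "lpp W (i + m) n \<le> lpp W i 1 + lpp (shifted i (1 - 1) W) m (Suc n - 1)"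
      by simp
    with assms(3) show ?thesis by (intro bexI[of _ 1]) auto
  qed auto
qed

lemma lpp_transpose: "lpp (\<lambda>v. W (snd v, fst v)) m n = lpp W n m"
proof (induction "m + n" arbitrary: m n rule: less_induct)
  case less
  show ?case
  proof (cases "m = 0 \<or> n = 0")
    case False
    then obtain i j where ij: "m = Suc i" "n = Suc j" by (meson not0_implies_Suc)
    with less[of i "Suc j"] less[of "Suc i" j] show ?thesis by (simp add: max.commute)
  qed auto
qed

subsection \<open>Paths and the recursion\<close>

lemma set_up_right_path:
  assumes "p \<in> up_right_paths q"
  shows "set p \<subseteq> {1..} \<times> {1..}"
proof -
  have "p \<noteq> [] \<Longrightarrow> hd p = (1, 1) \<Longrightarrow> successively up_right_step p \<Longrightarrow> set p \<subseteq> {1..} \<times> {1..}" for p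
  proof (induction p rule: rev_induct)
    case (snoc v p)
    show ?case
    proof (cases "p = []")
      case False
      then have "set p \<subseteq> {1..} \<times> {1..}" "up_right_step (last p) v" "last p \<in> set p"
        using snoc by (auto simp: successively_append_iff)
      then show ?thesis by (fastforce simp: up_right_step_def)
    qed (use snoc in auto)
  qed auto
  with assms show ?thesis by (auto simp: up_right_paths_def)
qed

lemma up_right_paths_coords:
  assumes "p \<in> up_right_paths (i, j)"
  shows "1 \<le> i \<and> 1 \<le> j"
  using set_up_right_path[OF assms] assms last_in_set[of p] by (auto simp: up_right_paths_def)

lemma path_sum_le_lpp:
  assumes "p \<in> up_right_paths q" and W: "\<And>v. 0 \<le> W v"
  shows "(\<Sum>v\<leftarrow>p. W v) \<le> lpp W (fst q) (snd q)"
  using assms(1)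
proof (induction p arbitrary: q rule: rev_induct)
  case (snoc v p)
  then have q: "q = v" by (auto simp: up_right_paths_def)
  from snoc.prems q have pos: "1 \<le> fst v" "1 \<le> snd v"
    using up_right_paths_coords[of _ "fst v" "snd v"] by auto
  then obtain i j where ij: "v = (Suc i, Suc j)"
    by (metis Suc_le_D One_nat_def prod.collapse)
  show ?case
  proof (cases "p = []")
    case True
    then show ?thesis using lpp_nonneg[of W, OF W] by (simp add: q ij le_max_iff_disj)
  next
    case False
    then have "p \<in> up_right_paths (last p)" "up_right_step (last p) v"
      using snoc.prems by (auto simp: up_right_paths_def successively_append_iff)
    with snoc.IH[OF this(1)] show ?thesis
      by (auto simp: q ij up_right_step_def le_max_iff_disj)
  qed
qed (auto simp: up_right_paths_def)

lemma path_attaining_lpp: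
  assumes "1 \<le> i" "1 \<le> j" and W: "\<And>v. 0 \<le> W v"
  shows "\<exists>p\<in>up_right_paths (i, j). lpp W i j \<le> (\<Sum>v\<leftarrow>p. W v)"
  using assms(1,2)
proof (induction "i + j" arbitrary: i j rule: less_induct)
  case less
  then obtain i' j' where ij: "i = Suc i'" "j = Suc j'" by (metis Suc_le_D One_nat_def)
  have ext: "\<exists>p\<in>up_right_paths (i, j). W (i, j) + lpp W a b \<le> (\<Sum>v\<leftarrow>p. W v)"
    if ab: "a + b < i + j" "1 \<le> a" "1 \<le> b" "up_right_step (a, b) (i, j)" for a b
  proof -
    obtain p where "p \<in> up_right_paths (a, b)" "lpp W a b \<le> (\<Sum>v\<leftarrow>p. W v)"
      using less.hyps[OF ab(1-3)] by blast
    with ab(4) show ?thesis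
      by (intro bexI[of _ "p @ [(i, j)]"])
        (auto simp: up_right_paths_def successively_append_iff)
  qed
  show ?case
  proof (cases "i' = 0 \<and> j' = 0")
    case True
    then show ?thesis by (intro bexI[of _ "[(1, 1)]"]) (auto simp: ij up_right_paths_def)
  next
    case False
    have n: "lpp W i' j \<ge> 0" "lpp W i j' \<ge> 0" by (auto intro: lpp_nonneg W)
    consider "i' \<noteq> 0" "lpp W i j \<le> W (i, j) + lpp W i' j" | "j' \<noteq> 0" "lpp W i j \<le> W (i, j) + lpp W i j'"
    proof (cases "lpp W i' j \<le> lpp W i j'")
      case T: True
      have e: "lpp W i j = W (i, j) + lpp W i j'" using T by (simp add: ij max_absorb2)
      show thesis
      proof (cases "j' = 0")
        case True
        with n T e False show thesis by (intro that(1)) auto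
      qed (use that(2) e in auto)
    next
      case T: False
      have e: "lpp W i j = W (i, j) + lpp W i' j" using T by (simp add: ij max_absorb1)
      show thesis
      proof (cases "i' = 0")
        case True
        with n T e False show thesis by (intro that(2)) auto
      qed (use that(1) e in auto)
    qed
    then show ?thesis
    proof cases
      case 1
      with ext[of i' j] show ?thesis by (force simp: ij up_right_step_def)
    next
      case 2
      with ext[of i j'] show ?thesis by (force simp: ij up_right_step_def)
    qed
  qed
qed

lemma last_passage_eq_lpp:
  assumes "1 \<le> i" "1 \<le> j" and W: "\<And>v. 0 \<le> W v"
  shows "last_passage W (i, j) = lpp W i j"
  unfolding last_passage_def
proof (rule Max_eqI)
  obtain p where p: "p \<in> up_right_paths (i, j)" "lpp W i j \<le> (\<Sum>v\<leftarrow>p. W v)"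
    using path_attaining_lpp[where W = W, OF assms(1,2) W] by auto
  have "lpp W i j = (\<Sum>v\<leftarrow>p. W v)"
    using p(2) path_sum_le_lpp[where W = W, OF p(1) W] by simp
  then show "lpp W i j \<in> (\<lambda>p. \<Sum>v\<leftarrow>p. W v) ` up_right_paths (i, j)"
    using p(1) by (rule image_eqI)
next
  fix y assume "y \<in> (\<lambda>p. \<Sum>v\<leftarrow>p. W v) ` up_right_paths (i, j)"
  then show "y \<le> lpp W i j"
    using path_sum_le_lpp[where q = "(i, j)" and W = W, OF _ W] by auto
qed (intro finite_imageI finite_up_right_paths)

text \<open>No path to (i, j) leaves the rectangle, so almost sure identities for finitely many
  weights can be inserted into the maximum.\<close>

lemma last_passage_cong:
  assumes "\<And>i' j'. i' \<in> {1..i} \<Longrightarrow> j' \<in> {1..j} \<Longrightarrow> W (i', j') = W' (i', j')"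
  shows "last_passage W (i, j) = last_passage W' (i, j)"
proof -
  have *: "(\<Sum>v\<leftarrow>p. W v) = (\<Sum>v\<leftarrow>p. W' v)" if "p \<in> up_right_paths q" "fst q \<le> i" "snd q \<le> j" for p q
    using that
  proof (induction p arbitrary: q rule: rev_induct)
    case (snoc v p)
    then have q: "q = v" by (auto simp: up_right_paths_def)
    have "W v = W' v"
      using snoc.prems q up_right_paths_coords[of _ "fst v" "snd v"] assms[of "fst v" "snd v"] by auto
    show ?case
    proof (cases "p = []")
      case False
      then have "p \<in> up_right_paths (last p)" "up_right_step (last p) v"
        using snoc.prems by (auto simp: up_right_paths_def successively_append_iff)
      moreover from this(2) have "fst (last p) \<le> i" "snd (last p) \<le> j"
        using snoc.prems q by (auto simp: up_right_step_def)
      ultimately show ?thesis using snoc.IH \<open>W v = W' v\<close> by auto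
    qed (use \<open>W v = W' v\<close> in auto)
  qed auto
  have "(\<lambda>p. \<Sum>v\<leftarrow>p. W v) ` up_right_paths (i, j) = (\<lambda>p. \<Sum>v\<leftarrow>p. W' v) ` up_right_paths (i, j)"
    using * by (intro image_cong) auto
  then show ?thesis by (simp add: last_passage_def)
qed

subsection \<open>Burke's theorem for a column\<close>

definition exp_law :: "real \<Rightarrow> real measure" where
  "exp_law r = density lborel (\<lambda>x. ennreal (exponential_density r x))"

lemma sets_exp_law [measurable_cong, simp]: "sets (exp_law r) = sets borel"
  by (simp add: exp_law_def)

lemma space_exp_law [simp]: "space (exp_law r) = UNIV"
  by (simp add: exp_law_def)

lemma prob_space_exp_law: "0 < r \<Longrightarrow> prob_space (exp_law r)"
  unfolding exp_law_def by (rule prob_space_exponential_density)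

lemma nn_integral_exp_law:
  "f \<in> borel_measurable borel \<Longrightarrow>
    (\<integral>\<^sup>+x. f x \<partial>exp_law r) = (\<integral>\<^sup>+x. ennreal (exponential_density r x) * f x \<partial>lborel)"
  unfolding exp_law_def by (subst nn_integral_density) auto

lemma sigma_finite_exp_law: "sigma_finite_measure (exp_law r)"
  unfolding exp_law_def by (subst sigma_finite_measure.sigma_finite_iff_density_finite[OF sigma_finite_lborel]) auto

lemma AE_exp_law_nonneg: "AE x in exp_law r. 0 \<le> x"
  unfolding exp_law_def by (subst AE_density) (auto simp: exponential_density_def)

lemma nn_integral_exp_law_exp:
  assumes "c < r" "0 < r"
  shows "(\<integral>\<^sup>+x. ennreal (exp (c * x)) \<partial>exp_law r) = ennreal (r / (r - c))"
proof -
  interpret prob_space "density lborel (exponential_density (r - c))"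
    by (rule prob_space_exponential_density) (use assms in simp)
  have "(\<integral>\<^sup>+x. ennreal (exp (c * x)) \<partial>exp_law r)
      = (\<integral>\<^sup>+x. ennreal (r / (r - c)) * ennreal (exponential_density (r - c) x) \<partial>lborel)"
    using assms
    by (subst nn_integral_exp_law, simp, intro nn_integral_cong)
      (auto simp: exponential_density_def ennreal_mult'[symmetric] exp_add[symmetric] field_simps)
  also have "\<dots> = ennreal (r / (r - c)) * emeasure (density lborel (exponential_density (r - c))) UNIV"
    by (subst emeasure_density) (auto simp: nn_integral_cmult)
  finally show ?thesis using emeasure_space_1 by simp
qed

text \<open>The joint density of x - y and min x y factorises: the minimum has rate z + (1 - z) = 1
  and is independent of the difference. This is where the two boundary rates have to add up to the
  bulk rate.\<close>

lemma exponential_difference_min: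
  fixes \<phi> :: "real \<times> real \<Rightarrow> ennreal"
  assumes z: "0 < z" "z < 1" and [measurable]: "\<phi> \<in> borel_measurable (borel \<Otimes>\<^sub>M borel)"
  shows "(\<integral>\<^sup>+y. \<integral>\<^sup>+x. \<phi> (x - y, min x y) \<partial>exp_law z \<partial>exp_law (1 - z)) =
    (\<integral>\<^sup>+d. ennreal (z * (1 - z) * exp (if d \<ge> 0 then - (z * d) else (1 - z) * d)) *
      (\<integral>\<^sup>+c. \<phi> (d, c) \<partial>exp_law 1) \<partial>lborel)"
proof -
  interpret Ez: sigma_finite_measure "exp_law r" for r by (rule sigma_finite_exp_law)
  let ?e = "\<lambda>r x. ennreal (exponential_density r x)"
  let ?q = "\<lambda>d. ennreal (z * (1 - z) * exp (if d \<ge> 0 then - (z * d) else (1 - z) * d))"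
  \<comment> \<open>With minimum \<open>c\<close> and difference \<open>d\<close> one has y = c -
    min d 0 and x = y + d. The substitution preserves Lebesgue measure, so this identity of
    densities carries the whole lemma.\<close>
  have dens: "?e (1 - z) (c - min d 0) * ?e z (c - min d 0 + d) = ?q d * ?e 1 c" for c d
    using z by (auto simp: exponential_density_def ennreal_mult'[symmetric] exp_add[symmetric]
      min_def algebra_simps minus_diff_commute intro!: arg_cong[of _ _ ennreal])
  have "(\<integral>\<^sup>+y. \<integral>\<^sup>+x. \<phi> (x - y, min x y) \<partial>exp_law z \<partial>exp_law (1 - z))
      = (\<integral>\<^sup>+y. \<integral>\<^sup>+x. ?e (1 - z) y * ?e z x * \<phi> (x - y, min x y) \<partial>lborel \<partial>lborel)"
    by (simp add: nn_integral_exp_law nn_integral_cmult mult.assoc)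
  also have "\<dots> = (\<integral>\<^sup>+y. \<integral>\<^sup>+d. ?e (1 - z) y * ?e z (y + d) * \<phi> (d, min (y + d) y) \<partial>lborel \<partial>lborel)"
  proof (rule nn_integral_cong)
    fix y
    show "(\<integral>\<^sup>+x. ?e (1 - z) y * ?e z x * \<phi> (x - y, min x y) \<partial>lborel) =
      (\<integral>\<^sup>+d. ?e (1 - z) y * ?e z (y + d) * \<phi> (d, min (y + d) y) \<partial>lborel)"
      by (subst nn_integral_real_affine[where c = 1 and t = y]) auto
  qed
  also have "\<dots> = (\<integral>\<^sup>+d. \<integral>\<^sup>+y. ?e (1 - z) y * ?e z (y + d) * \<phi> (d, min (y + d) y) \<partial>lborel \<partial>lborel)"
    by (rule lborel_pair.Fubini') measurable
  also have "\<dots> = (\<integral>\<^sup>+d. \<integral>\<^sup>+c. ?q d * ?e 1 c * \<phi> (d, c) \<partial>lborel \<partial>lborel)"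
  proof (rule nn_integral_cong)
    fix d
    have "(\<integral>\<^sup>+y. ?e (1 - z) y * ?e z (y + d) * \<phi> (d, min (y + d) y) \<partial>lborel) =
      (\<integral>\<^sup>+c. ?e (1 - z) (c - min d 0) * ?e z (c - min d 0 + d) * \<phi> (d, min (c - min d 0 + d) (c - min d 0)) \<partial>lborel)"
      by (subst nn_integral_real_affine[where c = 1 and t = "- min d 0"]) (auto simp: algebra_simps)
    also have "\<dots> = (\<integral>\<^sup>+c. ?q d * ?e 1 c * \<phi> (d, c) \<partial>lborel)"
      unfolding dens by (intro nn_integral_cong) (auto simp: min_def)
    finally show "(\<integral>\<^sup>+y. ?e (1 - z) y * ?e z (y + d) * \<phi> (d, min (y + d) y) \<partial>lborel) =
      (\<integral>\<^sup>+c. ?q d * ?e 1 c * \<phi> (d, c) \<partial>lborel)" .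
  qed
  also have "\<dots> = (\<integral>\<^sup>+d. ?q d * (\<integral>\<^sup>+c. \<phi> (d, c) \<partial>exp_law 1) \<partial>lborel)"
    by (simp add: nn_integral_exp_law nn_integral_cmult mult.assoc)
  finally show ?thesis .
qed

text \<open>Both x and y are recovered from minimum and difference: x = min x y + max 0 (x - y), and
  symmetrically for y. As the minimum is independent of the difference and has rate 1, a fresh
  weight \<open>c\<close> may replace it without changing the joint law.\<close>

lemma burke_cell:
  fixes f :: "real \<times> real \<Rightarrow> ennreal"
  assumes z: "0 < z" "z < 1" and [measurable]: "f \<in> borel_measurable (borel \<Otimes>\<^sub>M borel)"
  shows "(\<integral>\<^sup>+y. \<integral>\<^sup>+x. \<integral>\<^sup>+c. f (c + max 0 (x - y), c + max 0 (y - x)) \<partial>exp_law 1 \<partial>exp_law z \<partial>exp_law (1 - z)) =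
    (\<integral>\<^sup>+y. \<integral>\<^sup>+x. f (x, y) \<partial>exp_law z \<partial>exp_law (1 - z))"
proof -
  interpret E1: prob_space "exp_law 1" by (rule prob_space_exp_law) simp
  let ?\<phi> = "\<lambda>v::real \<times> real. f (snd v + max 0 (fst v), snd v + max 0 (- fst v))"
  \<comment> \<open>\<open>?\<psi>\<close> averages over a fresh minimum and so depends on the
    difference alone; only the law of the difference enters the comparison.\<close>
  let ?\<psi> = "\<lambda>v::real \<times> real. \<integral>\<^sup>+c. ?\<phi> (fst v, c) \<partial>exp_law 1"
  have [measurable]: "?\<psi> \<in> borel_measurable (borel \<Otimes>\<^sub>M borel)"
    by measurable
  have "(\<integral>\<^sup>+y. \<integral>\<^sup>+x. f (x, y) \<partial>exp_law z \<partial>exp_law (1 - z)) = (\<integral>\<^sup>+y. \<integral>\<^sup>+x. ?\<phi> (x - y, min x y) \<partial>exp_law z \<partial>exp_law (1 - z))"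
    by (intro nn_integral_cong arg_cong[where f = f]) (auto simp: min_def max_def)
  also have "\<dots> = (\<integral>\<^sup>+y. \<integral>\<^sup>+x. ?\<psi> (x - y, min x y) \<partial>exp_law z \<partial>exp_law (1 - z))"
    by (subst (1 2) exponential_difference_min[OF z]) (measurable, simp add: E1.emeasure_space_1[simplified])
  finally show ?thesis by simp
qed

text \<open>A column as a queue: \<open>x\<close> is the horizontal increment at the bottom, \<open>Y\<close> are the vertical
  increments on the left side and \<open>c\<close> the weights. The output is
  the horizontal increment \<open>queue_out\<close> at height \<open>j\<close> and the vertical increments \<open>queue_inc\<close> on the
  right side.\<close>

fun queue_out :: "real \<Rightarrow> (nat \<Rightarrow> real) \<Rightarrow> (nat \<Rightarrow> real) \<Rightarrow> nat \<Rightarrow> real" where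
  "queue_out x Y c 0 = x"
| "queue_out x Y c (Suc j) = c (Suc j) + max 0 (queue_out x Y c j - Y (Suc j))"

definition queue_inc :: "real \<Rightarrow> (nat \<Rightarrow> real) \<Rightarrow> (nat \<Rightarrow> real) \<Rightarrow> nat \<Rightarrow> real" where
  "queue_inc x Y c j = c j + max 0 (Y j - queue_out x Y c (j - 1))"

lemma queue_out_cong:
  "(\<And>j. j \<in> {1..n} \<Longrightarrow> Y j = Y' j) \<Longrightarrow> (\<And>j. j \<in> {1..n} \<Longrightarrow> c j = c' j) \<Longrightarrow>
    queue_out x Y c n = queue_out x Y' c' n"
  by (induction n) auto

lemma queue_out_measurable:
  "m \<le> n \<Longrightarrow> (\<lambda>w. queue_out (fst w) (fst (snd w)) (snd (snd w)) m) \<in> borel_measurable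
    (borel \<Otimes>\<^sub>M (PiM {1..n} (\<lambda>_. borel)) \<Otimes>\<^sub>M (PiM {1..n} (\<lambda>_. borel)))"
proof (induction m)
  case (Suc m)
  then have [measurable]: "(\<lambda>w. queue_out (fst w) (fst (snd w)) (snd (snd w)) m) \<in> borel_measurable
    (borel \<Otimes>\<^sub>M (PiM {1..n} (\<lambda>_. borel)) \<Otimes>\<^sub>M (PiM {1..n} (\<lambda>_. borel)))"
    and [measurable]: "Suc m \<in> {1..n}" by auto
  show ?case unfolding queue_out.simps by measurable
qed auto

lemma queue_inc_measurable:
  "(\<lambda>w. \<lambda>j\<in>{1..n}. queue_inc (fst w) (fst (snd w)) (snd (snd w)) j) \<in> measurable
    (borel \<Otimes>\<^sub>M (PiM {1..n} (\<lambda>_. borel)) \<Otimes>\<^sub>M (PiM {1..n} (\<lambda>_. borel))) (PiM {1..n} (\<lambda>_. borel))"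
proof (rule measurable_restrict)
  fix j assume j [measurable]: "j \<in> {1..n}"
  then have [measurable]: "(\<lambda>w. queue_out (fst w) (fst (snd w)) (snd (snd w)) (j - 1)) \<in> borel_measurable
    (borel \<Otimes>\<^sub>M (PiM {1..n} (\<lambda>_. borel)) \<Otimes>\<^sub>M (PiM {1..n} (\<lambda>_. borel)))"
    by (intro queue_out_measurable) auto
  show "(\<lambda>w. queue_inc (fst w) (fst (snd w)) (snd (snd w)) j) \<in> borel_measurable
    (borel \<Otimes>\<^sub>M (PiM {1..n} (\<lambda>_. borel)) \<Otimes>\<^sub>M (PiM {1..n} (\<lambda>_. borel)))"
    unfolding queue_inc_def by measurable
qed

abbreviation exp_laws :: "'i set \<Rightarrow> real \<Rightarrow> ('i \<Rightarrow> real) measure" where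
  "exp_laws I r \<equiv> PiM I (\<lambda>_. exp_law r)"

interpretation exp_law: product_sigma_finite "\<lambda>i. exp_law (r i)" for r
  unfolding product_sigma_finite_def by (auto intro: sigma_finite_exp_law)

lemma sigma_finite_PiM_exp_law: "finite I \<Longrightarrow> sigma_finite_measure (PiM I (\<lambda>i. exp_law (r i)))"
  by (rule exp_law.sigma_finite)

text \<open>Induction on the height. The top cell receives the horizontal increment put out by the
  cells below, which by induction is independent of the vertical increments already emitted, and
  \<open>burke_cell\<close> handles that cell. The independence is why the output is kept as a joint
  law instead of two marginals.\<close>

lemma burke_column:
  fixes f :: "real \<times> (nat \<Rightarrow> real) \<Rightarrow> ennreal"
  assumes z: "0 < z" "z < 1" and "f \<in> borel_measurable (borel \<Otimes>\<^sub>M PiM {1..n} (\<lambda>_. borel))"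
  shows "(\<integral>\<^sup>+Y. \<integral>\<^sup>+c. \<integral>\<^sup>+x. f (queue_out x Y c n, \<lambda>j\<in>{1..n}. queue_inc x Y c j)
      \<partial>exp_law z \<partial>exp_laws {1..n} 1 \<partial>exp_laws {1..n} (1 - z)) = (\<integral>\<^sup>+Y. \<integral>\<^sup>+x. f (x, Y) \<partial>exp_law z \<partial>exp_laws {1..n} (1 - z))"
  using assms(3)
proof (induction n arbitrary: f)
  case 0
  have "(\<lambda>j\<in>{}. queue_inc x Y c j) = (\<lambda>_. undefined)" for x Y c by (auto simp: fun_eq_iff)
  then show ?case by (auto simp: PiM_empty nn_integral_count_space_finite)
next
  case (Suc n)
  let ?I = "{1..n}" and ?I' = "{1..Suc n}"
  let ?E = "exp_laws ?I"
  have I': "?I' = insert (Suc n) ?I" "finite ?I" "Suc n \<notin> ?I" by auto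
  have f[measurable]: "f \<in> borel_measurable (borel \<Otimes>\<^sub>M PiM ?I' (\<lambda>_. borel))" by fact
  interpret E: sigma_finite_measure "exp_law r" for r by (rule sigma_finite_exp_law)
  interpret P: sigma_finite_measure "?E r" for r by (rule sigma_finite_PiM_exp_law) simp
  interpret P': sigma_finite_measure "exp_laws ?I' r" for r by (rule sigma_finite_PiM_exp_law) simp
  interpret PE: pair_sigma_finite "?E r" "exp_law s" for r s by standard
  interpret EE: pair_sigma_finite "exp_law r" "exp_law s" for r s by standard
  \<comment> \<open>\<open>G\<close> applies the top cell, with left increment \<open>y\<close> and
    weight \<open>d\<close>, to the output \<open>(x, Y)\<close> of the first \<open>n\<close>
    cells.\<close>
  define G where "G = (\<lambda>(x, Y, y, d). f (d + max 0 (x - y), Y(Suc n := d + max 0 (y - x))))"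
  have G[measurable]: "G \<in> borel_measurable (borel \<Otimes>\<^sub>M PiM ?I (\<lambda>_. borel) \<Otimes>\<^sub>M borel \<Otimes>\<^sub>M borel)"
  proof -
    have "(\<lambda>w. (fst (snd w))(Suc n := snd (snd (snd w)) + max 0 (fst (snd (snd w)) - fst w)))
      \<in> measurable (borel \<Otimes>\<^sub>M PiM ?I (\<lambda>_. borel) \<Otimes>\<^sub>M borel \<Otimes>\<^sub>M borel) (PiM ?I' (\<lambda>_. borel :: real measure))"
      by (rule measurable_fun_upd[where J = ?I]) (auto simp: I')
    then show ?thesis unfolding G_def case_prod_beta' by measurable
  qed
  define Q where "Q = (\<lambda>(x, Y, c). (queue_out x Y c n, \<lambda>j\<in>?I. queue_inc x Y c j))"
  have Q[measurable]: "Q \<in> measurable (borel \<Otimes>\<^sub>M PiM ?I (\<lambda>_. borel) \<Otimes>\<^sub>M PiM ?I (\<lambda>_. borel))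
    (borel \<Otimes>\<^sub>M PiM ?I (\<lambda>_. borel))"
    using queue_out_measurable[of n n] queue_inc_measurable[of n]
    unfolding Q_def case_prod_beta' by (intro measurable_Pair) simp_all
  define F where "F = (\<lambda>(x, Y, c). f (queue_out x Y c (Suc n), \<lambda>j\<in>?I'. queue_inc x Y c j))"
  have F[measurable]: "F \<in> borel_measurable (borel \<Otimes>\<^sub>M PiM ?I' (\<lambda>_. borel) \<Otimes>\<^sub>M PiM ?I' (\<lambda>_. borel))"
    using queue_out_measurable[of "Suc n" "Suc n"] queue_inc_measurable[of "Suc n"]
    unfolding F_def case_prod_beta' by measurable
  have FG: "F (x, Y(Suc n := y), c(Suc n := d)) = G (fst (Q (x, Y, c)), snd (Q (x, Y, c)), y, d)" for x Y y c d
  proof -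
    have out: "queue_out x (Y(Suc n := y)) (c(Suc n := d)) j = queue_out x Y c j" if "j \<le> n" for j
      using that by (intro queue_out_cong) auto
    have "(\<lambda>j\<in>?I'. queue_inc x (Y(Suc n := y)) (c(Suc n := d)) j) =
      (\<lambda>j\<in>?I. queue_inc x Y c j)(Suc n := d + max 0 (y - queue_out x Y c n))"
      by (auto simp: fun_eq_iff queue_inc_def out)
    then show ?thesis by (simp add: F_def G_def Q_def out)
  qed
  have "(\<integral>\<^sup>+Y. \<integral>\<^sup>+c. \<integral>\<^sup>+x. F (x, Y, c) \<partial>exp_law z \<partial>exp_laws ?I' 1 \<partial>exp_laws ?I' (1 - z))
    = (\<integral>\<^sup>+y. \<integral>\<^sup>+Y. \<integral>\<^sup>+c. \<integral>\<^sup>+x. F (x, Y(Suc n := y), c) \<partial>exp_law z \<partial>exp_laws ?I' 1 \<partial>?E (1 - z) \<partial>exp_law (1 - z))"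
    unfolding I'(1) by (rule exp_law.product_nn_integral_insert_rev) (use I' in simp, use I' in simp, unfold I'(1)[symmetric], measurable)
  also have "\<dots> = (\<integral>\<^sup>+y. \<integral>\<^sup>+Y. \<integral>\<^sup>+d. \<integral>\<^sup>+c. \<integral>\<^sup>+x. F (x, Y(Suc n := y), c(Suc n := d))
      \<partial>exp_law z \<partial>?E 1 \<partial>exp_law 1 \<partial>?E (1 - z) \<partial>exp_law (1 - z))"
  proof (rule nn_integral_cong, rule nn_integral_cong)
    fix y Y assume "Y \<in> space (?E (1 - z))"
    then have [measurable]: "Y(Suc n := y) \<in> space (PiM ?I' (\<lambda>_. borel))"
      by (auto simp: space_PiM PiE_def extensional_def)
    show "(\<integral>\<^sup>+c. \<integral>\<^sup>+x. F (x, Y(Suc n := y), c) \<partial>exp_law z \<partial>exp_laws ?I' 1) =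
      (\<integral>\<^sup>+d. \<integral>\<^sup>+c. \<integral>\<^sup>+x. F (x, Y(Suc n := y), c(Suc n := d)) \<partial>exp_law z \<partial>?E 1 \<partial>exp_law 1)"
      unfolding I'(1) by (rule exp_law.product_nn_integral_insert_rev)
        (use I' in simp, use I' in simp, unfold I'(1)[symmetric], measurable)
  qed
  also have "\<dots> = (\<integral>\<^sup>+y. \<integral>\<^sup>+Y. \<integral>\<^sup>+d. \<integral>\<^sup>+c. \<integral>\<^sup>+x. G (fst (Q (x, Y, c)), snd (Q (x, Y, c)), y, d)
      \<partial>exp_law z \<partial>?E 1 \<partial>exp_law 1 \<partial>?E (1 - z) \<partial>exp_law (1 - z))"
    by (simp only: FG)
  \<comment> \<open>The variables of the new cell move outside, so that the induction hypothesis
    applies for fixed \<open>y\<close> and \<open>d\<close>; afterwards they move back in next to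
    \<open>x\<close>.\<close>
  also have "\<dots> = (\<integral>\<^sup>+y. \<integral>\<^sup>+d. \<integral>\<^sup>+Y. \<integral>\<^sup>+c. \<integral>\<^sup>+x. G (fst (Q (x, Y, c)), snd (Q (x, Y, c)), y, d)
      \<partial>exp_law z \<partial>?E 1 \<partial>?E (1 - z) \<partial>exp_law 1 \<partial>exp_law (1 - z))"
    by (intro nn_integral_cong PE.Fubini'[symmetric]) measurable
  also have "\<dots> = (\<integral>\<^sup>+y. \<integral>\<^sup>+d. \<integral>\<^sup>+Y. \<integral>\<^sup>+x. G (x, Y, y, d) \<partial>exp_law z \<partial>?E (1 - z) \<partial>exp_law 1 \<partial>exp_law (1 - z))"
  proof (rule nn_integral_cong, rule nn_integral_cong)
    fix y d
    have "(\<lambda>v. G (fst v, snd v, y, d)) \<in> borel_measurable (borel \<Otimes>\<^sub>M PiM ?I (\<lambda>_. borel))" by measurable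
    from Suc.IH[OF this] show "(\<integral>\<^sup>+Y. \<integral>\<^sup>+c. \<integral>\<^sup>+x. G (fst (Q (x, Y, c)), snd (Q (x, Y, c)), y, d) \<partial>exp_law z \<partial>?E 1 \<partial>?E (1 - z)) =
      (\<integral>\<^sup>+Y. \<integral>\<^sup>+x. G (x, Y, y, d) \<partial>exp_law z \<partial>?E (1 - z))"
      unfolding Q_def prod.case fst_conv snd_conv .
  qed
  also have "\<dots> = (\<integral>\<^sup>+y. \<integral>\<^sup>+Y. \<integral>\<^sup>+d. \<integral>\<^sup>+x. G (x, Y, y, d) \<partial>exp_law z \<partial>exp_law 1 \<partial>?E (1 - z) \<partial>exp_law (1 - z))"
    by (intro nn_integral_cong PE.Fubini') measurable
  also have "\<dots> = (\<integral>\<^sup>+Y. \<integral>\<^sup>+y. \<integral>\<^sup>+d. \<integral>\<^sup>+x. G (x, Y, y, d) \<partial>exp_law z \<partial>exp_law 1 \<partial>exp_law (1 - z) \<partial>?E (1 - z))"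
    by (intro PE.Fubini') measurable
  also have "\<dots> = (\<integral>\<^sup>+Y. \<integral>\<^sup>+y. \<integral>\<^sup>+x. \<integral>\<^sup>+d. G (x, Y, y, d) \<partial>exp_law 1 \<partial>exp_law z \<partial>exp_law (1 - z) \<partial>?E (1 - z))"
  proof (rule nn_integral_cong, rule nn_integral_cong)
    fix Y y assume "Y \<in> space (?E (1 - z))"
    then have [measurable]: "Y \<in> space (PiM ?I (\<lambda>_. borel))" by (simp add: space_PiM)
    show "(\<integral>\<^sup>+d. \<integral>\<^sup>+x. G (x, Y, y, d) \<partial>exp_law z \<partial>exp_law 1) = (\<integral>\<^sup>+x. \<integral>\<^sup>+d. G (x, Y, y, d) \<partial>exp_law 1 \<partial>exp_law z)"
      by (rule EE.Fubini') measurable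
  qed
  also have "\<dots> = (\<integral>\<^sup>+Y. \<integral>\<^sup>+y. \<integral>\<^sup>+x. f (x, Y(Suc n := y)) \<partial>exp_law z \<partial>exp_law (1 - z) \<partial>?E (1 - z))"
  proof (rule nn_integral_cong)
    fix Y assume "Y \<in> space (?E (1 - z))"
    then have Y: "Y \<in> space (PiM ?I (\<lambda>_. borel))" by (simp add: space_PiM)
    have "(\<lambda>v. Y(Suc n := snd v)) \<in> measurable (borel \<Otimes>\<^sub>M borel) (PiM ?I' (\<lambda>_. borel :: real measure))"
      by (rule measurable_fun_upd[where J = ?I]) (use Y in \<open>auto simp: I'\<close>)
    then have "(\<lambda>v. f (fst v, Y(Suc n := snd v))) \<in> borel_measurable (borel \<Otimes>\<^sub>M borel)"
      by measurable
    from burke_cell[OF z this]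
    show "(\<integral>\<^sup>+y. \<integral>\<^sup>+x. \<integral>\<^sup>+d. G (x, Y, y, d) \<partial>exp_law 1 \<partial>exp_law z \<partial>exp_law (1 - z)) =
      (\<integral>\<^sup>+y. \<integral>\<^sup>+x. f (x, Y(Suc n := y)) \<partial>exp_law z \<partial>exp_law (1 - z))" by (simp add: G_def)
  qed
  also have "\<dots> = (\<integral>\<^sup>+Y. \<integral>\<^sup>+x. f (x, Y) \<partial>exp_law z \<partial>exp_laws ?I' (1 - z))"
    unfolding I'(1) by (rule exp_law.product_nn_integral_insert[symmetric]) (use I' in simp, use I' in simp, unfold I'(1)[symmetric], measurable)
  finally show ?case unfolding F_def prod.case .
qed

subsection \<open>Fields of independent exponential weights\<close>

lemma harris_1d:
  fixes f g :: "real \<Rightarrow> ennreal"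
  assumes "prob_space N" "sets N = sets borel"
    and [measurable]: "f \<in> borel_measurable borel" "g \<in> borel_measurable borel"
    and mono: "\<And>x y. x \<le> y \<Longrightarrow> f x \<le> f y" and anti: "\<And>x y. x \<le> y \<Longrightarrow> g y \<le> g x"
  shows "(\<integral>\<^sup>+x. f x * g x \<partial>N) \<le> (\<integral>\<^sup>+x. f x \<partial>N) * (\<integral>\<^sup>+x. g x \<partial>N)"
proof -
  interpret prob_space N by fact
  note [measurable_cong] = assms(2)
  \<comment> \<open>This is (f y - f x) (g x - g y) >= 0, put additively through the increments
    \<open>a\<close> and \<open>b\<close> because the values may be infinite.\<close>
  have le: "f x * g x + f y * g y \<le> f x * g y + f y * g x" if xy: "x \<le> y" for x y
  proof -
    obtain a b where ab: "f y = f x + a" "g x = g y + b"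
      using mono[OF xy] anti[OF xy] by (auto simp: le_iff_add)
    have "f x * g x + f y * g y \<le> f x * g x + f y * g y + a * b" by simp
    also have "\<dots> = f x * g y + f y * g x" unfolding ab by (simp add: algebra_simps)
    finally show ?thesis .
  qed
  have le': "f x * g x + f y * g y \<le> f x * g y + f y * g x" for x y
    using le[of x y] le[of y x] by (cases "x \<le> y") (auto simp: add.commute)
  \<comment> \<open>Integration over two independent copies turns the pointwise inequality into
    twice the claim.\<close>
  have "2 * (\<integral>\<^sup>+x. f x * g x \<partial>N) = (\<integral>\<^sup>+x. \<integral>\<^sup>+y. f x * g x + f y * g y \<partial>N \<partial>N)"
    by (simp add: nn_integral_add emeasure_space_1 mult_2)
  also have "\<dots> \<le> (\<integral>\<^sup>+x. \<integral>\<^sup>+y. f x * g y + f y * g x \<partial>N \<partial>N)"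
    by (intro nn_integral_mono le')
  also have "\<dots> = 2 * ((\<integral>\<^sup>+x. f x \<partial>N) * (\<integral>\<^sup>+x. g x \<partial>N))"
    by (simp add: nn_integral_add nn_integral_cmult nn_integral_multc mult_2 mult.commute)
  finally show ?thesis by (subst (asm) ennreal_mult_le_mult_iff) auto
qed

text \<open>With coordinate \<open>i\<close> fixed, the induction hypothesis bounds the inner
  integral by a product. Its two factors are again monotone in opposite directions as functions of
  coordinate \<open>i\<close>, so the one-dimensional case finishes.\<close>

lemma harris:
  fixes f g :: "('i \<Rightarrow> real) \<Rightarrow> ennreal"
  assumes N: "prob_space N" "sets N = sets borel" and "finite I"
    and "f \<in> borel_measurable (PiM I (\<lambda>_. borel))" "g \<in> borel_measurable (PiM I (\<lambda>_. borel))"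
    and "\<And>x y. (\<And>i. i \<in> I \<Longrightarrow> x i \<le> y i) \<Longrightarrow> f x \<le> f y"
    and "\<And>x y. (\<And>i. i \<in> I \<Longrightarrow> x i \<le> y i) \<Longrightarrow> g y \<le> g x"
  shows "(\<integral>\<^sup>+x. f x * g x \<partial>PiM I (\<lambda>_. N)) \<le>
    (\<integral>\<^sup>+x. f x \<partial>PiM I (\<lambda>_. N)) * (\<integral>\<^sup>+x. g x \<partial>PiM I (\<lambda>_. N))"
  using assms(3-)
proof (induction I arbitrary: f g rule: finite_induct)
  case (insert i I)
  interpret N: prob_space N by fact
  interpret P: product_prob_space "\<lambda>_. N" UNIV by standard
  interpret PI: prob_space "PiM I (\<lambda>_. N)" by (rule prob_space_PiM) (rule N(1))
  note [measurable_cong] = N(2)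
  have s [measurable_cong]: "sets (PiM J (\<lambda>_. N)) = sets (PiM J (\<lambda>_. borel))" for J :: "'i set"
    by (rule sets_PiM_cong) (simp_all add: N)
  note f [measurable] = insert.prems(1) and g [measurable] = insert.prems(2)
  have sec: "(\<lambda>x. h (x(i := y))) \<in> borel_measurable (PiM I (\<lambda>_. borel))"
    if "h \<in> borel_measurable (PiM (insert i I) (\<lambda>_. borel))" for y and h :: "('i \<Rightarrow> real) \<Rightarrow> ennreal"
    by (rule measurable_compose[OF measurable_fun_upd that])
      (use insert.hyps in \<open>auto\<close>)
  have jnt: "(\<lambda>v. h ((snd v)(i := fst v))) \<in> borel_measurable (borel \<Otimes>\<^sub>M PiM I (\<lambda>_. borel))"
    if "h \<in> borel_measurable (PiM (insert i I) (\<lambda>_. borel))" for h :: "('i \<Rightarrow> real) \<Rightarrow> ennreal"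
    by (rule measurable_compose[OF measurable_fun_upd that])
      (use insert.hyps in \<open>auto\<close>)
  note [measurable] = jnt[OF f] jnt[OF g]
  have split: "integral\<^sup>N (PiM (insert i I) (\<lambda>_. N)) h = (\<integral>\<^sup>+y. \<integral>\<^sup>+x. h (x(i := y)) \<partial>PiM I (\<lambda>_. N) \<partial>N)"
    if "h \<in> borel_measurable (PiM (insert i I) (\<lambda>_. borel))" for h
    by (rule P.product_nn_integral_insert_rev) (use that insert.hyps in \<open>simp_all cong: measurable_cong_sets add: s\<close>)
  have "(\<integral>\<^sup>+x. f x * g x \<partial>PiM (insert i I) (\<lambda>_. N)) =
    (\<integral>\<^sup>+y. \<integral>\<^sup>+x. f (x(i := y)) * g (x(i := y)) \<partial>PiM I (\<lambda>_. N) \<partial>N)"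
    by (rule split) measurable
  also have "\<dots> \<le> (\<integral>\<^sup>+y. (\<integral>\<^sup>+x. f (x(i := y)) \<partial>PiM I (\<lambda>_. N)) * (\<integral>\<^sup>+x. g (x(i := y)) \<partial>PiM I (\<lambda>_. N)) \<partial>N)"
    by (intro nn_integral_mono insert.IH sec f g insert.prems) auto
  also have "\<dots> \<le> (\<integral>\<^sup>+y. (\<integral>\<^sup>+x. f (x(i := y)) \<partial>PiM I (\<lambda>_. N)) \<partial>N) * (\<integral>\<^sup>+y. (\<integral>\<^sup>+x. g (x(i := y)) \<partial>PiM I (\<lambda>_. N)) \<partial>N)"
    by (intro harris_1d[OF N] nn_integral_mono insert.prems; (measurable; fail)?)
  finally show ?case unfolding split[OF f] split[OF g] .
qed (simp add: PiM_empty nn_integral_count_space_finite)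

text \<open>The rates vary with the site because the stationary model uses three of them.
  Nonnegativity is demanded at every sample point, so that monotonicity and superadditivity of
  passage times hold surely and no null sets have to be carried along.\<close>

locale expo_field = prob_space P for P :: "'a measure" +
  fixes W :: "nat \<times> nat \<Rightarrow> 'a \<Rightarrow> real" and r :: "nat \<times> nat \<Rightarrow> real" and I :: "(nat \<times> nat) set"
  assumes indep: "indep_vars (\<lambda>_. borel) W I"
    and dist: "v \<in> I \<Longrightarrow> distr P borel (W v) = exp_law (r v)"
    and rate_pos: "v \<in> I \<Longrightarrow> 0 < r v"
    and nonneg: "0 \<le> W v s"
begin

lemma W_measurable [measurable]: "v \<in> I \<Longrightarrow> W v \<in> borel_measurable P"
  using indep by (auto simp: indep_vars_def)

lemma restrict_measurable:
  "(\<And>i. i \<in> A \<Longrightarrow> \<sigma> i \<in> I) \<Longrightarrow> (\<lambda>s. \<lambda>i\<in>A. W (\<sigma> i) s) \<in> measurable P (PiM A (\<lambda>_. borel))"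
  by (rule measurable_restrict) auto

text \<open>Reindexing along an injection covers both a block in place (\<open>\<sigma>\<close> the
  identity) and a translated block.\<close>

lemma field_law:
  assumes "inj_on \<sigma> A" "\<And>i. i \<in> A \<Longrightarrow> \<sigma> i \<in> I"
    and f: "f \<in> borel_measurable (PiM A (\<lambda>_. borel))"
  shows "(\<integral>\<^sup>+s. f (\<lambda>i\<in>A. W (\<sigma> i) s) \<partial>P) = (\<integral>\<^sup>+x. f x \<partial>PiM A (\<lambda>i. exp_law (r (\<sigma> i))))"
proof (cases "A = {}")
  case True
  have "(\<lambda>i\<in>{}. W (\<sigma> i) s) = (\<lambda>_. undefined)" for s by (auto simp: fun_eq_iff)
  with True show ?thesis
    by (simp add: PiM_empty nn_integral_count_space_finite emeasure_space_1)
next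
  case False
  let ?J = "\<sigma> ` A"
  have J: "?J \<subseteq> I" using assms(2) by auto
  have "distr P (PiM ?J (\<lambda>_. borel)) (\<lambda>s. \<lambda>v\<in>?J. W v s) = PiM ?J (\<lambda>v. distr P borel (W v))"
    using J False by (intro indep_vars_iff_distr_eq_PiM'[THEN iffD1] indep_vars_subset[OF indep]) auto
  also have "\<dots> = PiM ?J (\<lambda>v. exp_law (r v))"
    using J by (intro PiM_cong) (auto simp: dist)
  finally have 1: "distr P (PiM ?J (\<lambda>_. borel)) (\<lambda>s. \<lambda>v\<in>?J. W v s) = PiM ?J (\<lambda>v. exp_law (r v))" .
  have 2: "distr (PiM ?J (\<lambda>v. exp_law (r v))) (PiM A (\<lambda>i. exp_law (r (\<sigma> i)))) (\<lambda>x. \<lambda>i\<in>A. x (\<sigma> i)) =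
    PiM A (\<lambda>i. exp_law (r (\<sigma> i)))"
    by (rule distr_PiM_reindex) (use assms J in \<open>auto intro!: prob_space_exp_law rate_pos\<close>)
  have m: "(\<lambda>x. \<lambda>i\<in>A. x (\<sigma> i)) \<in> measurable (PiM ?J (\<lambda>_. borel)) (PiM A (\<lambda>_. borel :: real measure))"
    by (rule measurable_restrict) auto
  have s: "sets (PiM K (\<lambda>i. exp_law (q i))) = sets (PiM K (\<lambda>_. borel))" for K :: "'k set" and q
    by (rule sets_PiM_cong) auto
  have m2: "(\<lambda>s. \<lambda>v\<in>?J. W v s) \<in> measurable P (PiM ?J (\<lambda>_. borel))"
    using J by (intro measurable_restrict) auto
  have "(\<integral>\<^sup>+x. f x \<partial>PiM A (\<lambda>i. exp_law (r (\<sigma> i)))) =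
    (\<integral>\<^sup>+x. f (\<lambda>i\<in>A. x (\<sigma> i)) \<partial>PiM ?J (\<lambda>v. exp_law (r v)))"
    by (subst 2[symmetric], rule nn_integral_distr)
      (use f m in \<open>auto simp: measurable_cong_sets[OF s s] measurable_cong_sets[OF s refl]\<close>)
  also have "\<dots> = (\<integral>\<^sup>+s. f (\<lambda>i\<in>A. (\<lambda>v\<in>?J. W v s) (\<sigma> i)) \<partial>P)"
    by (subst 1[symmetric], rule nn_integral_distr) (use m2 measurable_compose[OF m f] in auto)
  also have "\<dots> = (\<integral>\<^sup>+s. f (\<lambda>i\<in>A. W (\<sigma> i) s) \<partial>P)"
    by (intro nn_integral_cong arg_cong[where f = f]) auto
  finally show ?thesis by simp
qed

lemma block_indep:
  assumes AB: "A \<inter> B = {}" "A \<subseteq> I" "B \<subseteq> I"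
    and f: "f \<in> borel_measurable (PiM A (\<lambda>_. borel))" and g: "g \<in> borel_measurable (PiM B (\<lambda>_. borel))"
  shows "(\<integral>\<^sup>+s. f (\<lambda>v\<in>A. W v s) * g (\<lambda>v\<in>B. W v s) \<partial>P) =
    (\<integral>\<^sup>+s. f (\<lambda>v\<in>A. W v s) \<partial>P) * (\<integral>\<^sup>+s. g (\<lambda>v\<in>B. W v s) \<partial>P)"
proof -
  let ?S = "PiM A (\<lambda>_. borel :: real measure)" and ?T = "PiM B (\<lambda>_. borel :: real measure)"
  let ?X = "\<lambda>s. \<lambda>v\<in>A. W v s" and ?Y = "\<lambda>s. \<lambda>v\<in>B. W v s"
  have X [measurable]: "?X \<in> measurable P ?S" "?Y \<in> measurable P ?T"
    using AB by (auto intro!: measurable_restrict)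
  have "indep_var ?S ?X ?T ?Y" by (rule indep_var_restrict[OF indep AB])
  then have eq: "distr P ?S ?X \<Otimes>\<^sub>M distr P ?T ?Y = distr P (?S \<Otimes>\<^sub>M ?T) (\<lambda>s. (?X s, ?Y s))"
    by (simp add: indep_var_distribution_eq)
  interpret X: prob_space "distr P ?S ?X" by (rule prob_space_distr) measurable
  interpret Y: prob_space "distr P ?T ?Y" by (rule prob_space_distr) measurable
  interpret XY: pair_prob_space "distr P ?S ?X" "distr P ?T ?Y" ..
  note [measurable] = f g
  have "(\<integral>\<^sup>+s. f (?X s) * g (?Y s) \<partial>P) = (\<integral>\<^sup>+v. f (fst v) * g (snd v) \<partial>distr P (?S \<Otimes>\<^sub>M ?T) (\<lambda>s. (?X s, ?Y s)))"
    by (subst nn_integral_distr) auto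
  also have "\<dots> = (\<integral>\<^sup>+x. f x \<partial>distr P ?S ?X) * (\<integral>\<^sup>+y. g y \<partial>distr P ?T ?Y)"
    unfolding eq[symmetric]
    by (subst Y.nn_integral_fst[symmetric]) (auto simp: nn_integral_cmult nn_integral_multc)
  finally show ?thesis by (simp add: nn_integral_distr)
qed

end

text \<open>Moments such as \<open>lpp_mgf\<close> depend on a product measure only, so they may be
  estimated in any realisation. The coordinates of the product space provide one, clipped at 0 to
  make nonnegativity sure.\<close>

lemma ex_expo_field:
  fixes r :: "nat \<times> nat \<Rightarrow> real"
  assumes "I \<noteq> {}" and r: "\<And>v. v \<in> I \<Longrightarrow> 0 < r v"
  shows "\<exists>(P :: (nat \<times> nat \<Rightarrow> real) measure) W. expo_field P W r I"
proof -
  let ?P = "PiM I (\<lambda>v. exp_law (r v))" and ?W = "\<lambda>v (x :: nat \<times> nat \<Rightarrow> real). max 0 (if v \<in> I then x v else 0)"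
  interpret prob_space ?P by (rule prob_space_PiM) (use r in \<open>auto intro: prob_space_exp_law\<close>)
  have m: "(\<lambda>x. x v) \<in> borel_measurable ?P" if "v \<in> I" for v
    using that by measurable
  have c: "distr ?P borel (\<lambda>x. x v) = exp_law (r v)" if "v \<in> I" for v
  proof -
    have "distr ?P borel (\<lambda>x. x v) = distr ?P (exp_law (r v)) (\<lambda>x. x v)"
      by (intro distr_cong) auto
    also have "\<dots> = exp_law (r v)" using that by (intro distr_PiM_component) (use r in \<open>auto intro: prob_space_exp_law\<close>)
    finally show ?thesis .
  qed
  have "indep_vars (\<lambda>_. borel) (\<lambda>v x. x v) I"
  proof (rule indep_vars_iff_distr_eq_PiM'[THEN iffD2])
    have "distr ?P (PiM I (\<lambda>_. borel)) (\<lambda>x. \<lambda>i\<in>I. x i) = distr ?P ?P (\<lambda>x. x)"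
      by (intro distr_cong sets_PiM_cong) (auto simp: space_PiM)
    also have "\<dots> = PiM I (\<lambda>v. distr ?P borel (\<lambda>x. x v))"
      unfolding distr_id by (intro PiM_cong) (auto simp: c)
    finally show "distr ?P (PiM I (\<lambda>_. borel)) (\<lambda>x. \<lambda>i\<in>I. x i) = PiM I (\<lambda>v. distr ?P borel (\<lambda>x. x v))" .
  qed (use assms(1) m in auto)
  then have "indep_vars (\<lambda>_. borel) (\<lambda>v x. max 0 (x v)) I"
    by (rule indep_vars_compose2) auto
  then have 1: "indep_vars (\<lambda>_. borel) ?W I"
    by (rule indep_vars_cong[THEN iffD1, rotated -1]) auto
  have 2: "distr ?P borel (?W v) = exp_law (r v)" if v: "v \<in> I" for v
  proof -
    have "AE x in ?P. 0 \<le> x v"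
      using v by (intro AE_PiM_component[where P = "\<lambda>x. 0 \<le> x"] AE_exp_law_nonneg) (use r in \<open>auto intro: prob_space_exp_law\<close>)
    then have "AE x in ?P. ?W v x = x v" by eventually_elim (use v in auto)
    then have "distr ?P borel (?W v) = distr ?P borel (\<lambda>x. x v)"
      using v by (intro distr_cong_AE) (auto intro!: m)
    then show ?thesis using c[OF v] by simp
  qed
  show ?thesis by (intro exI expo_field.intro expo_field_axioms.intro) (use 1 2 r prob_space_axioms in auto)
qed

subsection \<open>The stationary model\<close>

text \<open>The corner (0, 0) is left out because the sums \<open>bottom\<close> and
  \<open>leftmost\<close> start at index 1: no boundary weight sits there.\<close>

definition grid :: "nat \<Rightarrow> nat \<Rightarrow> (nat \<times> nat) set" where
  "grid m n = {..m} \<times> {..n} - {(0, 0)}"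

definition boundary_rate :: "real \<Rightarrow> nat \<times> nat \<Rightarrow> real" where
  "boundary_rate z v = (if snd v = 0 then z else if fst v = 0 then 1 - z else 1)"

definition bottom :: "(nat \<times> nat \<Rightarrow> real) \<Rightarrow> nat \<Rightarrow> real" where
  "bottom x k = (\<Sum>i\<in>{1..k}. x (i, 0))"

definition leftmost :: "(nat \<times> nat \<Rightarrow> real) \<Rightarrow> nat \<Rightarrow> real" where
  "leftmost x k = (\<Sum>j\<in>{1..k}. x (0, j))"

definition stationary_lpp :: "(nat \<times> nat \<Rightarrow> real) \<Rightarrow> nat \<Rightarrow> nat \<Rightarrow> real" where
  "stationary_lpp x = boundary_lpp x (bottom x) (leftmost x)"

definition vertical_incr :: "(nat \<times> nat \<Rightarrow> real) \<Rightarrow> nat \<Rightarrow> nat \<Rightarrow> real" where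
  "vertical_incr x i j = stationary_lpp x i j - stationary_lpp x i (j - 1)"

lemma stationary_lpp_0_right [simp]: "stationary_lpp x i 0 = bottom x i"
  by (cases i) (auto simp: stationary_lpp_def bottom_def leftmost_def)

lemma stationary_lpp_0_left [simp]: "stationary_lpp x 0 j = leftmost x j"
  by (auto simp: stationary_lpp_def)

lemma stationary_lpp_Suc_Suc:
  "stationary_lpp x (Suc i) (Suc j) = x (Suc i, Suc j) + max (stationary_lpp x i (Suc j)) (stationary_lpp x (Suc i) j)"
  by (simp add: stationary_lpp_def)

text \<open>Written for the differences of neighbouring columns, the recursion of
  \<open>stationary_lpp\<close> becomes the Lindley recursion of the queue: the maximum turns into a
  positive part.\<close>

lemma queue_out_stationary_lpp:
  "queue_out (x (Suc i, 0)) (vertical_incr x i) (\<lambda>j. x (Suc i, j)) j = stationary_lpp x (Suc i) j - stationary_lpp x i j"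
  by (induction j) (auto simp: bottom_def vertical_incr_def stationary_lpp_Suc_Suc max_def)

lemma queue_inc_stationary_lpp:
  "1 \<le> j \<Longrightarrow> queue_inc (x (Suc i, 0)) (vertical_incr x i) (\<lambda>j. x (Suc i, j)) j = vertical_incr x (Suc i) j"
  unfolding queue_inc_def queue_out_stationary_lpp
  by (cases j) (auto simp: vertical_incr_def stationary_lpp_Suc_Suc max_def)

lemma boundary_lpp_measurable:
  assumes "{1..m} \<times> {1..n} \<subseteq> A"
    and "\<And>i. i \<in> {1..m} \<Longrightarrow> (\<lambda>x. f x i) \<in> borel_measurable (PiM A (\<lambda>_. borel))"
    and "\<And>j. j \<le> n \<Longrightarrow> (\<lambda>x. g x j) \<in> borel_measurable (PiM A (\<lambda>_. borel))"
  shows "(\<lambda>x. boundary_lpp x (f x) (g x) m n) \<in> borel_measurable (PiM A (\<lambda>_. borel))"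
proof -
  have "i \<le> m \<Longrightarrow> j \<le> n \<Longrightarrow> (\<lambda>x. boundary_lpp x (f x) (g x) i j) \<in> borel_measurable (PiM A (\<lambda>_. borel))" for i j
  proof (induction "i + j" arbitrary: i j rule: less_induct)
    case less
    show ?case
    proof (cases "i = 0 \<or> j = 0")
      case True
      then show ?thesis
        by (cases i) (use assms less.prems in auto)
    next
      case False
      then obtain i' j' where ij: "i = Suc i'" "j = Suc j'" by (meson not0_implies_Suc)
      have [measurable]: "(i, j) \<in> A" using assms(1) less.prems ij by auto
      have [measurable]: "(\<lambda>x. boundary_lpp x (f x) (g x) i' j) \<in> borel_measurable (PiM A (\<lambda>_. borel))"
        "(\<lambda>x. boundary_lpp x (f x) (g x) i j') \<in> borel_measurable (PiM A (\<lambda>_. borel))"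
        using less ij by auto
      show ?thesis unfolding ij boundary_lpp.simps unfolding ij[symmetric] by measurable
    qed
  qed
  then show ?thesis by simp
qed

lemma lpp_measurable:
  "{1..m} \<times> {1..n} \<subseteq> A \<Longrightarrow> (\<lambda>x. lpp x m n) \<in> borel_measurable (PiM A (\<lambda>_. borel))"
  by (rule boundary_lpp_measurable) auto

lemma sum_measurable_PiM:
  assumes "\<And>i. i \<in> K \<Longrightarrow> h i \<in> A"
  shows "(\<lambda>x. \<Sum>i\<in>K. x (h i)) \<in> borel_measurable (PiM A (\<lambda>_. borel :: real measure))"
  by (rule borel_measurable_sum) (use assms in auto)

lemma stationary_lpp_measurable:
  assumes "grid m n \<subseteq> A"
  shows "(\<lambda>x. stationary_lpp x m n) \<in> borel_measurable (PiM A (\<lambda>_. borel))"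
  unfolding stationary_lpp_def bottom_def leftmost_def
  by (rule boundary_lpp_measurable; (rule sum_measurable_PiM)?) (use assms in \<open>auto simp: grid_def\<close>)

lemma grid_mono: "m \<le> m' \<Longrightarrow> n \<le> n' \<Longrightarrow> grid m n \<subseteq> grid m' n'"
  by (auto simp: grid_def)

lemma vertical_incr_measurable:
  assumes "grid m n \<subseteq> A"
  shows "(\<lambda>x. \<lambda>j\<in>{1..n}. vertical_incr x m j) \<in> measurable (PiM A (\<lambda>_. borel)) (PiM {1..n} (\<lambda>_. borel))"
  unfolding vertical_incr_def
  by (intro measurable_restrict borel_measurable_diff stationary_lpp_measurable order_trans[OF grid_mono assms]) auto

lemma stationary_lpp_cong:
  assumes "\<And>v. v \<in> grid m n \<Longrightarrow> x v = y v"
  shows "stationary_lpp x m n = stationary_lpp y m n"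
proof -
  have "i \<le> m \<Longrightarrow> j \<le> n \<Longrightarrow> stationary_lpp x i j = stationary_lpp y i j" for i j
  proof (induction "i + j" arbitrary: i j rule: less_induct)
    case less
    show ?case
    proof (cases "i = 0 \<or> j = 0")
      case True
      then show ?thesis
        using less.prems assms by (auto simp: bottom_def leftmost_def grid_def intro!: sum.cong)
    next
      case False
      then obtain i' j' where ij: "i = Suc i'" "j = Suc j'" by (meson not0_implies_Suc)
      with less have "stationary_lpp x i' j = stationary_lpp y i' j" "stationary_lpp x i j' = stationary_lpp y i j'" "x (i, j) = y (i, j)"
        by (auto intro!: assms simp: grid_def)
      then show ?thesis by (simp add: ij stationary_lpp_Suc_Suc)
    qed
  qed
  then show ?thesis by simp
qed

lemma vertical_incr_cong:
  assumes "\<And>v. v \<in> grid m n \<Longrightarrow> x v = y v" "j \<le> n"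
  shows "vertical_incr x m j = vertical_incr y m j"
  unfolding vertical_incr_def using assms grid_mono[of m m] 
  by (intro arg_cong2[where f = "(-)"] stationary_lpp_cong assms(1)) (meson diff_le_self le_refl order_trans subsetD)+

lemma sets_PiM_exp_law: "sets (PiM K (\<lambda>i. exp_law (q i))) = sets (PiM K (\<lambda>_. borel))"
  by (rule sets_PiM_cong) auto

lemma nn_integral_reindex_exp_law:
  assumes "inj_on h J" "h \<in> J \<rightarrow> K" "\<And>v. v \<in> K \<Longrightarrow> 0 < q v"
    and f: "f \<in> borel_measurable (PiM J (\<lambda>_. borel))"
  shows "(\<integral>\<^sup>+x. f (\<lambda>i\<in>J. x (h i)) \<partial>PiM K (\<lambda>v. exp_law (q v))) = (\<integral>\<^sup>+x. f x \<partial>PiM J (\<lambda>i. exp_law (q (h i))))"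
proof -
  have 2: "distr (PiM K (\<lambda>v. exp_law (q v))) (PiM J (\<lambda>i. exp_law (q (h i)))) (\<lambda>x. \<lambda>i\<in>J. x (h i)) =
    PiM J (\<lambda>i. exp_law (q (h i)))"
    by (rule distr_PiM_reindex) (use assms in \<open>auto intro!: prob_space_exp_law\<close>)
  have m: "(\<lambda>x. \<lambda>i\<in>J. x (h i)) \<in> measurable (PiM K (\<lambda>_. borel)) (PiM J (\<lambda>_. borel :: real measure))"
    by (rule measurable_restrict) (use assms(2) in \<open>auto intro!: measurable_component_singleton\<close>)
  have m': "(\<lambda>x. \<lambda>i\<in>J. x (h i)) \<in> measurable (PiM K (\<lambda>v. exp_law (q v))) (PiM J (\<lambda>i. exp_law (q (h i))))"
    using m by (simp only: measurable_cong_sets[OF sets_PiM_exp_law sets_PiM_exp_law])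
  have f': "f \<in> borel_measurable (PiM J (\<lambda>i. exp_law (q (h i))))"
    using f by (simp only: measurable_cong_sets[OF sets_PiM_exp_law refl])
  show ?thesis
    by (subst 2[symmetric], rule nn_integral_distr[OF m', symmetric]) (use f' in simp)
qed

text \<open>Induction over columns. The vertical increments on column \<open>m\<close> are functions
  of \<open>grid m n\<close>, hence independent of the weights in the next column, and
  \<open>burke_column\<close> reproduces independent increments of rate 1 - z on its right
  side.\<close>

theorem burke:
  assumes z: "0 < z" "z < 1" and "f \<in> borel_measurable (PiM {1..n} (\<lambda>_. borel))"
  shows "(\<integral>\<^sup>+x. f (\<lambda>j\<in>{1..n}. vertical_incr x m j) \<partial>PiM (grid m n) (\<lambda>v. exp_law (boundary_rate z v))) =
    (\<integral>\<^sup>+Y. f Y \<partial>exp_laws {1..n} (1 - z))"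
  using assms(3)
proof (induction m arbitrary: f)
  case 0
  have "(\<integral>\<^sup>+x. f (\<lambda>j\<in>{1..n}. vertical_incr x 0 j) \<partial>PiM (grid 0 n) (\<lambda>v. exp_law (boundary_rate z v))) =
    (\<integral>\<^sup>+x. f (\<lambda>j\<in>{1..n}. x (0, j)) \<partial>PiM (grid 0 n) (\<lambda>v. exp_law (boundary_rate z v)))"
  proof (intro nn_integral_cong arg_cong[where f = f])
    fix x :: "nat \<times> nat \<Rightarrow> real"
    show "(\<lambda>j\<in>{1..n}. vertical_incr x 0 j) = (\<lambda>j\<in>{1..n}. x (0, j))"
    proof (intro restrict_ext)
      fix j assume "j \<in> {1..n}"
      then show "vertical_incr x 0 j = x (0, j)"
        by (cases j) (auto simp: vertical_incr_def leftmost_def)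
    qed
  qed
  also have "\<dots> = (\<integral>\<^sup>+Y. f Y \<partial>PiM {1..n} (\<lambda>j. exp_law (boundary_rate z (0, j))))"
    by (rule nn_integral_reindex_exp_law) (use z 0 in \<open>auto simp: inj_on_def grid_def boundary_rate_def\<close>)
  also have "PiM {1..n} (\<lambda>j. exp_law (boundary_rate z (0, j))) = exp_laws {1..n} (1 - z)"
    by (intro PiM_cong) (auto simp: boundary_rate_def)
  finally show ?case .
next
  case (Suc m)
  note f[measurable] = Suc.prems
  let ?C = "{Suc m} \<times> {..n}" and ?A = "grid m n" and ?I = "{1..n}"
  let ?P = "\<lambda>K. PiM K (\<lambda>v. exp_law (boundary_rate z v))"
  let ?K = "\<lambda>Y c. \<lambda>j\<in>?I. queue_inc (c 0) Y c j"
  have split: "grid (Suc m) n = ?A \<union> ?C" "?A \<inter> ?C = {}" "finite ?A" "finite ?C"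
    by (auto simp: grid_def)
  interpret E: sigma_finite_measure "exp_law r" for r by (rule sigma_finite_exp_law)
  have K: "(\<lambda>w. ?K (fst w) (snd w)) \<in> measurable (PiM ?I (\<lambda>_. borel) \<Otimes>\<^sub>M PiM {..n} (\<lambda>_. borel)) (PiM ?I (\<lambda>_. borel))"
  proof -
    let ?N = "PiM ?I (\<lambda>_. borel :: real measure) \<Otimes>\<^sub>M PiM {..n} (\<lambda>_. borel :: real measure)"
    have r1: "(\<lambda>w. restrict (snd w) ?I) \<in> measurable ?N (PiM ?I (\<lambda>_. borel :: real measure))"
      by (rule measurable_restrict) (auto intro!: measurable_compose[OF measurable_snd measurable_component_singleton])
    have r2: "(\<lambda>w. snd w 0) \<in> borel_measurable ?N"
      by (auto intro!: measurable_compose[OF measurable_snd measurable_component_singleton])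
    have r: "(\<lambda>w. (snd w 0, fst w, restrict (snd w) ?I)) \<in>
      measurable ?N (borel \<Otimes>\<^sub>M PiM ?I (\<lambda>_. borel) \<Otimes>\<^sub>M PiM ?I (\<lambda>_. borel :: real measure))"
      using r1 r2 by measurable
    have "(\<lambda>w. \<lambda>j\<in>?I. queue_inc (snd w 0) (fst w) (restrict (snd w) ?I) j) = (\<lambda>w. ?K (fst w) (snd w))"
    proof (rule ext, rule restrict_ext)
      fix w :: "(nat \<Rightarrow> real) \<times> (nat \<Rightarrow> real)" and j assume "j \<in> ?I"
      then show "queue_inc (snd w 0) (fst w) (restrict (snd w) ?I) j = queue_inc (snd w 0) (fst w) (snd w) j"
        by (auto simp: queue_inc_def intro!: queue_out_cong arg_cong[where f = "\<lambda>q. max 0 (fst w j - q)"])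
    qed
    with measurable_compose[OF r queue_inc_measurable[of n]] show ?thesis by simp
  qed
  \<comment> \<open>\<open>\<Psi>\<close> integrates out the new column for given increments on its
    left. Its entry \<open>c 0\<close> is the bottom weight, which is the input of the
    queue.\<close>
  define \<Psi> where "\<Psi> Y = (\<integral>\<^sup>+c. f (?K Y c) \<partial>PiM {..n} (\<lambda>j. exp_law (boundary_rate z (Suc m, j))))" for Y
  have fK: "(\<lambda>w. f (?K (fst w) (snd w))) \<in> borel_measurable (PiM ?I (\<lambda>_. borel) \<Otimes>\<^sub>M PiM {..n} (\<lambda>_. borel))"
    by (rule measurable_compose[OF K f])
  have \<Psi>m: "\<Psi> \<in> borel_measurable (PiM ?I (\<lambda>_. borel))"
    unfolding \<Psi>_def
    by (rule sigma_finite_measure.borel_measurable_nn_integral[OF sigma_finite_PiM_exp_law[OF finite_atMost]])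
      (use fK in \<open>auto simp: case_prod_beta' measurable_cong_sets[OF sets_pair_measure_cong[OF refl sets_PiM_exp_law] refl]\<close>)
  have "(\<integral>\<^sup>+x. f (\<lambda>j\<in>?I. vertical_incr x (Suc m) j) \<partial>?P (grid (Suc m) n)) =
    (\<integral>\<^sup>+x. \<integral>\<^sup>+c. f (\<lambda>j\<in>?I. vertical_incr (merge ?A ?C (x, c)) (Suc m) j) \<partial>?P ?C \<partial>?P ?A)"
    unfolding split(1)
    by (rule exp_law.product_nn_integral_fold[OF split(2-4)], unfold split(1)[symmetric] measurable_cong_sets[OF sets_PiM_exp_law refl])
      (rule measurable_compose[OF vertical_incr_measurable[OF order_refl] f])
  also have "\<dots> = (\<integral>\<^sup>+x. \<Psi> (\<lambda>j\<in>?I. vertical_incr x m j) \<partial>?P ?A)"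
  proof (rule nn_integral_cong)
    fix x :: "nat \<times> nat \<Rightarrow> real"
    let ?Y = "\<lambda>j\<in>?I. vertical_incr x m j"
    have "(\<integral>\<^sup>+c. f (\<lambda>j\<in>?I. vertical_incr (merge ?A ?C (x, c)) (Suc m) j) \<partial>?P ?C) =
      (\<integral>\<^sup>+c. f (?K ?Y (\<lambda>j\<in>{..n}. c (Suc m, j))) \<partial>?P ?C)"
    proof (intro nn_integral_cong arg_cong[where f = f] restrict_ext)
      fix c :: "nat \<times> nat \<Rightarrow> real" and j assume j: "j \<in> ?I"
      let ?x = "merge ?A ?C (x, c)" and ?c = "\<lambda>j\<in>{..n}. c (Suc m, j)"
      have v: "vertical_incr ?x m i = vertical_incr x m i" if "i \<le> n" for i
        using that by (intro vertical_incr_cong[of m n]) (auto simp: merge_def)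
      have w: "?x (Suc m, i) = c (Suc m, i)" if "i \<le> n" for i
        using that by (auto simp: merge_def grid_def)
      have "vertical_incr ?x (Suc m) j = queue_inc (?x (Suc m, 0)) (vertical_incr ?x m) (\<lambda>j. ?x (Suc m, j)) j"
        using j by (intro queue_inc_stationary_lpp[symmetric]) auto
      also have "\<dots> = queue_inc (c (Suc m, 0)) ?Y ?c j"
        using j by (auto simp: queue_inc_def v w intro!: queue_out_cong arg_cong[where f = "\<lambda>q. max 0 (vertical_incr x m j - q)"])
      finally show "vertical_incr ?x (Suc m) j = queue_inc (?c 0) ?Y ?c j" by simp
    qed
    also have "\<dots> = \<Psi> ?Y"
      unfolding \<Psi>_def
    proof (rule nn_integral_reindex_exp_law)
      have "(\<lambda>c. (?Y, c)) \<in> measurable (PiM {..n} (\<lambda>_. borel :: real measure)) (PiM ?I (\<lambda>_. borel :: real measure) \<Otimes>\<^sub>M PiM {..n} (\<lambda>_. borel :: real measure))"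
        by (rule measurable_Pair1') (auto simp: space_PiM)
      from measurable_compose[OF this fK] show "(\<lambda>c. f (?K ?Y c)) \<in> borel_measurable (PiM {..n} (\<lambda>_. borel))"
        by simp
    qed (use z in \<open>auto simp: inj_on_def boundary_rate_def\<close>)
    finally show "(\<integral>\<^sup>+c. f (\<lambda>j\<in>?I. vertical_incr (merge ?A ?C (x, c)) (Suc m) j) \<partial>?P ?C) = \<Psi> ?Y" .
  qed
  also have "\<dots> = (\<integral>\<^sup>+Y. \<Psi> Y \<partial>exp_laws ?I (1 - z))"
    by (rule Suc.IH) (rule \<Psi>m)
  also have "\<dots> = (\<integral>\<^sup>+Y. \<integral>\<^sup>+c. \<integral>\<^sup>+x. f (\<lambda>j\<in>?I. queue_inc x Y c j) \<partial>exp_law z \<partial>exp_laws ?I 1 \<partial>exp_laws ?I (1 - z))"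
  proof (rule nn_integral_cong)
    fix Y assume "Y \<in> space (exp_laws ?I (1 - z))"
    then have Y: "Y \<in> space (PiM ?I (\<lambda>_. borel :: real measure))" by (simp add: space_PiM)
    have ins: "{..n} = insert 0 ?I" and fin: "finite ?I" "0 \<notin> ?I" by auto
    have "(\<lambda>c. (Y, c)) \<in> measurable (PiM {..n} (\<lambda>_. borel :: real measure)) (PiM ?I (\<lambda>_. borel :: real measure) \<Otimes>\<^sub>M PiM {..n} (\<lambda>_. borel :: real measure))"
      by (rule measurable_Pair1') (rule Y)
    from measurable_compose[OF this fK] have m: "(\<lambda>c. f (?K Y c)) \<in> borel_measurable (PiM {..n} (\<lambda>_. borel))"
      by simp
    have "\<Psi> Y = (\<integral>\<^sup>+c. \<integral>\<^sup>+x. f (?K Y (c(0 := x))) \<partial>exp_law (boundary_rate z (Suc m, 0)) \<partial>PiM ?I (\<lambda>j. exp_law (boundary_rate z (Suc m, j))))"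
      unfolding \<Psi>_def ins
      by (rule exp_law.product_nn_integral_insert[OF fin], unfold ins[symmetric] measurable_cong_sets[OF sets_PiM_exp_law refl])
        (rule m)
    also have "PiM ?I (\<lambda>j. exp_law (boundary_rate z (Suc m, j))) = exp_laws ?I 1"
      by (intro PiM_cong) (auto simp: boundary_rate_def)
    also have "boundary_rate z (Suc m, 0) = z" by (simp add: boundary_rate_def)
    also have "(\<integral>\<^sup>+c. \<integral>\<^sup>+x. f (?K Y (c(0 := x))) \<partial>exp_law z \<partial>exp_laws ?I 1) = (\<integral>\<^sup>+c. \<integral>\<^sup>+x. f (\<lambda>j\<in>?I. queue_inc x Y c j) \<partial>exp_law z \<partial>exp_laws ?I 1)"
    proof (intro nn_integral_cong arg_cong[where f = f] restrict_ext)
      fix c :: "nat \<Rightarrow> real" and x j assume "j \<in> ?I"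
      then show "queue_inc ((c(0 := x)) 0) Y (c(0 := x)) j = queue_inc x Y c j"
        by (auto simp: queue_inc_def intro!: queue_out_cong arg_cong[where f = "\<lambda>q. max 0 (Y j - q)"])
    qed
    finally show "\<Psi> Y = (\<integral>\<^sup>+c. \<integral>\<^sup>+x. f (\<lambda>j\<in>?I. queue_inc x Y c j) \<partial>exp_law z \<partial>exp_laws ?I 1)" .
  qed
  also have "\<dots> = (\<integral>\<^sup>+Y. \<integral>\<^sup>+x. f Y \<partial>exp_law z \<partial>exp_laws ?I (1 - z))"
    using burke_column[OF z measurable_compose[OF measurable_snd f]] by (simp only: snd_conv)
  also have "\<dots> = (\<integral>\<^sup>+Y. f Y \<partial>exp_laws ?I (1 - z))"
    using prob_space.emeasure_space_1[OF prob_space_exp_law[OF z(1)]] by simp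
  finally show ?case .
qed

section \<open>Exponential moments in the bulk and on the boundary\<close>

definition lpp_mgf :: "real \<Rightarrow> nat \<Rightarrow> nat \<Rightarrow> ennreal" where
  "lpp_mgf \<theta> m n = (\<integral>\<^sup>+x. ennreal (exp (\<theta> * lpp x m n)) \<partial>exp_laws ({1..m} \<times> {1..n}) 1)"

lemma lpp_restrict:
  "{1..m} \<times> {1..n} \<subseteq> A \<Longrightarrow> lpp (restrict x A) m n = lpp x m n"
  by (rule boundary_lpp_cong) (simp add: subset_iff)

lemma lpp_shifted_restrict:
  "(\<lambda>v. (fst v + p, snd v + q)) ` ({1..m} \<times> {1..n}) \<subseteq> A \<Longrightarrow> lpp (shifted p q (restrict x A)) m n = lpp (shifted p q x) m n"
  by (rule boundary_lpp_cong) (simp add: shifted_def image_subset_iff)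

lemma lpp_shifted_measurable:
  assumes "(\<lambda>v. (fst v + p, snd v + q)) ` ({1..m} \<times> {1..n}) \<subseteq> A"
  shows "(\<lambda>x. lpp (shifted p q x) m n) \<in> borel_measurable (PiM A (\<lambda>_. borel))"
proof -
  let ?B = "{1..m} \<times> {1..n}"
  have "(\<lambda>x. \<lambda>v\<in>?B. x (fst v + p, snd v + q)) \<in> measurable (PiM A (\<lambda>_. borel)) (PiM ?B (\<lambda>_. borel :: real measure))"
    by (rule measurable_restrict) (use assms in \<open>auto intro!: measurable_component_singleton\<close>)
  from measurable_compose[OF this lpp_measurable[OF order_refl]]
  have "(\<lambda>x. lpp (\<lambda>v\<in>?B. x (fst v + p, snd v + q)) m n) \<in> borel_measurable (PiM A (\<lambda>_. borel))" .
  also have "(\<lambda>x. lpp (\<lambda>v\<in>?B. x (fst v + p, snd v + q)) m n) = (\<lambda>x. lpp (shifted p q x) m n)"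
    by (intro ext boundary_lpp_cong) (auto simp: shifted_def)
  finally show ?thesis .
qed

lemma nn_integral_exp_sum:
  assumes "finite K" "\<And>i. i \<in> K \<Longrightarrow> c i < r i" "\<And>i. i \<in> K \<Longrightarrow> 0 < r i"
  shows "(\<integral>\<^sup>+x. ennreal (exp (\<Sum>i\<in>K. c i * x i)) \<partial>PiM K (\<lambda>i. exp_law (r i))) = ennreal (\<Prod>i\<in>K. r i / (r i - c i))"
proof -
  have "(\<integral>\<^sup>+x. ennreal (exp (\<Sum>i\<in>K. c i * x i)) \<partial>PiM K (\<lambda>i. exp_law (r i))) =
    (\<integral>\<^sup>+x. (\<Prod>i\<in>K. ennreal (exp (c i * x i))) \<partial>PiM K (\<lambda>i. exp_law (r i)))"
    by (simp add: exp_sum assms prod_ennreal)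
  also have "\<dots> = (\<Prod>i\<in>K. (\<integral>\<^sup>+x. ennreal (exp (c i * x)) \<partial>exp_law (r i)))"
    by (rule exp_law.product_nn_integral_prod) (use assms in \<open>auto simp: measurable_cong_sets[OF sets_exp_law refl]\<close>)
  also have "\<dots> = (\<Prod>i\<in>K. ennreal (r i / (r i - c i)))"
    by (intro prod.cong nn_integral_exp_law_exp) (use assms in auto)
  also have "\<dots> = ennreal (\<Prod>i\<in>K. r i / (r i - c i))"
    by (rule prod_ennreal) (use assms in \<open>force intro!: divide_nonneg_pos simp: less_imp_le\<close>)
  finally show ?thesis .
qed

context expo_field begin

lemma block_law:
  assumes "(\<lambda>v. (fst v + p, snd v + q)) ` A \<subseteq> I" and "\<And>v. v \<in> A \<Longrightarrow> r (fst v + p, snd v + q) = 1"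
    and f: "f \<in> borel_measurable (PiM A (\<lambda>_. borel))"
  shows "(\<integral>\<^sup>+s. f (restrict (shifted p q (\<lambda>v. W v s)) A) \<partial>P) = (\<integral>\<^sup>+x. f x \<partial>exp_laws A 1)"
proof -
  have "(\<integral>\<^sup>+s. f (\<lambda>v\<in>A. W (fst v + p, snd v + q) s) \<partial>P) = (\<integral>\<^sup>+x. f x \<partial>PiM A (\<lambda>v. exp_law (r (fst v + p, snd v + q))))"
    by (rule field_law) (use assms in \<open>auto simp: inj_on_def\<close>)
  also have "PiM A (\<lambda>v. exp_law (r (fst v + p, snd v + q))) = exp_laws A 1"
    by (intro PiM_cong) (auto simp: assms)
  also have "(\<lambda>s. \<lambda>v\<in>A. W (fst v + p, snd v + q) s) = (\<lambda>s. restrict (shifted p q (\<lambda>v. W v s)) A)"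
    by (intro ext) (auto simp: shifted_def restrict_def)
  finally show ?thesis .
qed

lemma lpp_W_measurable:
  assumes "(\<lambda>v. (fst v + p, snd v + q)) ` ({1..m} \<times> {1..n}) \<subseteq> I"
  shows "(\<lambda>s. lpp (shifted p q (\<lambda>v. W v s)) m n) \<in> borel_measurable P"
proof -
  have "(\<lambda>s. \<lambda>v\<in>I. W v s) \<in> measurable P (PiM I (\<lambda>_. borel))"
    by (rule restrict_measurable[where \<sigma> = id, simplified])
  from measurable_compose[OF this lpp_shifted_measurable[OF assms]]
  show ?thesis by (simp add: lpp_shifted_restrict[OF assms])
qed

lemma lpp_mgf_field:
  assumes "(\<lambda>v. (fst v + p, snd v + q)) ` ({1..m} \<times> {1..n}) \<subseteq> I"
    and "\<And>v. v \<in> {1..m} \<times> {1..n} \<Longrightarrow> r (fst v + p, snd v + q) = 1"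
  shows "(\<integral>\<^sup>+s. ennreal (exp (\<theta> * lpp (shifted p q (\<lambda>v. W v s)) m n)) \<partial>P) = lpp_mgf \<theta> m n"
proof -
  have [measurable]: "(\<lambda>x. lpp x m n) \<in> borel_measurable (PiM ({1..m} \<times> {1..n}) (\<lambda>_. borel))"
    by (rule lpp_measurable) simp
  have "(\<lambda>x. ennreal (exp (\<theta> * lpp x m n))) \<in> borel_measurable (PiM ({1..m} \<times> {1..n}) (\<lambda>_. borel))"
    by measurable
  from block_law[OF assms this] show ?thesis
    by (simp add: lpp_mgf_def lpp_restrict)
qed

lemma exp_sum_field:
  assumes "finite K" "K \<subseteq> I" "\<And>v. v \<in> K \<Longrightarrow> c v < r v"
  shows "(\<integral>\<^sup>+s. ennreal (exp (\<Sum>v\<in>K. c v * W v s)) \<partial>P) = ennreal (\<Prod>v\<in>K. r v / (r v - c v))"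
proof -
  have m: "(\<lambda>x. ennreal (exp (\<Sum>v\<in>K. c v * x v))) \<in> borel_measurable (PiM K (\<lambda>_. borel))"
    by measurable
  have "(\<integral>\<^sup>+s. ennreal (exp (\<Sum>v\<in>K. c v * (\<lambda>v\<in>K. W v s) v)) \<partial>P) =
    (\<integral>\<^sup>+x. ennreal (exp (\<Sum>v\<in>K. c v * x v)) \<partial>PiM K (\<lambda>v. exp_law (r v)))"
    using assms(2) by (intro field_law[where \<sigma> = "\<lambda>v. v", OF _ _ m]) auto
  also have "\<dots> = ennreal (\<Prod>v\<in>K. r v / (r v - c v))"
    by (rule nn_integral_exp_sum) (use assms rate_pos in auto)
  finally show ?thesis by simp
qed

text \<open>The set \<open>K\<close> lies on the axes, so it is disjoint from the bulk and its
  moment factors out explicitly.\<close>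

lemma exp_sum_bulk_field:
  assumes K: "finite K" "K \<subseteq> I" "\<And>v. v \<in> K \<Longrightarrow> c v < r v" "K \<inter> ({1..} \<times> {1..}) = {}"
    and f: "f \<in> borel_measurable (PiM ({1..m} \<times> {1..n}) (\<lambda>_. borel))" and bulk: "{1..m} \<times> {1..n} \<subseteq> I"
  shows "(\<integral>\<^sup>+s. ennreal (exp (\<Sum>v\<in>K. c v * W v s)) * f (\<lambda>v\<in>{1..m} \<times> {1..n}. W v s) \<partial>P) =
    ennreal (\<Prod>v\<in>K. r v / (r v - c v)) * (\<integral>\<^sup>+s. f (\<lambda>v\<in>{1..m} \<times> {1..n}. W v s) \<partial>P)"
proof -
  let ?g = "\<lambda>x. ennreal (exp (\<Sum>v\<in>K. c v * x v))"
  have m: "?g \<in> borel_measurable (PiM K (\<lambda>_. borel))"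
    by measurable
  have disj: "K \<inter> ({1..m} \<times> {1..n}) = {}" using K(4) by auto
  have "(\<integral>\<^sup>+s. ?g (\<lambda>v\<in>K. W v s) * f (\<lambda>v\<in>{1..m} \<times> {1..n}. W v s) \<partial>P) =
    (\<integral>\<^sup>+s. ?g (\<lambda>v\<in>K. W v s) \<partial>P) * (\<integral>\<^sup>+s. f (\<lambda>v\<in>{1..m} \<times> {1..n}. W v s) \<partial>P)"
    by (rule block_indep[OF disj K(2) bulk m f])
  with exp_sum_field[OF K(1-3)] show ?thesis by simp
qed

end

lemma exp_add_measurable:
  fixes a b :: "'b \<Rightarrow> real"
  assumes [measurable]: "a \<in> borel_measurable N" "b \<in> borel_measurable N"
  shows "(\<lambda>s. ennreal (exp (a s + \<theta> * b s))) \<in> borel_measurable N"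
  by measurable

locale stationary = expo_field P W "boundary_rate z" "grid m n" for P :: "'a measure" and W z m n +
  assumes z: "0 < z" "z < 1" and mn: "1 \<le> m" "1 \<le> n"
begin

abbreviation "w s \<equiv> (\<lambda>v. W v s)"

lemma grid_simps [simp]: "1 \<le> i \<Longrightarrow> i \<le> m \<Longrightarrow> j \<le> n \<Longrightarrow> (i, j) \<in> grid m n"
  "1 \<le> j \<Longrightarrow> i \<le> m \<Longrightarrow> j \<le> n \<Longrightarrow> (i, j) \<in> grid m n"
  by (auto simp: grid_def)

lemma bottom_sum: "bottom (w s) k = (\<Sum>v\<in>{1..k} \<times> {0}. W v s)"
  unfolding bottom_def
  by (rule sum.reindex_bij_witness[where i = fst and j = "\<lambda>i. (i, 0)"]) auto

lemma leftmost_sum: "leftmost (w s) k = (\<Sum>v\<in>{0} \<times> {1..k}. W v s)"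
  unfolding leftmost_def
  by (rule sum.reindex_bij_witness[where i = snd and j = "\<lambda>j. (0, j)"]) auto

lemma lpp_le_stationary_lpp: "lpp (w s) i j \<le> stationary_lpp (w s) i j"
  unfolding stationary_lpp_def by (rule boundary_lpp_mono) (auto simp: bottom_def leftmost_def nonneg intro!: sum_nonneg)

lemma sum_vertical_incr: "(\<Sum>j\<in>{1..k}. vertical_incr x i j) = stationary_lpp x i k - bottom x i"
  by (induction k) (auto simp: vertical_incr_def)

lemma exp_vertical_incr:
  assumes "\<And>j. j \<in> {1..n} \<Longrightarrow> c j < 1 - z"
  shows "(\<integral>\<^sup>+s. ennreal (exp (\<Sum>j\<in>{1..n}. c j * vertical_incr (w s) m j)) \<partial>P) = ennreal (\<Prod>j\<in>{1..n}. (1 - z) / (1 - z - c j))"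
proof -
  let ?f = "\<lambda>Y::nat \<Rightarrow> real. ennreal (exp (\<Sum>j\<in>{1..n}. c j * Y j))"
  have f: "?f \<in> borel_measurable (PiM {1..n} (\<lambda>_. borel))" by measurable
  have "(\<integral>\<^sup>+s. ?f (\<lambda>j\<in>{1..n}. vertical_incr (\<lambda>v\<in>grid m n. W v s) m j) \<partial>P) =
    (\<integral>\<^sup>+x. ?f (\<lambda>j\<in>{1..n}. vertical_incr x m j) \<partial>PiM (grid m n) (\<lambda>v. exp_law (boundary_rate z v)))"
    by (rule field_law[where \<sigma> = "\<lambda>v. v"]) (use measurable_compose[OF vertical_incr_measurable[OF order_refl] f] in auto)
  also have "\<dots> = (\<integral>\<^sup>+Y. ?f Y \<partial>exp_laws {1..n} (1 - z))"
    by (rule burke[OF z f])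
  also have "\<dots> = ennreal (\<Prod>j\<in>{1..n}. (1 - z) / (1 - z - c j))"
    by (rule nn_integral_exp_sum) (use assms z in auto)
  also have "(\<integral>\<^sup>+s. ?f (\<lambda>j\<in>{1..n}. vertical_incr (\<lambda>v\<in>grid m n. W v s) m j) \<partial>P) =
    (\<integral>\<^sup>+s. ?f (\<lambda>j\<in>{1..n}. vertical_incr (w s) m j) \<partial>P)"
    by (intro nn_integral_cong arg_cong[where f = ?f] restrict_ext vertical_incr_cong[of m n]) auto
  finally show ?thesis by simp
qed

lemma prod_boundary_rate_bottom:
  assumes "k \<le> m"
  shows "(\<Prod>v\<in>{Suc k..m} \<times> {0::nat}. boundary_rate z v / (boundary_rate z v - c)) = (z / (z - c)) ^ (m - k)"
proof -
  have "(\<Prod>v\<in>{Suc k..m} \<times> {0::nat}. boundary_rate z v / (boundary_rate z v - c)) = (\<Prod>v\<in>{Suc k..m} \<times> {0::nat}. z / (z - c))"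
    by (intro prod.cong) (auto simp: boundary_rate_def)
  then show ?thesis by (simp add: card_cartesian_product)
qed

lemma exp_vertical_incr_total:
  assumes "c < 1 - z"
  shows "(\<integral>\<^sup>+s. ennreal (exp (c * (stationary_lpp (w s) m n - bottom (w s) m))) \<partial>P) = ennreal (((1 - z) / (1 - z - c)) ^ n)"
  using exp_vertical_incr[of "\<lambda>_. c"] assms unfolding sum_distrib_left[symmetric] sum_vertical_incr by simp

lemma grid_bulk: "{1..m} \<times> {1..n} \<subseteq> grid m n"
  by (auto simp: grid_def)

lemma lpp_mgf_stationary:
  assumes "m' + p \<le> m" "n' + q \<le> n"
  shows "(\<integral>\<^sup>+s. ennreal (exp (\<theta> * lpp (shifted p q (w s)) m' n')) \<partial>P) = lpp_mgf \<theta> m' n'"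
  by (rule lpp_mgf_field) (use assms in \<open>auto simp: boundary_rate_def\<close>)

lemma boundary_bulk:
  assumes K: "K \<subseteq> grid m n" "K \<inter> ({1..} \<times> {1..}) = {}" "\<And>v. v \<in> K \<Longrightarrow> c v < boundary_rate z v"
    and mn': "m' + p \<le> m" "n' + q \<le> n"
  shows "(\<integral>\<^sup>+s. ennreal (exp ((\<Sum>v\<in>K. c v * W v s) + \<theta> * lpp (shifted p q (w s)) m' n')) \<partial>P) =
    ennreal (\<Prod>v\<in>K. boundary_rate z v / (boundary_rate z v - c v)) * lpp_mgf \<theta> m' n'"
proof -
  have sub: "(\<lambda>v. (fst v + p, snd v + q)) ` ({1..m'} \<times> {1..n'}) \<subseteq> {1..m} \<times> {1..n}"
    using mn' by auto
  let ?f = "\<lambda>x. ennreal (exp (\<theta> * lpp (shifted p q x) m' n'))"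
  have f: "?f \<in> borel_measurable (PiM ({1..m} \<times> {1..n}) (\<lambda>_. borel))"
    using lpp_shifted_measurable[OF sub] by measurable
  have fin: "finite K" by (rule finite_subset[OF K(1)]) (simp add: grid_def)
  have "(\<integral>\<^sup>+s. ennreal (exp (\<Sum>v\<in>K. c v * W v s)) * ?f (\<lambda>v\<in>{1..m} \<times> {1..n}. W v s) \<partial>P) =
    ennreal (\<Prod>v\<in>K. boundary_rate z v / (boundary_rate z v - c v)) * (\<integral>\<^sup>+s. ?f (\<lambda>v\<in>{1..m} \<times> {1..n}. W v s) \<partial>P)"
    by (rule exp_sum_bulk_field[OF fin K(1,3,2) f grid_bulk])
  then show ?thesis
    unfolding lpp_shifted_restrict[OF sub] lpp_mgf_stationary[OF mn'] by (simp add: exp_add ennreal_mult)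
qed

text \<open>In the stationary model, passage times to column \<open>m\<close> minus the bottom sum
  are sums of the vertical increments on that column, which are independent by Burke's theorem.
  Multiplying the bulk quantity by the exponential of -(\<open>\<sigma>\<close> +
  \<open>\<theta>\<close>) times the independent bottom sum costs an explicit factor, and then
  \<open>lpp\<close> is dominated by \<open>stationary_lpp\<close>. A row is charged
  \<open>\<sigma>\<close>, \<open>\<theta>\<close>, both or neither, according to the heights above
  it.\<close>

lemma two_point:
  assumes "0 \<le> \<sigma>" "0 \<le> \<theta>" "\<sigma> + \<theta> < 1 - z" "n1 \<le> n" "n2 \<le> n"
  shows "(\<integral>\<^sup>+s. ennreal (exp (\<sigma> * lpp (w s) m n1 + \<theta> * lpp (w s) m n2)) \<partial>P) \<le>
    ennreal (((z + \<sigma> + \<theta>) / z) ^ m *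
      (\<Prod>j\<in>{1..n}. (1 - z) / (1 - z - (\<sigma> * of_bool (j \<le> n1) + \<theta> * of_bool (j \<le> n2)))))"
    (is "?E \<le> ennreal (_ * ?prod)")
proof -
  let ?K = "{1..m} \<times> {0::nat}" and ?c = "\<sigma> + \<theta>"
  let ?f = "\<lambda>x. ennreal (exp (\<sigma> * lpp x m n1 + \<theta> * lpp x m n2))"
  have f: "?f \<in> borel_measurable (PiM ({1..m} \<times> {1..n}) (\<lambda>_. borel))"
  proof -
    have [measurable]: "(\<lambda>x. lpp x m n1) \<in> borel_measurable (PiM ({1..m} \<times> {1..n}) (\<lambda>_. borel))"
      "(\<lambda>x. lpp x m n2) \<in> borel_measurable (PiM ({1..m} \<times> {1..n}) (\<lambda>_. borel))"
      using assms(4,5) by (auto intro!: lpp_measurable)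
    show ?thesis by measurable
  qed
  have restr: "?f (\<lambda>v\<in>{1..m} \<times> {1..n}. W v s) = ?f (w s)" for s
    using assms(4,5) by (subst (1 2) lpp_restrict) auto
  have vs: "(\<Sum>j\<in>{1..n}. (\<sigma> * of_bool (j \<le> n1) + \<theta> * of_bool (j \<le> n2)) * vertical_incr (w s) m j) =
    \<sigma> * (stationary_lpp (w s) m n1 - bottom (w s) m) + \<theta> * (stationary_lpp (w s) m n2 - bottom (w s) m)" for s
  proof -
    have *: "(\<Sum>j\<in>{1..n}. of_bool (j \<le> k) * vertical_incr (w s) m j) = stationary_lpp (w s) m k - bottom (w s) m" if "k \<le> n" for k
    proof -
      have "(\<Sum>j\<in>{1..n}. of_bool (j \<le> k) * vertical_incr (w s) m j) = (\<Sum>j\<in>{1..k}. vertical_incr (w s) m j)"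
        using that by (intro sum.mono_neutral_cong_right) auto
      then show ?thesis by (simp only: sum_vertical_incr)
    qed
    show ?thesis
      unfolding *[OF assms(4), symmetric] *[OF assms(5), symmetric]
      by (simp only: sum_distrib_left sum.distrib[symmetric] distrib_right mult.assoc)
  qed
  have pb: "(\<Prod>v\<in>?K. boundary_rate z v / (boundary_rate z v - (- ?c))) = (z / (z + ?c)) ^ m"
    using prod_boundary_rate_bottom[of 0 "- ?c", OF le0] unfolding diff_minus_eq_add diff_zero One_nat_def .
  have "ennreal ((z / (z + ?c)) ^ m) * ?E =
    ennreal (\<Prod>v\<in>?K. boundary_rate z v / (boundary_rate z v - (- ?c))) * (\<integral>\<^sup>+s. ?f (\<lambda>v\<in>{1..m} \<times> {1..n}. W v s) \<partial>P)"
    unfolding restr pb ..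
  also have "\<dots> = (\<integral>\<^sup>+s. ennreal (exp (\<Sum>v\<in>?K. - ?c * W v s)) * ?f (\<lambda>v\<in>{1..m} \<times> {1..n}. W v s) \<partial>P)"
    by (rule exp_sum_bulk_field[symmetric, OF _ _ _ _ f grid_bulk]) (use assms z in \<open>auto simp: boundary_rate_def\<close>)
  also have "\<dots> \<le> (\<integral>\<^sup>+s. ennreal (exp (\<Sum>j\<in>{1..n}. (\<sigma> * of_bool (j \<le> n1) + \<theta> * of_bool (j \<le> n2)) * vertical_incr (w s) m j)) \<partial>P)"
  proof (intro nn_integral_mono)
    fix s
    have "(\<Sum>v\<in>?K. - ?c * W v s) = - ?c * bottom (w s) m"
      unfolding bottom_sum sum_distrib_left ..
    moreover have "\<sigma> * lpp (w s) m n1 \<le> \<sigma> * stationary_lpp (w s) m n1" "\<theta> * lpp (w s) m n2 \<le> \<theta> * stationary_lpp (w s) m n2"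
      using assms lpp_le_stationary_lpp by (auto intro!: mult_left_mono)
    ultimately have "(\<Sum>v\<in>?K. - ?c * W v s) + (\<sigma> * lpp (w s) m n1 + \<theta> * lpp (w s) m n2) \<le>
      (\<Sum>j\<in>{1..n}. (\<sigma> * of_bool (j \<le> n1) + \<theta> * of_bool (j \<le> n2)) * vertical_incr (w s) m j)"
      unfolding vs by (simp add: algebra_simps)
    then show "ennreal (exp (\<Sum>v\<in>?K. - ?c * W v s)) * ?f (\<lambda>v\<in>{1..m} \<times> {1..n}. W v s) \<le>
      ennreal (exp (\<Sum>j\<in>{1..n}. (\<sigma> * of_bool (j \<le> n1) + \<theta> * of_bool (j \<le> n2)) * vertical_incr (w s) m j))"
      unfolding restr by (simp add: ennreal_mult[symmetric] exp_add[symmetric] del: sum_distrib_left)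
  qed
  also have "\<dots> = ennreal ?prod"
    by (rule exp_vertical_incr) (use assms z in auto)
  finally have le: "ennreal ((z / (z + ?c)) ^ m) * ?E \<le> ennreal ?prod" .
  have "?E = ennreal (((z + ?c) / z) ^ m) * (ennreal ((z / (z + ?c)) ^ m) * ?E)"
    using z assms by (simp add: mult.assoc[symmetric] ennreal_mult[symmetric] power_mult_distrib[symmetric])
  also have "\<dots> \<le> ennreal (((z + ?c) / z) ^ m) * ennreal ?prod"
    by (intro mult_left_mono le) simp
  also have "\<dots> = ennreal (((z + \<sigma> + \<theta>) / z) ^ m * ?prod)"
    using z assms by (subst ennreal_mult[symmetric]) (auto simp: add.assoc intro!: prod_nonneg divide_nonneg_pos)
  finally show ?thesis .
qed

text \<open>The left side is the exact moment of \<open>stationary_lpp\<close> minus the bottom sum.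
  Splitting by exit point and factoring off the independent boundary weights leaves bulk moments on
  the right, so the inequality bounds these from below.\<close>

lemma exit_bound:
  assumes \<theta>: "0 < \<theta>" "\<theta> < 1 - z"
  shows "ennreal (((1 - z) / (1 - z - \<theta>)) ^ n) \<le>
    (\<Sum>k\<in>{1..m}. ennreal ((z / (z + \<theta>)) ^ (m - k)) * lpp_mgf \<theta> (Suc m - k) n) +
    (\<Sum>k\<in>{1..n}. ennreal (((1 - z) / (1 - z - \<theta>)) ^ k * (z / (z + \<theta>)) ^ m) * lpp_mgf \<theta> m (Suc n - k))"
proof -
  let ?A = "\<lambda>k s. \<theta> * (bottom (w s) k - bottom (w s) m) + \<theta> * lpp (shifted (k - 1) 0 (w s)) (Suc m - k) n"
  let ?B = "\<lambda>k s. \<theta> * (leftmost (w s) k - bottom (w s) m) + \<theta> * lpp (shifted 0 (k - 1) (w s)) m (Suc n - k)"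
  let ?K = "\<lambda>k. {Suc k..m} \<times> {0::nat}" and ?K' = "\<lambda>k. {0::nat} \<times> {1..k} \<union> {1..m} \<times> {0::nat}"
  have A: "(\<integral>\<^sup>+s. ennreal (exp (?A k s)) \<partial>P) = ennreal ((z / (z + \<theta>)) ^ (m - k)) * lpp_mgf \<theta> (Suc m - k) n"
    and Am: "(\<lambda>s. ennreal (exp (?A k s))) \<in> borel_measurable P"
    if k: "k \<in> {1..m}" for k
  proof -
    \<comment> \<open>For an exit at \<open>k\<close> the bottom weights up to \<open>k\<close>
      cancel; those beyond stay, with coefficient \<open>- \<theta>\<close>.\<close>
    have "bottom (w s) m = bottom (w s) k + (\<Sum>v\<in>?K k. W v s)" for s
      using k unfolding bottom_sum
      by (subst sum.union_disjoint[symmetric]) (auto intro!: sum.cong)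
    then have eq: "?A k s = (\<Sum>v\<in>?K k. - \<theta> * W v s) + \<theta> * lpp (shifted (k - 1) 0 (w s)) (Suc m - k) n" for s
      by (simp add: sum_distrib_left[symmetric] sum_negf)
    show "(\<integral>\<^sup>+s. ennreal (exp (?A k s)) \<partial>P) = ennreal ((z / (z + \<theta>)) ^ (m - k)) * lpp_mgf \<theta> (Suc m - k) n"
      unfolding eq using prod_boundary_rate_bottom[of k "- \<theta>"] k \<theta> z
      by (subst boundary_bulk) (auto simp: boundary_rate_def)
    have [measurable]: "(\<lambda>s. lpp (shifted (k - 1) 0 (w s)) (Suc m - k) n) \<in> borel_measurable P"
      by (rule lpp_W_measurable) (use k in auto)
    show "(\<lambda>s. ennreal (exp (?A k s))) \<in> borel_measurable P"
    proof -
      have [measurable]: "(\<lambda>s. \<Sum>v\<in>?K k. - \<theta> * W v s) \<in> borel_measurable P"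
        using k by (intro borel_measurable_sum borel_measurable_times W_measurable) auto
      show ?thesis unfolding eq by (rule exp_add_measurable) fact+
    qed
  qed
  have B: "(\<integral>\<^sup>+s. ennreal (exp (?B k s)) \<partial>P) = ennreal (((1 - z) / (1 - z - \<theta>)) ^ k * (z / (z + \<theta>)) ^ m) * lpp_mgf \<theta> m (Suc n - k)"
    and Bm: "(\<lambda>s. ennreal (exp (?B k s))) \<in> borel_measurable P"
    if k: "k \<in> {1..n}" for k
  proof -
    let ?c = "\<lambda>v::nat \<times> nat. if snd v = 0 then - \<theta> else \<theta>"
    have split: "(\<Sum>v\<in>?K' k. h v) = (\<Sum>v\<in>{0::nat} \<times> {1..k}. h v) + (\<Sum>v\<in>{1..m} \<times> {0::nat}. h v)" for h :: "_ \<Rightarrow> real"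
      by (rule sum.union_disjoint) auto
    have l: "(\<Sum>v\<in>{0::nat} \<times> {1..k}. ?c v * W v s) = \<theta> * leftmost (w s) k" for s
      unfolding leftmost_sum sum_distrib_left by (intro sum.cong) auto
    have b: "(\<Sum>v\<in>{1..m} \<times> {0::nat}. ?c v * W v s) = - \<theta> * bottom (w s) m" for s
      unfolding bottom_sum sum_distrib_left by (intro sum.cong) auto
    have eq: "?B k s = (\<Sum>v\<in>?K' k. ?c v * W v s) + \<theta> * lpp (shifted 0 (k - 1) (w s)) m (Suc n - k)" for s
      unfolding split l b by (simp add: algebra_simps)
    have "(\<Prod>v\<in>?K' k. boundary_rate z v / (boundary_rate z v - ?c v)) =
      (\<Prod>v\<in>{0::nat} \<times> {1..k}. boundary_rate z v / (boundary_rate z v - ?c v)) * (\<Prod>v\<in>{1..m} \<times> {0::nat}. boundary_rate z v / (boundary_rate z v - ?c v))"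
      by (rule prod.union_disjoint) auto
    also have "(\<Prod>v\<in>{0::nat} \<times> {1..k}. boundary_rate z v / (boundary_rate z v - ?c v)) = (\<Prod>v\<in>{0::nat} \<times> {1..k}. (1 - z) / (1 - z - \<theta>))"
      by (intro prod.cong) (auto simp: boundary_rate_def)
    also have "(\<Prod>v\<in>{1..m} \<times> {0::nat}. boundary_rate z v / (boundary_rate z v - ?c v)) = (\<Prod>v\<in>{1..m} \<times> {0::nat}. z / (z + \<theta>))"
      by (intro prod.cong) (auto simp: boundary_rate_def)
    finally have pr: "(\<Prod>v\<in>?K' k. boundary_rate z v / (boundary_rate z v - ?c v)) = ((1 - z) / (1 - z - \<theta>)) ^ k * (z / (z + \<theta>)) ^ m"
      by (simp add: card_cartesian_product)
    show "(\<integral>\<^sup>+s. ennreal (exp (?B k s)) \<partial>P) = ennreal (((1 - z) / (1 - z - \<theta>)) ^ k * (z / (z + \<theta>)) ^ m) * lpp_mgf \<theta> m (Suc n - k)"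
      unfolding eq pr[symmetric] using k \<theta> z
      by (intro boundary_bulk) (auto simp: boundary_rate_def)
    have [measurable]: "(\<lambda>s. lpp (shifted 0 (k - 1) (w s)) m (Suc n - k)) \<in> borel_measurable P"
      by (rule lpp_W_measurable) (use k in auto)
    show "(\<lambda>s. ennreal (exp (?B k s))) \<in> borel_measurable P"
    proof -
      have [measurable]: "(\<lambda>s. \<Sum>v\<in>?K' k. ?c v * W v s) \<in> borel_measurable P"
        using k by (intro borel_measurable_sum borel_measurable_times W_measurable) auto
      show ?thesis unfolding eq by (rule exp_add_measurable) fact+
    qed
  qed
  have "ennreal (((1 - z) / (1 - z - \<theta>)) ^ n) = (\<integral>\<^sup>+s. ennreal (exp (\<theta> * (stationary_lpp (w s) m n - bottom (w s) m))) \<partial>P)"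
    by (rule exp_vertical_incr_total[symmetric]) (use \<theta> in auto)
  also have "\<dots> \<le> (\<integral>\<^sup>+s. (\<Sum>k\<in>{1..m}. ennreal (exp (?A k s))) + (\<Sum>k\<in>{1..n}. ennreal (exp (?B k s))) \<partial>P)"
  proof (intro nn_integral_mono)
    fix s
    from boundary_lpp_exit[OF mn, of "w s" "bottom (w s)" "leftmost (w s)"]
    consider k where "k \<in> {1..m}" "stationary_lpp (w s) m n \<le> bottom (w s) k + lpp (shifted (k - 1) 0 (w s)) (Suc m - k) n"
      | k where "k \<in> {1..n}" "stationary_lpp (w s) m n \<le> leftmost (w s) k + lpp (shifted 0 (k - 1) (w s)) m (Suc n - k)"
      unfolding stationary_lpp_def by blast
    then show "ennreal (exp (\<theta> * (stationary_lpp (w s) m n - bottom (w s) m))) \<le>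
      (\<Sum>k\<in>{1..m}. ennreal (exp (?A k s))) + (\<Sum>k\<in>{1..n}. ennreal (exp (?B k s)))"
    proof cases
      case (1 k)
      have "\<theta> * (stationary_lpp (w s) m n - bottom (w s) m) \<le> ?A k s"
        unfolding distrib_left[symmetric] using 1(2) \<theta> by (intro mult_left_mono) auto
      then have "ennreal (exp (\<theta> * (stationary_lpp (w s) m n - bottom (w s) m))) \<le> ennreal (exp (?A k s))"
        by (intro ennreal_leI) simp
      also have "\<dots> \<le> (\<Sum>k\<in>{1..m}. ennreal (exp (?A k s)))"
        using 1(1) by (intro member_le_sum) auto
      also have "\<dots> \<le> \<dots> + (\<Sum>k\<in>{1..n}. ennreal (exp (?B k s)))" by simp
      finally show ?thesis .
    next
      case (2 k)
      have "\<theta> * (stationary_lpp (w s) m n - bottom (w s) m) \<le> ?B k s"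
        unfolding distrib_left[symmetric] using 2(2) \<theta> by (intro mult_left_mono) auto
      then have "ennreal (exp (\<theta> * (stationary_lpp (w s) m n - bottom (w s) m))) \<le> ennreal (exp (?B k s))"
        by (intro ennreal_leI) simp
      also have "\<dots> \<le> (\<Sum>k\<in>{1..n}. ennreal (exp (?B k s)))"
        using 2(1) by (intro member_le_sum) auto
      also have "\<dots> \<le> (\<Sum>k\<in>{1..m}. ennreal (exp (?A k s))) + \<dots>" by simp
      finally show ?thesis .
    qed
  qed
  also have "\<dots> = (\<Sum>k\<in>{1..m}. \<integral>\<^sup>+s. ennreal (exp (?A k s)) \<partial>P) + (\<Sum>k\<in>{1..n}. \<integral>\<^sup>+s. ennreal (exp (?B k s)) \<partial>P)"
    by (subst nn_integral_add; (intro borel_measurable_sum Am Bm; assumption)?)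
      (intro arg_cong2[where f = "(+)"] nn_integral_sum Am Bm; assumption)
  also have "\<dots> = (\<Sum>k\<in>{1..m}. ennreal ((z / (z + \<theta>)) ^ (m - k)) * lpp_mgf \<theta> (Suc m - k) n) +
    (\<Sum>k\<in>{1..n}. ennreal (((1 - z) / (1 - z - \<theta>)) ^ k * (z / (z + \<theta>)) ^ m) * lpp_mgf \<theta> m (Suc n - k))"
    using A B by (intro arg_cong2[where f = "(+)"] sum.cong) auto
  finally show ?thesis .
qed

lemma bottom_measurable: "k \<le> m \<Longrightarrow> (\<lambda>s. bottom (w s) k) \<in> borel_measurable P"
  unfolding bottom_def by (intro borel_measurable_sum W_measurable) auto

lemma leftmost_measurable: "k \<le> n \<Longrightarrow> (\<lambda>s. leftmost (w s) k) \<in> borel_measurable P"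
  unfolding leftmost_def by (intro borel_measurable_sum W_measurable) auto

lemma exp_bottom:
  assumes "k \<le> m" "c < z"
  shows "(\<integral>\<^sup>+s. ennreal (exp (c * bottom (w s) k)) \<partial>P) = ennreal ((z / (z - c)) ^ k)"
proof -
  have "(\<Prod>v\<in>{1..k} \<times> {0::nat}. boundary_rate z v / (boundary_rate z v - c)) = (\<Prod>v\<in>{1..k} \<times> {0::nat}. z / (z - c))"
    by (intro prod.cong) (auto simp: boundary_rate_def)
  then show ?thesis
    unfolding bottom_sum sum_distrib_left using assms
    by (subst exp_sum_field) (auto simp: boundary_rate_def card_cartesian_product)
qed

lemma exp_bottom_lpp:
  assumes k: "k \<in> {1..m}" and "c < z"
  shows "(\<integral>\<^sup>+s. ennreal (exp (c * bottom (w s) k + c * lpp (shifted (k - 1) 0 (w s)) (Suc m - k) n)) \<partial>P) =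
    ennreal ((z / (z - c)) ^ k) * lpp_mgf c (Suc m - k) n"
proof -
  have "(\<Prod>v\<in>{1..k} \<times> {0::nat}. boundary_rate z v / (boundary_rate z v - c)) = (\<Prod>v\<in>{1..k} \<times> {0::nat}. z / (z - c))"
    by (intro prod.cong) (auto simp: boundary_rate_def)
  then show ?thesis
    unfolding bottom_sum sum_distrib_left using assms
    by (subst boundary_bulk) (auto simp: boundary_rate_def card_cartesian_product)
qed

lemma exp_leftmost:
  assumes "k \<le> n" "c < 1 - z"
  shows "(\<integral>\<^sup>+s. ennreal (exp (c * leftmost (w s) k)) \<partial>P) = ennreal (((1 - z) / (1 - z - c)) ^ k)"
proof -
  have "(\<Prod>v\<in>{0::nat} \<times> {1..k}. boundary_rate z v / (boundary_rate z v - c)) = (\<Prod>v\<in>{0::nat} \<times> {1..k}. (1 - z) / (1 - z - c))"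
    by (intro prod.cong) (auto simp: boundary_rate_def)
  then show ?thesis
    unfolding leftmost_sum sum_distrib_left using assms
    by (subst exp_sum_field) (auto simp: boundary_rate_def card_cartesian_product)
qed

lemma exp_leftmost_lpp:
  assumes k: "k \<in> {1..n}" and "c < 1 - z"
  shows "(\<integral>\<^sup>+s. ennreal (exp (c * leftmost (w s) k + c * lpp (shifted 0 (k - 1) (w s)) m (Suc n - k))) \<partial>P) =
    ennreal (((1 - z) / (1 - z - c)) ^ k) * lpp_mgf c m (Suc n - k)"
proof -
  have "(\<Prod>v\<in>{0::nat} \<times> {1..k}. boundary_rate z v / (boundary_rate z v - c)) = (\<Prod>v\<in>{0::nat} \<times> {1..k}. (1 - z) / (1 - z - c))"
    by (intro prod.cong) (auto simp: boundary_rate_def)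
  then show ?thesis
    unfolding leftmost_sum sum_distrib_left using assms
    by (subst boundary_bulk) (auto simp: boundary_rate_def card_cartesian_product)
qed

lemma nn_integral_exp_shift:
  assumes [measurable]: "X \<in> borel_measurable P"
  shows "(\<integral>\<^sup>+s. ennreal (exp (X s - b)) \<partial>P) = ennreal (exp (- b)) * (\<integral>\<^sup>+s. ennreal (exp (X s)) \<partial>P)"
  by (subst nn_integral_cmult[symmetric]) (auto simp: ennreal_mult[symmetric] exp_add[symmetric])

text \<open>Suppose the bulk passage time is at most \<open>A\<close>. Either the stationary one is
  at most \<open>B\<close>, and then its bottom part is at most \<open>u1\<close> or its right part
  at most \<open>u2\<close> (first two terms). Or its path profits from the boundary: up to exit
  \<open>K\<close> a short boundary stretch must supply B - A, and for a later exit the stretch and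
  the remaining bulk piece must reach \<open>B\<close> together.\<close>

lemma lower_tail_stationary:
  assumes \<sigma>: "0 < \<sigma>" "\<sigma> < z" "\<sigma> < 1 - z" and \<tau>: "0 < \<tau>"
    and c: "0 < c" "c < z" "0 < c'" "c' < 1 - z" and B: "B = u1 + u2"
  shows "emeasure P {s \<in> space P. lpp (w s) m n \<le> A} \<le>
    ennreal (exp (\<tau> * u1) * (z / (z + \<tau>)) ^ m) + ennreal (exp (\<tau> * u2) * ((1 - z) / (1 - z + \<tau>)) ^ n) +
    (\<Sum>k\<in>{1..m}. if k \<le> K then ennreal (exp (- (\<sigma> * (B - A))) * (z / (z - \<sigma>)) ^ k)
      else ennreal (exp (- (c * B)) * (z / (z - c)) ^ k) * lpp_mgf c (Suc m - k) n) +
    (\<Sum>k\<in>{1..n}. if k \<le> K then ennreal (exp (- (\<sigma> * (B - A))) * ((1 - z) / (1 - z - \<sigma>)) ^ k)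
      else ennreal (exp (- (c' * B)) * ((1 - z) / (1 - z - c')) ^ k) * lpp_mgf c' m (Suc n - k))"
proof -
  let ?h = "\<lambda>k s. lpp (shifted (k - 1) 0 (w s)) (Suc m - k) n" and ?v = "\<lambda>k s. lpp (shifted 0 (k - 1) (w s)) m (Suc n - k)"
  let ?A = "\<lambda>k s. if k \<le> K then exp (\<sigma> * bottom (w s) k - \<sigma> * (B - A)) else exp (c * bottom (w s) k + c * ?h k s - c * B)"
  let ?B = "\<lambda>k s. if k \<le> K then exp (\<sigma> * leftmost (w s) k - \<sigma> * (B - A)) else exp (c' * leftmost (w s) k + c' * ?v k s - c' * B)"
  let ?T1 = "\<lambda>s. exp (- \<tau> * bottom (w s) m - - (\<tau> * u1))"
    and ?T2 = "\<lambda>s. exp (- \<tau> * (stationary_lpp (w s) m n - bottom (w s) m) - - (\<tau> * u2))"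
  have h: "?h k \<in> borel_measurable P" if "k \<in> {1..m}" for k
    by (rule lpp_W_measurable) (use that in auto)
  have v: "?v k \<in> borel_measurable P" if "k \<in> {1..n}" for k
    by (rule lpp_W_measurable) (use that in auto)
  have "(\<lambda>s. \<lambda>v\<in>grid m n. W v s) \<in> measurable P (PiM (grid m n) (\<lambda>_. borel))"
    by (rule restrict_measurable[where \<sigma> = id, simplified])
  from measurable_compose[OF this stationary_lpp_measurable[OF order_refl]]
  have "(\<lambda>s. stationary_lpp (\<lambda>v\<in>grid m n. W v s) m n) \<in> borel_measurable P" .
  also have "(\<lambda>s. stationary_lpp (\<lambda>v\<in>grid m n. W v s) m n) = (\<lambda>s. stationary_lpp (w s) m n)"
    by (intro ext stationary_lpp_cong) auto
  finally have stationary_lpp: "(\<lambda>s. stationary_lpp (w s) m n) \<in> borel_measurable P" .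
  note [measurable] = stationary_lpp bottom_measurable leftmost_measurable
  have L[measurable]: "(\<lambda>s. lpp (w s) m n) \<in> borel_measurable P"
    using h[of 1] mn by simp
  have A: "(\<integral>\<^sup>+s. ennreal (?A k s) \<partial>P) = (if k \<le> K then ennreal (exp (- (\<sigma> * (B - A))) * (z / (z - \<sigma>)) ^ k)
      else ennreal (exp (- (c * B)) * (z / (z - c)) ^ k) * lpp_mgf c (Suc m - k) n)"
    and Am: "(\<lambda>s. ennreal (?A k s)) \<in> borel_measurable P" if k: "k \<in> {1..m}" for k
  proof -
    have [measurable]: "?h k \<in> borel_measurable P" "(\<lambda>s. bottom (w s) k) \<in> borel_measurable P"
      using h[OF k] bottom_measurable[of k] k by auto
    show "(\<lambda>s. ennreal (?A k s)) \<in> borel_measurable P"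
    proof (cases "k \<le> K")
      case False
      have "(\<lambda>s. ennreal (exp (c * bottom (w s) k + c * ?h k s - c * B))) \<in> borel_measurable P" by measurable
      then show ?thesis by (simp only: False if_False)
    qed simp
    show "(\<integral>\<^sup>+s. ennreal (?A k s) \<partial>P) = (if k \<le> K then ennreal (exp (- (\<sigma> * (B - A))) * (z / (z - \<sigma>)) ^ k)
      else ennreal (exp (- (c * B)) * (z / (z - c)) ^ k) * lpp_mgf c (Suc m - k) n)"
    proof (cases "k \<le> K")
      case True
      have "(\<integral>\<^sup>+s. ennreal (exp (\<sigma> * bottom (w s) k - \<sigma> * (B - A))) \<partial>P) =
        ennreal (exp (- (\<sigma> * (B - A)))) * (\<integral>\<^sup>+s. ennreal (exp (\<sigma> * bottom (w s) k)) \<partial>P)"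
        by (rule nn_integral_exp_shift) measurable
      with True k \<sigma> show ?thesis by (subst (asm) exp_bottom) (auto simp: ennreal_mult)
    next
      case False
      have "(\<integral>\<^sup>+s. ennreal (exp (c * bottom (w s) k + c * ?h k s - c * B)) \<partial>P) =
        ennreal (exp (- (c * B))) * (\<integral>\<^sup>+s. ennreal (exp (c * bottom (w s) k + c * ?h k s)) \<partial>P)"
        by (rule nn_integral_exp_shift) measurable
      with False k c z show ?thesis by (subst (asm) exp_bottom_lpp) (auto simp: ennreal_mult mult.assoc)
    qed
  qed
  have B': "(\<integral>\<^sup>+s. ennreal (?B k s) \<partial>P) = (if k \<le> K then ennreal (exp (- (\<sigma> * (B - A))) * ((1 - z) / (1 - z - \<sigma>)) ^ k)
      else ennreal (exp (- (c' * B)) * ((1 - z) / (1 - z - c')) ^ k) * lpp_mgf c' m (Suc n - k))"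
    and Bm: "(\<lambda>s. ennreal (?B k s)) \<in> borel_measurable P" if k: "k \<in> {1..n}" for k
  proof -
    have [measurable]: "?v k \<in> borel_measurable P" "(\<lambda>s. leftmost (w s) k) \<in> borel_measurable P"
      using v[OF k] leftmost_measurable[of k] k by auto
    show "(\<lambda>s. ennreal (?B k s)) \<in> borel_measurable P"
    proof (cases "k \<le> K")
      case False
      have "(\<lambda>s. ennreal (exp (c' * leftmost (w s) k + c' * ?v k s - c' * B))) \<in> borel_measurable P" by measurable
      then show ?thesis by (simp only: False if_False)
    qed simp
    show "(\<integral>\<^sup>+s. ennreal (?B k s) \<partial>P) = (if k \<le> K then ennreal (exp (- (\<sigma> * (B - A))) * ((1 - z) / (1 - z - \<sigma>)) ^ k)
      else ennreal (exp (- (c' * B)) * ((1 - z) / (1 - z - c')) ^ k) * lpp_mgf c' m (Suc n - k))"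
    proof (cases "k \<le> K")
      case True
      have "(\<integral>\<^sup>+s. ennreal (exp (\<sigma> * leftmost (w s) k - \<sigma> * (B - A))) \<partial>P) =
        ennreal (exp (- (\<sigma> * (B - A)))) * (\<integral>\<^sup>+s. ennreal (exp (\<sigma> * leftmost (w s) k)) \<partial>P)"
        by (rule nn_integral_exp_shift) measurable
      with True k \<sigma> show ?thesis by (subst (asm) exp_leftmost) (auto simp: ennreal_mult)
    next
      case False
      have "(\<integral>\<^sup>+s. ennreal (exp (c' * leftmost (w s) k + c' * ?v k s - c' * B)) \<partial>P) =
        ennreal (exp (- (c' * B))) * (\<integral>\<^sup>+s. ennreal (exp (c' * leftmost (w s) k + c' * ?v k s)) \<partial>P)"
        by (rule nn_integral_exp_shift) measurable
      with False k c z show ?thesis by (subst (asm) exp_leftmost_lpp) (auto simp: ennreal_mult mult.assoc)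
    qed
  qed
  have T1: "(\<integral>\<^sup>+s. ennreal (?T1 s) \<partial>P) = ennreal (exp (\<tau> * u1) * (z / (z + \<tau>)) ^ m)"
    using \<tau> z exp_bottom[of m "- \<tau>"] by (subst nn_integral_exp_shift) (auto simp: ennreal_mult)
  have T2: "(\<integral>\<^sup>+s. ennreal (?T2 s) \<partial>P) = ennreal (exp (\<tau> * u2) * ((1 - z) / (1 - z + \<tau>)) ^ n)"
    using \<tau> z exp_vertical_incr_total[of "- \<tau>"] by (subst nn_integral_exp_shift) (auto simp: ennreal_mult)
  have one: "1 \<le> ennreal (exp t)" if "0 \<le> t" for t using that by simp
  have pt: "indicator {s \<in> space P. lpp (w s) m n \<le> A} s \<le> ennreal (?T1 s) + ennreal (?T2 s) +
    (\<Sum>k\<in>{1..m}. ennreal (?A k s)) + (\<Sum>k\<in>{1..n}. ennreal (?B k s))" for s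
  proof (cases "lpp (w s) m n \<le> A")
    case LA: True
    have "1 \<le> ennreal (?T1 s) + ennreal (?T2 s) +
      (\<Sum>k\<in>{1..m}. ennreal (?A k s)) + (\<Sum>k\<in>{1..n}. ennreal (?B k s))"
    proof (cases "bottom (w s) m \<le> u1 \<or> stationary_lpp (w s) m n - bottom (w s) m \<le> u2")
      case True
      then have "1 \<le> ennreal (?T1 s) \<or> 1 \<le> ennreal (?T2 s)"
        using \<tau> by (auto simp: mult_left_mono)
      then show ?thesis by (auto intro: order_trans simp: add_increasing add_increasing2)
    next
      case False
      then have BB: "B \<le> stationary_lpp (w s) m n" using B by auto
      from boundary_lpp_exit[OF mn, of "w s" "bottom (w s)" "leftmost (w s)"]
      consider k where "k \<in> {1..m}" "stationary_lpp (w s) m n \<le> bottom (w s) k + ?h k s"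
        | k where "k \<in> {1..n}" "stationary_lpp (w s) m n \<le> leftmost (w s) k + ?v k s"
        unfolding stationary_lpp_def by blast
      then show ?thesis
      proof cases
        case (1 k)
        have "?h k s \<le> lpp (w s) m n"
          using lpp_shifted_le[of "w s" "k - 1" 0 "Suc m - k" n] nonneg 1 by auto
        with 1 BB LA \<sigma> c have "0 \<le> \<sigma> * bottom (w s) k - \<sigma> * (B - A)" "0 \<le> c * bottom (w s) k + c * ?h k s - c * B"
          unfolding right_diff_distrib[symmetric] distrib_left[symmetric] by (auto intro!: mult_nonneg_nonneg)
        then have "1 \<le> ennreal (?A k s)" using one by (cases "k \<le> K") simp_all
        also have "\<dots> \<le> (\<Sum>k\<in>{1..m}. ennreal (?A k s))"
          using 1(1) by (intro member_le_sum) auto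
        finally show ?thesis by (simp add: add_increasing add_increasing2)
      next
        case (2 k)
        have "?v k s \<le> lpp (w s) m n"
          using lpp_shifted_le[of "w s" 0 "k - 1" m "Suc n - k"] nonneg 2 by auto
        with 2 BB LA \<sigma> c have "0 \<le> \<sigma> * leftmost (w s) k - \<sigma> * (B - A)" "0 \<le> c' * leftmost (w s) k + c' * ?v k s - c' * B"
          unfolding right_diff_distrib[symmetric] distrib_left[symmetric] by (auto intro!: mult_nonneg_nonneg)
        then have "1 \<le> ennreal (?B k s)" using one by (cases "k \<le> K") simp_all
        also have "\<dots> \<le> (\<Sum>k\<in>{1..n}. ennreal (?B k s))"
          using 2(1) by (intro member_le_sum) auto
        finally show ?thesis by (simp add: add_increasing add_increasing2)
      qed
    qed
    then show ?thesis by (auto simp: indicator_def)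
  qed (auto simp: indicator_def)
  have "emeasure P {s \<in> space P. lpp (w s) m n \<le> A} = (\<integral>\<^sup>+s. indicator {s \<in> space P. lpp (w s) m n \<le> A} s \<partial>P)"
    by simp
  also have "\<dots> \<le> (\<integral>\<^sup>+s. ennreal (?T1 s) + ennreal (?T2 s) +
    (\<Sum>k\<in>{1..m}. ennreal (?A k s)) + (\<Sum>k\<in>{1..n}. ennreal (?B k s)) \<partial>P)"
    by (intro nn_integral_mono pt)
  also have "\<dots> = (\<integral>\<^sup>+s. ennreal (?T1 s) \<partial>P) + (\<integral>\<^sup>+s. ennreal (?T2 s) \<partial>P) +
    (\<Sum>k\<in>{1..m}. \<integral>\<^sup>+s. ennreal (?A k s) \<partial>P) + (\<Sum>k\<in>{1..n}. \<integral>\<^sup>+s. ennreal (?B k s) \<partial>P)"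
  proof -
    have a: "(\<lambda>s. \<Sum>k\<in>{1..m}. ennreal (?A k s)) \<in> borel_measurable P" by (rule borel_measurable_sum) (rule Am)
    have b: "(\<lambda>s. \<Sum>k\<in>{1..n}. ennreal (?B k s)) \<in> borel_measurable P" by (rule borel_measurable_sum) (rule Bm)
    have sA: "(\<integral>\<^sup>+s. (\<Sum>k\<in>{1..m}. ennreal (?A k s)) \<partial>P) = (\<Sum>k\<in>{1..m}. \<integral>\<^sup>+s. ennreal (?A k s) \<partial>P)"
      by (rule nn_integral_sum) (rule Am)
    have sB: "(\<integral>\<^sup>+s. (\<Sum>k\<in>{1..n}. ennreal (?B k s)) \<partial>P) = (\<Sum>k\<in>{1..n}. \<integral>\<^sup>+s. ennreal (?B k s) \<partial>P)"
      by (rule nn_integral_sum) (rule Bm)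
    have [measurable]: "(\<lambda>s. bottom (w s) m) \<in> borel_measurable P"
      by (rule bottom_measurable) simp
    have t: "(\<lambda>s. ennreal (?T1 s)) \<in> borel_measurable P" "(\<lambda>s. ennreal (?T2 s)) \<in> borel_measurable P"
      by measurable
    show ?thesis
      unfolding sA[symmetric] sB[symmetric]
      by (subst nn_integral_add[OF borel_measurable_add[OF borel_measurable_add[OF t] a] b],
          subst nn_integral_add[OF borel_measurable_add[OF t] a], subst nn_integral_add[OF t]) rule
  qed
  also have "(\<Sum>k\<in>{1..m}. \<integral>\<^sup>+s. ennreal (?A k s) \<partial>P) = (\<Sum>k\<in>{1..m}. if k \<le> K then ennreal (exp (- (\<sigma> * (B - A))) * (z / (z - \<sigma>)) ^ k)
      else ennreal (exp (- (c * B)) * (z / (z - c)) ^ k) * lpp_mgf c (Suc m - k) n)"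
    by (intro sum.cong refl A)
  also have "(\<Sum>k\<in>{1..n}. \<integral>\<^sup>+s. ennreal (?B k s) \<partial>P) = (\<Sum>k\<in>{1..n}. if k \<le> K then ennreal (exp (- (\<sigma> * (B - A))) * ((1 - z) / (1 - z - \<sigma>)) ^ k)
      else ennreal (exp (- (c' * B)) * ((1 - z) / (1 - z - c')) ^ k) * lpp_mgf c' m (Suc n - k))"
    by (intro sum.cong refl B')
  finally show ?thesis unfolding T1 T2 .
qed

end

lemma ex_stationary:
  assumes "0 < z" "z < 1" "1 \<le> m" "1 \<le> n"
  shows "\<exists>(P :: (nat \<times> nat \<Rightarrow> real) measure) W. stationary P W z m n"
proof -
  have "(1, 0) \<in> grid m n" using assms by (auto simp: grid_def)
  then have "\<exists>(P :: (nat \<times> nat \<Rightarrow> real) measure) W. expo_field P W (boundary_rate z) (grid m n)"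
    using assms by (intro ex_expo_field) (auto simp: boundary_rate_def)
  then show ?thesis using assms by (auto simp: stationary_def stationary_axioms_def)
qed

text \<open>The boundary has disappeared from the statement: the parameter \<open>z\<close> of the
  auxiliary stationary field survives only as a free parameter of the bound.\<close>

lemma two_point_bound:
  assumes "0 < z" "0 \<le> \<sigma>" "0 \<le> \<theta>" "\<sigma> + \<theta> < 1 - z" "n1 \<le> n" "n2 \<le> n" "1 \<le> m" "1 \<le> n"
  shows "(\<integral>\<^sup>+x. ennreal (exp (\<sigma> * lpp x m n1 + \<theta> * lpp x m n2)) \<partial>exp_laws ({1..m} \<times> {1..n}) 1) \<le>
    ennreal (((z + \<sigma> + \<theta>) / z) ^ m *
      (\<Prod>j\<in>{1..n}. (1 - z) / (1 - z - (\<sigma> * of_bool (j \<le> n1) + \<theta> * of_bool (j \<le> n2)))))"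
proof -
  have "z < 1" using assms by linarith
  then obtain P :: "(nat \<times> nat \<Rightarrow> real) measure" and W where "stationary P W z m n"
    using ex_stationary[of z m n] assms by blast
  then interpret stationary P W z m n .
  have [measurable]: "(\<lambda>x. lpp x m n1) \<in> borel_measurable (PiM ({1..m} \<times> {1..n}) (\<lambda>_. borel))"
      "(\<lambda>x. lpp x m n2) \<in> borel_measurable (PiM ({1..m} \<times> {1..n}) (\<lambda>_. borel))"
    using assms by (auto intro!: lpp_measurable)
  have f: "(\<lambda>x. ennreal (exp (\<sigma> * lpp x m n1 + \<theta> * lpp x m n2))) \<in> borel_measurable (PiM ({1..m} \<times> {1..n}) (\<lambda>_. borel))"
    by measurable
  have b: "(\<lambda>v. (fst v + 0, snd v + 0)) ` ({1..m} \<times> {1..n}) \<subseteq> grid m n"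
    "\<And>v. v \<in> {1..m} \<times> {1..n} \<Longrightarrow> boundary_rate z (fst v + 0, snd v + 0) = 1"
    by (auto simp: boundary_rate_def)
  have r: "lpp (restrict (shifted 0 0 (w s)) ({1..m} \<times> {1..n})) m k = lpp (w s) m k" if "k \<le> n" for k s
    unfolding shifted_0_0 using that by (intro lpp_restrict) auto
  have "(\<integral>\<^sup>+x. ennreal (exp (\<sigma> * lpp x m n1 + \<theta> * lpp x m n2)) \<partial>exp_laws ({1..m} \<times> {1..n}) 1) =
    (\<integral>\<^sup>+s. ennreal (exp (\<sigma> * lpp (w s) m n1 + \<theta> * lpp (w s) m n2)) \<partial>P)"
    using block_law[OF b f] by (simp only: r[OF assms(5)] r[OF assms(6)])
  also have "\<dots> \<le> ennreal (((z + \<sigma> + \<theta>) / z) ^ m *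
      (\<Prod>j\<in>{1..n}. (1 - z) / (1 - z - (\<sigma> * of_bool (j \<le> n1) + \<theta> * of_bool (j \<le> n2)))))"
    by (rule two_point) (use assms in auto)
  finally show ?thesis .
qed

text \<open>Here \<open>q\<close> is the parameter of the stationary model used for comparison. It
  may be chosen freely, and later gains come from moving it.\<close>

lemma lpp_mgf_le:
  assumes "0 < q" "0 \<le> \<theta>" "q + \<theta> < 1" "1 \<le> m" "1 \<le> n"
  shows "lpp_mgf \<theta> m n \<le> ennreal (((q + \<theta>) / q) ^ m * ((1 - q) / (1 - q - \<theta>)) ^ n)"
proof -
  have "(\<Prod>j\<in>{1..n}. (1 - q) / (1 - q - (0 * of_bool (j \<le> n) + \<theta> * of_bool (j \<le> n)))) =
    (\<Prod>j\<in>{1..n}. (1 - q) / (1 - q - \<theta>))" by (intro prod.cong) auto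
  then show ?thesis
    using two_point_bound[of q 0 \<theta> n n n m] assms unfolding lpp_mgf_def by simp
qed

lemma lpp_mgf_transpose: "lpp_mgf \<theta> m n = lpp_mgf \<theta> n m"
proof -
  let ?h = "\<lambda>v::nat \<times> nat. (snd v, fst v)"
  let ?f = "\<lambda>x. ennreal (exp (\<theta> * lpp x m n))"
  have f: "?f \<in> borel_measurable (PiM ({1..m} \<times> {1..n}) (\<lambda>_. borel))"
    using lpp_measurable[OF order_refl, of m n] by measurable
  have "lpp_mgf \<theta> m n = (\<integral>\<^sup>+x. ?f (\<lambda>v\<in>{1..m} \<times> {1..n}. x (?h v)) \<partial>exp_laws ({1..n} \<times> {1..m}) 1)"
    unfolding lpp_mgf_def
    by (rule nn_integral_reindex_exp_law[where q = "\<lambda>_. 1", symmetric]) (use f in \<open>auto simp: inj_on_def\<close>)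
  also have "\<dots> = lpp_mgf \<theta> n m"
    unfolding lpp_mgf_def by (simp only: lpp_restrict[OF order_refl] lpp_transpose)
  finally show ?thesis .
qed

lemma lpp_mgf_mono:
  assumes "0 \<le> \<theta>" "m \<le> m'" "n \<le> n'"
  shows "lpp_mgf \<theta> m n \<le> lpp_mgf \<theta> m' n'"
proof (cases "m' = 0 \<or> n' = 0")
  case True
  with assms have "lpp x m n = 0" "lpp x m' n' = 0" for x by auto
  then show ?thesis unfolding lpp_mgf_def
    using prob_space.emeasure_space_1[OF prob_space_PiM[of "{1..m} \<times> {1..n}" "\<lambda>_. exp_law 1"]]
      prob_space.emeasure_space_1[OF prob_space_PiM[of "{1..m'} \<times> {1..n'}" "\<lambda>_. exp_law 1"]] prob_space_exp_law[of 1] by simp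
next
  case False
  \<comment> \<open>Both moments are realised in one field, where the passage times compare
    pointwise. The value 1/2 is arbitrary: the bulk rates are 1 for every parameter.\<close>
  then obtain P :: "(nat \<times> nat \<Rightarrow> real) measure" and W where "stationary P W (1/2) m' n'"
    using ex_stationary[of "1/2" m' n'] by auto
  then interpret stationary P W "1/2" m' n' .
  have "lpp_mgf \<theta> m n = (\<integral>\<^sup>+s. ennreal (exp (\<theta> * lpp (shifted 0 0 (w s)) m n)) \<partial>P)"
    by (rule lpp_mgf_stationary[symmetric]) (use assms in auto)
  also have "\<dots> \<le> (\<integral>\<^sup>+s. ennreal (exp (\<theta> * lpp (shifted 0 0 (w s)) m' n')) \<partial>P)"
    using assms nonneg by (intro nn_integral_mono ennreal_leI) (auto intro!: mult_left_mono lpp_mono)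
  also have "\<dots> = lpp_mgf \<theta> m' n'" by (rule lpp_mgf_stationary) auto
  finally show ?thesis .
qed

subsection \<open>Exponential rates\<close>

text \<open>Half of the rate pays for the linear prefactor and the constant. Unions over exit points
  and rounding errors are absorbed in this way.\<close>

lemma poly_exp_eventually:
  fixes F c1 c2 c3 :: real
  assumes "F < 0"
  shows "\<forall>\<^sub>F N::nat in sequentially. (c1 + c2 * real N) * exp (c3 + F * real N) \<le> exp (F / 2 * real N)"
proof -
  have "((\<lambda>N::nat. (c1 + c2 * real N) * exp (c3 + F / 2 * real N)) \<longlongrightarrow> 0) sequentially"
    using assms by real_asymp
  then have "\<forall>\<^sub>F N::nat in sequentially. (c1 + c2 * real N) * exp (c3 + F / 2 * real N) < 1"
    by (rule order_tendstoD) simp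
  then show ?thesis
  proof eventually_elim
    case (elim N)
    have "(c1 + c2 * real N) * exp (c3 + F * real N) = (c1 + c2 * real N) * exp (c3 + F / 2 * real N) * exp (F / 2 * real N)"
      by (simp add: exp_add[symmetric] mult.assoc algebra_simps)
    also have "\<dots> \<le> 1 * exp (F / 2 * real N)" using elim by (intro mult_right_mono) auto
    finally show ?case by simp
  qed
qed

lemma mult_le_abs: "\<bar>t\<bar> \<le> D \<Longrightarrow> t * y \<le> D * \<bar>y\<bar>" for t y D :: real
  by (rule order_trans[OF abs_ge_self]) (simp add: abs_mult mult_right_mono)

lemma power_eq_exp: "0 < R \<Longrightarrow> R ^ m = exp (real m * ln R)"
  by (simp add: exp_of_nat_mult)

text \<open>From \<open>\<zeta>\<close> + \<open>\<theta>\<close> <= \<open>r\<close> it follows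
  that a boundary step contributes at most the factor of a bulk column. The bound thus decreases in
  \<open>k\<close>, and its value at the minimal distance \<open>d\<close> serves for all later
  exits.\<close>

lemma exit_term:
  assumes "0 < \<theta>" "0 < \<zeta>" "\<zeta> + \<theta> < 1" "\<zeta> + \<theta> \<le> r" "1 \<le> n" "k \<in> {1..m}" "d \<le> real k"
  shows "ennreal ((r / (r - \<theta>)) ^ k) * lpp_mgf \<theta> (Suc m - k) n \<le>
    ennreal (exp (d * ln (r / (r - \<theta>)) + (real m + 1 - d) * ln ((\<zeta> + \<theta>) / \<zeta>) + real n * ln ((1 - \<zeta>) / (1 - \<zeta> - \<theta>))))"
proof -
  have r: "0 < r - \<theta>" "0 < r / (r - \<theta>)" using assms by auto
  have "r / (r - \<theta>) \<le> (\<zeta> + \<theta>) / \<zeta>"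
    using r assms mult_left_mono[OF assms(4), of \<theta>] by (simp add: field_simps)
  then have xy: "ln (r / (r - \<theta>)) \<le> ln ((\<zeta> + \<theta>) / \<zeta>)" using r assms by simp
  have "ennreal ((r / (r - \<theta>)) ^ k) * lpp_mgf \<theta> (Suc m - k) n \<le>
    ennreal ((r / (r - \<theta>)) ^ k) * ennreal (((\<zeta> + \<theta>) / \<zeta>) ^ (Suc m - k) * ((1 - \<zeta>) / (1 - \<zeta> - \<theta>)) ^ n)"
    using assms by (intro mult_left_mono lpp_mgf_le) auto
  also have "\<dots> = ennreal (exp (real k * ln (r / (r - \<theta>)) + (real m + 1 - real k) * ln ((\<zeta> + \<theta>) / \<zeta>) + real n * ln ((1 - \<zeta>) / (1 - \<zeta> - \<theta>))))"
    using assms r by (subst ennreal_mult[symmetric]) (auto simp: power_eq_exp exp_add of_nat_diff intro!: divide_nonneg_nonneg)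
  also have "\<dots> \<le> ennreal (exp (d * ln (r / (r - \<theta>)) + (real m + 1 - d) * ln ((\<zeta> + \<theta>) / \<zeta>) + real n * ln ((1 - \<zeta>) / (1 - \<zeta> - \<theta>))))"
  proof -
    have "(real k - d) * ln (r / (r - \<theta>)) \<le> (real k - d) * ln ((\<zeta> + \<theta>) / \<zeta>)"
      using xy assms by (intro mult_left_mono) auto
    then show ?thesis by (intro ennreal_leI) (simp add: algebra_simps)
  qed
  finally show ?thesis .
qed

text \<open>This is the bound of \<open>lpp_mgf_le\<close> for the exponent w - z at q = z. For
  \<open>m\<close> and \<open>n\<close> along the matching ray it is sharp to exponential order, by
  \<open>lpp_mgf_ge\<close>.\<close>

definition tilt_factor :: "real \<Rightarrow> real \<Rightarrow> nat \<Rightarrow> nat \<Rightarrow> real" where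
  "tilt_factor w z m n = (w / z) ^ m * ((1 - z) / (1 - w)) ^ n"

lemma tilt_factor_exp: "0 < z \<Longrightarrow> z < w \<Longrightarrow> w < 1 \<Longrightarrow> tilt_factor w z m n = exp (real m * ln (w / z) + real n * ln ((1 - z) / (1 - w)))"
  by (simp add: tilt_factor_def power_eq_exp exp_add)

text \<open>Reflection in the diagonal acts on the parameters by (w, z) -> (1 - z, 1 - w).\<close>

lemma tilt_factor_swap: "tilt_factor (1 - z) (1 - w) n m = tilt_factor w z m n"
  by (simp add: tilt_factor_def)

lemma DERIV_neg_ex:
  fixes F :: "real \<Rightarrow> real"
  assumes "(F has_real_derivative D) (at 0)" "D < 0" "0 < u"
  shows "\<exists>s>0. s < u \<and> F s < F 0"
proof -
  from DERIV_neg_dec_right[OF assms(1,2)] obtain d where d: "d > 0" "\<And>h. 0 < h \<Longrightarrow> h < d \<Longrightarrow> F (0 + h) < F 0"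
    by auto
  then show ?thesis using assms(3) by (intro exI[of _ "min d u / 2"]) auto
qed

text \<open>The bulk factor is bounded with parameter \<open>z - \<kappa>\<close>. Since a/(w z) and
  b/((1 - w) (1 - z)) both equal l, the full bulk exponent is stationary at 0, and only the
  \<open>\<delta> * N\<close> columns spent on the boundary contribute to the derivative, with a
  negative sign.\<close>

lemma exit_tail:
  assumes wz: "0 < z" "z < w" "w < 1" and l: "0 < l" "0 < \<delta>"
    and m: "\<And>N. \<bar>real (m N) - l * w * z * real N\<bar> \<le> D" and n: "\<And>N. \<bar>real (n N) - l * (1 - w) * (1 - z) * real N\<bar> \<le> D"
    and n1: "\<forall>\<^sub>F N in sequentially. 1 \<le> n N"
  shows "\<exists>c>0. \<forall>\<^sub>F N::nat in sequentially. \<forall>k\<in>{1..m N}. \<delta> * real N \<le> real k \<longrightarrow>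
    ennreal ((w / z) ^ k) * lpp_mgf (w - z) (Suc (m N) - k) (n N) \<le> ennreal (tilt_factor w z (m N) (n N) * exp (- (c * real N)))"
proof -
  define a where "a = l * w * z"
  define b where "b = l * (1 - w) * (1 - z)"
  let ?Y = "\<lambda>\<kappa>. ln ((w - \<kappa>) / (z - \<kappa>))" and ?U = "\<lambda>\<kappa>. ln ((1 - z + \<kappa>) / (1 - w + \<kappa>))"
  let ?F = "\<lambda>\<kappa>. (a - \<delta>) * ?Y \<kappa> + b * ?U \<kappa>"
  have d1: "(?F has_real_derivative ((a - \<delta>) * ((w - z) / (w * z)) - b * ((w - z) / ((1 - w) * (1 - z))))) (at 0)"
    using wz by (auto intro!: derivative_eq_intros simp: divide_simps power2_eq_square) (simp_all add: algebra_simps)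
  have d2: "(a - \<delta>) * ((w - z) / (w * z)) - b * ((w - z) / ((1 - w) * (1 - z))) = - \<delta> * ((w - z) / (w * z))"
    using wz by (simp add: a_def b_def divide_simps) (simp add: algebra_simps)
  have d3: "- \<delta> * ((w - z) / (w * z)) < 0" using wz l by (simp add: divide_neg_pos mult_pos_pos)
  from DERIV_neg_ex[OF d1[unfolded d2] d3 wz(1)]
  obtain \<kappa> where \<kappa>: "0 < \<kappa>" "\<kappa> < z" "?F \<kappa> < ?F 0"
    by blast
  define f where "f = ?F \<kappa> - ?F 0"
  have f: "f < 0" using \<kappa> by (simp add: f_def)
  \<comment> \<open>\<open>C\<close> collects the errors from replacing \<open>m N\<close> and
    \<open>n N\<close>, plus the one extra column in \<open>exit_term\<close>, by linear functions
    of N.\<close>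
  define C where "C = (D + 1) * \<bar>?Y \<kappa>\<bar> + D * \<bar>?U \<kappa>\<bar> + D * \<bar>?Y 0\<bar> + D * \<bar>?U 0\<bar>"
  have "\<forall>\<^sub>F N::nat in sequentially. (1 + 0 * real N) * exp (C + f * real N) \<le> exp (f / 2 * real N)"
    by (rule poly_exp_eventually[OF f])
  then have "\<forall>\<^sub>F N::nat in sequentially. \<forall>k\<in>{1..m N}. \<delta> * real N \<le> real k \<longrightarrow>
    ennreal ((w / z) ^ k) * lpp_mgf (w - z) (Suc (m N) - k) (n N) \<le> ennreal (tilt_factor w z (m N) (n N) * exp (- (- f / 2 * real N)))"
    using n1
  proof (eventually_elim, intro ballI impI)
    fix N k assume N: "(1 + 0 * real N) * exp (C + f * real N) \<le> exp (f / 2 * real N)" and n1: "1 \<le> n N"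
      and k: "k \<in> {1..m N}" "\<delta> * real N \<le> real k"
    have "ennreal ((w / (w - (w - z))) ^ k) * lpp_mgf (w - z) (Suc (m N) - k) (n N) \<le>
      ennreal (exp (\<delta> * real N * ln (w / (w - (w - z))) + (real (m N) + 1 - \<delta> * real N) * ln ((z - \<kappa> + (w - z)) / (z - \<kappa>)) +
        real (n N) * ln ((1 - (z - \<kappa>)) / (1 - (z - \<kappa>) - (w - z)))))"
      by (rule exit_term) (use wz \<kappa> k n1 in auto)
    moreover have "\<delta> * real N * ln (w / (w - (w - z))) + (real (m N) + 1 - \<delta> * real N) * ln ((z - \<kappa> + (w - z)) / (z - \<kappa>)) +
        real (n N) * ln ((1 - (z - \<kappa>)) / (1 - (z - \<kappa>) - (w - z))) =
      \<delta> * real N * ?Y 0 + (real (m N) + 1 - \<delta> * real N) * ?Y \<kappa> + real (n N) * ?U \<kappa>"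
    proof -
      have "w - (w - z) = z" "z - \<kappa> + (w - z) = w - \<kappa>" "1 - (z - \<kappa>) = 1 - z + \<kappa>" "1 - z + \<kappa> - (w - z) = 1 - w + \<kappa>"
        by auto
      then show ?thesis by (simp only: diff_zero)
    qed
    moreover have "\<delta> * real N * ?Y 0 + (real (m N) + 1 - \<delta> * real N) * ?Y \<kappa> + real (n N) * ?U \<kappa> \<le>
      real (m N) * ?Y 0 + real (n N) * ?U 0 + (C + f * real N)"
    proof -
      have "(real (m N) - a * real N + 1) * ?Y \<kappa> \<le> (D + 1) * \<bar>?Y \<kappa>\<bar>"
        using m[of N] unfolding a_def by (intro mult_le_abs) linarith
      moreover have "(real (n N) - b * real N) * ?U \<kappa> \<le> D * \<bar>?U \<kappa>\<bar>"
        using n[of N] unfolding b_def by (intro mult_le_abs) linarith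
      moreover have "(a * real N - real (m N)) * ?Y 0 \<le> D * \<bar>?Y 0\<bar>"
        using m[of N] unfolding a_def by (intro mult_le_abs) linarith
      moreover have "(b * real N - real (n N)) * ?U 0 \<le> D * \<bar>?U 0\<bar>"
        using n[of N] unfolding b_def by (intro mult_le_abs) linarith
      ultimately show ?thesis unfolding C_def f_def by (simp add: algebra_simps)
    qed
    ultimately have "ennreal ((w / (w - (w - z))) ^ k) * lpp_mgf (w - z) (Suc (m N) - k) (n N) \<le>
      ennreal (exp (real (m N) * ?Y 0 + real (n N) * ?U 0 + (C + f * real N)))"
      by (elim order_trans) (intro ennreal_leI, simp only: exp_le_cancel_iff)
    then have "ennreal ((w / z) ^ k) * lpp_mgf (w - z) (Suc (m N) - k) (n N) \<le>
      ennreal (exp (real (m N) * ?Y 0 + real (n N) * ?U 0 + (C + f * real N)))"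
      by simp
    also have "exp (real (m N) * ?Y 0 + real (n N) * ?U 0 + (C + f * real N)) = tilt_factor w z (m N) (n N) * exp (C + f * real N)"
      using wz by (simp add: tilt_factor_exp exp_add)
    also have "ennreal (tilt_factor w z (m N) (n N) * exp (C + f * real N)) \<le> ennreal (tilt_factor w z (m N) (n N) * exp (- (- f / 2 * real N)))"
      using N wz by (intro ennreal_leI mult_left_mono) (auto simp: tilt_factor_exp)
    finally show "ennreal ((w / z) ^ k) * lpp_mgf (w - z) (Suc (m N) - k) (n N) \<le> ennreal (tilt_factor w z (m N) (n N) * exp (- (- f / 2 * real N)))" .
  qed
  then show ?thesis using f by (intro exI[of _ "- f / 2"]) auto
qed

lemma exp_lin_eventually:
  fixes m n :: "nat \<Rightarrow> nat" and x y :: real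
  assumes m: "\<And>N. \<bar>real (m N) - \<alpha> * real N\<bar> \<le> D" and n: "\<And>N. \<bar>real (n N) - \<beta> * real N\<bar> \<le> D"
    and f: "\<alpha> * x + \<beta> * y + \<gamma> < 0" and c: "0 \<le> c1" "0 \<le> c2"
  shows "\<forall>\<^sub>F N in sequentially. (c1 + c2 * real N) * exp (c3 + real (m N) * x + real (n N) * y + \<gamma> * real N)
    \<le> exp ((\<alpha> * x + \<beta> * y + \<gamma>) / 2 * real N)"
  using poly_exp_eventually[OF f, of c1 c2 "c3 + D * \<bar>x\<bar> + D * \<bar>y\<bar>"]
proof eventually_elim
  case (elim N)
  have "(real (m N) - \<alpha> * real N) * x \<le> D * \<bar>x\<bar>"
    using m[of N] by (intro mult_le_abs) linarith
  moreover have "(real (n N) - \<beta> * real N) * y \<le> D * \<bar>y\<bar>"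
    using n[of N] by (intro mult_le_abs) linarith
  ultimately have "c3 + real (m N) * x + real (n N) * y + \<gamma> * real N \<le>
    c3 + D * \<bar>x\<bar> + D * \<bar>y\<bar> + (\<alpha> * x + \<beta> * y + \<gamma>) * real N" by (simp add: algebra_simps)
  then have "(c1 + c2 * real N) * exp (c3 + real (m N) * x + real (n N) * y + \<gamma> * real N) \<le>
    (c1 + c2 * real N) * exp (c3 + D * \<bar>x\<bar> + D * \<bar>y\<bar> + (\<alpha> * x + \<beta> * y + \<gamma>) * real N)"
    using c by (intro mult_left_mono) auto
  with elim show ?case by linarith
qed

lemma eventually_ge_linear:
  fixes m :: "nat \<Rightarrow> nat"
  assumes "\<And>N. \<bar>real (m N) - a * real N\<bar> \<le> D" "0 < a"
  shows "\<forall>\<^sub>F N in sequentially. k \<le> m N"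
proof -
  have "filterlim (\<lambda>N::nat. a * real N - D) at_top sequentially"
    using assms(2) by real_asymp
  then have "\<forall>\<^sub>F N::nat in sequentially. real k \<le> a * real N - D"
    by (simp add: filterlim_at_top)
  then show ?thesis
  proof eventually_elim
    case (elim N)
    with assms(1)[of N] have "real k \<le> real (m N)" by linarith
    then show ?case by simp
  qed
qed

lemma lpp_mgf_real:
  assumes "0 \<le> \<theta>" "\<theta> < 1"
  obtains M where "lpp_mgf \<theta> m n = ennreal M" "0 \<le> M"
proof -
  have "lpp_mgf \<theta> m n \<le> lpp_mgf \<theta> (Suc m) (Suc n)" by (rule lpp_mgf_mono) (use assms in auto)
  also have "\<dots> < \<top>"
    using lpp_mgf_le[of "(1 - \<theta>) / 2" \<theta> "Suc m" "Suc n"] assms by (auto simp: field_simps intro: le_less_trans)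
  finally show ?thesis using that by (cases "lpp_mgf \<theta> m n" rule: ennreal_cases) auto
qed

text \<open>The stationary model has an explicit moment. Exits far from the corner contribute
  negligibly to it, so the bulk moments must account for the rest.\<close>

lemma lpp_mgf_ge:
  assumes wz: "0 < z" "z < w" "w < 1" and l: "0 < l" and \<eta>: "0 < \<eta>"
    and m: "\<And>N. \<bar>real (m N) - l * w * z * real N\<bar> \<le> D" and n: "\<And>N. \<bar>real (n N) - l * (1 - w) * (1 - z) * real N\<bar> \<le> D"
  shows "\<forall>\<^sub>F N in sequentially. ennreal (tilt_factor w z (m N) (n N) * exp (- (\<eta> * real N))) \<le> lpp_mgf (w - z) (m N) (n N)"
proof -
  define a where "a = l * w * z"
  define b where "b = l * (1 - w) * (1 - z)"
  have ab: "0 < a" "0 < b" using wz l by (auto simp: a_def b_def)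
  let ?X = "ln (w / z)" and ?U = "ln ((1 - z) / (1 - w))"
  have XU: "0 < ?X" "0 < ?U" using wz by auto
  \<comment> \<open>Chosen so that a boundary stretch of length \<open>\<delta> * N\<close> costs at
    most the factor exp(\<open>\<eta>\<close> N / 4) on either side.\<close>
  define \<delta> where "\<delta> = \<eta> / (4 * (?X + ?U))"
  have \<delta>: "0 < \<delta>" using \<eta> XU by (simp add: \<delta>_def)
  have dX: "\<delta> * ?X \<le> \<eta> / 4" "\<delta> * ?U \<le> \<eta> / 4" using XU \<eta> by (auto simp: \<delta>_def field_simps)
  have m1: "\<forall>\<^sub>F N in sequentially. 1 \<le> m N" and n1: "\<forall>\<^sub>F N in sequentially. 1 \<le> n N"
    using eventually_ge_linear[OF m] eventually_ge_linear[OF n] ab by (auto simp: a_def b_def)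
  have m': "\<bar>real (m N) - l * (1 - (1 - z)) * (1 - (1 - w)) * real N\<bar> \<le> D" 
    and n': "\<bar>real (n N) - l * (1 - z) * (1 - w) * real N\<bar> \<le> D" for N
    using m[of N] n[of N] by (simp_all add: mult_ac)
  from exit_tail[OF wz l \<delta> m n n1] obtain c where c: "c > 0"
    "\<forall>\<^sub>F N::nat in sequentially. \<forall>k\<in>{1..m N}. \<delta> * real N \<le> real k \<longrightarrow>
    ennreal ((w / z) ^ k) * lpp_mgf (w - z) (Suc (m N) - k) (n N) \<le> ennreal (tilt_factor w z (m N) (n N) * exp (- (c * real N)))"
    by blast
  \<comment> \<open>Exits on the left side are the reflected case, with 1 - z and 1 - w in the roles
    of \<open>w\<close> and \<open>z\<close>.\<close>
  have "\<exists>c>0. \<forall>\<^sub>F N::nat in sequentially. \<forall>k\<in>{1..n N}. \<delta> * real N \<le> real k \<longrightarrow>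
    ennreal (((1 - z) / (1 - w)) ^ k) * lpp_mgf (1 - z - (1 - w)) (Suc (n N) - k) (m N) \<le>
      ennreal (tilt_factor (1 - z) (1 - w) (n N) (m N) * exp (- (c * real N)))"
    by (rule exit_tail[OF _ _ _ l \<delta> n' m' m1]) (use wz in auto)
  then obtain c' where c': "c' > 0"
    "\<forall>\<^sub>F N::nat in sequentially. \<forall>k\<in>{1..n N}. \<delta> * real N \<le> real k \<longrightarrow>
    ennreal (((1 - z) / (1 - w)) ^ k) * lpp_mgf (w - z) (m N) (Suc (n N) - k) \<le> ennreal (tilt_factor w z (m N) (n N) * exp (- (c' * real N)))"
    by (auto simp: tilt_factor_swap lpp_mgf_transpose[of _ "m _"])
  define e where "e = min c c'"
  have e: "0 < e" using c c' by (simp add: e_def)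
  define c1 where "c1 = 2 * D"
  define c2 where "c2 = a + b"
  have D: "0 \<le> D" using m[of 0] by simp
  have c12: "0 \<le> c1" "0 \<le> c2" using D ab by (auto simp: c1_def c2_def)
  have "\<forall>\<^sub>F N::nat in sequentially. (2 * c1 + 2 * c2 * real N) * exp (0 + - e * real N) \<le> exp (- e / 2 * real N)"
    by (rule poly_exp_eventually) (use e in auto)
  moreover have "\<forall>\<^sub>F N::nat in sequentially. (2 * c1 + 2 * c2 * real N) * exp (0 + - (\<eta> / 4) * real N) \<le> exp (- (\<eta> / 4) / 2 * real N)"
    by (rule poly_exp_eventually) (use \<eta> in auto)
  ultimately show ?thesis using c(2) c'(2) m1 n1
  proof eventually_elim
    case (elim N)
    let ?K = "tilt_factor w z (m N) (n N)"
    have K: "0 < ?K" using wz by (simp add: tilt_factor_def)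
    obtain M where M: "lpp_mgf (w - z) (m N) (n N) = ennreal M" "0 \<le> M"
      by (rule lpp_mgf_real[of "w - z" "m N" "n N"]) (use wz in auto)
    \<comment> \<open>Every exit term is at most \<open>?T\<close>: the first summand covers exits
      beyond \<open>\<delta> * N\<close>, the second covers earlier ones, where the bulk moment is
      bounded by the full moment \<open>M\<close>.\<close>
    let ?T = "?K * exp (- (e * real N)) + exp (\<eta> / 4 * real N) * M"
    have eK: "?K * exp (- (c * real N)) \<le> ?K * exp (- (e * real N))" "?K * exp (- (c' * real N)) \<le> ?K * exp (- (e * real N))"
      using K by (auto simp: e_def intro!: mult_left_mono mult_right_mono)
    have t1: "ennreal ((w / z) ^ k) * lpp_mgf (w - z) (Suc (m N) - k) (n N) \<le> ennreal ?T" if k: "k \<in> {1..m N}" for k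
    proof (cases "\<delta> * real N \<le> real k")
      case True
      with elim(3) k have "ennreal ((w / z) ^ k) * lpp_mgf (w - z) (Suc (m N) - k) (n N) \<le> ennreal (?K * exp (- (c * real N)))" by blast
      also have "\<dots> \<le> ennreal ?T" using eK M by (intro ennreal_leI add_increasing2) auto
      finally show ?thesis .
    next
      case False
      have "real k * ?X \<le> \<delta> * real N * ?X" using False XU by (intro mult_right_mono) auto
      also have "\<dots> \<le> \<eta> / 4 * real N" using mult_right_mono[OF dX(1), of "real N"] by (simp add: algebra_simps)
      finally have "(w / z) ^ k \<le> exp (\<eta> / 4 * real N)" using wz by (simp add: power_eq_exp)
      then have "ennreal ((w / z) ^ k) * lpp_mgf (w - z) (Suc (m N) - k) (n N) \<le> ennreal (exp (\<eta> / 4 * real N)) * lpp_mgf (w - z) (m N) (n N)"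
        using k wz by (intro mult_mono ennreal_leI lpp_mgf_mono) auto
      also have "\<dots> = ennreal (exp (\<eta> / 4 * real N) * M)" unfolding M(1) using M(2) by (simp add: ennreal_mult)
      also have "\<dots> \<le> ennreal ?T" using K by (intro ennreal_leI add_increasing) auto
      finally show ?thesis .
    qed
    have t2: "ennreal (((1 - z) / (1 - w)) ^ k) * lpp_mgf (w - z) (m N) (Suc (n N) - k) \<le> ennreal ?T" if k: "k \<in> {1..n N}" for k
    proof (cases "\<delta> * real N \<le> real k")
      case True
      with elim(4) k have "ennreal (((1 - z) / (1 - w)) ^ k) * lpp_mgf (w - z) (m N) (Suc (n N) - k) \<le> ennreal (?K * exp (- (c' * real N)))" by blast
      also have "\<dots> \<le> ennreal ?T" using eK M by (intro ennreal_leI add_increasing2) auto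
      finally show ?thesis .
    next
      case False
      have "real k * ?U \<le> \<delta> * real N * ?U" using False XU by (intro mult_right_mono) auto
      also have "\<dots> \<le> \<eta> / 4 * real N" using mult_right_mono[OF dX(2), of "real N"] by (simp add: algebra_simps)
      finally have "((1 - z) / (1 - w)) ^ k \<le> exp (\<eta> / 4 * real N)" using wz by (simp add: power_eq_exp)
      then have "ennreal (((1 - z) / (1 - w)) ^ k) * lpp_mgf (w - z) (m N) (Suc (n N) - k) \<le> ennreal (exp (\<eta> / 4 * real N)) * lpp_mgf (w - z) (m N) (n N)"
        using k wz by (intro mult_mono ennreal_leI lpp_mgf_mono) auto
      also have "\<dots> = ennreal (exp (\<eta> / 4 * real N) * M)" unfolding M(1) using M(2) by (simp add: ennreal_mult)
      also have "\<dots> \<le> ennreal ?T" using K by (intro ennreal_leI add_increasing) auto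
      finally show ?thesis .
    qed
    obtain P :: "(nat \<times> nat \<Rightarrow> real) measure" and W where "stationary P W z (m N) (n N)"
      using ex_stationary[of z "m N" "n N"] wz elim by auto
    then interpret stationary P W z "m N" "n N" .
    have "ennreal ?K = ennreal ((w / z) ^ m N) * ennreal (((1 - z) / (1 - z - (w - z))) ^ n N)"
      using wz by (simp add: tilt_factor_def ennreal_mult)
    also have "\<dots> \<le> ennreal ((w / z) ^ m N) * ((\<Sum>k\<in>{1..m N}. ennreal ((z / (z + (w - z))) ^ (m N - k)) * lpp_mgf (w - z) (Suc (m N) - k) (n N)) +
      (\<Sum>k\<in>{1..n N}. ennreal (((1 - z) / (1 - z - (w - z))) ^ k * (z / (z + (w - z))) ^ m N) * lpp_mgf (w - z) (m N) (Suc (n N) - k)))"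
      by (intro mult_left_mono exit_bound) (use wz in auto)
    also have "\<dots> = (\<Sum>k\<in>{1..m N}. ennreal ((w / z) ^ k) * lpp_mgf (w - z) (Suc (m N) - k) (n N)) +
      (\<Sum>k\<in>{1..n N}. ennreal (((1 - z) / (1 - w)) ^ k) * lpp_mgf (w - z) (m N) (Suc (n N) - k))"
    proof -
      have e1: "(w / z) ^ m N * (z / w) ^ (m N - k) = (w / z) ^ k" if "k \<in> {1..m N}" for k
      proof -
        have "(w / z) ^ m N = (w / z) ^ k * (w / z) ^ (m N - k)" using that by (simp add: power_add[symmetric])
        then show ?thesis using wz by (simp add: power_mult_distrib[symmetric] mult.assoc)
      qed
      have e2: "(w / z) ^ m N * (((1 - z) / (1 - w)) ^ k * (z / w) ^ m N) = ((1 - z) / (1 - w)) ^ k" for k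
      proof -
        have "(w / z) ^ m N * (((1 - z) / (1 - w)) ^ k * (z / w) ^ m N) = ((w / z) * (z / w)) ^ m N * ((1 - z) / (1 - w)) ^ k"
          unfolding power_mult_distrib by simp
        then show ?thesis using wz by simp
      qed
      have q: "z + (w - z) = w" "1 - z - (w - z) = 1 - w" by auto
      have t: "ennreal ((w / z) ^ m N) * (ennreal X * Y) = ennreal ((w / z) ^ m N * X) * Y" for X Y
        using wz by (simp add: ennreal_mult' mult.assoc)
      show ?thesis
        unfolding distrib_left sum_distrib_left q t
        by (intro arg_cong2[where f = "(+)"] sum.cong refl) (simp_all only: e1 e2)
    qed
    also have "\<dots> \<le> (\<Sum>k\<in>{1..m N}. ennreal ?T) + (\<Sum>k\<in>{1..n N}. ennreal ?T)"
      by (intro add_mono sum_mono t1 t2)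
    also have "\<dots> = ennreal ((real (m N) + real (n N)) * ?T)"
      using K M by (simp add: ennreal_of_nat_eq_real_of_nat ennreal_mult[symmetric] ennreal_plus[symmetric] algebra_simps del: ennreal_plus)
    finally have "?K \<le> (real (m N) + real (n N)) * ?T" using K M by (subst (asm) ennreal_le_iff) auto
    also have "\<dots> \<le> (c1 + c2 * real N) * ?T"
      using m[of N] n[of N] K M by (intro mult_right_mono) (auto simp: c1_def c2_def a_def b_def algebra_simps)
    finally have main: "?K \<le> (c1 + c2 * real N) * ?K * exp (- (e * real N)) + (c1 + c2 * real N) * exp (\<eta> / 4 * real N) * M"
      by (simp add: algebra_simps)
    \<comment> \<open>The late exits make up at most half of \<open>?K\<close> and are subtracted
      from the left side. What remains bounds \<open>M\<close> from below.\<close>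
    have "2 * (c1 + c2 * real N) * exp (- (e * real N)) \<le> 1"
      using elim(1) e by (intro order_trans[OF _ exp_le_one_iff[THEN iffD2, of "- e / 2 * real N"]]) (auto simp: algebra_simps)
    from mult_right_mono[OF this, of ?K] main K
    have h: "?K \<le> 2 * (c1 + c2 * real N) * exp (\<eta> / 4 * real N) * M" by (simp add: algebra_simps)
    have "2 * (c1 + c2 * real N) * exp (- (\<eta> / 4 * real N)) \<le> 1"
      using elim(2) \<eta> by (intro order_trans[OF _ exp_le_one_iff[THEN iffD2, of "- (\<eta> / 4) / 2 * real N"]]) (auto simp: algebra_simps)
    from mult_right_mono[OF this, of "exp (\<eta> / 4 * real N)"]
    have h2: "2 * (c1 + c2 * real N) \<le> exp (\<eta> / 4 * real N)"
      by (simp add: mult.assoc exp_add[symmetric])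
    have "?K \<le> 2 * (c1 + c2 * real N) * (exp (\<eta> / 4 * real N) * M)"
      using h by (simp only: mult.assoc)
    also have "\<dots> \<le> exp (\<eta> / 4 * real N) * (exp (\<eta> / 4 * real N) * M)"
      by (rule mult_right_mono[OF h2]) (use M in simp)
    finally have "?K \<le> exp (\<eta> / 4 * real N) * exp (\<eta> / 4 * real N) * M"
      by (simp only: mult.assoc)
    also have "exp (\<eta> / 4 * real N) * exp (\<eta> / 4 * real N) * M \<le> exp (\<eta> * real N) * M"
      using \<eta> M by (intro mult_right_mono) (auto simp: exp_add[symmetric])
    finally have "?K \<le> exp (\<eta> * real N) * M" .
    then have "?K * exp (- (\<eta> * real N)) \<le> M" by (simp add: exp_minus field_simps)
    then show ?case unfolding M(1) by (rule ennreal_leI)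
  qed
qed

lemma tilt_factor_tilt:
  assumes "0 < z" "z < w" "w < 1" "0 < w'" "w' < 1"
  shows "(w' / z) ^ m * ((1 - z) / (1 - w')) ^ n = tilt_factor w z m n * exp (real m * ln (w' / w) + real n * ln ((1 - w) / (1 - w')))"
proof -
  have e: "exp (real m * ln (w' / w)) = (w' / w) ^ m" "exp (real n * ln ((1 - w) / (1 - w'))) = ((1 - w) / (1 - w')) ^ n"
    using assms by (simp_all add: power_eq_exp)
  have "(w' / z) ^ m = (w / z) ^ m * (w' / w) ^ m" "((1 - z) / (1 - w')) ^ n = ((1 - z) / (1 - w)) ^ n * ((1 - w) / (1 - w')) ^ n"
    unfolding power_mult_distrib[symmetric] using assms by simp_all
  then show ?thesis unfolding tilt_factor_def exp_add e by simp
qed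

lemma exp_add_le_one: "c * exp (e + t) \<le> 1 \<Longrightarrow> c * exp e \<le> exp (- t)" for c e t :: real
  by (simp add: exp_add exp_minus field_simps)

lemma le_exp_mult: "A \<le> exp t * p \<Longrightarrow> A * exp (- t) \<le> p" for A t p :: real
  by (simp add: exp_minus field_simps)

lemma prob_space_exp_laws: "0 < r \<Longrightarrow> prob_space (exp_laws A r)"
  by (intro prob_space_PiM prob_space_exp_law)

text \<open>Cramer's argument, carried out without changing the measure. In the moment of exponent w
  - z, passage times outside the window are controlled by the moments of slightly larger and
  slightly smaller exponent. Since a/w + b/(1 - w) = l, the level l is the derivative of the log
  moment at this exponent, so both contributions are exponentially smaller than the lower bound
  \<open>lpp_mgf_ge\<close>.\<close>

lemma window_ge:
  assumes wz: "0 < z" "z < w" "w < 1" and l: "0 < l" and \<eta>: "0 < \<eta>"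
    and m: "\<And>N. \<bar>real (m N) - l * w * z * real N\<bar> \<le> D" and n: "\<And>N. \<bar>real (n N) - l * (1 - w) * (1 - z) * real N\<bar> \<le> D"
  defines "\<mu> \<equiv> \<lambda>N. exp_laws ({1..m N} \<times> {1..n N}) 1"
  shows "\<forall>\<^sub>F N in sequentially. ennreal (tilt_factor w z (m N) (n N) * exp (- (((w - z) * l + \<eta>) * real N))) \<le>
    emeasure (\<mu> N) {x \<in> space (\<mu> N). (l - \<eta>) * real N < lpp x (m N) (n N) \<and> lpp x (m N) (n N) < (l + \<eta>) * real N}"
proof -
  define \<theta> where "\<theta> = w - z"
  define \<omega> where "\<omega> = \<eta> / 2"
  define a where "a = l * w * z"
  define b where "b = l * (1 - w) * (1 - z)"
  have ab: "0 < a" "0 < b" and \<theta>: "0 < \<theta>" "\<theta> < 1" and \<omega>: "0 < \<omega>"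
    using wz l \<eta> by (auto simp: a_def b_def \<theta>_def \<omega>_def)
  have "a / w = l * z" "b / (1 - w) = l * (1 - z)" using wz by (simp_all add: a_def b_def)
  then have awb: "a / w + b / (1 - w) = l" by (simp add: algebra_simps)
  let ?F1 = "\<lambda>s. a * ln ((w + s) / w) + b * ln ((1 - w) / (1 - w - s)) + - (s * (l + \<omega>))"
  let ?F2 = "\<lambda>s. a * ln ((w - s) / w) + b * ln ((1 - w) / (1 - w + s)) + s * (l - \<omega>)"
  have "(?F1 has_real_derivative (a / w + b / (1 - w) - (l + \<omega>))) (at 0)"
    using wz by (auto intro!: derivative_eq_intros simp: divide_simps power2_eq_square)
  from DERIV_neg_ex[OF this[unfolded awb], of "1 - w"] \<omega> wz
  obtain s1 where s1: "0 < s1" "s1 < 1 - w" "?F1 s1 < 0" by auto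
  have "(?F2 has_real_derivative (- (a / w + b / (1 - w)) + (l - \<omega>))) (at 0)"
    using wz by (auto intro!: derivative_eq_intros simp: divide_simps power2_eq_square) (simp add: algebra_simps)
  from DERIV_neg_ex[OF this[unfolded awb], of \<theta>] \<omega> \<theta> wz
  obtain s2 where s2: "0 < s2" "s2 < \<theta>" "?F2 s2 < 0" by auto
  define f1 where "f1 = ?F1 s1"
  define f2 where "f2 = ?F2 s2"
  have f: "f1 < 0" "f2 < 0" using s1 s2 by (simp_all add: f1_def f2_def)
  \<comment> \<open>Small against the gains \<open>f1\<close> and \<open>f2\<close>, so that the
    loss in \<open>lpp_mgf_ge\<close> does not use them up, and small enough for
    \<open>\<theta> * \<omega> + 2 * \<eta>' \<le> \<eta>\<close> in the last estimate.\<close>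
  define \<eta>' where "\<eta>' = min (\<eta> / 8) (min (- f1 / 4) (- f2 / 4))"
  have "0 < \<eta>'" "\<eta>' \<le> \<eta> / 8" "f1 + \<eta>' < 0" "f2 + \<eta>' < 0" using f \<eta> by (auto simp: \<eta>'_def min_def)
  then have \<eta>': "0 < \<eta>'" "\<eta>' \<le> \<eta> / 8" "?F1 s1 + \<eta>' < 0" "?F2 s2 + \<eta>' < 0" by (simp_all add: f1_def f2_def)
  have m1: "\<forall>\<^sub>F N in sequentially. 1 \<le> m N" and n1: "\<forall>\<^sub>F N in sequentially. 1 \<le> n N"
    using eventually_ge_linear[OF m] eventually_ge_linear[OF n] ab by (auto simp: a_def b_def)
  have m': "\<bar>real (m N) - a * real N\<bar> \<le> D" and n': "\<bar>real (n N) - b * real N\<bar> \<le> D" for N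
    using m n by (auto simp: a_def b_def)
  have "\<forall>\<^sub>F N in sequentially. (4 + 0 * real N) * exp (0 + real (m N) * ln ((w + s1) / w) + real (n N) * ln ((1 - w) / (1 - w - s1)) + (- (s1 * (l + \<omega>)) + \<eta>') * real N)
    \<le> exp ((a * ln ((w + s1) / w) + b * ln ((1 - w) / (1 - w - s1)) + (- (s1 * (l + \<omega>)) + \<eta>')) / 2 * real N)"
    by (rule exp_lin_eventually[OF m' n']) (use \<eta>' in auto)
  moreover have "\<forall>\<^sub>F N in sequentially. (4 + 0 * real N) * exp (0 + real (m N) * ln ((w - s2) / w) + real (n N) * ln ((1 - w) / (1 - w + s2)) + (s2 * (l - \<omega>) + \<eta>') * real N)
    \<le> exp ((a * ln ((w - s2) / w) + b * ln ((1 - w) / (1 - w + s2)) + (s2 * (l - \<omega>) + \<eta>')) / 2 * real N)"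
    by (rule exp_lin_eventually[OF m' n']) (use \<eta>' in auto)
  moreover have "\<forall>\<^sub>F N::nat in sequentially. (2 + 0 * real N) * exp (0 + - \<eta>' * real N) \<le> exp (- \<eta>' / 2 * real N)"
    by (rule poly_exp_eventually) (use \<eta>' in auto)
  ultimately show ?thesis using m1 n1 lpp_mgf_ge[OF wz l \<eta>'(1) m n]
  proof eventually_elim
    case (elim N)
    let ?M = "m N" and ?N = "n N" and ?X = "\<lambda>x. lpp x (m N) (n N)"
    let ?K = "tilt_factor w z ?M ?N" and ?S = "{x \<in> space (\<mu> N). (l - \<eta>) * real N < ?X x \<and> ?X x < (l + \<eta>) * real N}"
    let ?E1 = "real ?M * ln ((w + s1) / w) + real ?N * ln ((1 - w) / (1 - w - s1)) - s1 * (l + \<omega>) * real N"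
    let ?E2 = "real ?M * ln ((w - s2) / w) + real ?N * ln ((1 - w) / (1 - w + s2)) + s2 * (l - \<omega>) * real N"
    have K: "0 < ?K" using wz by (simp add: tilt_factor_def)
    interpret prob_space "\<mu> N" unfolding \<mu>_def by (rule prob_space_exp_laws) simp
    have X [measurable]: "?X \<in> borel_measurable (\<mu> N)"
      unfolding \<mu>_def by (subst measurable_cong_sets[OF sets_PiM_exp_law refl]) (rule lpp_measurable, simp)
    have lpp_mgf_\<mu>: "lpp_mgf t ?M ?N = (\<integral>\<^sup>+x. ennreal (exp (t * ?X x)) \<partial>\<mu> N)" for t
      by (simp add: lpp_mgf_def \<mu>_def)
    have S [measurable]: "?S \<in> sets (\<mu> N)" by measurable
    have le1: "exp ((a * ln ((w + s1) / w) + b * ln ((1 - w) / (1 - w - s1)) + (- (s1 * (l + \<omega>)) + \<eta>')) / 2 * real N) \<le> 1"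
      "exp ((a * ln ((w - s2) / w) + b * ln ((1 - w) / (1 - w + s2)) + (s2 * (l - \<omega>) + \<eta>')) / 2 * real N) \<le> 1"
      using \<eta>' by (auto intro!: mult_nonpos_nonneg divide_nonpos_nonneg)
    have b1: "4 * exp ?E1 \<le> exp (- (\<eta>' * real N))"
    proof -
      have "4 * exp (?E1 + \<eta>' * real N) \<le> 1"
        using order_trans[OF elim(1) le1(1)] by (simp add: algebra_simps)
      then show ?thesis by (rule exp_add_le_one)
    qed
    have b2: "4 * exp ?E2 \<le> exp (- (\<eta>' * real N))"
    proof -
      have "4 * exp (?E2 + \<eta>' * real N) \<le> 1"
        using order_trans[OF elim(2) le1(2)] by (simp add: algebra_simps)
      then show ?thesis by (rule exp_add_le_one)
    qed
    have b3: "2 * exp (- (\<eta>' * real N)) \<le> 1"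
    proof -
      have "exp (- \<eta>' / 2 * real N) \<le> 1" using \<eta>' by (auto simp: mult_nonpos_nonneg)
      from order_trans[OF elim(3) this] show ?thesis by simp
    qed
    have M1: "lpp_mgf (\<theta> + s1) ?M ?N \<le> ennreal (?K * exp (?E1 + s1 * (l + \<omega>) * real N))"
    proof -
      have "lpp_mgf (\<theta> + s1) ?M ?N \<le> ennreal (((z + (\<theta> + s1)) / z) ^ ?M * ((1 - z) / (1 - z - (\<theta> + s1))) ^ ?N)"
        by (rule lpp_mgf_le) (use wz \<theta> s1 elim in \<open>auto simp: \<theta>_def\<close>)
      also have "z + (\<theta> + s1) = w + s1" by (simp add: \<theta>_def)
      also have "1 - z - (\<theta> + s1) = 1 - (w + s1)" by (simp add: \<theta>_def)
      also have "((w + s1) / z) ^ ?M * ((1 - z) / (1 - (w + s1))) ^ ?N = ?K * exp (?E1 + s1 * (l + \<omega>) * real N)"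
        by (subst tilt_factor_tilt) (use wz s1 in \<open>auto simp: algebra_simps\<close>)
      finally show ?thesis .
    qed
    have M2: "lpp_mgf (\<theta> - s2) ?M ?N \<le> ennreal (?K * exp (?E2 - s2 * (l - \<omega>) * real N))"
    proof -
      have "lpp_mgf (\<theta> - s2) ?M ?N \<le> ennreal (((z + (\<theta> - s2)) / z) ^ ?M * ((1 - z) / (1 - z - (\<theta> - s2))) ^ ?N)"
        by (rule lpp_mgf_le) (use wz \<theta> s2 elim in \<open>auto simp: \<theta>_def\<close>)
      also have "z + (\<theta> - s2) = w - s2" by (simp add: \<theta>_def)
      also have "1 - z - (\<theta> - s2) = 1 - (w - s2)" by (simp add: \<theta>_def)
      also have "((w - s2) / z) ^ ?M * ((1 - z) / (1 - (w - s2))) ^ ?N = ?K * exp (?E2 - s2 * (l - \<omega>) * real N)"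
        by (subst tilt_factor_tilt) (use wz s2 \<theta>_def in \<open>auto simp: algebra_simps\<close>)
      finally show ?thesis .
    qed
    have pt: "ennreal (exp (\<theta> * ?X x)) \<le> ennreal (exp (\<theta> * ((l + \<omega>) * real N))) * indicator ?S x +
      ennreal (exp (- (s1 * (l + \<omega>) * real N))) * ennreal (exp ((\<theta> + s1) * ?X x)) +
      ennreal (exp (s2 * (l - \<omega>) * real N)) * ennreal (exp ((\<theta> - s2) * ?X x))" if x: "x \<in> space (\<mu> N)" for x
    proof -
      consider "(l + \<omega>) * real N \<le> ?X x" | "?X x \<le> (l - \<omega>) * real N"
        | "(l - \<omega>) * real N < ?X x" "?X x < (l + \<omega>) * real N" by linarith
      then show ?thesis
      proof cases
        case 1
        have "\<theta> * ?X x \<le> - (s1 * (l + \<omega>) * real N) + (\<theta> + s1) * ?X x"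
          using mult_left_mono[OF 1, of s1] s1 by (simp add: algebra_simps)
        then have "ennreal (exp (\<theta> * ?X x)) \<le> ennreal (exp (- (s1 * (l + \<omega>) * real N))) * ennreal (exp ((\<theta> + s1) * ?X x))"
          by (simp add: ennreal_mult[symmetric] exp_add[symmetric])
        then show ?thesis by (simp add: add_increasing add_increasing2)
      next
        case 2
        have "\<theta> * ?X x \<le> s2 * (l - \<omega>) * real N + (\<theta> - s2) * ?X x"
          using mult_left_mono[OF 2, of s2] s2 by (simp add: algebra_simps)
        then have "ennreal (exp (\<theta> * ?X x)) \<le> ennreal (exp (s2 * (l - \<omega>) * real N)) * ennreal (exp ((\<theta> - s2) * ?X x))"
          by (simp add: ennreal_mult[symmetric] exp_add[symmetric])
        then show ?thesis by (simp add: add_increasing add_increasing2)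
      next
        case 3
        have "0 \<le> \<omega> * real N" using \<omega> by simp
        then have "x \<in> ?S" using x 3 by (simp add: \<omega>_def algebra_simps)
        moreover have "ennreal (exp (\<theta> * ?X x)) \<le> ennreal (exp (\<theta> * ((l + \<omega>) * real N)))"
          using 3 \<theta> by (intro ennreal_leI) simp
        ultimately show ?thesis by (simp add: add_increasing add_increasing2 del: ennreal_le_iff)
      qed
    qed
    have "ennreal (?K * exp (- (\<eta>' * real N))) \<le> lpp_mgf \<theta> ?M ?N" using elim(6) by (simp add: \<theta>_def)
    also have "\<dots> \<le> (\<integral>\<^sup>+x. ennreal (exp (\<theta> * ((l + \<omega>) * real N))) * indicator ?S x +
      ennreal (exp (- (s1 * (l + \<omega>) * real N))) * ennreal (exp ((\<theta> + s1) * ?X x)) +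
      ennreal (exp (s2 * (l - \<omega>) * real N)) * ennreal (exp ((\<theta> - s2) * ?X x)) \<partial>\<mu> N)"
      unfolding lpp_mgf_\<mu> by (intro nn_integral_mono pt)
    also have "\<dots> = ennreal (exp (\<theta> * ((l + \<omega>) * real N))) * emeasure (\<mu> N) ?S +
      ennreal (exp (- (s1 * (l + \<omega>) * real N))) * lpp_mgf (\<theta> + s1) ?M ?N +
      ennreal (exp (s2 * (l - \<omega>) * real N)) * lpp_mgf (\<theta> - s2) ?M ?N"
      unfolding lpp_mgf_\<mu>
      by (simp add: nn_integral_add nn_integral_cmult S)
    also have "\<dots> \<le> ennreal (exp (\<theta> * ((l + \<omega>) * real N))) * emeasure (\<mu> N) ?S +
      ennreal (exp (- (s1 * (l + \<omega>) * real N))) * ennreal (?K * exp (?E1 + s1 * (l + \<omega>) * real N)) +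
      ennreal (exp (s2 * (l - \<omega>) * real N)) * ennreal (?K * exp (?E2 - s2 * (l - \<omega>) * real N))"
      by (intro add_mono mult_left_mono M1 M2) auto
    also have "\<dots> = ennreal (exp (\<theta> * ((l + \<omega>) * real N)) * prob ?S + ?K * exp ?E1 + ?K * exp ?E2)"
    proof -
      have e1: "exp (- (s1 * (l + \<omega>) * real N)) * (?K * exp (?E1 + s1 * (l + \<omega>) * real N)) = ?K * exp ?E1"
        unfolding exp_add by (simp add: exp_minus)
      have e2: "exp (s2 * (l - \<omega>) * real N) * (?K * exp (?E2 - s2 * (l - \<omega>) * real N)) = ?K * exp ?E2"
        unfolding exp_diff by simp
      have t1: "ennreal (exp (- (s1 * (l + \<omega>) * real N))) * ennreal (?K * exp (?E1 + s1 * (l + \<omega>) * real N)) = ennreal (?K * exp ?E1)"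
        using K by (subst ennreal_mult[symmetric]) (simp_all only: e1 exp_ge_zero mult_nonneg_nonneg less_imp_le)
      have t2: "ennreal (exp (s2 * (l - \<omega>) * real N)) * ennreal (?K * exp (?E2 - s2 * (l - \<omega>) * real N)) = ennreal (?K * exp ?E2)"
        using K by (subst ennreal_mult[symmetric]) (simp_all only: e2 exp_ge_zero mult_nonneg_nonneg less_imp_le)
      show ?thesis unfolding t1 t2 emeasure_eq_measure using K
        by (simp add: ennreal_mult[symmetric] ennreal_plus[symmetric] del: ennreal_plus)
    qed
    finally have "?K * exp (- (\<eta>' * real N)) \<le> exp (\<theta> * ((l + \<omega>) * real N)) * prob ?S + ?K * exp ?E1 + ?K * exp ?E2"
      using K by (subst (asm) ennreal_le_iff) auto
    moreover have "?K * (4 * exp ?E1) \<le> ?K * exp (- (\<eta>' * real N))" "?K * (4 * exp ?E2) \<le> ?K * exp (- (\<eta>' * real N))"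
      using b1 b2 K by (auto intro!: mult_left_mono simp del: mult_le_cancel_left_pos)
    ultimately have "?K * exp (- (\<eta>' * real N)) \<le> 2 * (exp (\<theta> * ((l + \<omega>) * real N)) * prob ?S)"
      by linarith
    then have "?K * exp (- (\<eta>' * real N)) * exp (- (\<eta>' * real N)) \<le> 2 * exp (- (\<eta>' * real N)) * (exp (\<theta> * ((l + \<omega>) * real N)) * prob ?S)"
      using mult_right_mono[of "?K * exp (- (\<eta>' * real N))" "2 * (exp (\<theta> * ((l + \<omega>) * real N)) * prob ?S)" "exp (- (\<eta>' * real N))"]
      by (simp add: mult_ac)
    also have "\<dots> \<le> 1 * (exp (\<theta> * ((l + \<omega>) * real N)) * prob ?S)"
      by (intro mult_right_mono b3) auto
    finally have "?K * exp (- (\<eta>' * real N)) * exp (- (\<eta>' * real N)) * exp (- (\<theta> * ((l + \<omega>) * real N))) \<le> prob ?S"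
      unfolding mult_1 by (rule le_exp_mult)
    moreover have "?K * exp (- (((w - z) * l + \<eta>) * real N)) \<le> ?K * exp (- (\<eta>' * real N)) * exp (- (\<eta>' * real N)) * exp (- (\<theta> * ((l + \<omega>) * real N)))"
    proof -
      have "\<theta> * \<omega> \<le> 1 * \<omega>" using \<theta> \<omega> by (intro mult_right_mono) auto
      then have "\<theta> * \<omega> + 2 * \<eta>' \<le> \<eta>" using \<eta>'(2) \<eta> \<omega>_def by linarith
      from mult_right_mono[OF this, of "real N"]
      have "- (((w - z) * l + \<eta>) * real N) \<le> - (\<eta>' * real N) + - (\<eta>' * real N) + - (\<theta> * ((l + \<omega>) * real N))"
        by (simp add: \<theta>_def algebra_simps)
      then show ?thesis
        using K unfolding mult.assoc exp_add[symmetric] by (intro mult_left_mono) auto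
    qed
    ultimately show ?case by (simp add: emeasure_eq_measure ennreal_leI)
  qed
qed

text \<open>The bulk moment is bounded with the parameter \<open>z - \<kappa>\<close> in place of \<open>z\<close>: to first order in \<open>\<kappa>\<close> this
  gains on every exit at distance at least \<open>\<delta> N\<close>.\<close>

lemma characteristic_exit_tail:
  assumes z: "0 < z" "z < 1" and \<rho>: "0 < \<rho>" "0 < \<delta>"
    and m: "\<And>N. \<bar>real (m N) - \<rho> * z\<^sup>2 * real N\<bar> \<le> D" and n: "\<And>N. \<bar>real (n N) - \<rho> * (1 - z)\<^sup>2 * real N\<bar> \<le> D"
    and n1: "\<forall>\<^sub>F N in sequentially. 1 \<le> n N"
  shows "\<exists>e>0. \<exists>s>0. s < z \<and> (\<exists>c>0. \<forall>\<^sub>F N::nat in sequentially. \<forall>k\<in>{1..m N}. \<delta> * real N \<le> real k \<longrightarrow>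
    ennreal (exp (- (s * ((\<rho> - 2 * e) * real N))) * (z / (z - s)) ^ k) * lpp_mgf s (Suc (m N) - k) (n N) \<le> ennreal (exp (- (c * real N))))"
proof -
  \<comment> \<open>\<open>?g \<kappa>\<close> is the derivative in \<open>s\<close>, at 0, of the
    exponent for the level \<open>\<rho>\<close>. It vanishes at \<open>\<kappa> = 0\<close>: the
    stationary mean of a (z^2, (1 - z)^2) rectangle is z + (1 - z) = 1. The slope there comes from
    the boundary stretch alone.\<close>
  let ?g = "\<lambda>\<kappa>. \<delta> / z + (\<rho> * z\<^sup>2 - \<delta>) / (z - \<kappa>) + \<rho> * (1 - z)\<^sup>2 / (1 - z + \<kappa>) - \<rho>"
  have "(?g has_real_derivative ((\<rho> * z\<^sup>2 - \<delta>) / z\<^sup>2 - \<rho> * (1 - z)\<^sup>2 / (1 - z)\<^sup>2)) (at 0)"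
    using z by (auto intro!: derivative_eq_intros simp: power2_eq_square)
  moreover have "(\<rho> * z\<^sup>2 - \<delta>) / z\<^sup>2 - \<rho> * (1 - z)\<^sup>2 / (1 - z)\<^sup>2 = - \<delta> / z\<^sup>2"
    using z by (simp add: field_simps)
  ultimately have d: "(?g has_real_derivative (- \<delta> / z\<^sup>2)) (at 0)" by simp
  have g0: "?g 0 = 0" using z by (simp add: field_simps power2_eq_square)
  have "- \<delta> / z\<^sup>2 < 0" using z \<rho> by simp
  from DERIV_neg_ex[OF d this z(1)] obtain \<kappa> where \<kappa>: "0 < \<kappa>" "\<kappa> < z" "?g \<kappa> < 0"
    unfolding g0 by blast
  define g where "g = ?g \<kappa>"
  \<comment> \<open>A quarter leaves g + 2 e = g / 2 negative, which is room for lowering the level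
    from \<open>\<rho>\<close> to \<open>\<rho> - 2 * e\<close>.\<close>
  define e where "e = - g / 4"
  have "g < 0" unfolding g_def by (rule \<kappa>(3))
  then have "0 < e" "g + 2 * e < 0" by (auto simp: e_def)
  then have e: "0 < e" "?g \<kappa> + 2 * e < 0" unfolding g_def by blast+
  let ?x = "\<lambda>s. ln (z / (z - s))" and ?y = "\<lambda>s. ln ((z - \<kappa> + s) / (z - \<kappa>))" and ?u = "\<lambda>s. ln ((1 - z + \<kappa>) / (1 - z + \<kappa> - s))"
  let ?F = "\<lambda>s. \<delta> * ?x s + (\<rho> * z\<^sup>2 - \<delta>) * ?y s + \<rho> * (1 - z)\<^sup>2 * ?u s - s * (\<rho> - 2 * e)"
  have zk: "0 < z - \<kappa>" "0 < 1 - z + \<kappa>" using \<kappa> z by auto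
  have lnq: "((\<lambda>s. ln (q / (q - s))) has_real_derivative (1 / q)) (at 0)"
    and lnq': "((\<lambda>s. ln ((q + s) / q)) has_real_derivative (1 / q)) (at 0)" if "0 < q" for q :: real
    using that by (auto intro!: derivative_eq_intros simp: power2_eq_square)
  have x': "(?x has_real_derivative (1 / z)) (at 0)" and y': "(?y has_real_derivative (1 / (z - \<kappa>))) (at 0)"
    and u': "(?u has_real_derivative (1 / (1 - z + \<kappa>))) (at 0)"
    using z zk by (auto intro: lnq lnq')
  have "(?F has_real_derivative (\<delta> * (1 / z) + (\<rho> * z\<^sup>2 - \<delta>) * (1 / (z - \<kappa>)) + \<rho> * (1 - z)\<^sup>2 * (1 / (1 - z + \<kappa>)) - 1 * (\<rho> - 2 * e))) (at 0)"
    by (intro DERIV_diff DERIV_add DERIV_cmult DERIV_cmult_right x' y' u' DERIV_ident)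
  then have "(?F has_real_derivative (?g \<kappa> + 2 * e)) (at 0)" by (simp add: diff_diff_eq2 diff_add_eq)
  from DERIV_neg_ex[OF this e(2), of "min \<kappa> (1 - z)"] z \<kappa> zk
  obtain s where s: "0 < s" "s < \<kappa>" "s < 1 - z" "?F s < 0" by auto
  let ?f = "\<delta> * ?x s + - \<delta> * ?y s - s * (\<rho> - 2 * e)"
  have "\<forall>\<^sub>F N in sequentially. (1 + 0 * real N) * exp (?y s + real (m N) * ?y s + real (n N) * ?u s + ?f * real N)
    \<le> exp ((\<rho> * z\<^sup>2 * ?y s + \<rho> * (1 - z)\<^sup>2 * ?u s + ?f) / 2 * real N)"
    by (rule exp_lin_eventually[OF m n]) (use s(4) in \<open>auto simp: algebra_simps\<close>)
  then have "\<forall>\<^sub>F N::nat in sequentially. \<forall>k\<in>{1..m N}. \<delta> * real N \<le> real k \<longrightarrow>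
    ennreal (exp (- (s * ((\<rho> - 2 * e) * real N))) * (z / (z - s)) ^ k) * lpp_mgf s (Suc (m N) - k) (n N) \<le> ennreal (exp (- (- ?F s / 2 * real N)))"
    using n1
  proof (eventually_elim, intro ballI impI)
    fix N k assume N: "(1 + 0 * real N) * exp (?y s + real (m N) * ?y s + real (n N) * ?u s + ?f * real N)
      \<le> exp ((\<rho> * z\<^sup>2 * ?y s + \<rho> * (1 - z)\<^sup>2 * ?u s + ?f) / 2 * real N)" and n1: "1 \<le> n N"
      and k: "k \<in> {1..m N}" "\<delta> * real N \<le> real k"
    let ?e = "\<delta> * real N * ln (z / (z - s)) + (real (m N) + 1 - \<delta> * real N) * ln ((z - \<kappa> + s) / (z - \<kappa>)) +
        real (n N) * ln ((1 - (z - \<kappa>)) / (1 - (z - \<kappa>) - s))"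
    have "ennreal (exp (- (s * ((\<rho> - 2 * e) * real N))) * (z / (z - s)) ^ k) * lpp_mgf s (Suc (m N) - k) (n N) =
      ennreal (exp (- (s * ((\<rho> - 2 * e) * real N)))) * (ennreal ((z / (z - s)) ^ k) * lpp_mgf s (Suc (m N) - k) (n N))"
      using s \<kappa> by (simp add: ennreal_mult' mult.assoc)
    also have "\<dots> \<le> ennreal (exp (- (s * ((\<rho> - 2 * e) * real N)))) * ennreal (exp ?e)"
      by (intro mult_left_mono exit_term) (use s \<kappa> z k n1 in auto)
    also have "\<dots> = ennreal (exp (- (s * ((\<rho> - 2 * e) * real N)) + ?e))"
      by (subst ennreal_mult[symmetric]) (simp_all only: exp_ge_zero exp_add[of "- (s * ((\<rho> - 2 * e) * real N))" ?e])
    also have "- (s * ((\<rho> - 2 * e) * real N)) + ?e = ?y s + real (m N) * ?y s + real (n N) * ?u s + ?f * real N"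
    proof -
      have eq: "1 - (z - \<kappa>) = 1 - z + \<kappa>" by simp
      show ?thesis unfolding eq by (simp only: ring_distribs) (simp only: algebra_simps)
    qed
    also have "ennreal (exp (?y s + real (m N) * ?y s + real (n N) * ?u s + ?f * real N)) \<le> ennreal (exp (- (- ?F s / 2 * real N)))"
    proof (rule ennreal_leI)
      have Fe: "\<delta> * t1 + (\<rho> * z\<^sup>2 - \<delta>) * t2 + \<rho> * (1 - z)\<^sup>2 * t3 - s * (\<rho> - 2 * e) =
        \<rho> * z\<^sup>2 * t2 + \<rho> * (1 - z)\<^sup>2 * t3 + (\<delta> * t1 + - \<delta> * t2 - s * (\<rho> - 2 * e))" for t1 t2 t3
        by (simp add: algebra_simps)
      have "(\<rho> * z\<^sup>2 * ?y s + \<rho> * (1 - z)\<^sup>2 * ?u s + ?f) / 2 * real N = - (- ?F s / 2 * real N)"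
        unfolding Fe by (simp only: minus_divide_left[symmetric] mult_minus_left minus_minus)
      with N show "exp (?y s + real (m N) * ?y s + real (n N) * ?u s + ?f * real N) \<le> exp (- (- ?F s / 2 * real N))"
        by (simp only: mult_zero_left add_0_right mult_1_left)
    qed
    finally show "ennreal (exp (- (s * ((\<rho> - 2 * e) * real N))) * (z / (z - s)) ^ k) * lpp_mgf s (Suc (m N) - k) (n N) \<le> ennreal (exp (- (- ?F s / 2 * real N)))" .
  qed
  then show ?thesis using e(1) s \<kappa> by (intro exI[of _ e] conjI exI[of _ s] exI[of _ "- ?F s / 2"]) auto
qed

lemma DERIV_neg_all:
  fixes F :: "real \<Rightarrow> real"
  assumes "(F has_real_derivative D) (at 0)" "D < 0"
  shows "\<exists>d>0. \<forall>s. 0 < s \<and> s < d \<longrightarrow> F s < F 0"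
  using DERIV_neg_dec_right[OF assms] by auto

lemma emeasure_le_eq_nn_integral:
  fixes X :: "'b \<Rightarrow> real"
  assumes [measurable]: "X \<in> borel_measurable N"
  shows "emeasure N {x \<in> space N. X x \<le> a} = (\<integral>\<^sup>+x. indicator {y. y \<le> a} (X x) \<partial>N)"
proof -
  have "(\<integral>\<^sup>+x. indicator {y. y \<le> a} (X x) \<partial>N) = (\<integral>\<^sup>+x. indicator {x \<in> space N. X x \<le> a} x \<partial>N)"
    by (intro nn_integral_cong) (auto simp: indicator_def)
  also have "\<dots> = emeasure N {x \<in> space N. X x \<le> a}" by (rule nn_integral_indicator) measurable
  finally show ?thesis by simp
qed

text \<open>In the direction (z^2, (1 - z)^2) late exits are too costly, by
  \<open>characteristic_exit_tail\<close> on both sides, and early exits collect too little on the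
  boundary. What remains are Chernoff bounds for the bottom and the right part, sums of independent
  exponentials with means close to \<open>\<rho> * z * N\<close> and
  \<open>\<rho> * (1 - z) * N\<close>, which add up to \<open>\<rho> * N\<close>.\<close>

lemma lower_tail:
  assumes z: "0 < z" "z < 1" and \<rho>: "0 < \<rho>" and \<epsilon>: "0 < \<epsilon>"
    and m: "\<And>N. \<bar>real (m N) - \<rho> * z\<^sup>2 * real N\<bar> \<le> D" and n: "\<And>N. \<bar>real (n N) - \<rho> * (1 - z)\<^sup>2 * real N\<bar> \<le> D"
  defines "\<mu> \<equiv> \<lambda>N. exp_laws ({1..m N} \<times> {1..n N}) 1"
  shows "\<exists>c>0. \<forall>\<^sub>F N in sequentially.
    emeasure (\<mu> N) {x \<in> space (\<mu> N). lpp x (m N) (n N) \<le> (\<rho> - \<epsilon>) * real N} \<le> ennreal (exp (- (c * real N)))"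
proof -
  define \<sigma> where "\<sigma> = min z (1 - z) / 2"
  have \<sigma>: "0 < \<sigma>" "\<sigma> < z" "\<sigma> < 1 - z" using z by (auto simp: \<sigma>_def min_def)
  define X where "X = ln (z / (z - \<sigma>))"
  define U where "U = ln ((1 - z) / (1 - z - \<sigma>))"
  have XU: "0 < X" "0 < U" using \<sigma> z by (auto simp: X_def U_def)
  \<comment> \<open>A stretch of length \<open>\<delta> * N\<close> has moment at most
    exp(\<open>\<sigma> * \<epsilon> / 4\<close> N), while it has to supply B - A >=
    \<open>\<epsilon> / 2\<close> N at exponent \<open>\<sigma>\<close>.\<close>
  define \<delta> where "\<delta> = \<sigma> * \<epsilon> / (4 * (X + U))"
  have \<delta>: "0 < \<delta>" using XU \<sigma> \<epsilon> by (simp add: \<delta>_def)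
  have dX: "\<delta> * X \<le> \<sigma> * \<epsilon> / 4" "\<delta> * U \<le> \<sigma> * \<epsilon> / 4" using XU \<sigma> \<epsilon> by (auto simp: \<delta>_def field_simps)
  have pos: "0 < \<rho> * z\<^sup>2" "0 < \<rho> * (1 - z)\<^sup>2" using \<rho> z by auto
  have m1: "\<forall>\<^sub>F N in sequentially. 1 \<le> m N" and n1: "\<forall>\<^sub>F N in sequentially. 1 \<le> n N"
    using eventually_ge_linear[OF m pos(1)] eventually_ge_linear[OF n pos(2)] by auto
  have m': "\<bar>real (m N) - \<rho> * (1 - (1 - z))\<^sup>2 * real N\<bar> \<le> D" for N using m by simp
  from characteristic_exit_tail[OF z \<rho> \<delta> m n n1] obtain e1 s1 c1 where 1: "0 < e1" "0 < s1" "s1 < z" "0 < c1"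
    "\<forall>\<^sub>F N::nat in sequentially. \<forall>k\<in>{1..m N}. \<delta> * real N \<le> real k \<longrightarrow>
    ennreal (exp (- (s1 * ((\<rho> - 2 * e1) * real N))) * (z / (z - s1)) ^ k) * lpp_mgf s1 (Suc (m N) - k) (n N) \<le> ennreal (exp (- (c1 * real N)))"
    by blast
  have z': "0 < 1 - z" "1 - z < 1" using z by auto
  from characteristic_exit_tail[OF z' \<rho> \<delta> n m' m1] obtain e2 s2 c2 where 2: "0 < e2" "0 < s2" "s2 < 1 - z" "0 < c2"
    "\<forall>\<^sub>F N::nat in sequentially. \<forall>k\<in>{1..n N}. \<delta> * real N \<le> real k \<longrightarrow>
    ennreal (exp (- (s2 * ((\<rho> - 2 * e2) * real N))) * ((1 - z) / (1 - z - s2)) ^ k) * lpp_mgf s2 (Suc (n N) - k) (m N) \<le> ennreal (exp (- (c2 * real N)))"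
    by blast
  \<comment> \<open>One slack for both sides. The bound \<open>\<epsilon> / 4\<close> ensures B - A
    = (\<open>\<epsilon>\<close> - 2 e) N >= \<open>\<epsilon> / 2\<close> N.\<close>
  define e where "e = min e1 (min e2 (\<epsilon> / 4))"
  have e: "0 < e" "e \<le> e1" "e \<le> e2" "e \<le> \<epsilon> / 4" using 1(1) 2(1) \<epsilon> by (auto simp: e_def)
  let ?f1 = "\<lambda>\<tau>. \<rho> * z\<^sup>2 * ln (z / (z + \<tau>)) + \<tau> * (\<rho> * z - e)"
  let ?f2 = "\<lambda>\<tau>. \<rho> * (1 - z)\<^sup>2 * ln ((1 - z) / (1 - z + \<tau>)) + \<tau> * (\<rho> * (1 - z) - e)"
  have l': "((\<lambda>\<tau>. ln (q / (q + \<tau>))) has_real_derivative - (1 / q)) (at 0)" if "0 < q" for q :: real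
    using that by (auto intro!: derivative_eq_intros simp: power2_eq_square)
  have "(?f1 has_real_derivative (\<rho> * z\<^sup>2 * - (1 / z) + 1 * (\<rho> * z - e))) (at 0)"
    by (intro DERIV_add DERIV_cmult DERIV_cmult_right DERIV_ident l' z)
  moreover have "\<rho> * z\<^sup>2 * - (1 / z) + 1 * (\<rho> * z - e) < 0" using z e by (simp add: power2_eq_square)
  ultimately obtain d1 where d1: "0 < d1" "\<And>\<tau>. 0 < \<tau> \<Longrightarrow> \<tau> < d1 \<Longrightarrow> ?f1 \<tau> < ?f1 0"
    using DERIV_neg_all[of ?f1] by blast
  have "(?f2 has_real_derivative (\<rho> * (1 - z)\<^sup>2 * - (1 / (1 - z)) + 1 * (\<rho> * (1 - z) - e))) (at 0)"
    by (intro DERIV_add DERIV_cmult DERIV_cmult_right DERIV_ident l' z')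
  moreover have "\<rho> * (1 - z)\<^sup>2 * - (1 / (1 - z)) + 1 * (\<rho> * (1 - z) - e) < 0" using z' e by (simp add: power2_eq_square)
  ultimately obtain d2 where d2: "0 < d2" "\<And>\<tau>. 0 < \<tau> \<Longrightarrow> \<tau> < d2 \<Longrightarrow> ?f2 \<tau> < ?f2 0"
    using DERIV_neg_all[of ?f2] by blast
  define \<tau> where "\<tau> = min d1 d2 / 2"
  have "0 < \<tau>" "\<tau> < d1" "\<tau> < d2" using d1 d2 by (auto simp: \<tau>_def min_def)
  then have \<tau>: "0 < \<tau>" and f: "?f1 \<tau> < 0" "?f2 \<tau> < 0" using d1(2)[of \<tau>] d2(2)[of \<tau>] z by auto
  define g1 where "g1 = - ?f1 \<tau> / 2"
  define g2 where "g2 = - ?f2 \<tau> / 2"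
  have g: "0 < g1" "0 < g2" using f by (simp_all add: g1_def g2_def)
  define c where "c = min (\<sigma> * \<epsilon> / 4) (min (min c1 c2) (min g1 g2))"
  have c: "0 < c" "c \<le> \<sigma> * \<epsilon> / 4" "c \<le> c1" "c \<le> c2" "c \<le> g1" "c \<le> g2"
    using \<sigma> \<epsilon> 1(4) 2(4) g by (auto simp: c_def)
  have D: "0 \<le> D" using m[of 0] by simp
  have T1: "\<forall>\<^sub>F N in sequentially. (1 + 0 * real N) * exp (0 + real (m N) * ln (z / (z + \<tau>)) + real (m N) * 0 + \<tau> * (\<rho> * z - e) * real N)
    \<le> exp ((\<rho> * z\<^sup>2 * ln (z / (z + \<tau>)) + \<rho> * z\<^sup>2 * 0 + \<tau> * (\<rho> * z - e)) / 2 * real N)"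
    by (rule exp_lin_eventually[OF m m]) (use f in auto)
  have T2: "\<forall>\<^sub>F N in sequentially. (1 + 0 * real N) * exp (0 + real (n N) * ln ((1 - z) / (1 - z + \<tau>)) + real (n N) * 0 + \<tau> * (\<rho> * (1 - z) - e) * real N)
    \<le> exp ((\<rho> * (1 - z)\<^sup>2 * ln ((1 - z) / (1 - z + \<tau>)) + \<rho> * (1 - z)\<^sup>2 * 0 + \<tau> * (\<rho> * (1 - z) - e)) / 2 * real N)"
    by (rule exp_lin_eventually[OF n n]) (use f in auto)
  have "\<forall>\<^sub>F N::nat in sequentially. (2 + 2 * D + (\<rho> * z\<^sup>2 + \<rho> * (1 - z)\<^sup>2) * real N) * exp (0 + - c * real N) \<le> exp (- c / 2 * real N)"
    by (rule poly_exp_eventually) (use c in auto)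
  with T1 T2 1(5) 2(5) m1 n1 have "\<forall>\<^sub>F N in sequentially.
    emeasure (\<mu> N) {x \<in> space (\<mu> N). lpp x (m N) (n N) \<le> (\<rho> - \<epsilon>) * real N} \<le> ennreal (exp (- (c / 2 * real N)))"
  proof eventually_elim
    case (elim N)
    let ?M = "m N" and ?N = "n N" and ?A = "(\<rho> - \<epsilon>) * real N" and ?B = "(\<rho> - 2 * e) * real N"
    let ?ec = "exp (- (c * real N))"
    define K where "K = nat \<lfloor>\<delta> * real N\<rfloor>"
    have K: "k \<le> K \<longleftrightarrow> real k \<le> \<delta> * real N" for k
      using \<delta> by (auto simp: K_def le_nat_iff le_floor_iff)
    have ec: "exp (- (c' * real N)) \<le> ?ec" if "c \<le> c'" for c'
      using that by (simp add: mult_right_mono)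
    have BA: "\<sigma> * (?B - ?A) \<ge> \<sigma> * (\<epsilon> / 2 * real N)"
    proof -
      have "(\<epsilon> - 2 * e) * real N \<ge> \<epsilon> / 2 * real N" using e by (intro mult_right_mono) auto
      then show ?thesis using \<sigma> by (intro mult_left_mono) (auto simp: algebra_simps)
    qed
    have near: "exp (- (\<sigma> * (?B - ?A))) * R ^ k \<le> ?ec" if "k \<le> K" "0 < R" "0 \<le> ln R" "\<delta> * ln R \<le> \<sigma> * \<epsilon> / 4" for k R
    proof -
      have "real k * ln R \<le> \<delta> * real N * ln R" using that K by (intro mult_right_mono) auto
      also have "\<dots> = \<delta> * ln R * real N" by simp
      also have "\<dots> \<le> \<sigma> * \<epsilon> / 4 * real N" using that by (intro mult_right_mono) auto
      finally have "real k * ln R \<le> \<sigma> * \<epsilon> / 4 * real N" .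
      with BA have "- (\<sigma> * (?B - ?A)) + real k * ln R \<le> - (\<sigma> * \<epsilon> / 4 * real N)" by (simp add: algebra_simps)
      then have "exp (- (\<sigma> * (?B - ?A)) + real k * ln R) \<le> exp (- (\<sigma> * \<epsilon> / 4 * real N))" by (simp only: exp_le_cancel_iff)
      then show ?thesis unfolding power_eq_exp[OF that(2)] exp_add using ec[OF c(2)] by linarith
    qed
    have far: "exp (- (s * ?B)) \<le> exp (- (s * ((\<rho> - 2 * e') * real N)))" if "0 < s" "e \<le> e'" for s e'
      using that by (auto intro!: mult_left_mono mult_right_mono)
    obtain P :: "(nat \<times> nat \<Rightarrow> real) measure" and W where "stationary P W z ?M ?N"
      using ex_stationary[of z ?M ?N] z elim by auto
    then interpret stationary P W z ?M ?N .
    have t1: "exp (\<tau> * ((\<rho> * z - e) * real N)) * (z / (z + \<tau>)) ^ ?M \<le> ?ec"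
    proof -
      have "exp (\<tau> * ((\<rho> * z - e) * real N)) * (z / (z + \<tau>)) ^ ?M = exp (0 + real (m N) * ln (z / (z + \<tau>)) + real (m N) * 0 + \<tau> * (\<rho> * z - e) * real N)"
        using z \<tau> by (simp add: power_eq_exp exp_add[symmetric] mult.assoc)
      also have "\<dots> \<le> exp ((\<rho> * z\<^sup>2 * ln (z / (z + \<tau>)) + \<rho> * z\<^sup>2 * 0 + \<tau> * (\<rho> * z - e)) / 2 * real N)"
        using elim(1) by (simp only: mult_zero_left add_0_right mult_1_left)
      also have "\<dots> = exp (- (g1 * real N))" by (simp only: g1_def mult_zero_right add_0_right minus_divide_left[symmetric] mult_minus_left minus_minus)
      also have "\<dots> \<le> ?ec" by (rule ec[OF c(5)])
      finally show ?thesis .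
    qed
    have t2: "exp (\<tau> * ((\<rho> * (1 - z) - e) * real N)) * ((1 - z) / (1 - z + \<tau>)) ^ ?N \<le> ?ec"
    proof -
      have "exp (\<tau> * ((\<rho> * (1 - z) - e) * real N)) * ((1 - z) / (1 - z + \<tau>)) ^ ?N =
        exp (0 + real (n N) * ln ((1 - z) / (1 - z + \<tau>)) + real (n N) * 0 + \<tau> * (\<rho> * (1 - z) - e) * real N)"
        using z \<tau> by (simp add: power_eq_exp exp_add[symmetric] mult.assoc)
      also have "\<dots> \<le> exp ((\<rho> * (1 - z)\<^sup>2 * ln ((1 - z) / (1 - z + \<tau>)) + \<rho> * (1 - z)\<^sup>2 * 0 + \<tau> * (\<rho> * (1 - z) - e)) / 2 * real N)"
        using elim(2) by (simp only: mult_zero_left add_0_right mult_1_left)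
      also have "\<dots> = exp (- (g2 * real N))" by (simp only: g2_def mult_zero_right add_0_right minus_divide_left[symmetric] mult_minus_left minus_minus)
      also have "\<dots> \<le> ?ec" by (rule ec[OF c(6)])
      finally show ?thesis .
    qed
    have h: "(if k \<le> K then ennreal (exp (- (\<sigma> * (?B - ?A))) * (z / (z - \<sigma>)) ^ k)
      else ennreal (exp (- (s1 * ?B)) * (z / (z - s1)) ^ k) * lpp_mgf s1 (Suc ?M - k) ?N) \<le> ennreal ?ec" if k: "k \<in> {1..?M}" for k
    proof (cases "k \<le> K")
      case True
      have "exp (- (\<sigma> * (?B - ?A))) * (z / (z - \<sigma>)) ^ k \<le> ?ec"
        by (rule near[OF True]) (use \<sigma> z XU dX in \<open>auto simp: X_def\<close>)
      with True show ?thesis by (simp only: if_True ennreal_leI)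
    next
      case False
      have "ennreal (exp (- (s1 * ?B)) * (z / (z - s1)) ^ k) * lpp_mgf s1 (Suc ?M - k) ?N \<le>
        ennreal (exp (- (s1 * ((\<rho> - 2 * e1) * real N))) * (z / (z - s1)) ^ k) * lpp_mgf s1 (Suc ?M - k) ?N"
        by (intro mult_right_mono ennreal_leI far) (use 1 e in auto)
      also have "\<dots> \<le> ennreal (exp (- (c1 * real N)))"
        using elim(3) k False K[of k] by auto
      also have "\<dots> \<le> ennreal ?ec" by (intro ennreal_leI ec c)
      finally show ?thesis using False by (simp only: if_False)
    qed
    have v: "(if k \<le> K then ennreal (exp (- (\<sigma> * (?B - ?A))) * ((1 - z) / (1 - z - \<sigma>)) ^ k)
      else ennreal (exp (- (s2 * ?B)) * ((1 - z) / (1 - z - s2)) ^ k) * lpp_mgf s2 ?M (Suc ?N - k)) \<le> ennreal ?ec" if k: "k \<in> {1..?N}" for k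
    proof (cases "k \<le> K")
      case True
      have "exp (- (\<sigma> * (?B - ?A))) * ((1 - z) / (1 - z - \<sigma>)) ^ k \<le> ?ec"
        by (rule near[OF True]) (use \<sigma> z XU dX in \<open>auto simp: U_def\<close>)
      with True show ?thesis by (simp only: if_True ennreal_leI)
    next
      case False
      have "ennreal (exp (- (s2 * ?B)) * ((1 - z) / (1 - z - s2)) ^ k) * lpp_mgf s2 ?M (Suc ?N - k) \<le>
        ennreal (exp (- (s2 * ((\<rho> - 2 * e2) * real N))) * ((1 - z) / (1 - z - s2)) ^ k) * lpp_mgf s2 (Suc ?N - k) ?M"
        unfolding lpp_mgf_transpose[of s2 ?M]
        by (intro mult_right_mono ennreal_leI far) (use 2 e z in auto)
      also have "\<dots> \<le> ennreal (exp (- (c2 * real N)))"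
        using elim(4) k False K[of k] by auto
      also have "\<dots> \<le> ennreal ?ec" by (intro ennreal_leI ec c)
      finally show ?thesis using False by (simp only: if_False)
    qed
    have B: "?B = (\<rho> * z - e) * real N + (\<rho> * (1 - z) - e) * real N" by (simp add: algebra_simps)
    have "emeasure P {s \<in> space P. lpp (w s) ?M ?N \<le> ?A} \<le>
      ennreal (exp (\<tau> * ((\<rho> * z - e) * real N)) * (z / (z + \<tau>)) ^ ?M) + ennreal (exp (\<tau> * ((\<rho> * (1 - z) - e) * real N)) * ((1 - z) / (1 - z + \<tau>)) ^ ?N) +
    (\<Sum>k\<in>{1..?M}. if k \<le> K then ennreal (exp (- (\<sigma> * (?B - ?A))) * (z / (z - \<sigma>)) ^ k)
      else ennreal (exp (- (s1 * ?B)) * (z / (z - s1)) ^ k) * lpp_mgf s1 (Suc ?M - k) ?N) +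
    (\<Sum>k\<in>{1..?N}. if k \<le> K then ennreal (exp (- (\<sigma> * (?B - ?A))) * ((1 - z) / (1 - z - \<sigma>)) ^ k)
      else ennreal (exp (- (s2 * ?B)) * ((1 - z) / (1 - z - s2)) ^ k) * lpp_mgf s2 ?M (Suc ?N - k))"
      by (rule lower_tail_stationary[OF \<sigma> \<tau> 1(2,3) 2(2,3) B])
    also have "\<dots> \<le> ennreal ?ec + ennreal ?ec + (\<Sum>k\<in>{1..?M}. ennreal ?ec) + (\<Sum>k\<in>{1..?N}. ennreal ?ec)"
      by (intro add_mono sum_mono h v ennreal_leI t1 t2)
    also have "\<dots> = ennreal ((2 + real ?M + real ?N) * ?ec)"
      by (simp add: ennreal_of_nat_eq_real_of_nat ennreal_mult[symmetric] ennreal_plus[symmetric] algebra_simps del: ennreal_plus)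
    also have "\<dots> \<le> ennreal (exp (- (c / 2 * real N)))"
    proof (rule ennreal_leI)
      have "(2 + real ?M + real ?N) * ?ec \<le> (2 + 2 * D + (\<rho> * z\<^sup>2 + \<rho> * (1 - z)\<^sup>2) * real N) * ?ec"
        using m[of N] n[of N] by (intro mult_right_mono) (auto simp: algebra_simps)
      also have "\<dots> \<le> exp (- (c / 2 * real N))" using elim(7) by simp
      finally show "(2 + real ?M + real ?N) * ?ec \<le> exp (- (c / 2 * real N))" .
    qed
    finally have bd: "emeasure P {s \<in> space P. lpp (w s) ?M ?N \<le> ?A} \<le> ennreal (exp (- (c / 2 * real N)))" .
    have X: "(\<lambda>x. lpp x ?M ?N) \<in> borel_measurable (PiM ({1..?M} \<times> {1..?N}) (\<lambda>_. borel))"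
      by (rule lpp_measurable) simp
    have X' [measurable]: "(\<lambda>x. lpp x ?M ?N) \<in> borel_measurable (\<mu> N)"
      unfolding \<mu>_def using X by (subst measurable_cong_sets[OF sets_PiM_exp_law refl])
    have [measurable]: "(\<lambda>s. lpp (w s) ?M ?N) \<in> borel_measurable P"
      using lpp_W_measurable[of 0 0 ?M ?N] grid_bulk by simp
    let ?f = "\<lambda>x. indicator {y. y \<le> ?A} (lpp x ?M ?N) :: ennreal"
    have fm: "?f \<in> borel_measurable (PiM ({1..?M} \<times> {1..?N}) (\<lambda>_. borel))"
      using X by measurable
    have b: "(\<lambda>v. (fst v + 0, snd v + 0)) ` ({1..?M} \<times> {1..?N}) \<subseteq> grid ?M ?N"
      "\<And>v. v \<in> {1..?M} \<times> {1..?N} \<Longrightarrow> boundary_rate z (fst v + 0, snd v + 0) = 1"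
      by (auto simp: boundary_rate_def)
    have "emeasure (\<mu> N) {x \<in> space (\<mu> N). lpp x ?M ?N \<le> ?A} = (\<integral>\<^sup>+x. ?f x \<partial>\<mu> N)"
      by (rule emeasure_le_eq_nn_integral) measurable
    also have "\<dots> = (\<integral>\<^sup>+s. ?f (restrict (shifted 0 0 (w s)) ({1..?M} \<times> {1..?N})) \<partial>P)"
      unfolding \<mu>_def by (rule block_law[OF b fm, symmetric])
    also have "\<dots> = (\<integral>\<^sup>+s. ?f (w s) \<partial>P)"
      by (simp only: shifted_0_0 lpp_restrict[OF order_refl])
    also have "\<dots> = emeasure P {s \<in> space P. lpp (w s) ?M ?N \<le> ?A}"
      by (rule emeasure_le_eq_nn_integral[symmetric]) measurable
    finally show ?case using bd by simp
  qed
  with c(1) show ?thesis by (intro exI[of _ "c / 2"]) auto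
qed

subsection \<open>Deviations jointly with a long passage time\<close>

locale bulk = expo_field P W "\<lambda>_. 1" "{1..} \<times> {1..}" for P :: "'a measure" and W
begin

abbreviation "wt s \<equiv> (\<lambda>v. W v s)"
abbreviation "L m n s \<equiv> lpp (wt s) m n"
abbreviation "T p q m n s \<equiv> lpp (shifted p q (wt s)) m n"

lemma T_measurable [measurable]: "T p q m n \<in> borel_measurable P"
  by (rule lpp_W_measurable) auto

lemma L_measurable [measurable]: "L m n \<in> borel_measurable P"
  using T_measurable[of 0 0 m n] by simp

lemma lpp_mgf_T: "(\<integral>\<^sup>+s. ennreal (exp (\<theta> * T p q m n s)) \<partial>P) = lpp_mgf \<theta> m n"
  by (rule lpp_mgf_field) auto

lemma lpp_mgf_L: "(\<integral>\<^sup>+s. ennreal (exp (\<theta> * L m n s)) \<partial>P) = lpp_mgf \<theta> m n"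
  using lpp_mgf_T[of \<theta> 0 0 m n] by simp

lemma column_indep:
  assumes "j \<le> n" "v \<le> n"
  shows "(\<integral>\<^sup>+s. ennreal (exp (\<sigma> * L i j s + \<theta> * L i v s)) * ennreal (exp (\<tau> * T i q m' n' s)) \<partial>P) =
    (\<integral>\<^sup>+x. ennreal (exp (\<sigma> * lpp x i j + \<theta> * lpp x i v)) \<partial>exp_laws ({1..i} \<times> {1..n}) 1) * lpp_mgf \<tau> m' n'"
proof -
  let ?A = "{1..i} \<times> {1..n}" and ?B = "{i + 1..i + m'} \<times> {q + 1..q + n'}"
  have sub: "(\<lambda>v. (fst v + i, snd v + q)) ` ({1..m'} \<times> {1..n'}) \<subseteq> ?B" by auto
  have [measurable]: "(\<lambda>x. lpp x i j) \<in> borel_measurable (PiM ?A (\<lambda>_. borel))" "(\<lambda>x. lpp x i v) \<in> borel_measurable (PiM ?A (\<lambda>_. borel))"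
    using assms by (auto intro!: lpp_measurable)
  have f: "(\<lambda>x. ennreal (exp (\<sigma> * lpp x i j + \<theta> * lpp x i v))) \<in> borel_measurable (PiM ?A (\<lambda>_. borel))" (is "?f \<in> _")
    by measurable
  have g: "(\<lambda>x. ennreal (exp (\<tau> * lpp (shifted i q x) m' n'))) \<in> borel_measurable (PiM ?B (\<lambda>_. borel))" (is "?g \<in> _")
    using lpp_shifted_measurable[OF sub] by measurable
  have r: "lpp (\<lambda>v\<in>?A. W v s) i k = L i k s" if "k \<le> n" for k s
    using that by (intro lpp_restrict) auto
  have "(\<integral>\<^sup>+s. ?f (\<lambda>v\<in>?A. W v s) * ?g (\<lambda>v\<in>?B. W v s) \<partial>P) =
    (\<integral>\<^sup>+s. ?f (\<lambda>v\<in>?A. W v s) \<partial>P) * (\<integral>\<^sup>+s. ?g (\<lambda>v\<in>?B. W v s) \<partial>P)"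
    by (rule block_indep[OF _ _ _ f g]) auto
  moreover have "(\<integral>\<^sup>+s. ?f (restrict (shifted 0 0 (wt s)) ?A) \<partial>P) = (\<integral>\<^sup>+x. ?f x \<partial>exp_laws ?A 1)"
    by (rule block_law[OF _ _ f]) auto
  ultimately show ?thesis
    by (simp only: lpp_shifted_restrict[OF sub] r[OF assms(1)] r[OF assms(2)] shifted_0_0 lpp_mgf_T)
qed

lemma column_indep1:
  "(\<integral>\<^sup>+s. ennreal (exp (\<theta> * L i v s)) * ennreal (exp (\<tau> * T i q m' n' s)) \<partial>P) = lpp_mgf \<theta> i v * lpp_mgf \<tau> m' n'"
  using column_indep[of v v v 0 i \<theta> \<tau> q m' n'] by (simp add: lpp_mgf_def)

lemma column_exit:
  assumes "1 \<le> i" "i < m" "1 \<le> n"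
  shows "\<exists>v\<in>{1..n}. L m n s \<le> L i v s + T i (v - 1) (m - i) (Suc n - v) s"
  using lpp_column_exit[of "wt s" "m - i" n i] nonneg assms by auto

lemma lpp_mgf_tail_le:
  assumes wz: "0 < z" "z < w" "w < 1" and "i < m" "v \<in> {1..n}"
  shows "lpp_mgf (w - z) (m - i) (Suc n - v) \<le> ennreal ((w / z) ^ (m - i) * ((1 - z) / (1 - w)) ^ (Suc n - v))"
  using lpp_mgf_le[of z "w - z" "m - i" "Suc n - v"] assms by auto

text \<open>Together the two pieces use every column once and row \<open>v\<close> twice, which
  leaves one spare row factor.\<close>

lemma tilt_factor_split:
  assumes "0 < z" "z < w" "w < 1" "i \<le> m" "v \<le> n"
  shows "(w / z) ^ i * ((1 - z) / (1 - w)) ^ v * ((w / z) ^ (m - i) * ((1 - z) / (1 - w)) ^ (Suc n - v)) =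
    (1 - z) / (1 - w) * tilt_factor w z m n"
proof -
  have "(w / z) ^ m = (w / z) ^ i * (w / z) ^ (m - i)" "((1 - z) / (1 - w)) ^ Suc n = ((1 - z) / (1 - w)) ^ v * ((1 - z) / (1 - w)) ^ (Suc n - v)"
    using assms by (simp_all only: power_add[symmetric]) simp_all
  then have "(w / z) ^ i * ((1 - z) / (1 - w)) ^ v * ((w / z) ^ (m - i) * ((1 - z) / (1 - w)) ^ (Suc n - v)) =
    (w / z) ^ m * ((1 - z) / (1 - w)) ^ Suc n" by (simp only: mult_ac)
  then show ?thesis by (simp only: tilt_factor_def power_Suc mult_ac)
qed

text \<open>The long path is cut at column \<open>i\<close>. Its unknown cut height \<open>v\<close>
  and the passage time to (i, j) are treated jointly, by the two-point moment with parameter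
  \<open>z - \<sigma>\<close>. The resulting bound does not depend on \<open>v\<close>, so the sum
  over cut heights costs only the factor \<open>n\<close>.\<close>

lemma upper_deviation:
  assumes wz: "0 < z" "z < w" "w < 1" and s: "0 < \<sigma>" "\<sigma> < z" and ij: "1 \<le> i" "i < m" "j \<le> n" "1 \<le> n"
  shows "emeasure P {s \<in> space P. A \<le> L i j s \<and> B \<le> L m n s} \<le>
    ennreal (real n * ((1 - z) / (1 - w)) * tilt_factor w z m n * (z / (z - \<sigma>)) ^ i * ((1 - z + \<sigma>) / (1 - z)) ^ j * exp (- (\<sigma> * A) - (w - z) * B))"
proof -
  let ?\<theta> = "w - z" and ?c = "(1 - z) / (1 - w)" and ?d = "(1 - z + \<sigma>) / (1 - z)"
  let ?R = "?c * tilt_factor w z m n * (z / (z - \<sigma>)) ^ i * ?d ^ j"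
  let ?g = "\<lambda>v s. ennreal (exp (\<sigma> * L i j s + ?\<theta> * L i v s)) * ennreal (exp (?\<theta> * T i (v - 1) (m - i) (Suc n - v) s))"
  have c: "1 \<le> ?c" "0 < ?c" using wz by auto
  have R: "0 \<le> ?R" using wz s by (auto simp: tilt_factor_def intro!: mult_nonneg_nonneg divide_nonneg_nonneg)
  have g: "(\<integral>\<^sup>+s. ?g v s \<partial>P) \<le> ennreal ?R" if v: "v \<in> {1..n}" for v
  proof -
    let ?f = "\<lambda>k. (1 - (z - \<sigma>)) / (1 - (z - \<sigma>) - (\<sigma> * of_bool (k \<le> j) + ?\<theta> * of_bool (k \<le> v)))"
    have "(\<integral>\<^sup>+s. ?g v s \<partial>P) = (\<integral>\<^sup>+x. ennreal (exp (\<sigma> * lpp x i j + ?\<theta> * lpp x i v)) \<partial>exp_laws ({1..i} \<times> {1..n}) 1) * lpp_mgf ?\<theta> (m - i) (Suc n - v)"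
      by (rule column_indep) (use ij v in auto)
    also have "\<dots> \<le> ennreal (((z - \<sigma> + \<sigma> + ?\<theta>) / (z - \<sigma>)) ^ i * (\<Prod>k\<in>{1..n}. ?f k)) *
      ennreal ((w / z) ^ (m - i) * ?c ^ (Suc n - v))"
      by (intro mult_mono two_point_bound lpp_mgf_tail_le) (use wz s ij v in auto)
    also have "\<dots> = ennreal ((w / (z - \<sigma>)) ^ i * (w / z) ^ (m - i) * ((\<Prod>k\<in>{1..n}. ?f k) * ?c ^ (Suc n - v)))"
      using wz s by (subst ennreal_mult[symmetric]) (auto simp: mult_ac intro!: mult_nonneg_nonneg prod_nonneg divide_nonneg_nonneg)
    also have "\<dots> \<le> ennreal ((w / (z - \<sigma>)) ^ i * (w / z) ^ (m - i) * (?d ^ j * (?c * ?c ^ n)))"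
    proof (intro ennreal_leI mult_left_mono)
      have split: "{1..n} = {1..v} \<union> {Suc v..n}" "{1..v} \<inter> {Suc v..n} = {}" using v by auto
      have "?c ^ (Suc n - v) = ?c * (\<Prod>k\<in>{1..n}. if k \<le> v then 1 else ?c)"
      proof -
        have "(\<Prod>k\<in>{1..n}. if k \<le> v then 1 else ?c) = (\<Prod>k\<in>{Suc v..n}. ?c)"
          using v by (intro prod.mono_neutral_cong_right) auto
        then show ?thesis using v by (simp add: Suc_diff_le)
      qed
      then have "(\<Prod>k\<in>{1..n}. ?f k) * ?c ^ (Suc n - v) = ?c * (\<Prod>k\<in>{1..n}. ?f k * (if k \<le> v then 1 else ?c))"
        unfolding prod.distrib by (simp only: mult_ac)
      \<comment> \<open>Row by row, in the four positions of \<open>k\<close> relative to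
        \<open>j\<close> and \<open>v\<close>: the factor of the first piece, times that of the
        second piece above \<open>v\<close>, is at most \<open>?c\<close>, with an extra
        \<open>?d\<close> for rows up to \<open>j\<close>. Equality fails only for v >= k >
        j.\<close>
      also have "\<dots> \<le> ?c * (\<Prod>k\<in>{1..n}. (if k \<le> j then ?d else 1) * ?c)"
      proof (intro mult_left_mono prod_mono conjI)
        fix k
        have p: "0 < 1 - w" "0 < 1 - z" using wz by auto
        show "0 \<le> ?f k * (if k \<le> v then 1 else ?c)"
          using wz s by (auto simp: of_bool_def intro!: mult_nonneg_nonneg divide_nonneg_nonneg)
        have "(1 - z + \<sigma>) / (1 - w + \<sigma>) \<le> ?c"
          using wz s p by (simp add: field_simps)
        then show "?f k * (if k \<le> v then 1 else ?c) \<le> (if k \<le> j then ?d else 1) * ?c"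
        proof -
          have dn: "1 - (z - \<sigma>) = 1 - z + \<sigma>" "1 - z + \<sigma> - (\<sigma> + ?\<theta>) = 1 - w" "1 - z + \<sigma> - \<sigma> = 1 - z" "1 - z + \<sigma> - ?\<theta> = 1 - w + \<sigma>"
            by simp_all
          have e: "?d * ?c = (1 - z + \<sigma>) / (1 - w)" "(1 - z + \<sigma>) / (1 - z + \<sigma>) = 1" using p s by simp_all
          show ?thesis
            using \<open>(1 - z + \<sigma>) / (1 - w + \<sigma>) \<le> ?c\<close>
            by (cases "k \<le> j"; cases "k \<le> v";
              simp only: of_bool_eq if_True if_False mult_1_right mult_1_left mult_zero_right add_0_right add_0_left diff_zero dn e order_refl)
        qed
      qed (use c in auto)
      also have "\<dots> = ?d ^ j * (?c * ?c ^ n)"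
      proof -
        have "(\<Prod>k\<in>{1..n}. if k \<le> j then ?d else 1) = (\<Prod>k\<in>{1..j}. ?d)"
          using ij by (intro prod.mono_neutral_cong_right) auto
        moreover have "(\<Prod>k\<in>{1..j}. ?d) = ?d ^ j" "(\<Prod>k\<in>{1..n}. ?c) = ?c ^ n" by simp_all
        ultimately show ?thesis unfolding prod.distrib by (simp only: mult_ac)
      qed
      finally show "(\<Prod>k\<in>{1..n}. ?f k) * ?c ^ (Suc n - v) \<le> ?d ^ j * (?c * ?c ^ n)" .
    qed (use wz s in \<open>auto intro!: mult_nonneg_nonneg divide_nonneg_nonneg\<close>)
    also have "(w / (z - \<sigma>)) ^ i * (w / z) ^ (m - i) * (?d ^ j * (?c * ?c ^ n)) = ?R"
    proof -
      have e1: "(w / (z - \<sigma>)) ^ i = (w / z) ^ i * (z / (z - \<sigma>)) ^ i"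
        unfolding power_mult_distrib[symmetric] using wz by simp
      have e2: "(w / z) ^ m = (w / z) ^ i * (w / z) ^ (m - i)" using ij by (simp add: power_add[symmetric])
      show ?thesis unfolding tilt_factor_def e1 e2 by (simp only: mult_ac)
    qed
    finally show ?thesis .
  qed
  have "emeasure P {s \<in> space P. A \<le> L i j s \<and> B \<le> L m n s} = (\<integral>\<^sup>+s. indicator {s \<in> space P. A \<le> L i j s \<and> B \<le> L m n s} s \<partial>P)"
    by simp
  also have "\<dots> \<le> (\<integral>\<^sup>+s. ennreal (exp (- (\<sigma> * A) - ?\<theta> * B)) * (\<Sum>v\<in>{1..n}. ?g v s) \<partial>P)"
  proof (intro nn_integral_mono)
    fix s
    show "indicator {s \<in> space P. A \<le> L i j s \<and> B \<le> L m n s} s \<le> ennreal (exp (- (\<sigma> * A) - ?\<theta> * B)) * (\<Sum>v\<in>{1..n}. ?g v s)"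
    proof (cases "A \<le> L i j s \<and> B \<le> L m n s")
      case True
      from column_exit[OF ij(1,2,4), of s] obtain v where v: "v \<in> {1..n}" "L m n s \<le> L i v s + T i (v - 1) (m - i) (Suc n - v) s"
        by blast
      have "\<sigma> * A \<le> \<sigma> * L i j s" using True s by (intro mult_left_mono) auto
      moreover have "?\<theta> * B \<le> ?\<theta> * (L i v s + T i (v - 1) (m - i) (Suc n - v) s)" using True v wz by (intro mult_left_mono) auto
      ultimately have "0 \<le> (- (\<sigma> * A) - ?\<theta> * B) + ((\<sigma> * L i j s + ?\<theta> * L i v s) + ?\<theta> * T i (v - 1) (m - i) (Suc n - v) s)"
        by (simp only: distrib_left; linarith)
      then have "1 \<le> ennreal (exp ((- (\<sigma> * A) - ?\<theta> * B) + ((\<sigma> * L i j s + ?\<theta> * L i v s) + ?\<theta> * T i (v - 1) (m - i) (Suc n - v) s)))"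
        by simp
      also have "\<dots> = ennreal (exp (- (\<sigma> * A) - ?\<theta> * B)) * ?g v s"
        unfolding exp_add by (simp add: ennreal_mult)
      also have "\<dots> \<le> ennreal (exp (- (\<sigma> * A) - ?\<theta> * B)) * (\<Sum>v\<in>{1..n}. ?g v s)"
        using v(1) by (intro mult_left_mono member_le_sum) auto
      finally show ?thesis by (auto simp: indicator_def)
    qed (auto simp: indicator_def)
  qed
  also have "\<dots> = ennreal (exp (- (\<sigma> * A) - ?\<theta> * B)) * (\<Sum>v\<in>{1..n}. \<integral>\<^sup>+s. ?g v s \<partial>P)"
    by (simp add: nn_integral_cmult nn_integral_sum)
  also have "\<dots> \<le> ennreal (exp (- (\<sigma> * A) - ?\<theta> * B)) * (\<Sum>v\<in>{1..n}. ennreal ?R)"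
    by (intro mult_left_mono sum_mono g) auto
  also have "\<dots> = ennreal (real n * ((1 - z) / (1 - w)) * tilt_factor w z m n * (z / (z - \<sigma>)) ^ i * ?d ^ j * exp (- (\<sigma> * A) - (w - z) * B))"
  proof -
    have "(\<Sum>v\<in>{1..n}. ennreal ?R) = ennreal (real n * ?R)" using R by (subst sum_ennreal) simp_all
    moreover have "ennreal (exp (- (\<sigma> * A) - ?\<theta> * B)) * ennreal (real n * ?R) = ennreal (exp (- (\<sigma> * A) - ?\<theta> * B) * (real n * ?R))"
      by (rule ennreal_mult[symmetric]) (use R in \<open>auto intro: mult_nonneg_nonneg simp del: times_divide_eq_left times_divide_eq_right\<close>)
    ultimately show ?thesis by (simp only: mult_ac)
  qed
  finally show ?thesis .
qed

text \<open>Two ways to see that a path leaving column \<open>i\<close> at height \<open>v\<close> is unlikely to be part of a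
  long path: move both parameters of the first piece by \<open>\<tau>\<close>, or lower its exponent by \<open>\<sigma>\<close>.\<close>

lemma exit_height_far:
  assumes wz: "0 < z" "z < w" "w < 1" and \<tau>: "- z < \<tau>" "\<tau> < 1 - w" and ij: "1 \<le> i" "i < m" and v: "v \<in> {1..n}"
  shows "emeasure P {s \<in> space P. B \<le> L i v s + T i (v - 1) (m - i) (Suc n - v) s} \<le>
    ennreal ((1 - z) / (1 - w) * tilt_factor w z m n * ((w + \<tau>) * z / ((z + \<tau>) * w)) ^ i * ((1 - z - \<tau>) * (1 - w) / ((1 - w - \<tau>) * (1 - z))) ^ v
      * exp (- ((w - z) * B)))"
proof -
  let ?\<theta> = "w - z"
  let ?g = "\<lambda>s. ennreal (exp (?\<theta> * L i v s)) * ennreal (exp (?\<theta> * T i (v - 1) (m - i) (Suc n - v) s))"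
  have "emeasure P {s \<in> space P. B \<le> L i v s + T i (v - 1) (m - i) (Suc n - v) s} =
    (\<integral>\<^sup>+s. indicator {s \<in> space P. B \<le> L i v s + T i (v - 1) (m - i) (Suc n - v) s} s \<partial>P)"
    by simp
  also have "\<dots> \<le> (\<integral>\<^sup>+s. ennreal (exp (- (?\<theta> * B))) * ?g s \<partial>P)"
  proof (intro nn_integral_mono)
    fix s
    show "indicator {s \<in> space P. B \<le> L i v s + T i (v - 1) (m - i) (Suc n - v) s} s \<le> ennreal (exp (- (?\<theta> * B))) * ?g s"
    proof (cases "B \<le> L i v s + T i (v - 1) (m - i) (Suc n - v) s")
      case True
      have "?\<theta> * B \<le> ?\<theta> * (L i v s + T i (v - 1) (m - i) (Suc n - v) s)" using True wz by (intro mult_left_mono) auto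
      then have "0 \<le> - (?\<theta> * B) + (?\<theta> * L i v s + ?\<theta> * T i (v - 1) (m - i) (Suc n - v) s)"
        by (simp only: distrib_left; linarith)
      then have "1 \<le> ennreal (exp (- (?\<theta> * B) + (?\<theta> * L i v s + ?\<theta> * T i (v - 1) (m - i) (Suc n - v) s)))"
        by simp
      also have "\<dots> = ennreal (exp (- (?\<theta> * B))) * ?g s"
        unfolding exp_add by (simp add: ennreal_mult)
      finally show ?thesis by (auto simp: indicator_def)
    qed (auto simp: indicator_def)
  qed
  also have "\<dots> = ennreal (exp (- (?\<theta> * B))) * (lpp_mgf ?\<theta> i v * lpp_mgf ?\<theta> (m - i) (Suc n - v))"
    by (simp add: nn_integral_cmult column_indep1)
  also have "\<dots> \<le> ennreal (exp (- (?\<theta> * B))) * (ennreal (((z + \<tau> + ?\<theta>) / (z + \<tau>)) ^ i * ((1 - (z + \<tau>)) / (1 - (z + \<tau>) - ?\<theta>)) ^ v) *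
    ennreal ((w / z) ^ (m - i) * ((1 - z) / (1 - w)) ^ (Suc n - v)))"
    by (intro mult_left_mono mult_mono lpp_mgf_le lpp_mgf_tail_le) (use wz \<tau> ij v in auto)
  also have "\<dots> = ennreal (exp (- (?\<theta> * B)) * (((z + \<tau> + ?\<theta>) / (z + \<tau>)) ^ i * ((1 - (z + \<tau>)) / (1 - (z + \<tau>) - ?\<theta>)) ^ v *
    ((w / z) ^ (m - i) * ((1 - z) / (1 - w)) ^ (Suc n - v))))"
  proof -
    have "0 \<le> ((z + \<tau> + ?\<theta>) / (z + \<tau>)) ^ i * ((1 - (z + \<tau>)) / (1 - (z + \<tau>) - ?\<theta>)) ^ v"
      "0 \<le> (w / z) ^ (m - i) * ((1 - z) / (1 - w)) ^ (Suc n - v)"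
      using wz \<tau> by (auto intro!: mult_nonneg_nonneg zero_le_power divide_nonneg_nonneg)
    then show ?thesis by (simp only: ennreal_mult[symmetric] exp_ge_zero mult_nonneg_nonneg)
  qed
  also have "((z + \<tau> + ?\<theta>) / (z + \<tau>)) ^ i * ((1 - (z + \<tau>)) / (1 - (z + \<tau>) - ?\<theta>)) ^ v * ((w / z) ^ (m - i) * ((1 - z) / (1 - w)) ^ (Suc n - v)) =
    (w / z) ^ i * ((1 - z) / (1 - w)) ^ v * ((w / z) ^ (m - i) * ((1 - z) / (1 - w)) ^ (Suc n - v)) *
    (((w + \<tau>) * z / ((z + \<tau>) * w)) ^ i * ((1 - z - \<tau>) * (1 - w) / ((1 - w - \<tau>) * (1 - z))) ^ v)"
  proof -
    have "(z + \<tau> + ?\<theta>) / (z + \<tau>) = (w / z) * ((w + \<tau>) * z / ((z + \<tau>) * w))"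
      "(1 - (z + \<tau>)) / (1 - (z + \<tau>) - ?\<theta>) = ((1 - z) / (1 - w)) * ((1 - z - \<tau>) * (1 - w) / ((1 - w - \<tau>) * (1 - z)))"
      using wz \<tau> by (simp_all add: divide_simps) (simp_all add: algebra_simps)
    then show ?thesis by (simp only: power_mult_distrib mult_ac)
  qed
  also have "(w / z) ^ i * ((1 - z) / (1 - w)) ^ v * ((w / z) ^ (m - i) * ((1 - z) / (1 - w)) ^ (Suc n - v)) = (1 - z) / (1 - w) * tilt_factor w z m n"
    by (rule tilt_factor_split[OF wz]) (use ij v in auto)
  finally show ?thesis by (simp only: mult_ac)
qed

lemma exit_height_near:
  assumes wz: "0 < z" "z < w" "w < 1" and \<sigma>: "0 < \<sigma>" "\<sigma> < w - z" and ij: "1 \<le> i" "i < m" and v: "v \<in> {1..n}"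
  shows "emeasure P {s \<in> space P. L i v s \<le> A \<and> B \<le> L i v s + T i (v - 1) (m - i) (Suc n - v) s} \<le>
    ennreal ((1 - z) / (1 - w) * tilt_factor w z m n * ((w - \<sigma>) / w) ^ i * ((1 - w) / (1 - w + \<sigma>)) ^ v
      * exp (\<sigma> * A - (w - z) * B))"
proof -
  let ?\<theta> = "w - z"
  let ?g = "\<lambda>s. ennreal (exp ((?\<theta> - \<sigma>) * L i v s)) * ennreal (exp (?\<theta> * T i (v - 1) (m - i) (Suc n - v) s))"
  let ?S = "{s \<in> space P. L i v s \<le> A \<and> B \<le> L i v s + T i (v - 1) (m - i) (Suc n - v) s}"
  have "emeasure P ?S = (\<integral>\<^sup>+s. indicator ?S s \<partial>P)"
    by simp
  also have "\<dots> \<le> (\<integral>\<^sup>+s. ennreal (exp (\<sigma> * A - ?\<theta> * B)) * ?g s \<partial>P)"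
  proof (intro nn_integral_mono)
    fix s
    show "indicator ?S s \<le> ennreal (exp (\<sigma> * A - ?\<theta> * B)) * ?g s"
    proof (cases "L i v s \<le> A \<and> B \<le> L i v s + T i (v - 1) (m - i) (Suc n - v) s")
      case True
      have "?\<theta> * B \<le> ?\<theta> * (L i v s + T i (v - 1) (m - i) (Suc n - v) s)" "\<sigma> * L i v s \<le> \<sigma> * A"
        using True wz \<sigma> by (auto intro!: mult_left_mono)
      then have "0 \<le> (\<sigma> * A - ?\<theta> * B) + ((?\<theta> - \<sigma>) * L i v s + ?\<theta> * T i (v - 1) (m - i) (Suc n - v) s)"
        by (simp only: distrib_left left_diff_distrib; linarith)
      then have "1 \<le> ennreal (exp ((\<sigma> * A - ?\<theta> * B) + ((?\<theta> - \<sigma>) * L i v s + ?\<theta> * T i (v - 1) (m - i) (Suc n - v) s)))"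
        by simp
      also have "\<dots> = ennreal (exp (\<sigma> * A - ?\<theta> * B)) * ?g s"
        unfolding exp_add by (simp add: ennreal_mult)
      finally show ?thesis by (auto simp: indicator_def)
    qed (auto simp: indicator_def)
  qed
  also have "\<dots> = ennreal (exp (\<sigma> * A - ?\<theta> * B)) * (lpp_mgf (?\<theta> - \<sigma>) i v * lpp_mgf ?\<theta> (m - i) (Suc n - v))"
    by (simp add: nn_integral_cmult column_indep1)
  also have "\<dots> \<le> ennreal (exp (\<sigma> * A - ?\<theta> * B)) * (ennreal (((z + (?\<theta> - \<sigma>)) / z) ^ i * ((1 - z) / (1 - z - (?\<theta> - \<sigma>))) ^ v) *
    ennreal ((w / z) ^ (m - i) * ((1 - z) / (1 - w)) ^ (Suc n - v)))"
    by (intro mult_left_mono mult_mono lpp_mgf_le lpp_mgf_tail_le) (use wz \<sigma> ij v in auto)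
  also have "\<dots> = ennreal (exp (\<sigma> * A - ?\<theta> * B) * (((z + (?\<theta> - \<sigma>)) / z) ^ i * ((1 - z) / (1 - z - (?\<theta> - \<sigma>))) ^ v *
    ((w / z) ^ (m - i) * ((1 - z) / (1 - w)) ^ (Suc n - v))))"
  proof -
    have "0 \<le> ((z + (?\<theta> - \<sigma>)) / z) ^ i * ((1 - z) / (1 - z - (?\<theta> - \<sigma>))) ^ v"
      "0 \<le> (w / z) ^ (m - i) * ((1 - z) / (1 - w)) ^ (Suc n - v)"
      using wz \<sigma> by (auto intro!: mult_nonneg_nonneg zero_le_power divide_nonneg_nonneg)
    then show ?thesis by (simp only: ennreal_mult[symmetric] exp_ge_zero mult_nonneg_nonneg)
  qed
  also have "((z + (?\<theta> - \<sigma>)) / z) ^ i * ((1 - z) / (1 - z - (?\<theta> - \<sigma>))) ^ v * ((w / z) ^ (m - i) * ((1 - z) / (1 - w)) ^ (Suc n - v)) =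
    (w / z) ^ i * ((1 - z) / (1 - w)) ^ v * ((w / z) ^ (m - i) * ((1 - z) / (1 - w)) ^ (Suc n - v)) *
    (((w - \<sigma>) / w) ^ i * ((1 - w) / (1 - w + \<sigma>)) ^ v)"
  proof -
    have "(z + (?\<theta> - \<sigma>)) / z = (w / z) * ((w - \<sigma>) / w)"
      "(1 - z) / (1 - z - (?\<theta> - \<sigma>)) = ((1 - z) / (1 - w)) * ((1 - w) / (1 - w + \<sigma>))"
      using wz \<sigma> by (simp_all add: divide_simps)
    then show ?thesis by (simp only: power_mult_distrib mult_ac)
  qed
  also have "(w / z) ^ i * ((1 - z) / (1 - w)) ^ v * ((w / z) ^ (m - i) * ((1 - z) / (1 - w)) ^ (Suc n - v)) = (1 - z) / (1 - w) * tilt_factor w z m n"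
    by (rule tilt_factor_split[OF wz]) (use ij v in auto)
  finally show ?thesis by (simp only: mult_ac)
qed

lemma upper_tail:
  assumes wz: "0 < z" "z < w" "w < 1" and mn: "1 \<le> m" "1 \<le> n"
  shows "emeasure P {s \<in> space P. B \<le> L m n s} \<le> ennreal (tilt_factor w z m n * exp (- ((w - z) * B)))"
proof -
  let ?\<theta> = "w - z"
  have "emeasure P {s \<in> space P. B \<le> L m n s} = (\<integral>\<^sup>+s. indicator {s \<in> space P. B \<le> L m n s} s \<partial>P)" by simp
  also have "\<dots> \<le> (\<integral>\<^sup>+s. ennreal (exp (- (?\<theta> * B))) * ennreal (exp (?\<theta> * L m n s)) \<partial>P)"
  proof (intro nn_integral_mono)
    fix s
    show "indicator {s \<in> space P. B \<le> L m n s} s \<le> ennreal (exp (- (?\<theta> * B))) * ennreal (exp (?\<theta> * L m n s))"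
    proof (cases "B \<le> L m n s")
      case True
      then have "?\<theta> * B \<le> ?\<theta> * L m n s" using wz by (intro mult_left_mono) auto
      then have "1 \<le> ennreal (exp (- (?\<theta> * B) + ?\<theta> * L m n s))" by simp
      then show ?thesis unfolding exp_add by (auto simp: indicator_def ennreal_mult)
    qed (auto simp: indicator_def)
  qed
  also have "\<dots> = ennreal (exp (- (?\<theta> * B))) * lpp_mgf ?\<theta> m n"
    by (simp add: nn_integral_cmult lpp_mgf_L)
  also have "\<dots> \<le> ennreal (exp (- (?\<theta> * B))) * ennreal (((z + ?\<theta>) / z) ^ m * ((1 - z) / (1 - z - ?\<theta>)) ^ n)"
    by (intro mult_left_mono lpp_mgf_le) (use wz mn in auto)
  also have "\<dots> = ennreal (tilt_factor w z m n * exp (- ((w - z) * B)))"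
    using wz by (subst ennreal_mult[symmetric]) (auto simp: tilt_factor_def mult_ac)
  finally show ?thesis .
qed

text \<open>Both passage times increase in the same independent weights, so the two events are
  monotone in opposite directions. A lower deviation of one piece can thus be estimated without
  conditioning: its unconditional probability multiplies the cost of the long path.\<close>

lemma negative_association:
  "emeasure P {s \<in> space P. T p q m' n' s \<le> A \<and> B \<le> L m n s} \<le>
    emeasure P {s \<in> space P. T p q m' n' s \<le> A} * emeasure P {s \<in> space P. B \<le> L m n s}"
proof -
  let ?S = "{1..max m (p + m')} \<times> {1..max n (q + n')}"
  let ?f = "\<lambda>x. indicator {y. B \<le> y} (lpp x m n) :: ennreal" and ?g = "\<lambda>x. indicator {y. y \<le> A} (lpp (shifted p q x) m' n') :: ennreal"
  have sub: "{1..m} \<times> {1..n} \<subseteq> ?S" "(\<lambda>v. (fst v + p, snd v + q)) ` ({1..m'} \<times> {1..n'}) \<subseteq> ?S" by auto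
  have [measurable]: "(\<lambda>x. lpp x m n) \<in> borel_measurable (PiM ?S (\<lambda>_. borel))"
    "(\<lambda>x. lpp (shifted p q x) m' n') \<in> borel_measurable (PiM ?S (\<lambda>_. borel))"
    by (intro lpp_measurable lpp_shifted_measurable sub)+
  have f: "?f \<in> borel_measurable (PiM ?S (\<lambda>_. borel))" and g: "?g \<in> borel_measurable (PiM ?S (\<lambda>_. borel))"
    by measurable
  have h: "(\<integral>\<^sup>+x. ?f x * ?g x \<partial>exp_laws ?S 1) \<le> (\<integral>\<^sup>+x. ?f x \<partial>exp_laws ?S 1) * (\<integral>\<^sup>+x. ?g x \<partial>exp_laws ?S 1)"
  proof (rule harris[OF prob_space_exp_law _ _ f g])
    fix x y :: "nat \<times> nat \<Rightarrow> real" assume xy: "\<And>i. i \<in> ?S \<Longrightarrow> x i \<le> y i"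
    have "lpp x m n \<le> lpp y m n" by (rule boundary_lpp_mono; (rule xy)?) auto
    then show "?f x \<le> ?f y" by (auto simp: indicator_def)
    have "lpp (shifted p q x) m' n' \<le> lpp (shifted p q y) m' n'" by (rule boundary_lpp_mono; (unfold shifted_def, rule xy)?) auto
    then show "?g y \<le> ?g x" by (auto simp: indicator_def)
  qed auto
  have law: "(\<integral>\<^sup>+s. F (restrict (wt s) ?S) \<partial>P) = (\<integral>\<^sup>+x. F x \<partial>exp_laws ?S 1)" if "F \<in> borel_measurable (PiM ?S (\<lambda>_. borel))" for F
  proof -
    have "(\<lambda>v. (fst v + 0, snd v + 0)) ` ?S \<subseteq> {1..} \<times> {1..}" by auto
    from block_law[OF this _ that] show ?thesis by simp
  qed
  have rf: "?f (restrict (wt s) ?S) = ?f (wt s)" and rg: "?g (restrict (wt s) ?S) = ?g (wt s)" for s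
    by (simp_all only: lpp_restrict[OF sub(1)] lpp_shifted_restrict[OF sub(2)])
  have fg: "(\<lambda>x. ?f x * ?g x) \<in> borel_measurable (PiM ?S (\<lambda>_. borel))" using f g by measurable
  have "emeasure P {s \<in> space P. T p q m' n' s \<le> A \<and> B \<le> L m n s} = (\<integral>\<^sup>+s. indicator {s \<in> space P. T p q m' n' s \<le> A \<and> B \<le> L m n s} s \<partial>P)"
    by simp
  also have "\<dots> = (\<integral>\<^sup>+s. ?f (wt s) * ?g (wt s) \<partial>P)" by (intro nn_integral_cong) (auto simp: indicator_def)
  also have "\<dots> \<le> (\<integral>\<^sup>+s. ?f (wt s) \<partial>P) * (\<integral>\<^sup>+s. ?g (wt s) \<partial>P)"
    using h unfolding law[OF f, symmetric] law[OF g, symmetric] law[OF fg, symmetric] rf rg .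
  also have "(\<integral>\<^sup>+s. ?f (wt s) \<partial>P) = (\<integral>\<^sup>+s. indicator {s \<in> space P. B \<le> L m n s} s \<partial>P)"
    by (intro nn_integral_cong) (auto simp: indicator_def)
  also have "\<dots> = emeasure P {s \<in> space P. B \<le> L m n s}" by simp
  also have "(\<integral>\<^sup>+s. ?g (wt s) \<partial>P) = emeasure P {s \<in> space P. T p q m' n' s \<le> A}"
    by (rule emeasure_le_eq_nn_integral[symmetric]) measurable
  finally show ?thesis by (simp add: mult.commute)
qed

end

section \<open>Exponential decay relative to the cost of a long passage time\<close>

definition decays :: "(nat \<Rightarrow> ennreal) \<Rightarrow> (nat \<Rightarrow> real) \<Rightarrow> bool" where
  "decays f g \<longleftrightarrow> (\<exists>c>0. \<forall>\<^sub>F N in sequentially. f N \<le> ennreal (g N * exp (- (c * real N))))"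

lemma decays_add:
  assumes "decays f1 g" "decays f2 g" and g: "\<And>N. 0 \<le> g N"
  shows "decays (\<lambda>N. f1 N + f2 N) g"
proof -
  from assms obtain c1 c2 where c: "0 < c1" "0 < c2"
    and f: "\<forall>\<^sub>F N in sequentially. f1 N \<le> ennreal (g N * exp (- (c1 * real N)))" "\<forall>\<^sub>F N in sequentially. f2 N \<le> ennreal (g N * exp (- (c2 * real N)))"
    by (auto simp: decays_def)
  define c where "c = min c1 c2"
  have c': "0 < c" "c \<le> c1" "c \<le> c2" using c by (auto simp: c_def)
  have "\<forall>\<^sub>F N::nat in sequentially. (2 + 0 * real N) * exp (0 + - c * real N) \<le> exp (- c / 2 * real N)"
    by (rule poly_exp_eventually) (use c' in auto)
  with f have "\<forall>\<^sub>F N in sequentially. f1 N + f2 N \<le> ennreal (g N * exp (- (c / 2 * real N)))"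
  proof eventually_elim
    case (elim N)
    have le: "g N * exp (- (c'' * real N)) \<le> g N * exp (- (c * real N))" if "c \<le> c''" for c''
      using that g by (intro mult_left_mono) (auto intro!: mult_right_mono)
    have "f1 N + f2 N \<le> ennreal (g N * exp (- (c * real N))) + ennreal (g N * exp (- (c * real N)))"
      using elim(1,2) le[OF c'(2)] le[OF c'(3)] by (intro add_mono) (auto intro: order_trans ennreal_leI)
    also have "\<dots> = ennreal (g N * (2 * exp (- (c * real N))))"
      using g by (subst ennreal_plus[symmetric]) (auto simp: algebra_simps)
    also have "\<dots> \<le> ennreal (g N * exp (- (c / 2 * real N)))"
      using elim(3) g by (intro ennreal_leI mult_left_mono) auto
    finally show ?case .
  qed
  with c' show ?thesis unfolding decays_def by (intro exI[of _ "c / 2"]) auto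
qed

lemma decays_mono:
  assumes "decays f g" "\<forall>\<^sub>F N in sequentially. f' N \<le> f N"
  shows "decays f' g"
proof -
  from assms(1) obtain c where c: "0 < c" "\<forall>\<^sub>F N in sequentially. f N \<le> ennreal (g N * exp (- (c * real N)))"
    by (auto simp: decays_def)
  from c(2) assms(2) have "\<forall>\<^sub>F N in sequentially. f' N \<le> ennreal (g N * exp (- (c * real N)))"
    by eventually_elim (rule order_trans)
  with c(1) show ?thesis by (auto simp: decays_def)
qed

lemma eventually_less_linear:
  fixes i m :: "nat \<Rightarrow> nat"
  assumes "\<And>N. \<bar>real (i N) - \<alpha> * real N\<bar> \<le> D" "\<And>N. \<bar>real (m N) - \<beta> * real N\<bar> \<le> D" "\<alpha> < \<beta>"
  shows "\<forall>\<^sub>F N in sequentially. i N < m N"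
proof -
  have "filterlim (\<lambda>N::nat. (\<beta> - \<alpha>) * real N - 2 * D) at_top sequentially"
    using assms(3) by real_asymp
  then have "\<forall>\<^sub>F N::nat in sequentially. 1 \<le> (\<beta> - \<alpha>) * real N - 2 * D"
    by (simp add: filterlim_at_top)
  then show ?thesis
  proof eventually_elim
    case (elim N)
    with assms(1)[of N] assms(2)[of N] have "real (i N) < real (m N)" by (simp add: algebra_simps abs_le_iff)
    then show ?case by simp
  qed
qed

text \<open>To exponential order this is the probability of a passage time of at least l N, when
  \<open>m\<close> and \<open>n\<close> follow the ray belonging to \<open>w\<close>,
  \<open>z\<close> and l: \<open>upper_tail\<close> gives one direction,
  \<open>window_lower_bound\<close> the other.\<close>

definition cost :: "real \<Rightarrow> real \<Rightarrow> real \<Rightarrow> (nat \<Rightarrow> nat) \<Rightarrow> (nat \<Rightarrow> nat) \<Rightarrow> nat \<Rightarrow> real" where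
  "cost w z l m n N = tilt_factor w z (m N) (n N) * exp (- ((w - z) * (l * real N)))"

lemma nat_ceil_bound: "0 \<le> c \<Longrightarrow> \<bar>real (nat \<lceil>c * real N\<rceil>) - c * real N\<bar> \<le> 1"
proof -
  assume "0 \<le> c"
  then have "0 \<le> c * real N" by simp
  then have "real (nat \<lceil>c * real N\<rceil>) = of_int \<lceil>c * real N\<rceil>" by simp
  then show ?thesis using ceiling_correct[of "c * real N"] by linarith
qed

text \<open>The endpoint is only required to stay within bounded distance \<open>D\<close> of the
  ray, which accommodates the rounding of coordinates.\<close>

locale tilted = bulk P W for P :: "'a measure" and W +
  fixes w z l D :: real and m n :: "nat \<Rightarrow> nat"
  assumes wz: "0 < z" "z < w" "w < 1" and l: "0 < l"
    and m: "\<And>N. \<bar>real (m N) - l * w * z * real N\<bar> \<le> D" and n: "\<And>N. \<bar>real (n N) - l * (1 - w) * (1 - z) * real N\<bar> \<le> D"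
begin

abbreviation "a \<equiv> l * w * z"
abbreviation "b \<equiv> l * (1 - w) * (1 - z)"
abbreviation "C \<equiv> cost w z l m n"
abbreviation "c0 \<equiv> (1 - z) / (1 - w)"

lemma ab: "0 < a" "0 < b" using wz l by auto

lemma C_nonneg: "0 \<le> C N" using wz by (simp add: cost_def tilt_factor_def)

lemma c0: "0 < c0" using wz by simp

lemma D: "0 \<le> D" using m[of 0] by simp

lemma mn_large: "\<forall>\<^sub>F N in sequentially. 1 \<le> m N" "\<forall>\<^sub>F N in sequentially. 1 \<le> n N"
  using eventually_ge_linear[OF m ab(1)] eventually_ge_linear[OF n ab(2)] by auto

text \<open>The exponent of \<open>upper_deviation\<close> has \<open>\<sigma>\<close>-derivative x
  a/z + y b/(1 - z) = l (w x + (1 - w) y) at 0, before the level is subtracted. An excess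
  \<open>\<epsilon>\<close> over this value leaves the slope \<open>- \<epsilon>\<close>.\<close>

lemma upper_deviation_decay:
  assumes x: "0 < x" "x < 1" and y: "0 < y" "y < 1" and \<epsilon>: "0 < \<epsilon>"
    and i: "\<And>N. \<bar>real (i N) - x * a * real N\<bar> \<le> D'" and j: "\<And>N. \<bar>real (j N) - y * b * real N\<bar> \<le> D'"
  shows "decays (\<lambda>N. emeasure P {s \<in> space P. (l * (w * x + (1 - w) * y) + \<epsilon>) * real N \<le> L (i N) (j N) s \<and> l * real N \<le> L (m N) (n N) s}) C"
proof -
  define h where "h = l * (w * x + (1 - w) * y)"
  let ?F = "\<lambda>s. x * a * ln (z / (z - s)) + y * b * ln ((1 - z + s) / (1 - z)) + - (s * (h + \<epsilon>))"
  have "((\<lambda>s. ln (z / (z - s))) has_real_derivative (1 / z)) (at 0)" "((\<lambda>s. ln ((1 - z + s) / (1 - z))) has_real_derivative (1 / (1 - z))) (at 0)"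
    using wz by (auto intro!: derivative_eq_intros simp: power2_eq_square)
  then have "(?F has_real_derivative (x * a * (1 / z) + y * b * (1 / (1 - z)) + - (1 * (h + \<epsilon>)))) (at 0)"
    by (intro DERIV_add DERIV_cmult DERIV_minus DERIV_cmult_right DERIV_ident)
  moreover have "x * a * (1 / z) + y * b * (1 / (1 - z)) + - (1 * (h + \<epsilon>)) = - \<epsilon>"
  proof -
    have "x * a * (1 / z) = x * (l * w)" "y * b * (1 / (1 - z)) = y * (l * (1 - w))" using wz by simp_all
    then show ?thesis by (simp only: h_def; simp add: algebra_simps)
  qed
  ultimately have d: "(?F has_real_derivative - \<epsilon>) (at 0)" by (simp only:)
  from DERIV_neg_ex[OF d _ wz(1)] \<epsilon> obtain s where s: "0 < s" "s < z" "?F s < 0" using wz by auto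
  have xy: "x * a < a" "y * b < b"
    using mult_strict_right_mono[OF x(2) ab(1)] mult_strict_right_mono[OF y(2) ab(2)] by (simp_all only: mult_1_left)
  let ?X = "ln (z / (z - s))" and ?Y = "ln ((1 - z + s) / (1 - z))"
  define f where "f = x * a * ?X + y * b * ?Y + - (s * (h + \<epsilon>))"
  have f: "f < 0" using s(3) by (simp add: f_def)
  have "\<forall>\<^sub>F N in sequentially. (c0 * D + c0 * b * real N) * exp (0 + real (i N) * ?X + real (j N) * ?Y + (- (s * (h + \<epsilon>))) * real N)
    \<le> exp ((x * a * ?X + y * b * ?Y + (- (s * (h + \<epsilon>)))) / 2 * real N)"
    by (rule exp_lin_eventually[OF i j s(3) mult_nonneg_nonneg[OF less_imp_le[OF c0] D] mult_nonneg_nonneg[OF less_imp_le[OF c0] less_imp_le[OF ab(2)]]])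
  moreover have "\<forall>\<^sub>F N in sequentially. 1 \<le> i N" by (rule eventually_ge_linear[OF i mult_pos_pos[OF x(1) ab(1)]])
  moreover have "\<forall>\<^sub>F N in sequentially. i N < m N"
    by (rule eventually_less_linear[where D = "max D D'", OF _ _ xy(1)])
      (use i m in \<open>auto simp: le_max_iff_disj\<close>)
  moreover have "\<forall>\<^sub>F N in sequentially. j N < n N"
    by (rule eventually_less_linear[where D = "max D D'", OF _ _ xy(2)])
      (use j n in \<open>auto simp: le_max_iff_disj\<close>)
  ultimately have "\<forall>\<^sub>F N in sequentially. emeasure P {s \<in> space P. (h + \<epsilon>) * real N \<le> L (i N) (j N) s \<and> l * real N \<le> L (m N) (n N) s}
    \<le> ennreal (C N * exp (- (- f / 2 * real N)))"
  proof eventually_elim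
    case (elim N)
    let ?E = "exp (0 + real (i N) * ?X + real (j N) * ?Y + (- (s * (h + \<epsilon>))) * real N)"
    have pw: "(z / (z - s)) ^ i N = exp (real (i N) * ?X)" "((1 - z + s) / (1 - z)) ^ j N = exp (real (j N) * ?Y)"
      using s wz by (auto intro!: power_eq_exp)
    have "emeasure P {s \<in> space P. (h + \<epsilon>) * real N \<le> L (i N) (j N) s \<and> l * real N \<le> L (m N) (n N) s} \<le>
      ennreal (real (n N) * c0 * tilt_factor w z (m N) (n N) * (z / (z - s)) ^ i N * ((1 - z + s) / (1 - z)) ^ j N *
        exp (- (s * ((h + \<epsilon>) * real N)) - (w - z) * (l * real N)))"
      by (rule upper_deviation[OF wz s(1,2)]) (use elim in auto)
    also have "real (n N) * c0 * tilt_factor w z (m N) (n N) * (z / (z - s)) ^ i N * ((1 - z + s) / (1 - z)) ^ j N *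
        exp (- (s * ((h + \<epsilon>) * real N)) - (w - z) * (l * real N)) = C N * (c0 * real (n N) * ?E)"
    proof -
      have e1: "exp (- (s * ((h + \<epsilon>) * real N)) - (w - z) * (l * real N)) = exp ((- (s * (h + \<epsilon>))) * real N) * exp (- ((w - z) * (l * real N)))"
        by (simp only: diff_conv_add_uminus[of "- (s * ((h + \<epsilon>) * real N))"] exp_add mult_minus_left mult.assoc)
      have e2: "?E = exp (real (i N) * ?X) * exp (real (j N) * ?Y) * exp ((- (s * (h + \<epsilon>))) * real N)"
        by (simp only: exp_add exp_zero mult_1_left)
      show ?thesis unfolding pw cost_def e1 e2 by (simp only: mult_ac)
    qed
    also have "ennreal (C N * (c0 * real (n N) * ?E)) \<le> ennreal (C N * ((c0 * D + c0 * b * real N) * ?E))"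
    proof (intro ennreal_leI mult_left_mono[OF _ C_nonneg] mult_right_mono)
      have "real (n N) \<le> D + b * real N" using n[of N] by linarith
      from mult_left_mono[OF this, of c0] c0 show "c0 * real (n N) \<le> c0 * D + c0 * b * real N" by (simp only: distrib_left mult.assoc)
    qed simp
    also have "\<dots> \<le> ennreal (C N * exp (- (- f / 2 * real N)))"
    proof (intro ennreal_leI mult_left_mono[OF _ C_nonneg])
      have "(x * a * ?X + y * b * ?Y + (- (s * (h + \<epsilon>)))) / 2 * real N = - (- f / 2 * real N)"
        by (simp only: f_def minus_divide_left[symmetric] mult_minus_left minus_minus)
      with elim(1) show "(c0 * D + c0 * b * real N) * ?E \<le> exp (- (- f / 2 * real N))" by (simp only:)
    qed
    finally show ?case .
  qed
  then show ?thesis unfolding decays_def h_def[symmetric] using f by (intro exI[of _ "- f / 2"]) auto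
qed

lemma decays_sum_heights:
  assumes f: "f < 0" and "\<forall>\<^sub>F N in sequentially. \<forall>v\<in>{1..n N}. p N v \<le> ennreal (c0 * C N * exp (f * real N))"
  shows "decays (\<lambda>N. \<Sum>v\<in>{1..n N}. p N v) C"
proof -
  have "\<forall>\<^sub>F N::nat in sequentially. (c0 * D + c0 * b * real N) * exp (0 + f * real N) \<le> exp (f / 2 * real N)"
    by (rule poly_exp_eventually[OF f])
  with assms(2) have "\<forall>\<^sub>F N in sequentially. (\<Sum>v\<in>{1..n N}. p N v) \<le> ennreal (C N * exp (- (- f / 2 * real N)))"
  proof eventually_elim
    case (elim N)
    have "(\<Sum>v\<in>{1..n N}. p N v) \<le> (\<Sum>v\<in>{1..n N}. ennreal (c0 * C N * exp (f * real N)))"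
      using elim(1) by (intro sum_mono) auto
    also have "\<dots> = ennreal (real (n N) * (c0 * C N * exp (f * real N)))"
    proof -
      have "0 \<le> c0 * C N * exp (f * real N)" by (intro mult_nonneg_nonneg less_imp_le[OF c0] C_nonneg exp_ge_zero)
      then show ?thesis by (subst sum_ennreal) simp_all
    qed
    also have "real (n N) * (c0 * C N * exp (f * real N)) = C N * (c0 * real (n N) * exp (0 + f * real N))"
      by (simp only: mult_ac add_0_left)
    also have "ennreal (C N * (c0 * real (n N) * exp (0 + f * real N))) \<le> ennreal (C N * ((c0 * D + c0 * b * real N) * exp (0 + f * real N)))"
    proof (intro ennreal_leI mult_left_mono[OF _ C_nonneg] mult_right_mono)
      have "real (n N) \<le> D + b * real N" using n[of N] by linarith
      from mult_left_mono[OF this, of c0] c0 show "c0 * real (n N) \<le> c0 * D + c0 * b * real N" by (simp only: distrib_left mult.assoc)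
    qed simp
    also have "\<dots> \<le> ennreal (C N * exp (- (- f / 2 * real N)))"
      using elim(2) by (intro ennreal_leI mult_left_mono[OF _ C_nonneg]) simp
    finally show ?case .
  qed
  with f show ?thesis unfolding decays_def by (intro exI[of _ "- f / 2"]) auto
qed

text \<open>The long path is cut in column (t - \<open>\<eta>\<close>) a N, slightly left of the
  diagonal point. For a cut at height v b N, a shift of both parameters changes the exponent at the
  rate l (w - z) (v - (t - \<open>\<eta>\<close>)), so with the right sign of the shift both high
  and low cuts are excluded. In between, the cut point lies below and left of the diagonal point,
  inherits its small passage time, and is excluded by lowering the exponent.\<close>

lemma diagonal_deviation_decay:
  assumes t: "0 < t" "t < 1" and \<epsilon>: "0 < \<epsilon>"
    and d1: "\<And>N. \<bar>real (d1 N) - t * a * real N\<bar> \<le> D'" and d2: "\<And>N. \<bar>real (d2 N) - t * b * real N\<bar> \<le> D'"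
  shows "decays (\<lambda>N. emeasure P {s \<in> space P. L (d1 N) (d2 N) s \<le> (t * l - \<epsilon>) * real N \<and> l * real N \<le> L (m N) (n N) s}) C"
proof -
  \<comment> \<open>The fractions t - 2 \<open>\<eta>\<close> < t - \<open>\<eta>\<close> < t mark
    the low heights, the column of the cut and the high heights. The condition
    \<open>2 * (\<eta> * l) < \<epsilon>\<close> keeps what the shorter piece loses below the
    deficit \<open>\<epsilon>\<close>.\<close>
  define \<eta> where "\<eta> = min (t / 4) (\<epsilon> / (4 * l))"
  have \<eta>: "0 < \<eta>" "2 * \<eta> < t" and "\<eta> \<le> \<epsilon> / (4 * l)" using t \<epsilon> l by (auto simp: \<eta>_def)
  then have \<eta>l: "2 * (\<eta> * l) < \<epsilon>" using l \<epsilon> by (simp add: field_simps)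
  define i where "i = (\<lambda>N::nat. nat \<lceil>(t - \<eta>) * a * real N\<rceil>)"
  define e where "e = (\<lambda>N::nat. nat \<lceil>(t - 2 * \<eta>) * b * real N\<rceil>)"
  define D1 where "D1 = max 1 D'"
  have iD: "\<bar>real (i N) - (t - \<eta>) * a * real N\<bar> \<le> D1" for N
    using nat_ceil_bound[of "(t - \<eta>) * a" N] \<eta> ab by (auto simp: i_def D1_def le_max_iff_disj)
  have eD: "\<bar>real (e N) - (t - 2 * \<eta>) * b * real N\<bar> \<le> D1" for N
    using nat_ceil_bound[of "(t - 2 * \<eta>) * b" N] \<eta> ab by (auto simp: e_def D1_def le_max_iff_disj)
  have d1D: "\<bar>real (d1 N) - t * a * real N\<bar> \<le> D1" and d2D: "\<bar>real (d2 N) - t * b * real N\<bar> \<le> D1" for N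
    using d1[of N] d2[of N] by (auto simp: D1_def le_max_iff_disj)
  let ?\<theta> = "w - z"
  let ?A = "\<lambda>\<tau>. ln ((w + \<tau>) * z / ((z + \<tau>) * w))" and ?B = "\<lambda>\<tau>. ln ((1 - z - \<tau>) * (1 - w) / ((1 - w - \<tau>) * (1 - z)))"
  have dA: "(?A has_real_derivative (1 / w - 1 / z)) (at 0)" and dB: "(?B has_real_derivative (1 / (1 - w) - 1 / (1 - z))) (at 0)"
    using wz by (auto intro!: derivative_eq_intros simp: divide_simps) (simp_all add: algebra_simps)
  have aw: "a * (1 / w - 1 / z) = - (l * ?\<theta>)" "b * (1 / (1 - w) - 1 / (1 - z)) = l * ?\<theta>"
  proof -
    have "a * (1 / w) = l * z" "a * (1 / z) = l * w" "b * (1 / (1 - w)) = l * (1 - z)" "b * (1 / (1 - z)) = l * (1 - w)"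
      using wz by simp_all
    then show "a * (1 / w - 1 / z) = - (l * ?\<theta>)" "b * (1 / (1 - w) - 1 / (1 - z)) = l * ?\<theta>"
      by (simp_all only: right_diff_distrib[of a "1 / w"] right_diff_distrib[of b "1 / (1 - w)"]) (simp_all add: algebra_simps)
  qed
  \<comment> \<open>\<open>?F1\<close>, \<open>?F2\<close> and \<open>?F3\<close> are the exponential rates of the exits above, below and near the
    diagonal. Each vanishes at \<open>0\<close> with a negative derivative there, hence is negative for a small parameter.\<close>
  let ?F1 = "\<lambda>\<kappa>. (t - \<eta>) * a * ?A (- \<kappa>) + t * b * ?B (- \<kappa>)"
  have "(?F1 has_real_derivative ((t - \<eta>) * a * - (1 / w - 1 / z) + t * b * - (1 / (1 - w) - 1 / (1 - z)))) (at 0)"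
  proof -
    have "((\<lambda>\<kappa>. ?A (- \<kappa>)) has_real_derivative - (1 / w - 1 / z)) (at 0)" "((\<lambda>\<kappa>. ?B (- \<kappa>)) has_real_derivative - (1 / (1 - w) - 1 / (1 - z))) (at 0)"
      by (rule DERIV_mirror[THEN iffD1]; simp only: minus_zero dA dB)+
    then show ?thesis by (intro DERIV_add DERIV_cmult)
  qed
  moreover have "(t - \<eta>) * a * - (1 / w - 1 / z) + t * b * - (1 / (1 - w) - 1 / (1 - z)) = - \<eta> * (l * ?\<theta>)"
  proof -
    have "(t - \<eta>) * a * - X + t * b * - Y = - (t - \<eta>) * (a * X) - t * (b * Y)" for X Y by (simp add: algebra_simps)
    then show ?thesis by (simp only: aw; simp add: algebra_simps)
  qed
  ultimately have d1': "(?F1 has_real_derivative - \<eta> * (l * ?\<theta>)) (at 0)" by (simp only:)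
  have neg: "- \<eta> * (l * ?\<theta>) < 0" using \<eta> l wz by simp
  from DERIV_neg_ex[OF d1' neg wz(1)] obtain \<kappa>1 where k1: "0 < \<kappa>1" "\<kappa>1 < z" "?F1 \<kappa>1 < 0" using wz by auto
  let ?F2 = "\<lambda>\<kappa>. (t - \<eta>) * a * ?A \<kappa> + (t - 2 * \<eta>) * b * ?B \<kappa>"
  have "(?F2 has_real_derivative ((t - \<eta>) * a * (1 / w - 1 / z) + (t - 2 * \<eta>) * b * (1 / (1 - w) - 1 / (1 - z)))) (at 0)"
    by (intro DERIV_add DERIV_cmult dA dB)
  moreover have "(t - \<eta>) * a * (1 / w - 1 / z) + (t - 2 * \<eta>) * b * (1 / (1 - w) - 1 / (1 - z)) = - \<eta> * (l * ?\<theta>)"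
    unfolding mult.assoc[of _ a] mult.assoc[of _ b] aw by (simp add: algebra_simps)
  ultimately have d2': "(?F2 has_real_derivative - \<eta> * (l * ?\<theta>)) (at 0)" by (simp only:)
  have w1: "0 < 1 - w" using wz by simp
  from DERIV_neg_ex[OF d2' neg w1] obtain \<kappa>2 where k2: "0 < \<kappa>2" "\<kappa>2 < 1 - w" "?F2 \<kappa>2 < 0" using wz by auto
  let ?X = "\<lambda>\<sigma>. ln ((w - \<sigma>) / w)" and ?Y = "\<lambda>\<sigma>. ln ((1 - w) / (1 - w + \<sigma>))"
  let ?F3 = "\<lambda>\<sigma>. (t - \<eta>) * a * ?X \<sigma> + (t - 2 * \<eta>) * b * ?Y \<sigma> + \<sigma> * (t * l - \<epsilon>)"
  have "(?X has_real_derivative - (1 / w)) (at 0)" "(?Y has_real_derivative - (1 / (1 - w))) (at 0)"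
  proof -
    have "((\<lambda>\<sigma>. ln ((q - \<sigma>) / q)) has_real_derivative - (1 / q)) (at 0)" "((\<lambda>\<sigma>. ln (q / (q + \<sigma>))) has_real_derivative - (1 / q)) (at 0)"
      if "0 < q" for q :: real
      using that by (auto intro!: derivative_eq_intros simp: power2_eq_square)
    then show "(?X has_real_derivative - (1 / w)) (at 0)" "(?Y has_real_derivative - (1 / (1 - w))) (at 0)"
      using wz by auto
  qed
  then have "(?F3 has_real_derivative ((t - \<eta>) * a * - (1 / w) + (t - 2 * \<eta>) * b * - (1 / (1 - w)) + 1 * (t * l - \<epsilon>))) (at 0)"
    by (intro DERIV_add DERIV_cmult DERIV_cmult_right DERIV_ident)
  moreover have "(t - \<eta>) * a * - (1 / w) + (t - 2 * \<eta>) * b * - (1 / (1 - w)) + 1 * (t * l - \<epsilon>) < 0"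
  proof -
    have "(t - \<eta>) * a * - (1 / w) + (t - 2 * \<eta>) * b * - (1 / (1 - w)) + 1 * (t * l - \<epsilon>) = 2 * (\<eta> * l) - \<eta> * l * z - \<epsilon>"
    proof -
      have e: "(t - \<eta>) * a * - X + (t - 2 * \<eta>) * b * - Y + 1 * Z = - (t - \<eta>) * (a * X) - (t - 2 * \<eta>) * (b * Y) + Z" for X Y Z
        by (simp add: algebra_simps)
      have "a * (1 / w) = l * z" "b * (1 / (1 - w)) = l * (1 - z)" using wz by simp_all
      then show ?thesis by (simp only: e; simp add: algebra_simps)
    qed
    moreover have "0 < \<eta> * l * z" using \<eta> l wz by simp
    ultimately show ?thesis using \<eta>l by linarith
  qed
  ultimately obtain \<sigma> where s: "0 < \<sigma>" "\<sigma> < ?\<theta>" "?F3 \<sigma> < 0" using DERIV_neg_ex[of ?F3 _ ?\<theta>] wz by auto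
  define f1 where "f1 = (t - \<eta>) * a * ?A (- \<kappa>1) + t * b * ?B (- \<kappa>1)"
  define f2 where "f2 = (t - \<eta>) * a * ?A \<kappa>2 + (t - 2 * \<eta>) * b * ?B \<kappa>2"
  define f3 where "f3 = (t - \<eta>) * a * ?X \<sigma> + (t - 2 * \<eta>) * b * ?Y \<sigma> + \<sigma> * (t * l - \<epsilon>)"
  have f: "f1 < 0" "f2 < 0" "f3 < 0" using k1(3) k2(3) s(3) by (simp_all only: f1_def f2_def f3_def)
  define f where "f = max f1 (max f2 f3) / 2"
  have fneg: "f < 0" "f1 / 2 \<le> f" "f2 / 2 \<le> f" "f3 / 2 \<le> f" using f by (auto simp: f_def)
  have sB1: "?B (- \<kappa>1) \<le> 0" and sB2: "0 \<le> ?B \<kappa>2" and sY: "?Y \<sigma> \<le> 0"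
  proof -
    have "(1 - z - - \<kappa>1) * (1 - w) \<le> (1 - w - - \<kappa>1) * (1 - z)"
      using mult_left_mono[of z w \<kappa>1] wz k1 by (simp add: algebra_simps)
    then show "?B (- \<kappa>1) \<le> 0" using wz k1 by (subst ln_le_zero_iff) auto
    have "(1 - w - \<kappa>2) * (1 - z) \<le> (1 - z - \<kappa>2) * (1 - w)"
      using mult_left_mono[of z w \<kappa>2] wz k2 by (simp add: algebra_simps)
    then show "0 \<le> ?B \<kappa>2" using wz k2 by (subst ln_ge_zero_iff) auto
    show "?Y \<sigma> \<le> 0" using wz s by (subst ln_le_zero_iff) auto
  qed
  have E1: "\<forall>\<^sub>F N in sequentially. (1 + 0 * real N) * exp (0 + real (i N) * ?A (- \<kappa>1) + real (d2 N) * ?B (- \<kappa>1) + 0 * real N)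
    \<le> exp (((t - \<eta>) * a * ?A (- \<kappa>1) + t * b * ?B (- \<kappa>1) + 0) / 2 * real N)"
    by (rule exp_lin_eventually[OF iD d2D]) (use f(1) f1_def in simp_all)
  have E2: "\<forall>\<^sub>F N in sequentially. (1 + 0 * real N) * exp (0 + real (i N) * ?A \<kappa>2 + real (e N) * ?B \<kappa>2 + 0 * real N)
    \<le> exp (((t - \<eta>) * a * ?A \<kappa>2 + (t - 2 * \<eta>) * b * ?B \<kappa>2 + 0) / 2 * real N)"
    by (rule exp_lin_eventually[OF iD eD]) (use f(2) f2_def in simp_all)
  have E3: "\<forall>\<^sub>F N in sequentially. (1 + 0 * real N) * exp (0 + real (i N) * ?X \<sigma> + real (e N) * ?Y \<sigma> + \<sigma> * (t * l - \<epsilon>) * real N)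
    \<le> exp (((t - \<eta>) * a * ?X \<sigma> + (t - 2 * \<eta>) * b * ?Y \<sigma> + \<sigma> * (t * l - \<epsilon>)) / 2 * real N)"
    by (rule exp_lin_eventually[OF iD eD s(3)]) auto
  have i1: "\<forall>\<^sub>F N in sequentially. 1 \<le> i N" by (rule eventually_ge_linear[OF iD mult_pos_pos[OF _ ab(1)]]) (use \<eta> in linarith)
  have im: "\<forall>\<^sub>F N in sequentially. i N < m N"
  proof (rule eventually_less_linear[where D = "max D D1"])
    have "(t - \<eta>) * a < 1 * a" using t \<eta> by (intro mult_strict_right_mono ab) linarith
    then show "(t - \<eta>) * a < a" by (simp only: mult_1_left)
  qed (use iD m in \<open>auto simp: le_max_iff_disj\<close>)
  have id: "\<forall>\<^sub>F N in sequentially. i N < d1 N"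
    by (rule eventually_less_linear[OF iD d1D mult_strict_right_mono[OF _ ab(1)]]) (use \<eta> in linarith)
  let ?p = "\<lambda>N v. emeasure P {s \<in> space P. (L (d1 N) (d2 N) s \<le> (t * l - \<epsilon>) * real N) \<and>
    l * real N \<le> L (i N) v s + T (i N) (v - 1) (m N - i N) (Suc (n N) - v) s}"
  have "\<forall>\<^sub>F N in sequentially. \<forall>v\<in>{1..n N}. ?p N v \<le> ennreal (c0 * C N * exp (f * real N))"
    using E1 E2 E3 i1 im id
  proof (eventually_elim, intro ballI)
    fix N v
    assume E: "(1 + 0 * real N) * exp (0 + real (i N) * ?A (- \<kappa>1) + real (d2 N) * ?B (- \<kappa>1) + 0 * real N)
      \<le> exp (((t - \<eta>) * a * ?A (- \<kappa>1) + t * b * ?B (- \<kappa>1) + 0) / 2 * real N)"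
      "(1 + 0 * real N) * exp (0 + real (i N) * ?A \<kappa>2 + real (e N) * ?B \<kappa>2 + 0 * real N)
      \<le> exp (((t - \<eta>) * a * ?A \<kappa>2 + (t - 2 * \<eta>) * b * ?B \<kappa>2 + 0) / 2 * real N)"
      "(1 + 0 * real N) * exp (0 + real (i N) * ?X \<sigma> + real (e N) * ?Y \<sigma> + \<sigma> * (t * l - \<epsilon>) * real N)
      \<le> exp (((t - \<eta>) * a * ?X \<sigma> + (t - 2 * \<eta>) * b * ?Y \<sigma> + \<sigma> * (t * l - \<epsilon>)) / 2 * real N)"
      and i1: "1 \<le> i N" and im: "i N < m N" and id: "i N < d1 N" and v: "v \<in> {1..n N}"
    let ?K = "c0 * tilt_factor w z (m N) (n N)" and ?\<epsilon> = "exp (- (?\<theta> * (l * real N)))"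
    have K: "0 \<le> ?K" using wz by (simp add: tilt_factor_def)
    have KC: "?K * X * ?\<epsilon> = c0 * C N * X" for X by (simp only: cost_def mult_ac)
    have fin: "ennreal (c0 * C N * X) \<le> ennreal (c0 * C N * exp (f * real N))" if "X \<le> exp (f' / 2 * real N)" "f' / 2 \<le> f" for X f'
    proof -
      have "f' / 2 * real N \<le> f * real N" using that(2) by (rule mult_right_mono) simp
      then have "exp (f' / 2 * real N) \<le> exp (f * real N)" by (simp only: exp_le_cancel_iff)
      with that(1) have "X \<le> exp (f * real N)" by linarith
      moreover have "0 \<le> c0 * C N" using c0 C_nonneg[of N] by (intro mult_nonneg_nonneg) auto
      ultimately show ?thesis by (intro ennreal_leI mult_left_mono)
    qed
    have far: "?p N v \<le> ennreal (?K * ((w + \<tau>) * z / ((z + \<tau>) * w)) ^ i N * ((1 - z - \<tau>) * (1 - w) / ((1 - w - \<tau>) * (1 - z))) ^ v * ?\<epsilon>)"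
      if "- z < \<tau>" "\<tau> < 1 - w" for \<tau>
    proof -
      have "?p N v \<le> emeasure P {s \<in> space P. l * real N \<le> L (i N) v s + T (i N) (v - 1) (m N - i N) (Suc (n N) - v) s}"
        by (intro emeasure_mono) auto
      also have "\<dots> \<le> ennreal (?K * ((w + \<tau>) * z / ((z + \<tau>) * w)) ^ i N * ((1 - z - \<tau>) * (1 - w) / ((1 - w - \<tau>) * (1 - z))) ^ v * ?\<epsilon>)"
        by (rule exit_height_far[OF wz that i1 im v])
      finally show ?thesis .
    qed
    have pA: "((w + \<tau>) * z / ((z + \<tau>) * w)) ^ i N = exp (real (i N) * ?A \<tau>)"
      and pB: "((1 - z - \<tau>) * (1 - w) / ((1 - w - \<tau>) * (1 - z))) ^ v = exp (real v * ?B \<tau>)" if "- z < \<tau>" "\<tau> < 1 - w" for \<tau>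
      using that wz by (auto intro!: power_eq_exp divide_pos_pos mult_pos_pos)
    consider "d2 N < v" | "v \<le> e N" | "e N < v" "v \<le> d2 N" by linarith
    then show "?p N v \<le> ennreal (c0 * C N * exp (f * real N))"
    proof cases
      case 1
      have \<tau>: "- z < - \<kappa>1" "- \<kappa>1 < 1 - w" using k1 wz by auto
      have "?p N v \<le> ennreal (?K * (exp (real (i N) * ?A (- \<kappa>1)) * exp (real v * ?B (- \<kappa>1))) * ?\<epsilon>)"
        using far[OF \<tau>] unfolding pA[OF \<tau>] pB[OF \<tau>] by (simp only: mult.assoc)
      also have "\<dots> \<le> ennreal (c0 * C N * exp (f * real N))"
        unfolding KC
      proof (rule fin[OF _ fneg(2)])
        have "real v * ?B (- \<kappa>1) \<le> real (d2 N) * ?B (- \<kappa>1)" using 1 sB1 by (intro mult_right_mono_neg) auto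
        then have "exp (real (i N) * ?A (- \<kappa>1)) * exp (real v * ?B (- \<kappa>1)) \<le> exp (0 + real (i N) * ?A (- \<kappa>1) + real (d2 N) * ?B (- \<kappa>1) + 0 * real N)"
          unfolding exp_add[symmetric] by (simp only: exp_le_cancel_iff; linarith)
        also have "\<dots> \<le> exp (f1 / 2 * real N)" using E(1) by (simp only: f1_def mult_zero_left add_0_right mult_1_left)
        finally show "exp (real (i N) * ?A (- \<kappa>1)) * exp (real v * ?B (- \<kappa>1)) \<le> exp (f1 / 2 * real N)" .
      qed
      finally show ?thesis .
    next
      case 2
      have \<tau>: "- z < \<kappa>2" "\<kappa>2 < 1 - w" using k2 wz by auto
      have "?p N v \<le> ennreal (?K * (exp (real (i N) * ?A \<kappa>2) * exp (real v * ?B \<kappa>2)) * ?\<epsilon>)"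
        using far[OF \<tau>] unfolding pA[OF \<tau>] pB[OF \<tau>] by (simp only: mult.assoc)
      also have "\<dots> \<le> ennreal (c0 * C N * exp (f * real N))"
        unfolding KC
      proof (rule fin[OF _ fneg(3)])
        have "real v * ?B \<kappa>2 \<le> real (e N) * ?B \<kappa>2" using 2 sB2 by (intro mult_right_mono) auto
        then have "exp (real (i N) * ?A \<kappa>2) * exp (real v * ?B \<kappa>2) \<le> exp (0 + real (i N) * ?A \<kappa>2 + real (e N) * ?B \<kappa>2 + 0 * real N)"
          unfolding exp_add[symmetric] by (simp only: exp_le_cancel_iff; linarith)
        also have "\<dots> \<le> exp (f2 / 2 * real N)" using E(2) by (simp only: f2_def mult_zero_left add_0_right mult_1_left)
        finally show "exp (real (i N) * ?A \<kappa>2) * exp (real v * ?B \<kappa>2) \<le> exp (f2 / 2 * real N)" .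
      qed
      finally show ?thesis .
    next
      case 3
      have Lm: "L (i N) v s \<le> L (d1 N) (d2 N) s" for s
        using id 3 by (intro lpp_mono nonneg) auto
      have "?p N v \<le> emeasure P {s \<in> space P. L (i N) v s \<le> (t * l - \<epsilon>) * real N \<and> l * real N \<le> L (i N) v s + T (i N) (v - 1) (m N - i N) (Suc (n N) - v) s}"
        by (intro emeasure_mono) (auto intro: order_trans[OF Lm])
      also have "\<dots> \<le> ennreal (?K * ((w - \<sigma>) / w) ^ i N * ((1 - w) / (1 - w + \<sigma>)) ^ v * exp (\<sigma> * ((t * l - \<epsilon>) * real N) - ?\<theta> * (l * real N)))"
        by (rule exit_height_near[OF wz s(1,2) i1 im v])
      also have "?K * ((w - \<sigma>) / w) ^ i N * ((1 - w) / (1 - w + \<sigma>)) ^ v * exp (\<sigma> * ((t * l - \<epsilon>) * real N) - ?\<theta> * (l * real N)) =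
        ?K * (exp (real (i N) * ?X \<sigma>) * exp (real v * ?Y \<sigma>) * exp (\<sigma> * (t * l - \<epsilon>) * real N)) * ?\<epsilon>"
      proof -
        have q: "((w - \<sigma>) / w) ^ i N = exp (real (i N) * ?X \<sigma>)" "((1 - w) / (1 - w + \<sigma>)) ^ v = exp (real v * ?Y \<sigma>)"
          using s wz by (auto intro!: power_eq_exp)
        show ?thesis unfolding q diff_conv_add_uminus[of "\<sigma> * ((t * l - \<epsilon>) * real N)"] exp_add by (simp only: mult_ac)
      qed
      also have "ennreal (?K * (exp (real (i N) * ?X \<sigma>) * exp (real v * ?Y \<sigma>) * exp (\<sigma> * (t * l - \<epsilon>) * real N)) * ?\<epsilon>) \<le> ennreal (c0 * C N * exp (f * real N))"
        unfolding KC
      proof (rule fin[OF _ fneg(4)])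
        have "real v * ?Y \<sigma> \<le> real (e N) * ?Y \<sigma>" using 3 sY by (intro mult_right_mono_neg) auto
        then have "exp (real (i N) * ?X \<sigma>) * exp (real v * ?Y \<sigma>) * exp (\<sigma> * (t * l - \<epsilon>) * real N) \<le>
          exp (0 + real (i N) * ?X \<sigma> + real (e N) * ?Y \<sigma> + \<sigma> * (t * l - \<epsilon>) * real N)"
          unfolding exp_add[symmetric] by (simp only: exp_le_cancel_iff; linarith)
        also have "\<dots> \<le> exp (f3 / 2 * real N)" using E(3) by (simp only: f3_def mult_zero_left add_0_right mult_1_left)
        finally show "exp (real (i N) * ?X \<sigma>) * exp (real v * ?Y \<sigma>) * exp (\<sigma> * (t * l - \<epsilon>) * real N) \<le> exp (f3 / 2 * real N)" .
      qed
      finally show ?thesis .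
    qed
  qed
  from decays_sum_heights[OF fneg(1) this] show ?thesis
  proof (rule decays_mono)
    show "\<forall>\<^sub>F N in sequentially. emeasure P {s \<in> space P. L (d1 N) (d2 N) s \<le> (t * l - \<epsilon>) * real N \<and> l * real N \<le> L (m N) (n N) s} \<le> (\<Sum>v\<in>{1..n N}. ?p N v)"
      using i1 im mn_large
    proof eventually_elim
      case (elim N)
      have "emeasure P {s \<in> space P. L (d1 N) (d2 N) s \<le> (t * l - \<epsilon>) * real N \<and> l * real N \<le> L (m N) (n N) s} \<le>
        emeasure P (\<Union>v\<in>{1..n N}. {s \<in> space P. (L (d1 N) (d2 N) s \<le> (t * l - \<epsilon>) * real N) \<and>
          l * real N \<le> L (i N) v s + T (i N) (v - 1) (m N - i N) (Suc (n N) - v) s})"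
      proof (rule emeasure_mono)
        show "{s \<in> space P. L (d1 N) (d2 N) s \<le> (t * l - \<epsilon>) * real N \<and> l * real N \<le> L (m N) (n N) s} \<subseteq>
          (\<Union>v\<in>{1..n N}. {s \<in> space P. (L (d1 N) (d2 N) s \<le> (t * l - \<epsilon>) * real N) \<and>
          l * real N \<le> L (i N) v s + T (i N) (v - 1) (m N - i N) (Suc (n N) - v) s})"
        proof
          fix s assume s: "s \<in> {s \<in> space P. L (d1 N) (d2 N) s \<le> (t * l - \<epsilon>) * real N \<and> l * real N \<le> L (m N) (n N) s}"
          from column_exit[OF elim(1,2,4), of s] obtain v where v: "v \<in> {1..n N}"
            "L (m N) (n N) s \<le> L (i N) v s + T (i N) (v - 1) (m N - i N) (Suc (n N) - v) s" by blast
          with s show "s \<in> (\<Union>v\<in>{1..n N}. {s \<in> space P. (L (d1 N) (d2 N) s \<le> (t * l - \<epsilon>) * real N) \<and>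
            l * real N \<le> L (i N) v s + T (i N) (v - 1) (m N - i N) (Suc (n N) - v) s})"
            by (intro UN_I[OF v(1)]) auto
        qed
      qed auto
      also have "\<dots> \<le> (\<Sum>v\<in>{1..n N}. ?p N v)"
        by (rule emeasure_subadditive_finite) auto
      finally show ?case .
    qed
  qed
qed

text \<open>The starting point \<open>d1\<close>, \<open>d2\<close> is arbitrary: the lower tail is
  translation invariant and negative correlation ignores where the piece lies.\<close>

lemma bulk_deviation_decay:
  assumes \<rho>: "0 < \<rho>" and \<epsilon>: "0 < \<epsilon>"
    and p: "\<And>N. \<bar>real (p N) - \<rho> * z\<^sup>2 * real N\<bar> \<le> D'" and q: "\<And>N. \<bar>real (q N) - \<rho> * (1 - z)\<^sup>2 * real N\<bar> \<le> D'"
  shows "decays (\<lambda>N. emeasure P {s \<in> space P. T (d1 N) (d2 N) (p N) (q N) s \<le> (\<rho> - \<epsilon>) * real N \<and> l * real N \<le> L (m N) (n N) s}) C"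
proof -
  have z1: "z < 1" using wz by simp
  from lower_tail[OF wz(1) z1 \<rho> \<epsilon> p q] obtain c where c: "0 < c" "\<forall>\<^sub>F N in sequentially.
    emeasure (exp_laws ({1..p N} \<times> {1..q N}) 1) {x \<in> space (exp_laws ({1..p N} \<times> {1..q N}) 1). lpp x (p N) (q N) \<le> (\<rho> - \<epsilon>) * real N} \<le> ennreal (exp (- (c * real N)))"
    by blast
  from c(2) mn_large have "\<forall>\<^sub>F N in sequentially. emeasure P {s \<in> space P. T (d1 N) (d2 N) (p N) (q N) s \<le> (\<rho> - \<epsilon>) * real N \<and> l * real N \<le> L (m N) (n N) s}
    \<le> ennreal (C N * exp (- (c * real N)))"
  proof eventually_elim
    case (elim N)
    let ?S = "{1..p N} \<times> {1..q N}" and ?A = "(\<rho> - \<epsilon>) * real N"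
    let ?f = "\<lambda>x. indicator {y. y \<le> ?A} (lpp x (p N) (q N)) :: ennreal"
    have X: "(\<lambda>x. lpp x (p N) (q N)) \<in> borel_measurable (PiM ?S (\<lambda>_. borel))" by (rule lpp_measurable) simp
    then have f: "?f \<in> borel_measurable (PiM ?S (\<lambda>_. borel))" by measurable
    have X': "(\<lambda>x. lpp x (p N) (q N)) \<in> borel_measurable (exp_laws ?S 1)"
      using X by (subst measurable_cong_sets[OF sets_PiM_exp_law refl])
    have sub: "(\<lambda>v. (fst v + d1 N, snd v + d2 N)) ` ?S \<subseteq> {1..} \<times> {1..}" by auto
    have "emeasure P {s \<in> space P. T (d1 N) (d2 N) (p N) (q N) s \<le> ?A} = (\<integral>\<^sup>+s. ?f (shifted (d1 N) (d2 N) (wt s)) \<partial>P)"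
      by (rule emeasure_le_eq_nn_integral) measurable
    also have "\<dots> = (\<integral>\<^sup>+s. ?f (restrict (shifted (d1 N) (d2 N) (wt s)) ?S) \<partial>P)"
      by (simp only: lpp_restrict[OF order_refl])
    also have "\<dots> = (\<integral>\<^sup>+x. ?f x \<partial>exp_laws ?S 1)" by (rule block_law[OF sub _ f]) simp
    also have "\<dots> = emeasure (exp_laws ?S 1) {x \<in> space (exp_laws ?S 1). lpp x (p N) (q N) \<le> ?A}"
      by (rule emeasure_le_eq_nn_integral[OF X', symmetric])
    also have "\<dots> \<le> ennreal (exp (- (c * real N)))" by (rule elim(1))
    finally have T: "emeasure P {s \<in> space P. T (d1 N) (d2 N) (p N) (q N) s \<le> ?A} \<le> ennreal (exp (- (c * real N)))" .
    have "emeasure P {s \<in> space P. T (d1 N) (d2 N) (p N) (q N) s \<le> ?A \<and> l * real N \<le> L (m N) (n N) s} \<le>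
      emeasure P {s \<in> space P. T (d1 N) (d2 N) (p N) (q N) s \<le> ?A} * emeasure P {s \<in> space P. l * real N \<le> L (m N) (n N) s}"
      by (rule negative_association)
    also have "\<dots> \<le> ennreal (exp (- (c * real N))) * ennreal (C N)"
      unfolding cost_def by (intro mult_mono T upper_tail wz elim) auto
    also have "\<dots> = ennreal (C N * exp (- (c * real N)))"
      using C_nonneg by (subst ennreal_mult[symmetric]) (auto simp: mult.commute)
    finally show ?case .
  qed
  with c(1) show ?thesis unfolding decays_def by blast
qed

text \<open>The two directions differ in kind: an upper deviation is excluded by one moment bound, a
  lower one by superadditivity along a broken route, half of \<open>\<epsilon>\<close> being
  allotted to each of its two pieces.\<close>

lemma shape_deviation_decay:
  assumes x: "0 < x" "x \<le> y" and y: "y < 1" and cone: "z * (1 - w) * y < w * (1 - z) * x" and \<epsilon>: "0 < \<epsilon>"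
  defines "i \<equiv> \<lambda>N::nat. nat \<lceil>x * a * real N\<rceil>" and "j \<equiv> \<lambda>N::nat. nat \<lceil>y * b * real N\<rceil>"
  shows "decays (\<lambda>N. emeasure P {s \<in> space P. \<epsilon> * real N < \<bar>L (i N) (j N) s - l * (w * x + (1 - w) * y) * real N\<bar> \<and>
    l * real N \<le> L (m N) (n N) s}) C"
proof -
  define h where "h = l * (w * x + (1 - w) * y)"
  have iD: "\<bar>real (i N) - x * a * real N\<bar> \<le> 1" and jD: "\<bar>real (j N) - y * b * real N\<bar> \<le> 1" for N
  proof -
    have "0 \<le> x * a" "0 \<le> y * b" using mult_nonneg_nonneg[of x a] mult_nonneg_nonneg[of y b] x ab by linarith+
    then show "\<bar>real (i N) - x * a * real N\<bar> \<le> 1" "\<bar>real (j N) - y * b * real N\<bar> \<le> 1"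
      unfolding i_def j_def using nat_ceil_bound[of "x * a" N] nat_ceil_bound[of "y * b" N] by blast+
  qed
  let ?A = "\<lambda>N. {s \<in> space P. (h + \<epsilon>) * real N \<le> L (i N) (j N) s \<and> l * real N \<le> L (m N) (n N) s}"
  let ?B = "\<lambda>N. {s \<in> space P. L (i N) (j N) s \<le> (h - \<epsilon>) * real N \<and> l * real N \<le> L (m N) (n N) s}"
  let ?S = "\<lambda>N. {s \<in> space P. \<epsilon> * real N < \<bar>L (i N) (j N) s - h * real N\<bar> \<and> l * real N \<le> L (m N) (n N) s}"
  have A: "decays (\<lambda>N. emeasure P (?A N)) C"
    unfolding h_def by (rule upper_deviation_decay[OF _ _ _ _ \<epsilon> iD jD]) (use x y in auto)
  \<comment> \<open>The path to \<open>(x a, y b)\<close> follows the diagonal up to the fraction \<open>t\<close> and then runs in the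
    characteristic direction of \<open>z\<close>.\<close>
  define \<kappa> where "\<kappa> = z * (1 - w) / (w * (1 - z))"
  have \<kappa>: "0 < \<kappa>" "\<kappa> < 1" using wz by (auto simp: \<kappa>_def algebra_simps)
  have kx: "\<kappa> * y < x" using cone wz by (simp add: \<kappa>_def field_simps)
  \<comment> \<open>The solution of x - t = \<open>\<kappa>\<close> (y - t). With this
    \<open>\<kappa>\<close>, which is the reciprocal of the slope bounding the cone, it says that (x
    - t) a and (y - t) b stand in the ratio z^2 to (1 - z)^2.\<close>
  define t where "t = (x - \<kappa> * y) / (1 - \<kappa>)"
  have t: "0 < t" "t \<le> x" "t \<le> y" "x - t = \<kappa> * (y - t)" "y - t = (y - x) / (1 - \<kappa>)"
  proof -
    show "0 < t" using kx \<kappa> by (simp add: t_def)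
    show e: "y - t = (y - x) / (1 - \<kappa>)" using \<kappa> by (simp add: t_def field_simps)
    show e': "x - t = \<kappa> * (y - t)" using \<kappa> unfolding e by (simp add: t_def field_simps)
    have "0 \<le> y - t" unfolding e using x \<kappa> by simp
    then show "t \<le> y" by simp
    have "0 \<le> x - t" unfolding e' using \<open>0 \<le> y - t\<close> \<kappa> by simp
    then show "t \<le> x" by simp
  qed
  define d1 where "d1 = (\<lambda>N::nat. nat \<lceil>t * a * real N\<rceil>)"
  define d2 where "d2 = (\<lambda>N::nat. nat \<lceil>t * b * real N\<rceil>)"
  have d1D: "\<bar>real (d1 N) - t * a * real N\<bar> \<le> 1" and d2D: "\<bar>real (d2 N) - t * b * real N\<bar> \<le> 1" for N
  proof -
    have "0 \<le> t * a" "0 \<le> t * b" using mult_nonneg_nonneg[of t a] mult_nonneg_nonneg[of t b] t(1) ab by linarith+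
    then show "\<bar>real (d1 N) - t * a * real N\<bar> \<le> 1" "\<bar>real (d2 N) - t * b * real N\<bar> \<le> 1"
      unfolding d1_def d2_def using nat_ceil_bound[of "t * a" N] nat_ceil_bound[of "t * b" N] by blast+
  qed
  have di: "d1 N \<le> i N" "d2 N \<le> j N" for N
    unfolding d1_def d2_def i_def j_def
    by (rule nat_mono, rule ceiling_mono, rule mult_right_mono, rule mult_right_mono, rule t less_imp_le[OF ab(1)] less_imp_le[OF ab(2)],
      rule less_imp_le[OF ab(1)] less_imp_le[OF ab(2)], simp)+
  have \<epsilon>2: "0 < \<epsilon> / 2" using \<epsilon> by simp
  let ?D = "\<lambda>N. {s \<in> space P. L (d1 N) (d2 N) s \<le> (t * l - \<epsilon> / 2) * real N \<and> l * real N \<le> L (m N) (n N) s}"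
  have D: "decays (\<lambda>N. emeasure P (?D N)) C"
    by (rule diagonal_deviation_decay[OF _ _ \<epsilon>2 d1D d2D]) (use t y in auto)
  have B: "decays (\<lambda>N. emeasure P (?B N)) C"
  \<comment> \<open>On the diagonal the second piece is empty, so \<open>\<rho>\<close> would be 0,
    which \<open>bulk_deviation_decay\<close> does not allow.\<close>
  proof (cases "x = y")
    case True
    then have tx: "t = x" using t(5) by simp
    then have ij: "d1 = i" "d2 = j" by (simp_all add: d1_def d2_def i_def j_def True)
    have h: "h = t * l" by (simp add: h_def tx True algebra_simps)
    show ?thesis
      using D
    proof (rule decays_mono, intro always_eventually allI emeasure_mono)
      fix N
      have "(t * l - \<epsilon>) * real N \<le> (t * l - \<epsilon> / 2) * real N" using \<epsilon> by (intro mult_right_mono) auto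
      then show "?B N \<subseteq> ?D N" unfolding ij h by auto
    qed auto
  next
    case False
    then have xy: "x < y" using x by simp
    \<comment> \<open>Determined by \<open>\<rho> * (1 - z)\<^sup>2 = (y - t) * b\<close>. It is the
      size of the second piece and at the same time its limiting passage time, whence h = t l +
      \<open>\<rho>\<close>.\<close>
    define \<rho> where "\<rho> = (y - t) * l * (1 - w) / (1 - z)"
    have yt: "0 < y - t" unfolding t(5) using xy \<kappa> by simp
    have \<rho>: "0 < \<rho>" using yt l wz by (simp add: \<rho>_def)
    have r1: "\<rho> * z\<^sup>2 = (x - t) * a"
      unfolding t(4) using wz by (simp add: \<rho>_def \<kappa>_def power2_eq_square field_simps)
    have r2: "\<rho> * (1 - z)\<^sup>2 = (y - t) * b"
      using wz by (simp add: \<rho>_def power2_eq_square)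
    have h: "h = t * l + \<rho>"
    proof -
      have e1: "l * w * (x - t) = \<rho> * z" unfolding t(4) using wz by (simp add: \<rho>_def \<kappa>_def field_simps)
      have e2: "l * (1 - w) * (y - t) = \<rho> * (1 - z)" using wz by (simp add: \<rho>_def)
      have "h = t * l + (l * w * (x - t) + l * (1 - w) * (y - t))" by (simp add: h_def algebra_simps)
      also have "\<dots> = t * l + \<rho>" unfolding e1 e2 by (simp add: algebra_simps)
      finally show ?thesis .
    qed
    define p where "p = (\<lambda>N. i N - d1 N)"
    define q where "q = (\<lambda>N. j N - d2 N)"
    have pD: "\<bar>real (p N) - \<rho> * z\<^sup>2 * real N\<bar> \<le> 2" for N
      unfolding r1 p_def left_diff_distrib using iD[of N] d1D[of N] di[of N] by (auto simp: of_nat_diff abs_le_iff)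
    have qD: "\<bar>real (q N) - \<rho> * (1 - z)\<^sup>2 * real N\<bar> \<le> 2" for N
      unfolding r2 q_def left_diff_distrib using jD[of N] d2D[of N] di[of N] by (auto simp: of_nat_diff abs_le_iff)
    let ?E = "\<lambda>N. {s \<in> space P. T (d1 N) (d2 N) (p N) (q N) s \<le> (\<rho> - \<epsilon> / 2) * real N \<and> l * real N \<le> L (m N) (n N) s}"
    have E: "decays (\<lambda>N. emeasure P (?E N)) C"
      by (rule bulk_deviation_decay[OF \<rho> \<epsilon>2 pD qD])
    from decays_add[OF D E C_nonneg] show ?thesis
    proof (rule decays_mono, intro always_eventually allI)
      fix N
      have "?B N \<subseteq> ?D N \<union> ?E N"
      proof
        fix s assume s: "s \<in> ?B N"
        have "L (d1 N) (d2 N) s + T (d1 N) (d2 N) (p N) (q N) s \<le> L (d1 N + p N) (d2 N + q N) s"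
          by (rule lpp_superadditive) (rule nonneg)
        also have "d1 N + p N = i N" using di[of N] by (auto simp: p_def)
        also have "d2 N + q N = j N" using di[of N] by (auto simp: q_def)
        finally have "L (d1 N) (d2 N) s + T (d1 N) (d2 N) (p N) (q N) s \<le> (h - \<epsilon>) * real N" using s by auto
        moreover have "(h - \<epsilon>) * real N = (t * l - \<epsilon> / 2) * real N + (\<rho> - \<epsilon> / 2) * real N" by (simp add: h algebra_simps)
        ultimately have "L (d1 N) (d2 N) s \<le> (t * l - \<epsilon> / 2) * real N \<or> T (d1 N) (d2 N) (p N) (q N) s \<le> (\<rho> - \<epsilon> / 2) * real N"
          by linarith
        with s show "s \<in> ?D N \<union> ?E N" by auto
      qed
      then have "emeasure P (?B N) \<le> emeasure P (?D N \<union> ?E N)" by (intro emeasure_mono) auto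
      also have "\<dots> \<le> emeasure P (?D N) + emeasure P (?E N)" by (intro emeasure_subadditive) auto
      finally show "emeasure P (?B N) \<le> emeasure P (?D N) + emeasure P (?E N)" .
    qed
  qed
  from decays_add[OF A B C_nonneg] show ?thesis
    unfolding h_def[symmetric]
  proof (rule decays_mono, intro always_eventually allI)
    fix N
    have "?S N \<subseteq> ?A N \<union> ?B N"
    proof
      fix s assume s: "s \<in> ?S N"
      then have "(h + \<epsilon>) * real N \<le> L (i N) (j N) s \<or> L (i N) (j N) s \<le> (h - \<epsilon>) * real N"
        unfolding distrib_right left_diff_distrib by (auto simp: abs_if split: if_splits)
      with s show "s \<in> ?A N \<union> ?B N" by auto
    qed
    then have "emeasure P (?S N) \<le> emeasure P (?A N \<union> ?B N)" by (intro emeasure_mono) auto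
    also have "\<dots> \<le> emeasure P (?A N) + emeasure P (?B N)" by (intro emeasure_subadditive) auto
    finally show "emeasure P (?S N) \<le> emeasure P (?A N) + emeasure P (?B N)" .
  qed
qed

end

subsection \<open>Conditioning on the passage time\<close>

definition expcdf :: "real \<Rightarrow> real" where
  "expcdf u = max 0 (1 - exp (- u))"

text \<open>The value at \<open>0\<close> is the symmetric derivative of \<open>expcdf\<close>, which is what symmetric windows see.\<close>

definition expdens :: "real \<Rightarrow> real" where
  "expdens u = (if u < 0 then 0 else if u = 0 then 1 / 2 else exp (- u))"

lemma measure_exp_law_atMost: "measure (exp_law 1) {..u} = expcdf u"
proof -
  have "emeasure (exp_law 1) {..u} = ennreal (erlang_CDF 0 1 u)"
    unfolding exp_law_def by (rule emeasure_erlang_density) simp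
  then show ?thesis by (auto simp: measure_def erlang_CDF_def expcdf_def)
qed

lemma AE_exp_law_neq: "AE x in exp_law r. x \<noteq> a"
  unfolding exp_law_def by (subst AE_density) (use AE_lborel_singleton[of a] in auto)

lemma measure_exp_law_interval:
  assumes "u \<le> v"
  shows "measure (exp_law 1) {u<..v} = expcdf v - expcdf u"
proof -
  interpret prob_space "exp_law 1" by (rule prob_space_exp_law) simp
  have "{u<..v} = {..v} - {..u}" by auto
  then show ?thesis using assms by (simp add: finite_measure_Diff measure_exp_law_atMost)
qed

lemma measure_exp_law_open: "u \<le> v \<Longrightarrow> measure (exp_law 1) {u<..<v} = expcdf v - expcdf u"
  by (subst measure_exp_law_interval[symmetric], assumption, rule measure_eq_AE)
    (use AE_exp_law_neq[of v 1] in \<open>auto elim!: eventually_mono\<close>)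

lemma measure_exp_law_lessThan: "u \<le> v \<Longrightarrow> measure (exp_law 1) {u..<v} = expcdf v - expcdf u"
proof (subst measure_exp_law_interval[symmetric], assumption, rule measure_eq_AE)
  show "AE x in exp_law 1. x \<in> {u..<v} \<longleftrightarrow> x \<in> {u<..v}"
    using AE_exp_law_neq[of u 1] AE_exp_law_neq[of v 1] by eventually_elim auto
qed auto

lemma measure_exp_law_atLeast: "measure (exp_law 1) {u..} = 1 - expcdf u"
proof -
  interpret prob_space "exp_law 1" by (rule prob_space_exp_law) simp
  have "measure (exp_law 1) {u..} = measure (exp_law 1) (space (exp_law 1) - {..u})"
    by (rule measure_eq_AE) (use AE_exp_law_neq[of u 1] in \<open>auto elim!: eventually_mono\<close>)
  also have "\<dots> = 1 - expcdf u" by (subst prob_compl) (auto simp: measure_exp_law_atMost)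
  finally show ?thesis .
qed

lemma expcdf_mono: "u \<le> v \<Longrightarrow> expcdf u \<le> expcdf v"
  unfolding expcdf_def by (intro max.mono) auto

text \<open>Supplies the constant bound under which the shrinking-window quotients converge
  dominatedly in \<open>endpoint_density\<close>.\<close>

lemma expcdf_lipschitz:
  assumes "u \<le> v"
  shows "expcdf v - expcdf u \<le> v - u"
proof -
  have *: "exp (- a) - exp (- b) \<le> b - a" if "0 \<le> a" "a \<le> b" for a b :: real
  proof -
    have "1 - exp (- (b - a)) \<le> b - a" using exp_ge_add_one_self[of "- (b - a)"] by linarith
    then have "exp (- a) * (1 - exp (- (b - a))) \<le> 1 * (b - a)"
      using that by (intro mult_mono) auto
    then show ?thesis by (simp add: right_diff_distrib exp_add[symmetric])
  qed
  have p: "expcdf t = (if t \<le> 0 then 0 else 1 - exp (- t))" for t by (auto simp: expcdf_def)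
  show ?thesis using assms *[of u v] *[of 0 v] by (auto simp: p)
qed

lemma expcdf_symmetric_difference:
  "((\<lambda>\<delta>. (expcdf (u + \<delta>) - expcdf (u - \<delta>)) / (2 * \<delta>)) \<longlongrightarrow> expdens u) (at_right 0)"
proof -
  have p: "expcdf t = (if t \<le> 0 then 0 else 1 - exp (- t))" for t by (auto simp: expcdf_def)
  consider "u < 0" | "u = 0" | "0 < u" by linarith
  then show ?thesis
  proof cases
    case 1
    then have "\<forall>\<^sub>F \<delta> in at_right 0. (expcdf (u + \<delta>) - expcdf (u - \<delta>)) / (2 * \<delta>) = 0"
      using eventually_at_right_real[of 0 "- u"] by (auto elim!: eventually_mono simp: p)
    then show ?thesis using 1 by (simp add: expdens_def tendsto_eventually)
  next
    case 2
    have "((\<lambda>\<delta>::real. (1 - exp (- \<delta>)) / (2 * \<delta>)) \<longlongrightarrow> 1 / 2) (at_right 0)" by real_asymp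
    moreover have "\<forall>\<^sub>F \<delta> in at_right 0. (1 - exp (- \<delta>)) / (2 * \<delta>) = (expcdf (u + \<delta>) - expcdf (u - \<delta>)) / (2 * \<delta>)"
      using eventually_at_right_real[of 0 1] 2 by (auto elim!: eventually_mono simp: p)
    ultimately show ?thesis using 2 by (auto simp: expdens_def intro: Lim_transform_eventually)
  next
    case 3
    have "((\<lambda>\<delta>::real. exp (- u) * ((exp \<delta> - exp (- \<delta>)) / (2 * \<delta>))) \<longlongrightarrow> exp (- u) * 1) (at_right 0)"
      by (intro tendsto_mult tendsto_const) real_asymp
    moreover have "\<forall>\<^sub>F \<delta> in at_right 0. exp (- u) * ((exp \<delta> - exp (- \<delta>)) / (2 * \<delta>)) = (expcdf (u + \<delta>) - expcdf (u - \<delta>)) / (2 * \<delta>)"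
      using eventually_at_right_real[of 0 u] 3
      by (auto elim!: eventually_mono simp: p right_diff_distrib exp_add[symmetric])
    ultimately show ?thesis using 3 by (auto simp: expdens_def intro: Lim_transform_eventually)
  qed
qed

text \<open>At rate 1 density and tail coincide for positive arguments. This turns the numerator
  density of a conditional probability into a tail probability.\<close>

lemma expdens_le_tail: "expdens u \<le> 1 - expcdf u"
  by (auto simp: expdens_def expcdf_def)

text \<open>The window lies in [u - t, infinity), whose mass is at most exp(t) times the density at
  a positive u. It provides the lower bound for the denominator density.\<close>

lemma window_le_expdens:
  assumes "0 \<le> t"
  shows "expcdf u - expcdf (u - t) \<le> exp t * expdens u"
proof (cases "0 < u")
  case True
  have "expcdf u - expcdf (u - t) \<le> (1 - exp (- u)) - (1 - exp (- (u - t)))"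
    using True by (auto simp: expcdf_def)
  also have "\<dots> \<le> exp (- (u - t))" by simp
  also have "\<dots> = exp t * expdens u" using True by (simp add: expdens_def exp_add[symmetric])
  finally show ?thesis .
next
  case False
  then have "expcdf u = 0" "expcdf (u - t) = 0" using assms by (auto simp: expcdf_def)
  then show ?thesis by (simp add: expdens_def)
qed

lemma expdens_measurable [measurable]: "expdens \<in> borel_measurable borel"
  unfolding expdens_def by measurable

lemma expcdf_measurable [measurable]: "expcdf \<in> borel_measurable borel"
  unfolding expcdf_def by measurable

context bulk begin

text \<open>The weight of the endpoint is independent of all other weights, so the law of the passage
  time jointly with an event of the other weights has an explicit density.\<close>

lemma endpoint_density:
  assumes mn: "1 \<le> m" "1 \<le> n" and ij: "i \<le> m" "j \<le> n" "i < m \<or> j < n" and U: "U \<in> sets borel" and t: "0 \<le> t"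
  shows "\<exists>I\<ge>0. ((\<lambda>\<delta>. prob {s \<in> space P. L i j s \<in> U \<and> L m n s \<in> {c - \<delta><..<c + \<delta>}} / (2 * \<delta>)) \<longlongrightarrow> I) (at_right 0) \<and>
    I \<le> prob {s \<in> space P. L i j s \<in> U \<and> c \<le> L m n s} \<and>
    prob {s \<in> space P. L i j s \<in> U \<and> c - t \<le> L m n s \<and> L m n s < c} \<le> exp t * I"
proof -
  obtain m' n' where m': "m = Suc m'" "n = Suc n'" using mn by (metis Suc_le_D One_nat_def)
  let ?A = "{1..m} \<times> {1..n}"
  define B where "B = ?A - {(m, n)}"
  have AB: "?A = insert (m, n) B" "finite B" "(m, n) \<notin> B" using mn by (auto simp: B_def)
  let ?Q = "exp_laws B 1"
  interpret Q: prob_space ?Q by (rule prob_space_exp_laws) simp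
  interpret E: prob_space "exp_law 1" by (rule prob_space_exp_law) simp
  \<comment> \<open>The passage time to (m, n) is the corner weight plus \<open>Y\<close>, and
    neither \<open>Y\<close> nor the passage time to (i, j) sees the corner. Hence everything else
    can be integrated last.\<close>
  define Y where "Y x = max (lpp x m' n) (lpp x m n')" for x
  have bB: "(\<lambda>x. lpp x i' j') \<in> borel_measurable (PiM B (\<lambda>_. borel))" if "i' \<le> m" "j' \<le> n" "i' < m \<or> j' < n" for i' j'
    using that by (intro lpp_measurable) (auto simp: B_def)
  have [measurable]: "(\<lambda>x. lpp x i j) \<in> borel_measurable ?Q" "Y \<in> borel_measurable ?Q"
    unfolding Y_def using bB[OF ij] bB[of m' n] bB[of m n'] m'
    by (auto simp: measurable_cong_sets[OF sets_PiM_exp_law refl])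
  have upd: "lpp (x((m, n) := c)) i' j' = lpp x i' j'" if "i' \<le> m" "j' \<le> n" "i' < m \<or> j' < n" for x c i' j'
    using that by (intro boundary_lpp_cong) auto
  have updmn: "lpp (x((m, n) := c)) m n = c + Y x" for x c
  proof -
    have "lpp (x((m, n) := c)) m n = c + max (lpp (x((m, n) := c)) m' n) (lpp (x((m, n) := c)) m n')"
      by (simp add: m')
    then show ?thesis using upd[of m' n] upd[of m n'] by (simp add: Y_def m')
  qed
  have key: "prob {s \<in> space P. L i j s \<in> U \<and> L m n s \<in> S} = (\<integral>x. indicator U (lpp x i j) * measure (exp_law 1) {c. c + Y x \<in> S} \<partial>?Q)"
    if S [measurable]: "S \<in> sets borel" for S
  proof -
    note U [measurable]
    let ?F = "\<lambda>x. indicator U (lpp x i j) * indicator S (lpp x m n) :: ennreal"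
    have [measurable]: "(\<lambda>x. lpp x i j) \<in> borel_measurable (PiM ?A (\<lambda>_. borel))" "(\<lambda>x. lpp x m n) \<in> borel_measurable (PiM ?A (\<lambda>_. borel))"
      using ij by (auto intro!: lpp_measurable)
    have F: "?F \<in> borel_measurable (PiM ?A (\<lambda>_. borel))" by measurable
    have sub: "(\<lambda>v. (fst v + 0, snd v + 0)) ` ?A \<subseteq> {1..} \<times> {1..}" by auto
    have r: "lpp (restrict (wt s) ?A) i j = L i j s" "lpp (restrict (wt s) ?A) m n = L m n s" for s
      using ij by (auto intro!: lpp_restrict)
    have "emeasure P {s \<in> space P. L i j s \<in> U \<and> L m n s \<in> S} = (\<integral>\<^sup>+s. indicator {s \<in> space P. L i j s \<in> U \<and> L m n s \<in> S} s \<partial>P)"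
      by simp
    also have "\<dots> = (\<integral>\<^sup>+s. ?F (restrict (shifted 0 0 (wt s)) ?A) \<partial>P)"
      unfolding shifted_0_0 r by (intro nn_integral_cong) (auto simp: indicator_def)
    also have "\<dots> = (\<integral>\<^sup>+x. ?F x \<partial>exp_laws ?A 1)" by (rule block_law[OF sub _ F]) simp
    also have "\<dots> = (\<integral>\<^sup>+x. \<integral>\<^sup>+c. ?F (x((m, n) := c)) \<partial>exp_law 1 \<partial>?Q)"
      unfolding AB(1)
      by (rule exp_law.product_nn_integral_insert[OF AB(2,3)], unfold AB(1)[symmetric] measurable_cong_sets[OF sets_PiM_exp_law refl]) (rule F)
    also have "\<dots> = (\<integral>\<^sup>+x. ennreal (indicator U (lpp x i j) * measure (exp_law 1) {c. c + Y x \<in> S}) \<partial>?Q)"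
    proof (rule nn_integral_cong)
      fix x
      have m: "{c. c + Y x \<in> S} \<in> sets borel" by measurable
      have "(\<integral>\<^sup>+c. ?F (x((m, n) := c)) \<partial>exp_law 1) = (\<integral>\<^sup>+c. indicator U (lpp x i j) * indicator {c. c + Y x \<in> S} c \<partial>exp_law 1)"
        unfolding updmn upd[OF ij] by (intro nn_integral_cong) (auto simp: indicator_def)
      also have "\<dots> = indicator U (lpp x i j) * emeasure (exp_law 1) {c. c + Y x \<in> S}"
        using m by (simp add: nn_integral_cmult)
      finally show "(\<integral>\<^sup>+c. ?F (x((m, n) := c)) \<partial>exp_law 1) = ennreal (indicator U (lpp x i j) * measure (exp_law 1) {c. c + Y x \<in> S})"
        by (auto simp: E.emeasure_eq_measure indicator_def)
    qed
    finally have e: "emeasure P {s \<in> space P. L i j s \<in> U \<and> L m n s \<in> S} =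
      (\<integral>\<^sup>+x. ennreal (indicator U (lpp x i j) * measure (exp_law 1) {c. c + Y x \<in> S}) \<partial>?Q)" .
    have mm: "(\<lambda>x. measure (exp_law 1) {c. c + Y x \<in> S}) \<in> borel_measurable ?Q"
    proof -
      have "(\<lambda>x. \<integral>\<^sup>+c. indicator S (c + Y x) \<partial>exp_law 1) \<in> borel_measurable ?Q" by measurable
      then have "(\<lambda>x. enn2real (\<integral>\<^sup>+c. indicator S (c + Y x) \<partial>exp_law 1)) \<in> borel_measurable ?Q" by measurable
      also have "(\<lambda>x. enn2real (\<integral>\<^sup>+c. indicator S (c + Y x) \<partial>exp_law 1)) = (\<lambda>x. measure (exp_law 1) {c. c + Y x \<in> S})"
      proof
        fix x
        have m: "{c. c + Y x \<in> S} \<in> sets borel" by measurable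
        have "(\<integral>\<^sup>+c. indicator S (c + Y x) \<partial>exp_law 1) = (\<integral>\<^sup>+c. indicator {c. c + Y x \<in> S} c \<partial>exp_law 1)"
          by (intro nn_integral_cong) (auto simp: indicator_def)
        then show "enn2real (\<integral>\<^sup>+c. indicator S (c + Y x) \<partial>exp_law 1) = measure (exp_law 1) {c. c + Y x \<in> S}"
          using m by (simp add: measure_def)
      qed
      finally show ?thesis .
    qed
    have "prob {s \<in> space P. L i j s \<in> U \<and> L m n s \<in> S} =
      enn2real (\<integral>\<^sup>+x. ennreal (indicator U (lpp x i j) * measure (exp_law 1) {c. c + Y x \<in> S}) \<partial>?Q)"
      unfolding measure_def e ..
    also have "\<dots> = (\<integral>x. indicator U (lpp x i j) * measure (exp_law 1) {c. c + Y x \<in> S} \<partial>?Q)"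
      by (rule integral_eq_nn_integral[symmetric]) (use mm in measurable)
    finally show ?thesis .
  qed
  note U [measurable]
  let ?u = "\<lambda>x. c - Y x" and ?i = "\<lambda>x. indicator U (lpp x i j) :: real"
  have k1: "prob {s \<in> space P. L i j s \<in> U \<and> L m n s \<in> {c - \<delta><..<c + \<delta>}} = (\<integral>x. ?i x * (expcdf (?u x + \<delta>) - expcdf (?u x - \<delta>)) \<partial>?Q)"
    if "0 \<le> \<delta>" for \<delta>
  proof -
    have "{q. q + Y x \<in> {c - \<delta><..<c + \<delta>}} = {?u x - \<delta><..<?u x + \<delta>}" for x by auto
    then show ?thesis using that by (subst key) (auto simp: measure_exp_law_open)
  qed
  have k2: "prob {s \<in> space P. L i j s \<in> U \<and> c \<le> L m n s} = (\<integral>x. ?i x * (1 - expcdf (?u x)) \<partial>?Q)"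
  proof -
    have "{q. q + Y x \<in> {c..}} = {?u x..}" for x by auto
    then show ?thesis using key[of "{c..}"] by (simp add: measure_exp_law_atLeast)
  qed
  have k3: "prob {s \<in> space P. L i j s \<in> U \<and> c - t \<le> L m n s \<and> L m n s < c} = (\<integral>x. ?i x * (expcdf (?u x) - expcdf (?u x - t)) \<partial>?Q)"
  proof -
    have "{q. q + Y x \<in> {c - t..<c}} = {?u x - t..<?u x}" for x by auto
    then show ?thesis using key[of "{c - t..<c}"] t by (simp add: measure_exp_law_lessThan)
  qed
  have b1: "0 \<le> expcdf u" "expcdf u \<le> 1" "0 \<le> expdens u" "expdens u \<le> 1" for u
    by (auto simp: expcdf_def expdens_def)
  have int: "integrable ?Q (\<lambda>x. ?i x * f x)" if [measurable]: "f \<in> borel_measurable ?Q" and "\<And>x. \<bar>f x\<bar> \<le> 2" for f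
    by (rule Q.integrable_const_bound[where B = 2]) (use that(2) in \<open>auto simp: indicator_def\<close>)
  define I where "I = (\<integral>x. ?i x * expdens (?u x) \<partial>?Q)"
  have "0 \<le> I" unfolding I_def by (intro integral_nonneg_AE) (use b1 in auto)
  moreover have "((\<lambda>\<delta>. prob {s \<in> space P. L i j s \<in> U \<and> L m n s \<in> {c - \<delta><..<c + \<delta>}} / (2 * \<delta>)) \<longlongrightarrow> I) (at_right 0)"
  \<comment> \<open>The one-sided limit is tested along sequences, so that dominated convergence
    applies.\<close>
  proof (rule tendsto_at_right_sequentially[of 0 1])
    fix S :: "nat \<Rightarrow> real" assume S: "\<And>k. 0 < S k" "S \<longlonglongrightarrow> 0"
    have S0: "filterlim S (at_right 0) sequentially"
      using S(2) by (simp add: filterlim_at S(1) less_imp_neq[OF S(1), symmetric])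
    have "(\<lambda>k. \<integral>x. ?i x * ((expcdf (?u x + S k) - expcdf (?u x - S k)) / (2 * S k)) \<partial>?Q) \<longlonglongrightarrow> I"
      unfolding I_def
    proof (rule integral_dominated_convergence[where w = "\<lambda>_. 1"])
      show "AE x in ?Q. (\<lambda>k. ?i x * ((expcdf (?u x + S k) - expcdf (?u x - S k)) / (2 * S k))) \<longlonglongrightarrow> ?i x * expdens (?u x)"
        by (intro always_eventually allI tendsto_mult tendsto_const filterlim_compose[OF expcdf_symmetric_difference S0])
      show "AE x in ?Q. norm (?i x * ((expcdf (?u x + S k) - expcdf (?u x - S k)) / (2 * S k))) \<le> 1" for k
      proof (intro always_eventually allI)
        fix x
        have "0 \<le> expcdf (?u x + S k) - expcdf (?u x - S k)" using S(1)[of k] by (simp add: expcdf_mono)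
        moreover have "expcdf (?u x + S k) - expcdf (?u x - S k) \<le> 2 * S k"
          using expcdf_lipschitz[of "?u x - S k" "?u x + S k"] S(1)[of k] by simp
        ultimately show "norm (?i x * ((expcdf (?u x + S k) - expcdf (?u x - S k)) / (2 * S k))) \<le> 1"
          using S(1)[of k] by (auto simp: indicator_def)
      qed
    qed auto
    moreover have "prob {s \<in> space P. L i j s \<in> U \<and> L m n s \<in> {c - S k<..<c + S k}} / (2 * S k) =
      (\<integral>x. ?i x * ((expcdf (?u x + S k) - expcdf (?u x - S k)) / (2 * S k)) \<partial>?Q)" for k
      using k1[of "S k"] S(1)[of k] by simp
    ultimately show "(\<lambda>k. prob {s \<in> space P. L i j s \<in> U \<and> L m n s \<in> {c - S k<..<c + S k}} / (2 * S k)) \<longlonglongrightarrow> I"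
      by (simp only:)
  qed simp
  moreover have "I \<le> prob {s \<in> space P. L i j s \<in> U \<and> c \<le> L m n s}"
    unfolding k2 I_def
  proof (rule integral_mono)
    show "integrable ?Q (\<lambda>x. ?i x * expdens (?u x))"
    proof (rule int)
      show "\<bar>expdens (?u x)\<bar> \<le> 2" for x using b1(3,4)[of "?u x"] by linarith
    qed measurable
    show "integrable ?Q (\<lambda>x. ?i x * (1 - expcdf (?u x)))"
    proof (rule int)
      show "\<bar>1 - expcdf (?u x)\<bar> \<le> 2" for x using b1(1,2)[of "?u x"] by linarith
    qed measurable
    show "?i x * expdens (?u x) \<le> ?i x * (1 - expcdf (?u x))" for x
      by (intro mult_left_mono expdens_le_tail) auto
  qed
  moreover have "prob {s \<in> space P. L i j s \<in> U \<and> c - t \<le> L m n s \<and> L m n s < c} \<le> exp t * I"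
    unfolding k3 I_def integral_mult_right_zero[symmetric]
  proof (rule integral_mono)
    show "integrable ?Q (\<lambda>x. ?i x * (expcdf (?u x) - expcdf (?u x - t)))"
    proof (rule int)
      show "\<bar>expcdf (?u x) - expcdf (?u x - t)\<bar> \<le> 2" for x
        using b1(1,2)[of "?u x"] b1(1,2)[of "?u x - t"] by linarith
    qed measurable
    have "integrable ?Q (\<lambda>x. ?i x * expdens (?u x))"
    proof (rule int)
      show "\<bar>expdens (?u x)\<bar> \<le> 2" for x using b1(3,4)[of "?u x"] by linarith
    qed measurable
    then show "integrable ?Q (\<lambda>x. exp t * (?i x * expdens (?u x)))" by simp
    show "?i x * (expcdf (?u x) - expcdf (?u x - t)) \<le> exp t * (?i x * expdens (?u x))" for x
      using window_le_expdens[OF t, of "?u x"] by (auto simp: indicator_def)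
  qed
  ultimately show ?thesis by blast
qed

end

definition upper_tilt :: "real \<Rightarrow> real \<Rightarrow> real \<Rightarrow> real" where
  "upper_tilt a b l = (l + a - b + sqrt (discr a b l)) / (2 * l)"

text \<open>\<open>lower_tilt\<close> and \<open>upper_tilt\<close> are the roots q of l q^2 - (l +
  a - b) q + a = 0, which is a/q + b/(1 - q) = l cleared of denominators. The sum and product of the
  roots give the identities used below.\<close>

definition lower_tilt :: "real \<Rightarrow> real \<Rightarrow> real \<Rightarrow> real" where
  "lower_tilt a b l = (l + a - b - sqrt (discr a b l)) / (2 * l)"

context
  fixes a b l :: real
  assumes ab: "0 < a" "0 < b" and l: "(sqrt a + sqrt b)\<^sup>2 < l"
begin

lemma length_greater: "a + b < l"
proof -
  have "(sqrt a + sqrt b)\<^sup>2 = a + b + 2 * (sqrt a * sqrt b)" using ab by (simp add: power2_sum)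
  then show ?thesis using l ab by (smt (verit) mult_nonneg_nonneg real_sqrt_ge_zero)
qed

lemma length_pos: "0 < l"
  using length_greater ab by linarith

text \<open>The discriminant is (l - a - b)^2 - 4 a b, and the hypothesis on l says precisely that l
  - a - b exceeds 2 sqrt(a b).\<close>

lemma discr_pos: "0 < discr a b l"
proof -
  have e: "(sqrt a + sqrt b)\<^sup>2 = a + b + 2 * sqrt (a * b)" using ab by (simp add: power2_sum real_sqrt_mult)
  have "2 * sqrt (a * b) < l - a - b" using l e by linarith
  then have "(2 * sqrt (a * b))\<^sup>2 < (l - a - b)\<^sup>2" by (intro power_strict_mono) (use ab in auto)
  then have "4 * (a * b) < (l - a - b)\<^sup>2" using ab by (simp add: power_mult_distrib)
  moreover have "discr a b l = (l - a - b)\<^sup>2 - 4 * (a * b)" by (simp add: discr_def power2_eq_square algebra_simps)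
  ultimately show ?thesis by simp
qed

private abbreviation (input) "w \<equiv> upper_tilt a b l"
private abbreviation (input) "z \<equiv> lower_tilt a b l"

lemma tilt_diff: "l * (w - z) = sqrt (discr a b l)"
  using length_pos by (simp add: upper_tilt_def lower_tilt_def field_simps)

lemma tilt_sum: "l * (w + z) = l + a - b"
  using length_pos by (simp add: upper_tilt_def lower_tilt_def field_simps)

lemma tilt_prod: "l * w * z = a"
proof -
  have "(l + a - b + sqrt (discr a b l)) * (l + a - b - sqrt (discr a b l)) = (l + a - b)\<^sup>2 - (sqrt (discr a b l))\<^sup>2"
    by (simp add: power2_eq_square algebra_simps)
  also have "\<dots> = (l + a - b)\<^sup>2 - discr a b l" using discr_pos by simp
  also have "\<dots> = 4 * l * a" by (simp add: discr_def power2_eq_square algebra_simps)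
  finally have e: "(l + a - b + sqrt (discr a b l)) * (l + a - b - sqrt (discr a b l)) = 4 * l * a" .
  have "l * (p / (2 * l)) * (q / (2 * l)) = p * q / (4 * l)" for p q
    using length_pos by (simp add: field_simps)
  then show ?thesis using length_pos by (simp add: upper_tilt_def lower_tilt_def e)
qed

lemma tilt_prod_compl: "l * (1 - w) * (1 - z) = b"
proof -
  have "l * (1 - w) * (1 - z) = l - l * (w + z) + l * w * z" by (simp add: algebra_simps)
  then show ?thesis unfolding tilt_sum tilt_prod by simp
qed

text \<open>Positivity of \<open>w\<close> and 1 - z is visible from the formulas. For
  \<open>z\<close> and 1 - w, where the square root is subtracted, it follows from the products
  \<open>a\<close> and \<open>b\<close>.\<close>

lemma tilt_order: "0 < z" "z < w" "w < 1"
proof -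
  have s: "0 < sqrt (discr a b l)" using discr_pos by simp
  then have "0 < l * (w - z)" by (simp only: tilt_diff)
  then show "z < w" using length_pos by (simp add: zero_less_mult_iff)
  have "0 < l + a - b + sqrt (discr a b l)" using s length_greater ab by linarith
  then have w: "0 < w" using length_pos by (simp add: upper_tilt_def)
  have "0 < (l * w) * z" using tilt_prod ab by simp
  then show "0 < z" by (rule zero_less_mult_pos) (intro mult_pos_pos length_pos w)
  have "0 < l - a + b + sqrt (discr a b l)" using s length_greater ab by linarith
  then have z: "0 < 1 - z" using length_pos by (simp add: lower_tilt_def field_simps)
  have "0 < (l * (1 - z)) * (1 - w)" using tilt_prod_compl ab by (simp add: mult.commute mult.left_commute)
  then have "0 < 1 - w" by (rule zero_less_mult_pos) (intro mult_pos_pos length_pos z)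
  then show "w < 1" by simp
qed

lemma cone_slope_eq: "cone_slope a b l = w * (1 - z) / (z * (1 - w))"
proof -
  have e: "l - a - b = l * (w + z - 2 * w * z)"
    using tilt_sum tilt_prod by (simp add: algebra_simps)
  have "cone_slope a b l = (l * (w + z - 2 * w * z) + l * (w - z)) / (l * (w + z - 2 * w * z) - l * (w - z))"
    unfolding cone_slope_def e tilt_diff ..
  also have "l * (w + z - 2 * w * z) + l * (w - z) = (2 * l) * (w * (1 - z))" by (simp add: algebra_simps)
  also have "l * (w + z - 2 * w * z) - l * (w - z) = (2 * l) * (z * (1 - w))" by (simp add: algebra_simps)
  also have "(2 * l) * (w * (1 - z)) / ((2 * l) * (z * (1 - w))) = w * (1 - z) / (z * (1 - w))"
    using length_pos by simp
  finally show ?thesis .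
qed

lemma limit_shape_eq:
  "limit_shape a b l x y = (if x \<le> y then l * (w * x + (1 - w) * y) else l * (z * x + (1 - z) * y))"
proof -
  have s: "l + a - b = l * (w + z)" "l - a + b = l * (2 - (w + z))" using tilt_sum by (simp_all add: algebra_simps)
  show ?thesis unfolding limit_shape_def s tilt_diff[symmetric] by (simp add: field_simps)
qed

end

text \<open>Exchanging \<open>a\<close> and \<open>b\<close> reflects the model in the diagonal,
  which maps a root q to 1 - q and so interchanges the two.\<close>

lemma tilt_swap:
  assumes "l \<noteq> 0"
  shows "upper_tilt b a l = 1 - lower_tilt a b l" "lower_tilt b a l = 1 - upper_tilt a b l"
proof -
  have "discr b a l = discr a b l" by (simp add: discr_def power2_commute)
  then show "upper_tilt b a l = 1 - lower_tilt a b l" "lower_tilt b a l = 1 - upper_tilt a b l"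
    using assms by (simp_all add: upper_tilt_def lower_tilt_def field_simps)
qed

lemma tilt_isCont:
  assumes "0 < l"
  shows "isCont (upper_tilt a b) l" "isCont (lower_tilt a b) l"
  unfolding upper_tilt_def lower_tilt_def discr_def using assms by (auto intro!: continuous_intros)

context bulk begin

text \<open>The window has to lie below l N, whereas \<open>window_ge\<close> centres its window at
  its own level. It is therefore applied at a level \<open>l0\<close> just below l, where the rate
  \<open>F\<close>, continuous in the level, is smaller by less than
  \<open>\<eta> / 4\<close>.\<close>

lemma window_lower_bound:
  assumes ab: "0 < a" "0 < b" and l: "(sqrt a + sqrt b)\<^sup>2 < l" and \<eta>: "0 < \<eta>"
    and m: "\<And>N. \<bar>real (m N) - a * real N\<bar> \<le> D" and n: "\<And>N. \<bar>real (n N) - b * real N\<bar> \<le> D"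
  shows "\<forall>\<^sub>F N in sequentially. ennreal (cost (upper_tilt a b l) (lower_tilt a b l) l m n N * exp (- (\<eta> * real N))) \<le>
    emeasure P {s \<in> space P. l * real N - \<eta> * real N \<le> L (m N) (n N) s \<and> L (m N) (n N) s < l * real N}"
proof -
  note ord = tilt_order[OF ab]
  define A where "A l' = ln (upper_tilt a b l' / lower_tilt a b l')" for l'
  define B where "B l' = ln ((1 - lower_tilt a b l') / (1 - upper_tilt a b l'))" for l'
  define F where "F l' = a * A l' + b * B l' - (upper_tilt a b l' - lower_tilt a b l') * l'" for l'
  have lp: "0 < l" by (rule length_pos[OF ab l])
  have "isCont F l"
    unfolding F_def A_def B_def using ord[OF l]
    by (intro continuous_intros tilt_isCont[OF lp]) auto
  then have "(F \<longlongrightarrow> F l) (at_left l)" by (simp add: isCont_def filterlim_at_split)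
  then have "\<forall>\<^sub>F l' in at_left l. F l - \<eta> / 4 < F l'" by (rule order_tendstoD) (use \<eta> in simp)
  moreover have "\<forall>\<^sub>F l' in at_left l. l' \<in> {max ((sqrt a + sqrt b)\<^sup>2) (l - \<eta> / 2)<..<l}"
    by (rule eventually_at_left_real) (use l \<eta> in auto)
  ultimately have "\<forall>\<^sub>F l' in at_left l. F l - \<eta> / 4 < F l' \<and> (sqrt a + sqrt b)\<^sup>2 < l' \<and> l - \<eta> / 2 < l' \<and> l' < l"
    by eventually_elim auto
  then obtain l0 where l0: "F l - \<eta> / 4 < F l0" "(sqrt a + sqrt b)\<^sup>2 < l0" "l - \<eta> / 2 < l0" "l0 < l"
    using eventually_happens'[OF trivial_limit_at_left_real] by blast
  \<comment> \<open>The half-width of the window at \<open>l0\<close>: it must not reach beyond l N,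
    nor below (l - \<open>\<eta>\<close>) N.\<close>
  define \<eta>0 where "\<eta>0 = min (l - l0) (\<eta> / 4)"
  have \<eta>0: "0 < \<eta>0" "\<eta>0 \<le> l - l0" "\<eta>0 \<le> \<eta> / 4" using l0 \<eta> unfolding \<eta>0_def by linarith+
  let ?w = "upper_tilt a b l" and ?z = "lower_tilt a b l" and ?wl = "upper_tilt a b l0" and ?zl = "lower_tilt a b l0"
  \<comment> \<open>The rounding error of \<open>m N\<close> and \<open>n N\<close>, multiplied by
    the change of their coefficients between the levels l and \<open>l0\<close>.\<close>
  define K where "K = D * (\<bar>A l0 - A l\<bar> + \<bar>B l0 - B l\<bar>)"
  note W = window_ge[OF ord[OF l0(2)] length_pos[OF ab l0(2)] \<eta>0(1), unfolded tilt_prod[OF ab l0(2)] tilt_prod_compl[OF ab l0(2)], OF m n]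
  have "filterlim (\<lambda>N::nat. \<eta> / 2 * real N - K) at_top sequentially" using \<eta> by real_asymp
  then have "\<forall>\<^sub>F N::nat in sequentially. 0 \<le> \<eta> / 2 * real N - K" unfolding filterlim_at_top by (rule spec)
  with W show ?thesis
  proof eventually_elim
    case (elim N)
    let ?\<mu> = "exp_laws ({1..m N} \<times> {1..n N}) 1"
    have K1: "tilt_factor ?w ?z (m N) (n N) = exp (real (m N) * A l + real (n N) * B l)"
      unfolding A_def B_def by (rule tilt_factor_exp) (rule ord l)+
    have K0: "tilt_factor ?wl ?zl (m N) (n N) = exp (real (m N) * A l0 + real (n N) * B l0)"
      unfolding A_def B_def by (rule tilt_factor_exp) (rule ord l0)+
    have "cost ?w ?z l m n N * exp (- (\<eta> * real N)) = exp (real (m N) * A l + real (n N) * B l - (?w - ?z) * l * real N - \<eta> * real N)"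
      unfolding cost_def K1 exp_add[symmetric] by (simp add: algebra_simps)
    also have "\<dots> \<le> exp (real (m N) * A l0 + real (n N) * B l0 - ((?wl - ?zl) * l0 + \<eta>0) * real N)"
    proof -
      have "real (m N) * (A l - A l0) = a * real N * (A l - A l0) + (real (m N) - a * real N) * (A l - A l0)"
        "real (n N) * (B l - B l0) = b * real N * (B l - B l0) + (real (n N) - b * real N) * (B l - B l0)"
        by (simp_all add: algebra_simps)
      moreover have "(real (m N) - a * real N) * (A l - A l0) \<le> D * \<bar>A l0 - A l\<bar>"
      proof -
        have "(real (m N) - a * real N) * (A l - A l0) \<le> \<bar>(real (m N) - a * real N) * (A l - A l0)\<bar>" by simp
        also have "\<dots> \<le> D * \<bar>A l - A l0\<bar>" unfolding abs_mult by (intro mult_right_mono m) simp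
        finally show ?thesis by (simp only: abs_minus_commute)
      qed
      moreover have "(real (n N) - b * real N) * (B l - B l0) \<le> D * \<bar>B l0 - B l\<bar>"
      proof -
        have "(real (n N) - b * real N) * (B l - B l0) \<le> \<bar>(real (n N) - b * real N) * (B l - B l0)\<bar>" by simp
        also have "\<dots> \<le> D * \<bar>B l - B l0\<bar>" unfolding abs_mult by (intro mult_right_mono n) simp
        finally show ?thesis by (simp only: abs_minus_commute)
      qed
      moreover have "a * real N * (A l - A l0) + b * real N * (B l - B l0) - (?w - ?z) * l * real N + (?wl - ?zl) * l0 * real N = (F l - F l0) * real N"
        by (simp add: F_def algebra_simps)
      moreover have "(F l - F l0) * real N \<le> \<eta> / 4 * real N" using l0(1) by (intro mult_right_mono) auto
      moreover have "\<eta>0 * real N \<le> \<eta> / 4 * real N" using \<eta>0(3) by (intro mult_right_mono) auto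
      moreover have "K = D * \<bar>A l0 - A l\<bar> + D * \<bar>B l0 - B l\<bar>" by (simp add: K_def algebra_simps)
      ultimately show ?thesis
        using elim(2) by (subst exp_le_cancel_iff) (simp only: right_diff_distrib distrib_right; linarith)
    qed
    also have "\<dots> = tilt_factor ?wl ?zl (m N) (n N) * exp (- (((?wl - ?zl) * l0 + \<eta>0) * real N))"
      unfolding K0 exp_add[symmetric] by simp
    finally have 1: "ennreal (cost ?w ?z l m n N * exp (- (\<eta> * real N))) \<le>
      ennreal (tilt_factor ?wl ?zl (m N) (n N) * exp (- (((?wl - ?zl) * l0 + \<eta>0) * real N)))" by (rule ennreal_leI)
    have 2: "(l0 + \<eta>0) * real N \<le> l * real N" "l * real N - \<eta> * real N \<le> (l0 - \<eta>0) * real N"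
    proof -
      show "(l0 + \<eta>0) * real N \<le> l * real N" using \<eta>0 by (intro mult_right_mono) auto
      have "(l - \<eta>) * real N \<le> (l0 - \<eta>0) * real N" using \<eta>0 l0 \<eta> by (intro mult_right_mono) auto
      then show "l * real N - \<eta> * real N \<le> (l0 - \<eta>0) * real N" by (simp only: left_diff_distrib)
    qed
    have [measurable]: "(\<lambda>x. lpp x (m N) (n N)) \<in> borel_measurable (PiM ({1..m N} \<times> {1..n N}) (\<lambda>_. borel))"
      by (rule lpp_measurable) auto
    then have [measurable]: "(\<lambda>x. lpp x (m N) (n N)) \<in> borel_measurable ?\<mu>"
      by (simp add: measurable_cong_sets[OF sets_PiM_exp_law refl])
    let ?S = "{l * real N - \<eta> * real N..<l * real N}"
    let ?f = "\<lambda>x. indicator ?S (lpp x (m N) (n N)) :: ennreal"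
    have f: "?f \<in> borel_measurable (PiM ({1..m N} \<times> {1..n N}) (\<lambda>_. borel))" by measurable
    have sub: "(\<lambda>v. (fst v + 0, snd v + 0)) ` ({1..m N} \<times> {1..n N}) \<subseteq> {1..} \<times> {1..}" by auto
    have r: "lpp (restrict (wt s) ({1..m N} \<times> {1..n N})) (m N) (n N) = L (m N) (n N) s" for s
      by (rule lpp_restrict) simp
    note 1
    also note elim(1)
    also have "emeasure ?\<mu> {x \<in> space ?\<mu>. (l0 - \<eta>0) * real N < lpp x (m N) (n N) \<and> lpp x (m N) (n N) < (l0 + \<eta>0) * real N} \<le>
      emeasure ?\<mu> {x \<in> space ?\<mu>. lpp x (m N) (n N) \<in> ?S}"
      by (rule emeasure_mono) (use 2 in \<open>auto simp del: One_nat_def\<close>, measurable)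
    also have "\<dots> = (\<integral>\<^sup>+x. indicator {x \<in> space ?\<mu>. lpp x (m N) (n N) \<in> ?S} x \<partial>?\<mu>)"
      by (rule nn_integral_indicator[symmetric]) measurable
    also have "\<dots> = (\<integral>\<^sup>+x. ?f x \<partial>?\<mu>)" by (rule nn_integral_cong) (auto simp: indicator_def)
    also have "\<dots> = (\<integral>\<^sup>+s. ?f (restrict (shifted 0 0 (wt s)) ({1..m N} \<times> {1..n N})) \<partial>P)"
      by (rule block_law[OF sub _ f, symmetric]) simp
    also have "\<dots> = (\<integral>\<^sup>+s. indicator {s \<in> space P. L (m N) (n N) s \<in> ?S} s \<partial>P)"
      unfolding shifted_0_0 r by (rule nn_integral_cong) (auto simp: indicator_def)
    also have "\<dots> = emeasure P {s \<in> space P. L (m N) (n N) s \<in> ?S}"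
      by (rule nn_integral_indicator) measurable
    finally show ?case by (simp only: atLeastLessThan_iff)
  qed
qed

lemma bulk_transpose: "bulk P (\<lambda>v. W (snd v, fst v))"
proof (intro bulk.intro expo_field.intro expo_field_axioms.intro)
  let ?s = "\<lambda>v::nat \<times> nat. (snd v, fst v)" and ?I = "{1..} \<times> {1..} :: (nat \<times> nat) set"
  show "prob_space P" by unfold_locales
  show "indep_vars (\<lambda>_. borel) (\<lambda>v. W (?s v)) ?I"
    unfolding indep_vars_def2
  proof (intro conjI ballI)
    show "random_variable borel (W (?s v))" if "v \<in> ?I" for v
      using indep that unfolding indep_vars_def2 by auto
    let ?F = "\<lambda>v. {W v -` A \<inter> space P |A. A \<in> sets borel}"
    have F: "indep_sets ?F ?I" using indep unfolding indep_vars_def2 by blast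
    show "indep_sets (\<lambda>v. ?F (?s v)) ?I"
    proof (rule indep_setsI)
      show "?F (?s v) \<subseteq> events" if "v \<in> ?I" for v
        using F that unfolding indep_sets_def by auto
      fix A J assume J: "J \<noteq> {}" "J \<subseteq> ?I" "finite J" "\<forall>j\<in>J. A j \<in> ?F (?s j)"
      have inj: "inj_on ?s J" by (auto simp: inj_on_def)
      have "prob (\<Inter>j\<in>?s ` J. A (?s j)) = (\<Prod>j\<in>?s ` J. prob (A (?s j)))"
        by (rule indep_setsD[OF F]) (use J in auto)
      then show "prob (\<Inter>j\<in>J. A j) = (\<Prod>j\<in>J. prob (A j))"
        by (simp add: prod.reindex[OF inj])
    qed
  qed
qed (use dist nonneg in auto)

text \<open>Divided by the window width, numerator and denominator converge to densities
  \<open>I\<close> and \<open>J\<close> by \<open>endpoint_density\<close>, with J > 0. So the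
  defining limit exists and equals I/J. The decay estimate bounds \<open>I\<close> from above, the
  window estimate bounds \<open>J\<close> from below.\<close>

lemma conditional_decay:
  assumes decay: "decays (\<lambda>N. emeasure P {s \<in> space P. L (i N) (j N) s \<in> U N \<and> l * real N \<le> L (m N) (n N) s}) C"
    and window: "\<And>\<eta>. 0 < \<eta> \<Longrightarrow> \<forall>\<^sub>F N in sequentially. ennreal (C N * exp (- (\<eta> * real N))) \<le>
      emeasure P {s \<in> space P. l * real N - \<eta> * real N \<le> L (m N) (n N) s \<and> L (m N) (n N) s < l * real N}"
    and C: "\<And>N. 0 < C N" and U: "\<And>N. U N \<in> sets borel"
    and mn: "\<forall>\<^sub>F N in sequentially. 1 \<le> m N \<and> 1 \<le> n N"
    and ij: "\<forall>\<^sub>F N in sequentially. i N \<le> m N \<and> j N \<le> n N \<and> (i N < m N \<or> j N < n N)"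
  shows "(\<lambda>N. cond_prob_eq P (\<lambda>s. L (i N) (j N) s \<in> U N) (L (m N) (n N)) (l * real N)) \<longlonglongrightarrow> 0"
proof -
  obtain c where c: "0 < c" and dec: "\<forall>\<^sub>F N in sequentially.
    emeasure P {s \<in> space P. L (i N) (j N) s \<in> U N \<and> l * real N \<le> L (m N) (n N) s} \<le> ennreal (C N * exp (- (c * real N)))"
    using decay by (auto simp: decays_def)
  \<comment> \<open>The loss exp(\<open>- \<eta>\<close> N) occurs twice, in the window estimate and
    in passing from a window to a density. With c/4 this uses half of the gain c.\<close>
  define \<eta> where "\<eta> = c / 4"
  have \<eta>: "0 < \<eta>" using c by (simp add: \<eta>_def)
  let ?p = "\<lambda>N. cond_prob_eq P (\<lambda>s. L (i N) (j N) s \<in> U N) (L (m N) (n N)) (l * real N)"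
  have "\<forall>\<^sub>F N in sequentially. 0 \<le> ?p N \<and> ?p N \<le> exp (- (c / 2 * real N))"
    using dec window[OF \<eta>] mn ij
  proof eventually_elim
    case (elim N)
    let ?L = "L (m N) (n N)" and ?E = "L (i N) (j N)" and ?t = "\<eta> * real N" and ?c = "l * real N"
    have t: "0 \<le> ?t" using \<eta> by simp
    obtain I where I: "0 \<le> I"
      "((\<lambda>\<delta>. prob {s \<in> space P. ?E s \<in> U N \<and> ?L s \<in> {?c - \<delta><..<?c + \<delta>}} / (2 * \<delta>)) \<longlongrightarrow> I) (at_right 0)"
      "I \<le> prob {s \<in> space P. ?E s \<in> U N \<and> ?c \<le> ?L s}"
      using endpoint_density[of "m N" "n N" "i N" "j N" "U N" 0 ?c] elim(3,4) U by auto
    \<comment> \<open>The point (0, 0) and the event \<open>UNIV\<close> impose no condition, so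
      \<open>J\<close> is the density of the passage time itself.\<close>
    obtain J where J: "0 \<le> J"
      "((\<lambda>\<delta>. prob {s \<in> space P. ?L s \<in> {?c - \<delta><..<?c + \<delta>}} / (2 * \<delta>)) \<longlongrightarrow> J) (at_right 0)"
      "prob {s \<in> space P. ?c - ?t \<le> ?L s \<and> ?L s < ?c} \<le> exp ?t * J"
      using endpoint_density[of "m N" "n N" 0 0 UNIV ?t ?c] elim(3) t by auto
    have "ennreal (C N * exp (- ?t)) \<le> ennreal (prob {s \<in> space P. ?c - ?t \<le> ?L s \<and> ?L s < ?c})"
      using elim(2) by (simp add: emeasure_eq_measure)
    then have "C N * exp (- ?t) \<le> prob {s \<in> space P. ?c - ?t \<le> ?L s \<and> ?L s < ?c}"
      by (simp add: ennreal_le_iff)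
    also note J(3)
    finally have "exp (- ?t) * (C N * exp (- ?t)) \<le> exp (- ?t) * (exp ?t * J)" by (rule mult_left_mono) simp
    also have "exp (- ?t) * (exp ?t * J) = J" by (simp add: mult.assoc[symmetric] exp_add[symmetric])
    also have "exp (- ?t) * (C N * exp (- ?t)) = C N * exp (- (c / 2 * real N))"
      by (simp add: \<eta>_def exp_add[symmetric] mult.commute mult.left_commute)
    finally have J': "C N * exp (- (c / 2 * real N)) \<le> J" .
    then have Jpos: "0 < J" using C[of N] by (smt (verit) exp_gt_zero mult_pos_pos)
    have "ennreal (prob {s \<in> space P. ?E s \<in> U N \<and> ?c \<le> ?L s}) \<le> ennreal (C N * exp (- (c * real N)))"
      using elim(1) by (simp add: emeasure_eq_measure)
    then have "prob {s \<in> space P. ?E s \<in> U N \<and> ?c \<le> ?L s} \<le> C N * exp (- (c * real N))"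
      using C[of N] by (subst (asm) ennreal_le_iff) auto
    with I(3) have "I \<le> C N * exp (- (c * real N))" by linarith
    also have "\<dots> = exp (- (c / 2 * real N)) * (C N * exp (- (c / 2 * real N)))"
      by (simp add: exp_add[symmetric] mult.left_commute)
    also have "\<dots> \<le> exp (- (c / 2 * real N)) * J" using J' by (intro mult_left_mono) auto
    finally have IJ: "I / J \<le> exp (- (c / 2 * real N))" using Jpos by (simp add: field_simps)
    have "((\<lambda>\<delta>. cond_prob P (\<lambda>s. ?E s \<in> U N) (\<lambda>s. ?L s \<in> {?c - \<delta><..<?c + \<delta>})) \<longlongrightarrow> I / J) (at_right 0)"
    proof (rule Lim_transform_eventually[OF tendsto_divide[OF I(2) J(2)]])
      show "J \<noteq> 0" using Jpos by simp
      show "\<forall>\<^sub>F \<delta> in at_right 0. prob {s \<in> space P. ?E s \<in> U N \<and> ?L s \<in> {?c - \<delta><..<?c + \<delta>}} / (2 * \<delta>) /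
          (prob {s \<in> space P. ?L s \<in> {?c - \<delta><..<?c + \<delta>}} / (2 * \<delta>)) =
        cond_prob P (\<lambda>s. ?E s \<in> U N) (\<lambda>s. ?L s \<in> {?c - \<delta><..<?c + \<delta>})"
        using eventually_at_right_less[of 0] by eventually_elim (simp add: cond_prob_def)
    qed
    then have "?p N = I / J" unfolding cond_prob_eq_def by (rule tendsto_Lim[OF trivial_limit_at_right_real])
    with IJ I(1) J(1) show ?case by simp
  qed
  then have lo: "\<forall>\<^sub>F N in sequentially. 0 \<le> ?p N" and hi: "\<forall>\<^sub>F N in sequentially. ?p N \<le> exp (- (c / 2 * real N))"
    by (auto elim: eventually_mono)
  have "(\<lambda>N::nat. exp (- (c / 2 * real N))) \<longlonglongrightarrow> 0" using c by real_asymp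
  then show ?thesis by (rule tendsto_sandwich[OF lo hi tendsto_const])
qed

end

context bulk begin

lemma cost_pos: "0 < z \<Longrightarrow> z < w \<Longrightarrow> w < 1 \<Longrightarrow> 0 < cost w z l m n N"
  by (simp add: cost_def tilt_factor_def)

lemma conditional_shape_above_diagonal:
  assumes ab: "0 < a" "0 < b" and l: "(sqrt a + sqrt b)\<^sup>2 < l" and \<epsilon>: "0 < \<epsilon>"
    and xy: "0 < x" "x \<le> y" "y < 1"
    and cone: "lower_tilt a b l * (1 - upper_tilt a b l) * y < upper_tilt a b l * (1 - lower_tilt a b l) * x"
  shows "(\<lambda>N. cond_prob_eq P
    (\<lambda>s. \<epsilon> < \<bar>L (nat \<lceil>x * a * real N\<rceil>) (nat \<lceil>y * b * real N\<rceil>) s / real N - l * (upper_tilt a b l * x + (1 - upper_tilt a b l) * y)\<bar>)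
    (L (nat \<lceil>a * real N\<rceil>) (nat \<lceil>b * real N\<rceil>)) (l * real N)) \<longlonglongrightarrow> 0"
proof -
  let ?w = "upper_tilt a b l" and ?z = "lower_tilt a b l"
  let ?h = "l * (?w * x + (1 - ?w) * y)"
  define m where "m = (\<lambda>N::nat. nat \<lceil>a * real N\<rceil>)"
  define n where "n = (\<lambda>N::nat. nat \<lceil>b * real N\<rceil>)"
  define i where "i = (\<lambda>N::nat. nat \<lceil>x * a * real N\<rceil>)"
  define j where "j = (\<lambda>N::nat. nat \<lceil>y * b * real N\<rceil>)"
  have xa: "0 \<le> x * a" "0 \<le> y * b" "x * a < a" using ab xy by (auto intro!: mult_nonneg_nonneg)
  have m: "\<bar>real (m N) - a * real N\<bar> \<le> 1" and n: "\<bar>real (n N) - b * real N\<bar> \<le> 1"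
    and i: "\<bar>real (i N) - x * a * real N\<bar> \<le> 1" for N
    unfolding m_def n_def i_def by (rule nat_ceil_bound, use ab xa in linarith)+
  note ord = tilt_order[OF ab l] and lp = length_pos[OF ab l]
  interpret tilted: tilted P W ?w ?z l 1 m n
    by unfold_locales (use ord lp m n in \<open>simp_all add: tilt_prod[OF ab l] tilt_prod_compl[OF ab l]\<close>)
  let ?U = "\<lambda>N::nat. {r. \<epsilon> < \<bar>r / real N - ?h\<bar>}"
  have dec: "decays (\<lambda>N. emeasure P {s \<in> space P. \<epsilon> * real N < \<bar>L (i N) (j N) s - ?h * real N\<bar> \<and> l * real N \<le> L (m N) (n N) s}) (cost ?w ?z l m n)"
    using tilted.shape_deviation_decay[OF xy cone \<epsilon>] unfolding tilt_prod[OF ab l] tilt_prod_compl[OF ab l] i_def j_def .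
  \<comment> \<open>Positivity of N is needed because division by 0 yields 0; the comparison below
    is accordingly made for large N only.\<close>
  have U_iff: "r \<in> ?U N \<longleftrightarrow> \<epsilon> * real N < \<bar>r - ?h * real N\<bar>" if "0 < N" for r and N :: nat
  proof -
    have "\<bar>r - ?h * real N\<bar> = \<bar>r / real N - ?h\<bar> * real N"
      using that by (simp add: abs_mult[symmetric, of _ "real N", simplified] left_diff_distrib)
    then show ?thesis using that by simp
  qed
  have "(\<lambda>N. cond_prob_eq P (\<lambda>s. L (i N) (j N) s \<in> ?U N) (L (m N) (n N)) (l * real N)) \<longlonglongrightarrow> 0"
  proof (rule conditional_decay)
    show "decays (\<lambda>N. emeasure P {s \<in> space P. L (i N) (j N) s \<in> ?U N \<and> l * real N \<le> L (m N) (n N) s}) (cost ?w ?z l m n)"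
      using dec
    proof (rule decays_mono)
      show "\<forall>\<^sub>F N in sequentially. emeasure P {s \<in> space P. L (i N) (j N) s \<in> ?U N \<and> l * real N \<le> L (m N) (n N) s}
        \<le> emeasure P {s \<in> space P. \<epsilon> * real N < \<bar>L (i N) (j N) s - ?h * real N\<bar> \<and> l * real N \<le> L (m N) (n N) s}"
        using eventually_gt_at_top[of 0] by eventually_elim (simp only: U_iff order_refl)
    qed
    show "\<forall>\<^sub>F N in sequentially. ennreal (cost ?w ?z l m n N * exp (- (\<eta> * real N))) \<le>
      emeasure P {s \<in> space P. l * real N - \<eta> * real N \<le> L (m N) (n N) s \<and> L (m N) (n N) s < l * real N}" if "0 < \<eta>" for \<eta>
      by (rule window_lower_bound[OF ab l that m n])
    show "0 < cost ?w ?z l m n N" for N using ord by (rule cost_pos)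
    show "?U N \<in> sets borel" for N by measurable
    show "\<forall>\<^sub>F N in sequentially. 1 \<le> m N \<and> 1 \<le> n N" using tilted.mn_large by eventually_elim simp
    have "x * a * real N \<le> a * real N" "y * b * real N \<le> b * real N" for N
      using ab xy by (intro mult_right_mono; simp)+
    then have "i N \<le> m N" "j N \<le> n N" for N
      unfolding i_def j_def m_def n_def by (intro nat_mono ceiling_mono; blast)+
    with eventually_less_linear[OF i m xa(3)]
    show "\<forall>\<^sub>F N in sequentially. i N \<le> m N \<and> j N \<le> n N \<and> (i N < m N \<or> j N < n N)"
      by (auto elim: eventually_mono)
  qed
  then show ?thesis by (simp only: m_def n_def i_def j_def mem_Collect_eq)
qed

lemma conditional_shape:
  assumes ab: "0 < a" "0 < b" and l: "(sqrt a + sqrt b)\<^sup>2 < l" and \<epsilon>: "0 < \<epsilon>"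
    and xy: "0 < x" "x < 1" "0 < y" "y < 1" and cone: "1 / cone_slope a b l < y / x" "y / x < cone_slope a b l"
  shows "(\<lambda>N. cond_prob_eq P
    (\<lambda>s. \<epsilon> < \<bar>L (nat \<lceil>x * a * real N\<rceil>) (nat \<lceil>y * b * real N\<rceil>) s / real N - limit_shape a b l x y\<bar>)
    (L (nat \<lceil>a * real N\<rceil>) (nat \<lceil>b * real N\<rceil>)) (l * real N)) \<longlonglongrightarrow> 0"
proof -
  let ?w = "upper_tilt a b l" and ?z = "lower_tilt a b l"
  note ord = tilt_order[OF ab l] and lp = length_pos[OF ab l]
  have p: "0 < ?z * (1 - ?w)" "0 < ?w * (1 - ?z)" using ord by auto
  show ?thesis
  proof (cases "x \<le> y")
    case True
    have "?z * (1 - ?w) * y < ?w * (1 - ?z) * x"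
      using cone(2) p xy unfolding cone_slope_eq[OF ab l] by (simp add: divide_simps mult_ac)
    with conditional_shape_above_diagonal[OF ab l \<epsilon> xy(1) True xy(4)] show ?thesis
      by (simp only: limit_shape_eq[OF ab l] True if_True)
  next
    case False
    \<comment> \<open>Below the diagonal the reflected field is used. It exchanges (a, x) with (b,
      y), and the lower bound on y/x becomes the cone condition of the other case.\<close>
    interpret t: bulk P "\<lambda>v. W (snd v, fst v)" by (rule bulk_transpose)
    have "?z * (1 - ?w) * x < ?w * (1 - ?z) * y"
      using cone(1) p xy unfolding cone_slope_eq[OF ab l] by (simp add: divide_simps mult_ac)
    then have cone': "lower_tilt b a l * (1 - upper_tilt b a l) * x < upper_tilt b a l * (1 - lower_tilt b a l) * y"
      using lp by (simp add: tilt_swap[of l b a] mult_ac)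
    have l': "(sqrt b + sqrt a)\<^sup>2 < l" using l by (simp add: add.commute)
    have yx: "y \<le> x" using False by simp
    have h: "l * (upper_tilt b a l * y + (1 - upper_tilt b a l) * x) = limit_shape a b l x y"
      using False lp by (simp add: limit_shape_eq[OF ab l] tilt_swap[of l b a] add.commute)
    have tr: "lpp (\<lambda>v. W (snd v, fst v) s) m n = L n m s" for s m n
      using lpp_transpose[of "wt s" m n] by simp
    from t.conditional_shape_above_diagonal[OF ab(2,1) l' \<epsilon> xy(3) yx xy(2) cone'] show ?thesis
      unfolding h tr .
  qed
qed

end

section \<open>From clipped weights back to the given ones\<close>

lemma cond_prob_eq_cong_AE:
  assumes "\<And>\<delta>. {s \<in> space M. E s \<and> X s \<in> {c - \<delta><..<c + \<delta>}} \<in> sets M" "\<And>\<delta>. {s \<in> space M. E' s \<and> X' s \<in> {c - \<delta><..<c + \<delta>}} \<in> sets M"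
    and "\<And>\<delta>. {s \<in> space M. X s \<in> {c - \<delta><..<c + \<delta>}} \<in> sets M" "\<And>\<delta>. {s \<in> space M. X' s \<in> {c - \<delta><..<c + \<delta>}} \<in> sets M"
    and ae: "AE s in M. (E s \<longleftrightarrow> E' s) \<and> X s = X' s"
  shows "cond_prob_eq M E X c = cond_prob_eq M E' X' c"
proof -
  have "cond_prob M E (\<lambda>s. X s \<in> {c - \<delta><..<c + \<delta>}) = cond_prob M E' (\<lambda>s. X' s \<in> {c - \<delta><..<c + \<delta>})" for \<delta>
    unfolding cond_prob_def
    by (intro arg_cong2[where f = "(/)"] measure_eq_AE assms(1-4) eventually_mono[OF ae]) auto
  then show ?thesis by (simp only: cond_prob_eq_def)
qed

theorem theorem1p2:
  fixes M :: "'a measure" and \<omega> :: "nat \<times> nat \<Rightarrow> 'a \<Rightarrow> real"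
    and a b l x y \<epsilon> :: real
  assumes "prob_space M"
    and "iid_exponential_weights M \<omega>"
    and "a > 0" and "b > 0" and "l > (sqrt a + sqrt b)\<^sup>2"
    and "\<epsilon> > 0"
    and "x \<in> {0<..<1}" and "y \<in> {0<..<1}"
    and "1 / cone_slope a b l < y / x" and "y / x < cone_slope a b l"
  shows "(\<lambda>N::nat. cond_prob_eq M
            (\<lambda>s. \<bar>last_passage_real (\<lambda>v. \<omega> v s) (x * a * real N) (y * b * real N) / real N
                   - limit_shape a b l x y\<bar> > \<epsilon>)
            (\<lambda>s. last_passage_real (\<lambda>v. \<omega> v s) (a * real N) (b * real N))
            (l * real N))
         \<longlonglongrightarrow> 0"
proof -
  interpret prob_space M by fact
  let ?I = "{1..} \<times> {1..} :: (nat \<times> nat) set"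
  have ind: "indep_vars (\<lambda>_. borel) \<omega> ?I" and dis: "\<And>v. v \<in> ?I \<Longrightarrow> distributed M lborel (\<omega> v) (exponential_density 1)"
    using assms(2) by (auto simp: iid_exponential_weights_def)
  have meas: "\<omega> v \<in> borel_measurable M" if "v \<in> ?I" for v
    using distributed_measurable[OF dis[OF that]] by simp
  have dE: "distr M borel (\<omega> v) = exp_law 1" if "v \<in> ?I" for v
    unfolding exp_law_def using distributed_distr_eq_density[OF dis[OF that]] by (simp cong: distr_cong)
  have pos: "AE s in M. 0 \<le> \<omega> v s" if "v \<in> ?I" for v
  proof -
    have "AE r in distr M borel (\<omega> v). 0 \<le> r" unfolding dE[OF that] by (rule AE_exp_law_nonneg)
    then show ?thesis using meas[OF that] by (subst (asm) AE_distr_iff) auto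
  qed
  \<comment> \<open>Clipping at 0, and setting the weights to 0 off the quadrant, makes
    nonnegativity sure. Each weight in the quadrant changes on a null set only.\<close>
  define W where "W v s = max 0 (if v \<in> ?I then \<omega> v s else 0)" for v s
  have WI: "W v s = max 0 (\<omega> v s)" if "v \<in> ?I" for v s using that by (simp only: W_def if_True)
  interpret W: bulk M W
  proof (intro bulk.intro expo_field.intro expo_field_axioms.intro)
    have "indep_vars (\<lambda>_. borel) (\<lambda>v s. max 0 (\<omega> v s)) ?I"
      by (rule indep_vars_compose2[OF ind]) measurable
    then show "indep_vars (\<lambda>_. borel) W ?I"
      by (rule indep_vars_cong[THEN iffD1, rotated -1]) (auto simp: WI fun_eq_iff)
    show "distr M borel (W v) = exp_law 1" if "v \<in> ?I" for v
    proof -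
      have e: "W v = (\<lambda>s. max 0 (\<omega> v s))" using WI[OF that] by blast
      note [measurable] = meas[OF that]
      have "distr M borel (W v) = distr M borel (\<omega> v)"
      proof (rule distr_cong_AE)
        show "AE s in M. W v s = \<omega> v s" unfolding e using pos[OF that] by eventually_elim simp
      qed (unfold e, simp_all)
      then show ?thesis by (simp only: dE[OF that])
    qed
  qed (use assms(1) in \<open>auto simp: W_def\<close>)
  have AE_eq: "AE s in M. \<forall>v\<in>{1..i} \<times> {1..j}. \<omega> v s = W v s" for i j
  proof (rule AE_finite_allI)
    fix v assume "v \<in> {1..i} \<times> {1..j}"
    then have v: "v \<in> ?I" by auto
    show "AE s in M. \<omega> v s = W v s" using pos[OF v] by eventually_elim (simp only: WI[OF v] max.absorb2)
  qed simp
  have lp: "AE s in M. last_passage (\<lambda>v. \<omega> v s) (i, j) = lpp (\<lambda>v. W v s) i j" if "1 \<le> i" "1 \<le> j" for i j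
    using AE_eq[of i j]
  proof eventually_elim
    case (elim s)
    have "last_passage (\<lambda>v. \<omega> v s) (i, j) = last_passage (\<lambda>v. W v s) (i, j)"
      by (rule last_passage_cong) (use elim in auto)
    also have "\<dots> = lpp (\<lambda>v. W v s) i j" by (rule last_passage_eq_lpp[OF that]) (simp add: W_def)
    finally show ?case .
  qed
  have lm: "(\<lambda>s. last_passage (\<lambda>v. \<omega> v s) (i, j)) \<in> borel_measurable M" if "1 \<le> i" "1 \<le> j" for i j
  proof -
    have "(\<lambda>s. \<Sum>v\<leftarrow>p. \<omega> v s) \<in> borel_measurable M" if "p \<in> up_right_paths (i, j)" for p
    proof -
      have "set p \<subseteq> ?I" using that by (rule set_up_right_path)
      then show ?thesis by (induction p) (auto intro!: borel_measurable_add meas)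
    qed
    then show ?thesis
      unfolding last_passage_def image_image
      using borel_measurable_Max[of "up_right_paths (i, j)" "\<lambda>p s. \<Sum>v\<leftarrow>p. \<omega> v s" M] finite_up_right_paths up_right_paths_nonempty[OF that]
      by simp
  qed
  let ?h = "limit_shape a b l x y"
  let ?i = "\<lambda>N::nat. nat \<lceil>x * a * real N\<rceil>" and ?j = "\<lambda>N::nat. nat \<lceil>y * b * real N\<rceil>"
  let ?m = "\<lambda>N::nat. nat \<lceil>a * real N\<rceil>" and ?n = "\<lambda>N::nat. nat \<lceil>b * real N\<rceil>"
  have "\<forall>\<^sub>F N in sequentially. cond_prob_eq M (\<lambda>s. \<epsilon> < \<bar>lpp (\<lambda>v. W v s) (?i N) (?j N) / real N - ?h\<bar>)
      (\<lambda>s. lpp (\<lambda>v. W v s) (?m N) (?n N)) (l * real N) =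
    cond_prob_eq M (\<lambda>s. \<bar>last_passage_real (\<lambda>v. \<omega> v s) (x * a * real N) (y * b * real N) / real N - ?h\<bar> > \<epsilon>)
            (\<lambda>s. last_passage_real (\<lambda>v. \<omega> v s) (a * real N) (b * real N)) (l * real N)"
    \<comment> \<open>At N = 0 the endpoints would be (0, 0), to which no path leads;
      \<open>last_passage\<close> agrees with \<open>lpp\<close> only for positive
      coordinates.\<close>
    using eventually_gt_at_top[of 0]
  proof eventually_elim
    case (elim N)
    have ge: "1 \<le> nat \<lceil>c * real N\<rceil>" if "0 < c" for c :: real
    proof -
      have "0 < c * real N" using that elim by simp
      then show ?thesis by linarith
    qed
    have i: "1 \<le> ?i N" "1 \<le> ?j N" "1 \<le> ?m N" "1 \<le> ?n N"
      by (rule ge, use assms(3,4,7,8) in simp)+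
    note [measurable] = lm[OF i(1,2)] lm[OF i(3,4)] W.L_measurable
    show ?case
      unfolding last_passage_real_def
    proof (rule cond_prob_eq_cong_AE)
      show "AE s in M. (\<epsilon> < \<bar>lpp (\<lambda>v. W v s) (?i N) (?j N) / real N - ?h\<bar> \<longleftrightarrow>
          \<epsilon> < \<bar>last_passage (\<lambda>v. \<omega> v s) (?i N, ?j N) / real N - ?h\<bar>) \<and>
        lpp (\<lambda>v. W v s) (?m N) (?n N) = last_passage (\<lambda>v. \<omega> v s) (?m N, ?n N)"
        using lp[OF i(1,2)] lp[OF i(3,4)] by eventually_elim simp
    qed measurable
  qed
  with W.conditional_shape[OF assms(3,4,5,6)] show ?thesis
    using assms(7-10) by (auto intro: Lim_transform_eventually)
qed

end
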